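(* Let $X$ be the supercritical superprocess described in the context, whose spatial motion satisfies conditions (a), (b), (c) listed there, and assume in addition that for every $f\in C_0(E;\mathbb{R})$, $$\lim_{t\to0}\|T^{\phi_0}_tf-f\|_\infty=0 .$$ Then there exists $\Omega_0\subset\Omega$ of probability one (that is, $\mathbb{P}_\mu(\Omega_0)=1$ for every $\mu\in\mathcal{M}_F(E)$ with compact support) such that, for every $\omega\in\Omega_0$ and for every bounded Borel function $f$ on $E$ satisfying (i) $|f|\le c\phi_0$ for some constant $c>0$ and (ii) the set of discontinuity points of $f$ has zero $m$-measure, we have $$\lim_{t\to\infty}e^{-\lambda_0t}\langle f,X_t\rangle(\omega)=W_\infty(\omega)\int_E\widehat\phi_0(y)f(y)\,m(dy).$$
   Context: Spatial motion. $E$ is a locally compact separable metric space, $m$ is a $\sigma$-finite Borel measure on $E$ with full support, $E_\partial=E\cup\{\partial\}$ is the one-point compactification; functions on $E$ are extended by $f(\partial)=0$. $\xi=\{\xi_t,\Pi_x\}$ is a Hunt process on $E$ with lifetime $\zeta=\inf\{t>0:\xi_t=\partial\}$ and transition semigroup $\{P_t\}$; $\Pi_x$ also denotes expectation. There is a family of strictly positive continuous functions $\{p(t,x,y),t>0\}$ on $E\times E$ with $P_tf(x)=\int_Ep(t,x,y)f(y)\,m(dy)$. Put $a_t(x)=\int_Ep(t,x,y)^2m(dy)$ and $\widehat a_t(x)=\int_Ep(t,y,x)^2m(dy)$. It is assumed that: (a) $\int_Ep(t,y,x)\,m(dy)\le1$ for all $t>0$, $x\in E$; (b) for every $t>0$,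 $a_t$ and $\widehat a_t$ are continuous and in $L^1(E;m)$; (c) there is $t_0>0$ with $a_{t_0},\widehat a_{t_0}\in L^2(E;m)$. Superprocess. $\beta\ge0$ is a bounded Borel function on $E$ (branching rate), and the branching mechanism is $$\psi(x,\lambda)=-a(x)\lambda+b(x)\lambda^2+\int_{(0,\infty)}(e^{-\lambda y}-1+\lambda y)\,n(x,dy),\quad x\in E,\ \lambda>0,$$ with $a$ bounded Borel, $b$ nonnegative bounded Borel, and $n$ a kernel from $E$ to $(0,\infty)$ with $\sup_{x\in E}\int_0^\infty y^2n(x,dy)<\infty$; $\psi(\partial,\lambda)=0$. $\mathcal{M}_F(E)$ is the space of finite Borel measures on $E$ with the weak topology, and $\langle f,\mu\rangle=\int f\,d\mu$. $X=\{\Omega,\mathcal{G},\mathcal{G}_t,X_t,\mathbb{P}_\mu\}$ is the superprocess, a Hunt process in $\mathcal{M}_F(E)$ (with $\mathcal{G},\mathcal{G}_t$ augmented and $(\mathcal{G}_t)$ right continuous) with $-\log\mathbb{P}_\mu(e^{-\langle f,X_t\rangle})=\langle u_f(\cdot,t),\mu\rangle$ for all nonnegative bounded Borel $f$ and $\mu\in\mathcal{M}_F(E)$, where $u_f$ is the unique positive solution of $$u_f(x,t)+\Pi_x\int_0^t\psi(\xi_s,u_f(\xi_s,t-s))\beta(\xi_s)\,ds=\Pi_xf(\xi_t).$$ $\mathbb{P}_\mu$ also denotes expectation. Mean semigroup and eigenfunctions. $\alpha(x)=\beta(x)a(x)$, and $T_tf(x)=\Pi_x[e^{\int_0^t\alpha(\xi_s)ds}f(\xi_t)]=\mathbb{P}_{\delta_x}\langle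 f,X_t\rangle$. $\{T_t\}$ is a strongly continuous semigroup of compact operators ($t>0$) on $L^2(E;m)$ with generator $L$, and it has a density $q(t,x,y)$ with respect to $m$, continuous in $(x,y)$. $\widehat T_tg(x)=\int_Eq(t,y,x)g(y)m(dy)$ is the adjoint semigroup, with generator $\widehat L$. $\lambda_0=\sup\mathrm{Re}(\sigma(L))=\sup\mathrm{Re}(\sigma(\widehat L))$ is an eigenvalue of multiplicity one of both $L$ and $\widehat L$; $\phi_0$ and $\widehat\phi_0$ are the corresponding eigenfunctions of $L$ and $\widehat L$, chosen continuous and strictly positive with $\|\phi_0\|_{L^2(E;m)}=1$ and $\int_E\phi_0\widehat\phi_0\,dm=1$. The superprocess is supercritical: $\lambda_0>0$. $W_t=e^{-\lambda_0t}\langle\phi_0,X_t\rangle$ is a nonnegative martingale and $W_\infty=\lim_{t\to\infty}W_t$. $C_0(E;\mathbb{R})$ is the set of real-valued continuous $f$ on $E$ with $\lim_{x\to\partial}f(x)=0$, $\|\cdot\|_\infty$ is the sup norm, and $$T^{\phi_0}_tf(x)=\frac{e^{-\lambda_0t}}{\phi_0(x)}\Pi_x\Big[\exp\Big(\int_0^t\alpha(\xi_s)ds\Big)(f\phi_0)(\xi_t)\Big].$$ *)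

theory Defs
  imports "HOL-Probability.Probability"
begin

section \<open>State spaces\<close>

text \<open>
  The one-point compactification of \<open>'a\<close> is carried by \<^typ>\<open>'a option\<close>; the cemetery point is
  \<^term>\<open>None\<close>. If \<open>'a\<close> is compact, \<^term>\<open>None\<close> is an isolated point.
\<close>

definition one_point_compactification :: "'a::t2_space option topology" where
  "one_point_compactification =
     topology (\<lambda>U. open (Some -` U) \<and> (None \<in> U \<longrightarrow> compact (- (Some -` U))))"

lemma openin_one_point_compactification:
  "openin one_point_compactification U \<longleftrightarrow>
     open (Some -` U) \<and> (None \<in> U \<longrightarrow> compact (- (Some -` (U :: 'a::t2_space option set))))"
proof -
  have "istopology (\<lambda>U :: 'a option set. open (Some -` U) \<and> (None \<in> U \<longrightarrow> compact (- (Some -` U))))"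
    unfolding istopology_def
  proof (intro conjI allI impI)
    fix S T :: "'a option set"
    assume "open (Some -` S) \<and> (None \<in> S \<longrightarrow> compact (- (Some -` S)))"
      and "open (Some -` T) \<and> (None \<in> T \<longrightarrow> compact (- (Some -` T)))"
    then show "open (Some -` (S \<inter> T))" and "None \<in> S \<inter> T \<Longrightarrow> compact (- (Some -` (S \<inter> T)))"
      by (auto simp: vimage_Int Compl_Int intro: compact_Un)
  next
    fix \<K> :: "'a option set set"
    assume K: "\<forall>K\<in>\<K>. open (Some -` K) \<and> (None \<in> K \<longrightarrow> compact (- (Some -` K)))"
    show op: "open (Some -` (\<Union>\<K>))"
      unfolding vimage_Union using K by auto
    assume "None \<in> \<Union>\<K>"
    then obtain K where K1: "K \<in> \<K>" "None \<in> K" by auto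
    have "closed (- (Some -` (\<Union>\<K>)))" using op by auto
    moreover have "- (Some -` (\<Union>\<K>)) = - (Some -` K) \<inter> - (Some -` (\<Union>\<K>))" using K1 by auto
    ultimately show "compact (- (Some -` (\<Union>\<K>)))"
      using K K1 compact_Int_closed by metis
  qed
  then show ?thesis
    by (simp add: one_point_compactification_def topology_inverse')
qed

lemma topspace_one_point_compactification [simp]:
  "topspace (one_point_compactification :: 'a::t2_space option topology) = UNIV"
proof -
  have "openin (one_point_compactification :: 'a option topology) UNIV"
    by (simp add: openin_one_point_compactification)
  then show ?thesis
    using openin_subset by blast
qed

text \<open>Functions on the state space vanish at the cemetery.\<close>

abbreviation ext :: "('a \<Rightarrow> 'b::zero) \<Rightarrow> 'a option \<Rightarrow> 'b" where
  "ext f \<equiv> case_option 0 f"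

definition C0 :: "('a::t2_space \<Rightarrow> real) set" where
  "C0 = {f. continuous_on UNIV f \<and> (ext f \<longlongrightarrow> 0) (atin one_point_compactification None)}"

definition finite_borel_measures :: "'a::topological_space measure set" where
  "finite_borel_measures = {\<mu>. sets \<mu> = sets borel \<and> finite_measure \<mu>}"

definition weak_topology :: "'a::topological_space measure topology" where
  "weak_topology = topology_generated_by
     {{\<mu> \<in> finite_borel_measures. (\<integral>x. f x \<partial>\<mu>) \<in> U} | f U.
        continuous_on UNIV (f :: 'a \<Rightarrow> real) \<and> bounded (range f) \<and> open U}"

lemma topspace_weak_topology [simp]: "topspace weak_topology = finite_borel_measures"
proof -
  have "finite_borel_measures \<in> {{\<mu> \<in> finite_borel_measures. (\<integral>x. f x \<partial>\<mu>) \<in> U} | f U.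
        continuous_on UNIV (f :: 'a \<Rightarrow> real) \<and> bounded (range f) \<and> open U}"
    by (intro CollectI exI[of _ "\<lambda>_. 0"] exI[of _ UNIV]) auto
  then show ?thesis
    unfolding weak_topology_def topology_generated_by_topspace by blast
qed

definition measure_support :: "'a::topological_space measure \<Rightarrow> 'a set" where
  "measure_support \<mu> = {x. \<forall>U. open U \<and> x \<in> U \<longrightarrow> emeasure \<mu> U > 0}"

definition borel_on :: "'a topology \<Rightarrow> 'a measure" where
  "borel_on S = sigma (topspace S) {U. openin S U}"


section \<open>Hunt processes\<close>

text \<open>
  The filtration is indexed by \<^typ>\<open>ennreal\<close> so that stopping times may be infinite; \<^term>\<open>F \<top>\<close> is
  the \<open>\<sigma>\<close>-algebra on which all the laws live. A cemetery, if there is one, is a point of the state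
  space \<^term>\<open>S\<close>.
\<close>

locale hunt_process = filtration \<Omega> F
  for \<Omega> :: "'w set" and F :: "ennreal \<Rightarrow> 'w measure" +
  fixes S :: "'s topology" and X :: "real \<Rightarrow> 'w \<Rightarrow> 's" and P :: "'s \<Rightarrow> 'w measure"
  assumes prob_space_P: "x \<in> topspace S \<Longrightarrow> prob_space (P x)"
    and sets_P: "x \<in> topspace S \<Longrightarrow> sets (P x) = sets (F \<top>)"
    and adapted: "0 \<le> t \<Longrightarrow> X t \<in> F (ennreal t) \<rightarrow>\<^sub>M borel_on S"
    and kernel: "0 \<le> t \<Longrightarrow> B \<in> sets (borel_on S) \<Longrightarrow>
          (\<lambda>x. emeasure (P x) {\<omega> \<in> \<Omega>. X t \<omega> \<in> B}) \<in> borel_measurable (borel_on S)"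
    and normal: "x \<in> topspace S \<Longrightarrow> AE \<omega> in P x. X 0 \<omega> = x"
    and right_continuous: "\<omega> \<in> \<Omega> \<Longrightarrow> 0 \<le> t \<Longrightarrow> limitin S (\<lambda>s. X s \<omega>) (X t \<omega>) (at_right t)"
    and left_limits: "\<omega> \<in> \<Omega> \<Longrightarrow> 0 < t \<Longrightarrow> \<exists>l. limitin S (\<lambda>s. X s \<omega>) l (at_left t)"
    and shifts: "0 \<le> t \<Longrightarrow> \<exists>\<theta>\<in>\<Omega> \<rightarrow> \<Omega>. \<forall>\<omega>\<in>\<Omega>. \<forall>s\<ge>0. X s (\<theta> \<omega>) = X (t + s) \<omega>"
    and right_continuous_filtration: "t < \<top> \<Longrightarrow> sets (F t) = (\<Inter>s\<in>{t<..}. sets (F s))"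
    and strong_markov:
      "stopping_time F \<tau> \<Longrightarrow> A \<in> sets (pre_sigma \<tau>) \<Longrightarrow> 0 \<le> s \<Longrightarrow> x \<in> topspace S \<Longrightarrow>
       B \<in> sets (borel_on S) \<Longrightarrow>
       emeasure (P x) {\<omega> \<in> A. \<tau> \<omega> < \<top> \<and> X (enn2real (\<tau> \<omega>) + s) \<omega> \<in> B} =
       (\<integral>\<^sup>+\<omega>\<in>{\<omega> \<in> A. \<tau> \<omega> < \<top>}.
          emeasure (P (X (enn2real (\<tau> \<omega>)) \<omega>)) {\<omega>' \<in> \<Omega>. X s \<omega>' \<in> B} \<partial>P x)"
    and quasi_left_continuous:
      "(\<And>k. stopping_time F (\<sigma> k)) \<Longrightarrow> (\<And>\<omega>. \<omega> \<in> \<Omega> \<Longrightarrow> incseq (\<lambda>k. \<sigma> k \<omega>)) \<Longrightarrow> x \<in> topspace S \<Longrightarrow>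
       AE \<omega> in P x. (SUP k. \<sigma> k \<omega>) < \<top> \<longrightarrow>
         limitin S (\<lambda>k. X (enn2real (\<sigma> k \<omega>)) \<omega>) (X (enn2real (SUP k. \<sigma> k \<omega>)) \<omega>) sequentially"

text \<open>
  Augmentation: for an initial law \<open>\<nu>\<close>, a subset of a set \<open>B\<close> with
  \<open>P\<^sub>\<nu>(B) = \<integral> P\<^sub>x(B) \<nu>(dx) = 0\<close> is adjoined as a null set, and one intersects over all initial laws.
\<close>

definition augmented :: "'w set \<Rightarrow> (ennreal \<Rightarrow> 'w measure) \<Rightarrow> 's topology \<Rightarrow> ('s \<Rightarrow> 'w measure) \<Rightarrow> bool"
where
  "augmented \<Omega> F S P \<longleftrightarrow>
     (\<forall>t. sets (F t) =
       (\<Inter>\<nu>\<in>{\<nu>. prob_space \<nu> \<and> sets \<nu> = sets (borel_on S)}.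
          sigma_sets \<Omega> (sets (F t) \<union>
            {N. \<exists>B\<in>sets (F \<top>). N \<subseteq> B \<and> (AE x in \<nu>. emeasure (P x) B = 0)})))"


section \<open>The spatial motion\<close>

text \<open>
  \<^term>\<open>Q\<close> is the family of laws \<open>\<Pi>\<^sub>x\<close> of the motion \<open>\<xi>\<close>, with starting points \<^term>\<open>Some x\<close> in
  \<open>E\<close> or \<^term>\<open>None\<close>. Since Bochner integrals of non-integrable functions are \<open>0\<close>, finiteness of
  the integrals below is stated separately.
\<close>

definition sq_mass :: "'e measure \<Rightarrow> (real \<Rightarrow> 'e \<Rightarrow> 'e \<Rightarrow> real) \<Rightarrow> real \<Rightarrow> 'e \<Rightarrow> real" where
  "sq_mass m p t x = (\<integral>y. (p t x y)\<^sup>2 \<partial>m)"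

definition dual_sq_mass :: "'e measure \<Rightarrow> (real \<Rightarrow> 'e \<Rightarrow> 'e \<Rightarrow> real) \<Rightarrow> real \<Rightarrow> 'e \<Rightarrow> real" where
  "dual_sq_mass m p t x = (\<integral>y. (p t y x)\<^sup>2 \<partial>m)"

locale spatial_motion =
  hunt_process \<Omega> F "one_point_compactification :: 'e option topology" \<xi> Q
  for \<Omega> :: "'w set" and F :: "ennreal \<Rightarrow> 'w measure"
    and \<xi> :: "real \<Rightarrow> 'w \<Rightarrow> 'e::{metric_space, second_countable_topology} option"
    and Q :: "'e option \<Rightarrow> 'w measure" +
  fixes m :: "'e measure" and p :: "real \<Rightarrow> 'e \<Rightarrow> 'e \<Rightarrow> real"
  assumes locally_compact_E: "locally_compact_space (euclidean :: 'e topology)"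
    and sets_m: "sets m = sets borel"
    and sigma_finite_m: "sigma_finite_measure m"
    and full_support_m: "measure_support m = UNIV"
    and absorbing: "\<omega> \<in> \<Omega> \<Longrightarrow> 0 \<le> s \<Longrightarrow> s \<le> t \<Longrightarrow> \<xi> s \<omega> = None \<Longrightarrow> \<xi> t \<omega> = None"
    and p_pos: "0 < t \<Longrightarrow> 0 < p t x y"
    and p_continuous: "0 < t \<Longrightarrow> continuous_on UNIV (\<lambda>(x, y). p t x y)"
    and p_density: "0 < t \<Longrightarrow> f \<in> borel_measurable borel \<Longrightarrow> bounded (range f) \<Longrightarrow>
          integrable m (\<lambda>y. p t x y * f y) \<and>
          (\<integral>\<omega>. ext f (\<xi> t \<omega>) \<partial>Q (Some x)) = (\<integral>y. p t x y * f y \<partial>m)"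
    and dual_mass_le_1: "0 < t \<Longrightarrow> (\<integral>\<^sup>+y. ennreal (p t y x) \<partial>m) \<le> 1"
    and sq_mass_finite: "0 < t \<Longrightarrow> integrable m (\<lambda>y. (p t x y)\<^sup>2)"
    and dual_sq_mass_finite: "0 < t \<Longrightarrow> integrable m (\<lambda>y. (p t y x)\<^sup>2)"
    and sq_mass_continuous: "0 < t \<Longrightarrow> continuous_on UNIV (sq_mass m p t)"
    and dual_sq_mass_continuous: "0 < t \<Longrightarrow> continuous_on UNIV (dual_sq_mass m p t)"
    and sq_mass_L1: "0 < t \<Longrightarrow> integrable m (sq_mass m p t)"
    and dual_sq_mass_L1: "0 < t \<Longrightarrow> integrable m (dual_sq_mass m p t)"
    and sq_mass_L2: "\<exists>t0>0. integrable m (\<lambda>x. (sq_mass m p t0 x)\<^sup>2) \<and>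
          integrable m (\<lambda>x. (dual_sq_mass m p t0 x)\<^sup>2)"


section \<open>The superprocess\<close>

definition branching_mechanism ::
  "('e \<Rightarrow> real) \<Rightarrow> ('e \<Rightarrow> real) \<Rightarrow> ('e \<Rightarrow> real measure) \<Rightarrow> 'e option \<Rightarrow> real \<Rightarrow> real" where
  "branching_mechanism a b n z l = (case z of None \<Rightarrow> 0 | Some x \<Rightarrow>
     - a x * l + b x * l\<^sup>2 + (\<integral>y. (exp (- l * y) - 1 + l * y) \<partial>n x))"

locale branching_data =
  fixes \<beta> a b :: "'e::topological_space \<Rightarrow> real" and n :: "'e \<Rightarrow> real measure"
  assumes beta: "\<beta> \<in> borel_measurable borel" "bounded (range \<beta>)" "\<And>x. 0 \<le> \<beta> x"
    and a: "a \<in> borel_measurable borel" "bounded (range a)"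
    and b: "b \<in> borel_measurable borel" "bounded (range b)" "\<And>x. 0 \<le> b x"
    and sets_n: "sets (n x) = sets (restrict_space borel {0<..})"
    and kernel_n: "B \<in> sets (restrict_space borel {0<..}) \<Longrightarrow>
          (\<lambda>x. emeasure (n x) B) \<in> borel_measurable borel"
    and second_moment_n: "(SUP x. \<integral>\<^sup>+y. ennreal (y\<^sup>2) \<partial>n x) < \<top>"

text \<open>
  Solutions are nonnegative, jointly Borel on \<open>E \<times> [0,\<infinity>)\<close> and bounded on \<open>E \<times> [0,T]\<close> for every
  \<open>T\<close>, the class in which the equation is well-posed. Values \<^term>\<open>u x t\<close> at \<^term>\<open>t < 0\<close> are
  irrelevant.
\<close>

definition cumulant_solution ::
  "(real \<Rightarrow> 'w \<Rightarrow> 'e::topological_space option) \<Rightarrow> ('e option \<Rightarrow> 'w measure) \<Rightarrow> ('e \<Rightarrow> real) \<Rightarrow>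
   ('e option \<Rightarrow> real \<Rightarrow> real) \<Rightarrow> ('e \<Rightarrow> real) \<Rightarrow> ('e \<Rightarrow> real \<Rightarrow> real) \<Rightarrow> bool" where
  "cumulant_solution \<xi> Q \<beta> \<psi> f u \<longleftrightarrow>
     (\<lambda>(x, t). u x t) \<in> borel_measurable (borel \<Otimes>\<^sub>M restrict_space borel {0..}) \<and>
     (\<forall>x. \<forall>t\<ge>0. 0 \<le> u x t) \<and>
     (\<forall>T. \<exists>C. \<forall>x. \<forall>t\<in>{0..T}. u x t \<le> C) \<and>
     (\<forall>x. \<forall>t\<ge>0.
        u x t +
        (\<integral>\<omega>. (LINT s:{0..t}|lborel.
                \<psi> (\<xi> s \<omega>) (ext (\<lambda>y. u y (t - s)) (\<xi> s \<omega>)) * ext \<beta> (\<xi> s \<omega>)) \<partial>Q (Some x)) =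
        (\<integral>\<omega>. ext f (\<xi> t \<omega>) \<partial>Q (Some x)))"

locale superprocess =
  hunt_process \<Omega> G "weak_topology :: 'e measure topology" X P
  for \<Omega> :: "'v set" and G :: "ennreal \<Rightarrow> 'v measure"
    and X :: "real \<Rightarrow> 'v \<Rightarrow> 'e::topological_space measure" and P :: "'e measure \<Rightarrow> 'v measure" +
  fixes \<xi> :: "real \<Rightarrow> 'w \<Rightarrow> 'e option" and Q :: "'e option \<Rightarrow> 'w measure"
    and \<beta> :: "'e \<Rightarrow> real" and \<psi> :: "'e option \<Rightarrow> real \<Rightarrow> real"
  assumes augmented: "augmented \<Omega> G (weak_topology :: 'e measure topology) P"
    and log_laplace: "f \<in> borel_measurable borel \<Longrightarrow> bounded (range f) \<Longrightarrow> (\<And>x. 0 \<le> f x) \<Longrightarrow>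
      \<exists>u. cumulant_solution \<xi> Q \<beta> \<psi> f u \<and>
          (\<forall>v. cumulant_solution \<xi> Q \<beta> \<psi> f v \<longrightarrow> (\<forall>x. \<forall>t\<ge>0. v x t = u x t)) \<and>
          (\<forall>\<mu>\<in>finite_borel_measures. \<forall>t\<ge>0.
             - ln (\<integral>\<omega>. exp (- (\<integral>x. f x \<partial>X t \<omega>)) \<partial>P \<mu>) = (\<integral>x. u x t \<partial>\<mu>))"


section \<open>Semigroups on complex \<open>L\<^sup>2\<close>\<close>

text \<open>
  Elements of \<open>L\<^sup>2(m)\<close> are represented by functions, and equality in \<open>L\<^sup>2(m)\<close> by equality almost
  everywhere.
\<close>

definition l2 :: "'a measure \<Rightarrow> ('a \<Rightarrow> complex) set" where
  "l2 m = {f. f \<in> borel_measurable m \<and> integrable m (\<lambda>x. (cmod (f x))\<^sup>2)}"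

definition l2_norm :: "'a measure \<Rightarrow> ('a \<Rightarrow> complex) \<Rightarrow> real" where
  "l2_norm m f = sqrt (\<integral>x. (cmod (f x))\<^sup>2 \<partial>m)"

definition l2_bounded_operator :: "'a measure \<Rightarrow> (('a \<Rightarrow> complex) \<Rightarrow> 'a \<Rightarrow> complex) \<Rightarrow> bool" where
  "l2_bounded_operator m A \<longleftrightarrow>
     (\<forall>f\<in>l2 m. A f \<in> l2 m) \<and>
     (\<forall>f\<in>l2 m. \<forall>g\<in>l2 m. \<forall>c. AE x in m. A (\<lambda>y. c * f y + g y) x = c * A f x + A g x) \<and>
     (\<exists>C. \<forall>f\<in>l2 m. l2_norm m (A f) \<le> C * l2_norm m f)"

definition l2_compact_operator :: "'a measure \<Rightarrow> (('a \<Rightarrow> complex) \<Rightarrow> 'a \<Rightarrow> complex) \<Rightarrow> bool" where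
  "l2_compact_operator m A \<longleftrightarrow> l2_bounded_operator m A \<and>
     (\<forall>f :: nat \<Rightarrow> 'a \<Rightarrow> complex. (\<forall>k. f k \<in> l2 m) \<and> bounded (range (\<lambda>k. l2_norm m (f k))) \<longrightarrow>
        (\<exists>g\<in>l2 m. \<exists>r. strict_mono (r :: nat \<Rightarrow> nat) \<and>
           (\<lambda>k. l2_norm m (\<lambda>x. A (f (r k)) x - g x)) \<longlonglongrightarrow> 0))"

definition l2_C0_semigroup ::
  "'a measure \<Rightarrow> (real \<Rightarrow> ('a \<Rightarrow> complex) \<Rightarrow> 'a \<Rightarrow> complex) \<Rightarrow> bool" where
  "l2_C0_semigroup m T \<longleftrightarrow>
     (\<forall>t\<ge>0. l2_bounded_operator m (T t)) \<and>
     (\<forall>f\<in>l2 m. AE x in m. T 0 f x = f x) \<and>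
     (\<forall>s\<ge>0. \<forall>t\<ge>0. \<forall>f\<in>l2 m. AE x in m. T (s + t) f x = T s (T t f) x) \<and>
     (\<forall>f\<in>l2 m. ((\<lambda>t. l2_norm m (\<lambda>x. T t f x - f x)) \<longlongrightarrow> 0) (at_right 0))"

text \<open>The graph of the generator: \<^term>\<open>f\<close> is in the domain and is mapped to \<^term>\<open>g\<close>.\<close>

definition l2_generator ::
  "'a measure \<Rightarrow> (real \<Rightarrow> ('a \<Rightarrow> complex) \<Rightarrow> 'a \<Rightarrow> complex) \<Rightarrow> ('a \<Rightarrow> complex) \<Rightarrow> ('a \<Rightarrow> complex) \<Rightarrow> bool"
where
  "l2_generator m T f g \<longleftrightarrow> f \<in> l2 m \<and> g \<in> l2 m \<and>
     ((\<lambda>t. l2_norm m (\<lambda>x. (T t f x - f x) / of_real t - g x)) \<longlongrightarrow> 0) (at_right 0)"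

text \<open>
  The following notions concern an operator given by its graph \<^term>\<open>L\<close>. The estimate in the
  definition of the resolvent set says that \<open>z - L\<close> is injective with bounded inverse.
\<close>

definition l2_resolvent_set ::
  "'a measure \<Rightarrow> (('a \<Rightarrow> complex) \<Rightarrow> ('a \<Rightarrow> complex) \<Rightarrow> bool) \<Rightarrow> complex set" where
  "l2_resolvent_set m L = {z.
     (\<forall>g\<in>l2 m. \<exists>f h. L f h \<and> (AE x in m. z * f x - h x = g x)) \<and>
     (\<exists>C. \<forall>f h. L f h \<longrightarrow> l2_norm m f \<le> C * l2_norm m (\<lambda>x. z * f x - h x))}"

definition l2_spectrum ::
  "'a measure \<Rightarrow> (('a \<Rightarrow> complex) \<Rightarrow> ('a \<Rightarrow> complex) \<Rightarrow> bool) \<Rightarrow> complex set" where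
  "l2_spectrum m L = - l2_resolvent_set m L"

text \<open>\<open>generalized_eigenfunction m L z k f\<close> means \<open>(L - z)\<^sup>k f = 0\<close>.\<close>

primrec generalized_eigenfunction ::
  "'a measure \<Rightarrow> (('a \<Rightarrow> complex) \<Rightarrow> ('a \<Rightarrow> complex) \<Rightarrow> bool) \<Rightarrow> complex \<Rightarrow> nat \<Rightarrow> ('a \<Rightarrow> complex) \<Rightarrow> bool"
where
  "generalized_eigenfunction m L z 0 f \<longleftrightarrow> f \<in> l2 m \<and> (AE x in m. f x = 0)"
| "generalized_eigenfunction m L z (Suc k) f \<longleftrightarrow>
     (\<exists>h. L f h \<and> generalized_eigenfunction m L z k (\<lambda>x. h x - z * f x))"

text \<open>
  Multiplicity one: the root space is one-dimensional, hence spanned by an eigenfunction.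
\<close>

definition eigenvalue_multiplicity_one ::
  "'a measure \<Rightarrow> (('a \<Rightarrow> complex) \<Rightarrow> ('a \<Rightarrow> complex) \<Rightarrow> bool) \<Rightarrow> complex \<Rightarrow> bool" where
  "eigenvalue_multiplicity_one m L z \<longleftrightarrow>
     (\<exists>\<phi>\<in>l2 m. \<not> (AE x in m. \<phi> x = 0) \<and>
        {f. \<exists>k. generalized_eigenfunction m L z k f} =
        {f \<in> l2 m. \<exists>c. AE x in m. f x = c * \<phi> x})"


section \<open>The mean semigroup and its principal eigenfunctions\<close>

definition mean_op ::
  "(real \<Rightarrow> 'w \<Rightarrow> 'e option) \<Rightarrow> ('e option \<Rightarrow> 'w measure) \<Rightarrow> ('e \<Rightarrow> real) \<Rightarrow>
   real \<Rightarrow> ('e \<Rightarrow> 'b::{banach, second_countable_topology}) \<Rightarrow> 'e \<Rightarrow> 'b" where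
  "mean_op \<xi> Q \<alpha> t f x =
     (\<integral>\<omega>. exp (LINT s:{0..t}|lborel. ext \<alpha> (\<xi> s \<omega>)) *\<^sub>R ext f (\<xi> t \<omega>) \<partial>Q (Some x))"

definition dual_op ::
  "'e measure \<Rightarrow> (real \<Rightarrow> 'e \<Rightarrow> 'e \<Rightarrow> real) \<Rightarrow> real \<Rightarrow> ('e \<Rightarrow> complex) \<Rightarrow> 'e \<Rightarrow> complex" where
  "dual_op m q t g x = (\<integral>y. q t y x *\<^sub>R g y \<partial>m)"

locale principal_eigenfunctions =
  fixes m :: "'e::topological_space measure"
    and \<xi> :: "real \<Rightarrow> 'w \<Rightarrow> 'e option" and Q :: "'e option \<Rightarrow> 'w measure" and \<alpha> :: "'e \<Rightarrow> real"
    and q :: "real \<Rightarrow> 'e \<Rightarrow> 'e \<Rightarrow> real"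
    and lam0 :: real and \<phi>0 \<phi>h0 :: "'e \<Rightarrow> real"
  assumes C0_semigroup: "l2_C0_semigroup m (mean_op \<xi> Q \<alpha>)"
    and compact_T: "0 < t \<Longrightarrow> l2_compact_operator m (mean_op \<xi> Q \<alpha> t)"
    and q_continuous: "0 < t \<Longrightarrow> continuous_on UNIV (\<lambda>(x, y). q t x y)"
    and q_density: "0 < t \<Longrightarrow> (f :: 'e \<Rightarrow> real) \<in> borel_measurable borel \<Longrightarrow> bounded (range f) \<Longrightarrow>
          integrable m (\<lambda>y. q t x y * f y) \<and> mean_op \<xi> Q \<alpha> t f x = (\<integral>y. q t x y * f y \<partial>m)"
    and sup_spectrum:
          "(SUP z\<in>l2_spectrum m (l2_generator m (mean_op \<xi> Q \<alpha>)). ereal (Re z)) = ereal lam0"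
    and sup_dual_spectrum:
          "(SUP z\<in>l2_spectrum m (l2_generator m (dual_op m q)). ereal (Re z)) = ereal lam0"
    and eigenvalue: "eigenvalue_multiplicity_one m (l2_generator m (mean_op \<xi> Q \<alpha>)) (of_real lam0)"
    and dual_eigenvalue: "eigenvalue_multiplicity_one m (l2_generator m (dual_op m q)) (of_real lam0)"
    and eigenfunction:
          "l2_generator m (mean_op \<xi> Q \<alpha>) (\<lambda>x. of_real (\<phi>0 x)) (\<lambda>x. of_real (lam0 * \<phi>0 x))"
    and dual_eigenfunction:
          "l2_generator m (dual_op m q) (\<lambda>x. of_real (\<phi>h0 x)) (\<lambda>x. of_real (lam0 * \<phi>h0 x))"
    and eigenfunctions_continuous: "continuous_on UNIV \<phi>0" "continuous_on UNIV \<phi>h0"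
    and eigenfunctions_pos: "\<And>x. 0 < \<phi>0 x" "\<And>x. 0 < \<phi>h0 x"
    and normalization: "(\<integral>x. (\<phi>0 x)\<^sup>2 \<partial>m) = 1" "(\<integral>x. \<phi>0 x * \<phi>h0 x \<partial>m) = 1"

definition h_transformed_op ::
  "(real \<Rightarrow> ('e \<Rightarrow> real) \<Rightarrow> 'e \<Rightarrow> real) \<Rightarrow> real \<Rightarrow> ('e \<Rightarrow> real) \<Rightarrow> real \<Rightarrow> ('e \<Rightarrow> real) \<Rightarrow> 'e \<Rightarrow> real"
where
  "h_transformed_op T lam0 \<phi>0 t f x = exp (- lam0 * t) / \<phi>0 x * T t (\<lambda>y. f y * \<phi>0 y) x"

definition W :: "(real \<Rightarrow> 'v \<Rightarrow> 'e measure) \<Rightarrow> real \<Rightarrow> ('e \<Rightarrow> real) \<Rightarrow> real \<Rightarrow> 'v \<Rightarrow> real" where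
  "W X lam0 \<phi>0 t \<omega> = exp (- lam0 * t) * (\<integral>x. \<phi>0 x \<partial>X t \<omega>)"

definition W_infinity :: "(real \<Rightarrow> 'v \<Rightarrow> 'e measure) \<Rightarrow> real \<Rightarrow> ('e \<Rightarrow> real) \<Rightarrow> 'v \<Rightarrow> real" where
  "W_infinity X lam0 \<phi>0 \<omega> = Lim at_top (\<lambda>t. W X lam0 \<phi>0 t \<omega>)"

end

theory Submission
  imports Defs "HOL-Real_Asymp.Real_Asymp"
begin

text \<open>
 Let \<open>U\<^sub>t = exp (- \<lambda>\<^sub>0 t) T\<^sub>t\<close>. Since \<open>T\<^sub>t\<close> is compact and strictly positive, \<open>U\<^sub>n\<^sub>\<sigma> f\<close> decays
 geometrically in \<open>L\<^sup>2(m)\<close> on the hyperplane orthogonal to the dual eigenfunction. Expanding the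
 log-Laplace equation at \<open>0\<close> gives the first two moments of \<open>\<langle>f, X\<^sub>t\<rangle>\<close>, so for \<open>|f| \<le> c \<phi>\<^sub>0\<close> the
 increments \<open>R\<^sub>t\<^sub>+\<^sub>\<sigma> f - R\<^sub>t (U\<^sub>\<sigma> f)\<close> of \<open>R\<^sub>t f = exp (- \<lambda>\<^sub>0 t) \<langle>f, X\<^sub>t\<rangle>\<close> have variance of order
 \<open>exp (- \<lambda>\<^sub>0 t)\<close>. This yields almost sure convergence along every lattice \<open>\<sigma> \<nat>\<close>. Between lattice
 points the maximal inequality controls the martingale \<open>R\<^sub>t (U\<^sub>n\<^sub>\<sigma>\<^sub>+\<^sub>\<sigma>\<^sub>-\<^sub>t f)\<close>, and the regularity
 hypothesis makes \<open>|U\<^sub>s f - f| \<le> \<delta> \<phi>\<^sub>0\<close> for small \<open>s\<close>; so \<open>R\<^sub>t f\<close> converges along dyadic times for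
 \<open>f = \<phi>\<^sub>0\<close> and for \<open>f = g \<phi>\<^sub>0\<close> with \<open>g\<close> in a countable family of compactly supported functions.
 Right continuity passes to real times, and Portmanteau for the measures
 \<open>exp (- \<lambda>\<^sub>0 t) \<phi>\<^sub>0 X\<^sub>t\<close> covers all \<open>f\<close> on one event.
\<close>

text \<open>Two obstacles shape the proof. The exceptional null set may depend neither on
  \<open>f\<close> nor on the initial law, so the event is cut out by countably many explicit
  conditions at dyadic times; the dyadic grids are nested, which lets a discrete maximal inequality
  act on all of them at once. Moreover \<open>phi0\<close> may be unbounded, so right continuity of
  \<open>X\<close> in the weak topology says nothing directly about the integral of
  \<open>phi0\<close> against \<open>X t\<close>; at a general time that mass is bounded by way of
  compactly supported functions below \<open>phi0\<close>. The variance decays like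
  \<open>exp (- lam0 * t)\<close> because the rescaling contributes
  \<open>exp (- 2 * lam0 * t)\<close>, while the conditional variance grows only like the mean of
  the square of \<open>phi0\<close>, which is of order \<open>exp (lam0 * t)\<close>. That this mean
  is finite and of this order rests on the square of \<open>phi0\<close> being in
  \<open>L2 m\<close>, which comes from condition (c). An initial law may be singular to
  \<open>m\<close>; estimates in \<open>L2 m\<close> reach it only after one application of the
  smoothing kernel. The decay of the iterates is a pure compactness argument, and the limit constant
  is the coefficient \<kappa> that makes \<open>f - \<kappa> phi0\<close> orthogonal to
  \<open>phih0\<close>.\<close>

abbreviation (input) NN :: "'a measure => ('a => ennreal) => ennreal" where
 "NN M f \<equiv> integral\<^sup>N M f"

lemmas integral_cong = Bochner_Integration.integral_cong
 and integrable_bound = Bochner_Integration.integrable_bound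

section \<open>Strictly positive compact operators on square integrable functions\<close>

definition L2 :: "'a measure => ('a => real) set" where
 "L2 m = {f \<in> borel_measurable m. integrable m (%x. (f x)^2)}"

text \<open>The squared norm serves throughout in place of the norm: for the compactness arguments
  the triangle inequality with constant 2 in \<open>sq_int_add_le\<close> is as good as the sharp
  one.\<close>

definition sq_int :: "'a measure => ('a => real) => real" where
 "sq_int m f = (LINT x|m. (f x)^2)"

lemma L2D:
 assumes "f \<in> L2 m"
 shows "f \<in> borel_measurable m" "integrable m (%x. (f x)^2)"
 using assms by (auto simp: L2_def)

lemma sq_int_nonneg [simp]: "0 <= sq_int m f"
 by (simp add: sq_int_def)

lemma L2_mult:
 assumes "f \<in> L2 m" "g \<in> L2 m"
 shows "integrable m (%x. f x * g x)"
proof (rule integrable_bound)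
 show "integrable m (%x. (f x)^2 + (g x)^2)"
  using assms by (auto dest: L2D)
 show "(%x. f x * g x) \<in> borel_measurable m"
  using assms[THEN L2D(1)] by measurable
 show "AE x in m. norm (f x * g x) <= norm ((f x)^2 + (g x)^2)"
 proof (rule AE_I2)
  fix x
  have "0 <= (\<bar>f x\<bar> - \<bar>g x\<bar>)^2" by simp
  then have "2 * (\<bar>f x\<bar> * \<bar>g x\<bar>) <= (f x)^2 + (g x)^2" by (simp add: power2_diff)
  moreover have "0 <= \<bar>f x\<bar> * \<bar>g x\<bar>" by simp
  ultimately show "norm (f x * g x) <= norm ((f x)^2 + (g x)^2)" unfolding real_norm_def abs_mult by linarith
 qed
qed

lemma L2_lincomb:
 assumes "f \<in> L2 m" "g \<in> L2 m"
 shows "(%x. c * f x + d * g x) \<in> L2 m"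
proof -
 note [measurable] = assms[THEN L2D(1)]
 have "(%x. (c * f x + d * g x)^2) = (%x. c^2 * (f x)^2 + 2 * c * d * (f x * g x) + d^2 * (g x)^2)"
  by (auto simp: power2_eq_square algebra_simps)
 then show ?thesis
  unfolding L2_def
  using L2_mult[OF assms] assms[THEN L2D(2)] by auto
qed

lemma L2_add:
 "f \<in> L2 m ==> g \<in> L2 m ==> (%x. f x + g x) \<in> L2 m"
 using L2_lincomb[of f m g 1 1] by simp

lemma L2_diff:
 "f \<in> L2 m ==> g \<in> L2 m ==> (%x. f x - g x) \<in> L2 m"
 using L2_lincomb[of f m g 1 "-1"] by simp

lemma L2_cmult: "f \<in> L2 m ==> (%x. c * f x) \<in> L2 m"
 using L2_lincomb[of f m f c 0] by simp

lemma L2_zero [simp]: "(%x. 0) \<in> L2 m"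
 by (simp add: L2_def)

lemma L2_abs: "f \<in> L2 m ==> (%x. \<bar>f x\<bar>) \<in> L2 m"
 by (auto simp: L2_def)

lemma L2_bound:
 assumes "g \<in> L2 m" "f \<in> borel_measurable m" "!!x. \<bar>f x\<bar> <= \<bar>g x\<bar>"
 shows "f \<in> L2 m"
proof -
 have "integrable m (%x. (f x)^2)"
  by (rule integrable_bound[OF L2D(2)[OF assms(1)]])
   (use assms in \<open>auto simp: abs_le_square_iff[symmetric]\<close>)
 then show ?thesis using assms by (simp add: L2_def)
qed

lemma sq_int_mono:
 assumes "g \<in> L2 m" "f \<in> borel_measurable m" "!!x. \<bar>f x\<bar> <= \<bar>g x\<bar>"
 shows "sq_int m f <= sq_int m g"
 unfolding sq_int_def
 by (rule integral_mono)
  (use assms L2_bound[OF assms] in \<open>auto simp: abs_le_square_iff[symmetric] dest: L2D\<close>)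

lemma sq_int_cmult: "sq_int m (%x. c * f x) = c^2 * sq_int m f"
 by (simp add: sq_int_def power_mult_distrib)

lemma sq_int_eq_0_iff:
 assumes "f \<in> L2 m"
 shows "sq_int m f = 0 \<longleftrightarrow> (AE x in m. f x = 0)"
 unfolding sq_int_def
 using integral_nonneg_eq_0_iff_AE[OF L2D(2)[OF assms]] by auto

lemma sq_int_add_le:
 assumes "f \<in> L2 m" "g \<in> L2 m"
 shows "sq_int m (%x. f x + g x) <= 2 * sq_int m f + 2 * sq_int m g"
proof -
 have "sq_int m (%x. f x + g x) <= (LINT x|m. 2 * (f x)^2 + 2 * (g x)^2)"
  unfolding sq_int_def
 proof (rule integral_mono)
  show "integrable m (%x. (f x + g x)^2)"
   by (rule L2D(2)[OF L2_add[OF assms]])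
  show "integrable m (%x. 2 * (f x)^2 + 2 * (g x)^2)"
   using assms[THEN L2D(2)] by simp
  fix x
  have "0 <= (f x - g x)^2" by simp
  then show "(f x + g x)^2 <= 2 * (f x)^2 + 2 * (g x)^2"
   by (simp add: power2_eq_square algebra_simps)
 qed
 also have "... = 2 * sq_int m f + 2 * sq_int m g"
  using assms by (simp add: sq_int_def L2D)
 finally show ?thesis .
qed

lemma cauchy_schwarz_integral:
 assumes "f \<in> L2 m" "g \<in> L2 m"
 shows "(LINT x|m. f x * g x)^2 <= sq_int m f * sq_int m g"
proof (cases "sq_int m g = 0")
 case True
 then have "AE x in m. g x = 0" using sq_int_eq_0_iff[OF assms(2)] by simp
 then have "AE x in m. f x * g x = 0" by auto
 then have "(LINT x|m. f x * g x) = 0" by (rule integral_eq_zero_AE)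
 then show ?thesis by (simp add: True)
next
 case False
 define A where "A = sq_int m f"
 define B where "B = sq_int m g"
 define I where "I = (LINT x|m. f x * g x)"
 have B: "B > 0" using False sq_int_nonneg[of m g] unfolding B_def by linarith
 \<comment> \<open>The minimiser of the nonnegative quadratic
   \<open>A + 2 * t * I + t^2 * B\<close>.\<close>
 define t where "t = - I / B"
 have "0 <= sq_int m (%x. f x + t * g x)" by simp
 also have "... = (LINT x|m. (f x)^2 + (2 * t * (f x * g x) + t^2 * (g x)^2))"
  unfolding sq_int_def by (rule integral_cong) (auto simp: power2_eq_square algebra_simps)
 also have "... = A + (2 * t * I + t^2 * B)"
  using assms L2_mult[OF assms] by (simp add: L2D A_def B_def I_def sq_int_def)
 also have "... = A - I^2 / B"
  using B by (simp add: t_def power2_eq_square field_simps)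
 finally have "I^2 <= A * B" using B by (simp add: field_simps)
 then show ?thesis by (simp add: A_def B_def I_def)
qed

text \<open>Cauchy-Schwarz against the difference. The version with absolute values carries
  \<open>L2\<close> limits over to the weighted \<open>L1\<close> norm, the quantity that is
  monotone along orbits of a positive operator.\<close>

lemma integral_mult_tendsto:
 assumes phi: "phi \<in> L2 m" and f: "!!k. f k \<in> L2 m" and g: "g \<in> L2 m"
  and lim: "(%k. sq_int m (%x. f k x - g x)) \<longlonglongrightarrow> 0"
 shows "(%k. LINT x|m. phi x * f k x) \<longlonglongrightarrow> (LINT x|m. phi x * g x)"
  and "(%k. LINT x|m. phi x * \<bar>f k x\<bar>) \<longlonglongrightarrow> (LINT x|m. phi x * \<bar>g x\<bar>)"
proof -
 have d: "(%x. f k x - g x) \<in> L2 m" for k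
  using f g by (rule L2_diff)
 have 0: "(%k. LINT x|m. \<bar>phi x\<bar> * \<bar>f k x - g x\<bar>) \<longlonglongrightarrow> 0"
 proof -
  have "(%k. (LINT x|m. \<bar>phi x\<bar> * \<bar>f k x - g x\<bar>)^2) \<longlonglongrightarrow> 0"
  proof (rule tendsto_sandwich[OF _ _ tendsto_const])
   show "(%k. sq_int m phi * sq_int m (%x. f k x - g x)) \<longlonglongrightarrow> 0"
    using tendsto_mult[OF tendsto_const lim, of "sq_int m phi"] by simp
   show "\<forall>\<^sub>F k in sequentially. (LINT x|m. \<bar>phi x\<bar> * \<bar>f k x - g x\<bar>)^2 <= sq_int m phi * sq_int m (%x. f k x - g x)"
    using cauchy_schwarz_integral[OF L2_abs[OF phi] L2_abs[OF d]]
    by (simp add: sq_int_def)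
  qed auto
  from tendsto_real_sqrt[OF this] show ?thesis
   by (simp add: tendsto_rabs_zero_iff)
 qed
 have i1: "integrable m (%x. \<bar>phi x\<bar> * \<bar>f k x - g x\<bar>)" for k
  by (rule L2_mult[OF L2_abs[OF phi] L2_abs[OF d]])
 have i2: "integrable m (%x. phi x * f k x)" "integrable m (%x. phi x * \<bar>f k x\<bar>)" 
  "integrable m (%x. phi x * g x)" "integrable m (%x. phi x * \<bar>g x\<bar>)" for k
  by (auto intro!: L2_mult phi f g L2_abs)
 have est: "norm ((LINT x|m. phi x * F x) - (LINT x|m. phi x * G x)) <= (LINT x|m. \<bar>phi x\<bar> * \<bar>f k x - g x\<bar>)"
  if "integrable m (%x. phi x * F x)" "integrable m (%x. phi x * G x)"
   "!!x. \<bar>F x - G x\<bar> <= \<bar>f k x - g x\<bar>" for F G k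
 proof -
  have "norm ((LINT x|m. phi x * F x) - (LINT x|m. phi x * G x)) = norm (LINT x|m. phi x * F x - phi x * G x)"
   using that by simp
  also have "... <= (LINT x|m. norm (phi x * F x - phi x * G x))" by (rule integral_norm_bound)
  also have "... <= (LINT x|m. \<bar>phi x\<bar> * \<bar>f k x - g x\<bar>)"
  proof (rule integral_mono[OF _ i1])
   show "integrable m (%x. norm (phi x * F x - phi x * G x))" using that by simp
   show "norm (phi x * F x - phi x * G x) <= \<bar>phi x\<bar> * \<bar>f k x - g x\<bar>" for x
    using that(3)[of x] by (simp add: right_diff_distrib[symmetric] abs_mult mult_left_mono)
  qed
  finally show ?thesis .
 qed
 have "(%k. (LINT x|m. phi x * f k x) - (LINT x|m. phi x * g x)) \<longlonglongrightarrow> 0"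
  by (rule Lim_null_comparison[OF _ 0]) (intro always_eventually allI est i2 order_refl)
 then show "(%k. LINT x|m. phi x * f k x) \<longlonglongrightarrow> (LINT x|m. phi x * g x)" 
  by (rule LIM_zero_cancel)
 have "(%k. (LINT x|m. phi x * \<bar>f k x\<bar>) - (LINT x|m. phi x * \<bar>g x\<bar>)) \<longlonglongrightarrow> 0"
  by (rule Lim_null_comparison[OF _ 0]) (intro always_eventually allI est i2 abs_triangle_ineq3)
 then show "(%k. LINT x|m. phi x * \<bar>f k x\<bar>) \<longlonglongrightarrow> (LINT x|m. phi x * \<bar>g x\<bar>)" 
  by (rule LIM_zero_cancel)
qed

lemma AE_zero_of_weighted_abs:
 assumes "f \<in> L2 m" "phi \<in> L2 m" "!!x. 0 < phi x" "(LINT x|m. phi x * \<bar>f x\<bar>) = 0"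
 shows "AE x in m. f x = 0"
proof -
 have "AE x in m. phi x * \<bar>f x\<bar> = 0"
  using integral_nonneg_eq_0_iff_AE[OF L2_mult[OF assms(2) L2_abs[OF assms(1)]]] assms
  by (auto simp: less_imp_le)
 then show ?thesis using assms(3) by (auto simp: less_le)
qed

text \<open>A Perron-Frobenius setting whose leading eigenvalue is normalised to one:
  \<open>weight_invariant\<close> says that \<open>phi\<close> is an eigenfunction of the adjoint.
  It will be instantiated by \<open>U t\<close> for a fixed \<open>t\<close>. Functions are not
  identified modulo null sets; \<open>B_pos\<close> and \<open>B_cong\<close> are pointwise, as an
  operator with a positive kernel provides.\<close>

locale positive_compact_operator =
 fixes m :: "'a measure" and B :: "('a => real) => 'a => real" and phi :: "'a => real" and c0 :: real
 assumes B_closed: "f \<in> L2 m ==> B f \<in> L2 m"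
  and B_linear: "f \<in> L2 m ==> g \<in> L2 m ==>
    B (%x. c * f x + d * g x) = (%x. c * B f x + d * B g x)"
  and B_cong: "f \<in> L2 m ==> (AE x in m. f x = 0) ==> B f x = 0"
  and B_pos: "f \<in> L2 m ==> (!!x. 0 <= f x) ==> \<not> (AE x in m. f x = 0) ==> 0 < B f x"
  and B_bound: "f \<in> L2 m ==> sq_int m (B f) <= c0 * sq_int m f"
  and B_compact: "(!!k::nat. F k \<in> L2 m) ==> (!!k. sq_int m (F k) <= c) ==>
    \<exists>g\<in>L2 m. \<exists>r. strict_mono r \<and> (%k. sq_int m (%x. B (F (r k)) x - g x)) \<longlonglongrightarrow> 0"
  and weight: "phi \<in> L2 m" "!!x. 0 < phi x"
  and weight_invariant: "f \<in> L2 m ==> (LINT x|m. phi x * B f x) = (LINT x|m. phi x * f x)"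
  and nontrivial: "emeasure m (space m) \<noteq> 0"
begin

lemma B_diff:
 assumes "f \<in> L2 m" "g \<in> L2 m"
 shows "B (%x. f x - g x) = (%x. B f x - B g x)"
 using B_linear[OF assms, of 1 "-1"] by simp

lemma B_cmult: "f \<in> L2 m ==> B (%x. c * f x) = (%x. c * B f x)"
 using B_linear[of f f c 0] by simp

lemma B_nonneg: "f \<in> L2 m ==> (!!x. 0 <= f x) ==> 0 <= B f x"
 using B_pos[of f x] B_cong[of f x] by fastforce

lemma B_mono:
 assumes "f \<in> L2 m" "g \<in> L2 m" "!!x. f x <= g x"
 shows "B f x <= B g x"
proof -
 have "0 <= B (%x. g x - f x) x"
  using assms by (intro B_nonneg L2_diff) auto
 then show ?thesis using assms by (simp add: B_diff)
qed

lemma B_abs: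
 assumes "f \<in> L2 m"
 shows "\<bar>B f x\<bar> <= B (%x. \<bar>f x\<bar>) x"
proof -
 have "B f x <= B (%x. \<bar>f x\<bar>) x"
  using assms by (intro B_mono L2_abs) auto
 moreover have "- B f x <= B (%x. \<bar>f x\<bar>) x"
 proof -
  have "B (%x. (-1) * f x) x <= B (%x. \<bar>f x\<bar>) x"
   using assms by (intro B_mono L2_abs L2_cmult) auto
  then show ?thesis using B_cmult[OF assms, of "-1"] by simp
 qed
 ultimately show ?thesis by linarith
qed

lemma Bn_closed: "f \<in> L2 m ==> (B ^^ n) f \<in> L2 m"
 by (induction n) (auto intro: B_closed)

lemma Bn_linear:
 "f \<in> L2 m ==> g \<in> L2 m ==>
  (B ^^ n) (%x. c * f x + d * g x) = (%x. c * (B ^^ n) f x + d * (B ^^ n) g x)"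
 by (induction n) (auto simp: B_linear Bn_closed)

lemma Bn_abs:
 "f \<in> L2 m ==> \<bar>(B ^^ n) f x\<bar> <= (B ^^ n) (%x. \<bar>f x\<bar>) x"
proof (induction n arbitrary: x)
 case (Suc n)
 have "\<bar>B ((B ^^ n) f) x\<bar> <= B (%x. \<bar>(B ^^ n) f x\<bar>) x"
  by (intro B_abs Bn_closed Suc)
 also have "... <= B ((B ^^ n) (%x. \<bar>f x\<bar>)) x"
  by (intro B_mono L2_abs Bn_closed Suc)
 finally show ?case by simp
qed simp

lemma Bn_nonneg: "f \<in> L2 m ==> (!!x. 0 <= f x) ==> 0 <= (B ^^ n) f x"
 using Bn_abs[of f n x] by (simp add: abs_of_nonneg)

lemma Bn_weight: "f \<in> L2 m ==> (LINT x|m. phi x * (B ^^ n) f x) = (LINT x|m. phi x * f x)"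
 by (induction n) (auto simp: weight_invariant Bn_closed)

text \<open>
 If the powers were unbounded, rescaling at the first power exceeding a level \<open>k\<close> would produce,
 by compactness, a limit that is nonzero but integrates to zero against the invariant weight.
\<close>

lemma Bn_bounded_pos:
 "\<exists>C. \<forall>n. \<forall>f\<in>L2 m. (\<forall>x. 0 <= f x) \<longrightarrow> sq_int m f <= 1 \<longrightarrow> sq_int m ((B ^^ n) f) <= C"
proof (rule ccontr)
 let ?U = "{f \<in> L2 m. (\<forall>x. 0 <= f x) \<and> sq_int m f <= 1}"
 assume unbounded: "\<not> ?thesis"
 have unb: "\<exists>n. \<exists>f\<in>?U. C < sq_int m ((B ^^ n) f)" for C
 proof -
  from unbounded obtain n f where "f \<in> L2 m" "\<forall>x. 0 <= f x" "sq_int m f <= 1" "\<not> sq_int m ((B ^^ n) f) <= C"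
   by blast
  then show ?thesis by (intro exI[of _ n] bexI[of _ f]) auto
 qed
 \<comment> \<open>Minimality bounds the iterate just before. The level is \<open>Suc k\<close>, at
   least the squared norm of the starting function, which forces \<open>N k\<close> to be
   positive.\<close>
 define N where "N k = (LEAST n. \<exists>f\<in>?U. real (Suc k) < sq_int m ((B ^^ n) f))" for k
 have N: "\<exists>f\<in>?U. real (Suc k) < sq_int m ((B ^^ N k) f)" for k
  unfolding N_def by (rule LeastI_ex[OF unb])
 have Nmin: "sq_int m ((B ^^ j) f) <= real (Suc k)" if "j < N k" "f \<in> ?U" for j k f
  using not_less_Least[OF that(1)[unfolded N_def]] that(2) by (meson linorder_not_less)
 obtain f where f: "!!k. f k \<in> ?U" "!!k. real (Suc k) < sq_int m ((B ^^ N k) (f k))"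
  using choice[of "%k f. f \<in> ?U \<and> real (Suc k) < sq_int m ((B ^^ N k) f)"] N by blast
 have N0: "N k > 0" for k
 proof (rule ccontr)
  assume "\<not> 0 < N k"
  then have "real (Suc k) < sq_int m (f k)" using f(2)[of k] by simp
  then show False using f(1)[of k] by auto
 qed
 define s where "s k = sqrt (sq_int m ((B ^^ N k) (f k)))" for k
 have s2: "(s k)^2 = sq_int m ((B ^^ N k) (f k))" for k by (simp add: s_def)
 have s0: "s k > 0" for k using f(2)[of k] unfolding s_def by simp
 \<comment> \<open>The last iterate below the level, divided by the norm of the next one: the
   \<open>g k\<close> stay in the unit ball while their images have norm exactly one.\<close>
 define g where "g k = (%x. (1 / s k) * (B ^^ (N k - 1)) (f k) x)" for k
 have g: "g k \<in> L2 m" for k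
  unfolding g_def using f(1) by (intro L2_cmult Bn_closed) auto
 have g1: "sq_int m (g k) <= 1" for k
 proof -
  have "sq_int m (g k) = sq_int m ((B ^^ (N k - 1)) (f k)) / (s k)^2"
   unfolding g_def sq_int_cmult by (simp add: power_divide)
  also have "... <= 1"
   using Nmin[of "N k - 1" k "f k"] f[of k] N0[of k] s2[of k] s0[of k] by (auto simp: divide_le_eq)
  finally show ?thesis .
 qed
 have Bg: "B (g k) = (%x. (1 / s k) * (B ^^ N k) (f k) x)" for k
 proof -
  have "B (g k) = (%x. (1 / s k) * B ((B ^^ (N k - 1)) (f k)) x)"
   unfolding g_def using f(1) by (intro B_cmult Bn_closed) auto
  moreover have "B ((B ^^ (N k - 1)) (f k)) = (B ^^ N k) (f k)"
   using N0[of k] by (cases "N k") auto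
  ultimately show ?thesis by simp
 qed
 have Bg1: "sq_int m (B (g k)) = 1" for k
  unfolding Bg sq_int_cmult using s0[of k] by (simp add: s2[symmetric] power_divide)
 obtain h r where h: "h \<in> L2 m" and r: "strict_mono r"
  and lim: "(%k. sq_int m (%x. B (g (r k)) x - h x)) \<longlonglongrightarrow> 0"
  using B_compact[of g 1] g g1 by blast
 \<comment> \<open>On nonnegative functions the weighted integral is invariant, so the rescaling
   divides a bounded quantity by \<open>s k\<close>, which tends to infinity.\<close>
 have w0: "(%k. LINT x|m. phi x * \<bar>B (g k) x\<bar>) \<longlonglongrightarrow> 0"
 proof (rule tendsto_sandwich[OF _ _ tendsto_const])
  show "(%k. sqrt (sq_int m phi / real (Suc k))) \<longlonglongrightarrow> 0"
   using tendsto_real_sqrt[OF tendsto_mult[OF tendsto_const[of "sq_int m phi"] lim_inverse_n'[THEN LIMSEQ_Suc]]]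
   by (simp add: field_simps)
  show "\<forall>\<^sub>F k in sequentially. 0 <= (LINT x|m. phi x * \<bar>B (g k) x\<bar>)"
   by (auto intro!: always_eventually integral_nonneg_AE simp: weight(2) less_imp_le)
  show "\<forall>\<^sub>F k in sequentially. (LINT x|m. phi x * \<bar>B (g k) x\<bar>) <= sqrt (sq_int m phi / real (Suc k))"
  proof (intro always_eventually allI)
   fix k
   have fk: "f k \<in> L2 m" "!!x. 0 <= f k x" "sq_int m (f k) <= 1" using f(1)[of k] by auto
   have "(LINT x|m. phi x * \<bar>B (g k) x\<bar>) = (LINT x|m. (1 / s k) * (phi x * (B ^^ N k) (f k) x))"
    unfolding Bg using s0[of k] Bn_nonneg[OF fk(1,2)]
    by (intro integral_cong) (auto simp: abs_mult)
   also have "... = (1 / s k) * (LINT x|m. phi x * f k x)"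
    using Bn_weight[OF fk(1)] by simp
   finally have "(LINT x|m. phi x * \<bar>B (g k) x\<bar>)^2 = (LINT x|m. phi x * f k x)^2 / (s k)^2"
    by (simp add: power_divide)
   also have "... <= sq_int m phi / (s k)^2"
   proof (rule divide_right_mono)
    have "(LINT x|m. phi x * f k x)^2 <= sq_int m phi * sq_int m (f k)"
     by (rule cauchy_schwarz_integral[OF weight(1) fk(1)])
    also have "... <= sq_int m phi" using fk(3) by (simp add: mult_left_le)
    finally show "(LINT x|m. phi x * f k x)^2 <= sq_int m phi" .
   qed simp
   also have "... <= sq_int m phi / real (Suc k)"
    using f(2)[of k] s2[of k] by (intro divide_left_mono) (auto intro!: mult_pos_pos)
   finally show "(LINT x|m. phi x * \<bar>B (g k) x\<bar>) <= sqrt (sq_int m phi / real (Suc k))"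
    by (rule real_le_rsqrt)
  qed
 qed
 have "(%k. LINT x|m. phi x * \<bar>B (g (r k)) x\<bar>) \<longlonglongrightarrow> (LINT x|m. phi x * \<bar>h x\<bar>)"
  by (rule integral_mult_tendsto(2)[OF weight(1) B_closed[OF g] h lim])
 moreover have "(%k. LINT x|m. phi x * \<bar>B (g (r k)) x\<bar>) \<longlonglongrightarrow> 0"
  using LIMSEQ_subseq_LIMSEQ[OF w0 r] by (simp add: o_def)
 ultimately have "(LINT x|m. phi x * \<bar>h x\<bar>) = 0" by (rule LIMSEQ_unique)
 then have "sq_int m h = 0"
  using AE_zero_of_weighted_abs[OF h weight] sq_int_eq_0_iff[OF h] by simp
 moreover have "1 <= 2 * sq_int m (%x. B (g (r k)) x - h x) + 2 * sq_int m h" for k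
  using sq_int_add_le[OF L2_diff[OF B_closed[OF g[of "r k"]] h] h] Bg1[of "r k"] by simp
 ultimately have "1 / 2 <= sq_int m (%x. B (g (r k)) x - h x)" for k
  by (simp add: mult.commute)
 then have "1 / 2 <= (0::real)"
  by (intro LIMSEQ_le_const[OF lim]) auto
 then show False by simp
qed

text \<open>Domination of \<open>(B ^^ n) f\<close> by the iterate of the absolute value and
  homogeneity extend the bound from the nonnegative part of the unit ball.\<close>

lemma Bn_bounded:
 obtains C where "C > 0" "!!n f. f \<in> L2 m ==> sq_int m ((B ^^ n) f) <= C * sq_int m f"
proof -
 obtain C where C: "!!n f. f \<in> L2 m ==> (!!x. 0 <= f x) ==> sq_int m f <= 1 ==> sq_int m ((B ^^ n) f) <= C"
  using Bn_bounded_pos by metis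
 have C0: "C \<ge> 0" using C[of "%_. 0" 0] by (simp add: sq_int_def)
 show ?thesis
 proof (rule that[of "C + 1"])
  show "C + 1 > 0" using C0 by simp
  fix n f assume f: "f \<in> L2 m"
  have af: "(%x. \<bar>f x\<bar>) \<in> L2 m" using f by (rule L2_abs)
  have aeq: "sq_int m (%x. \<bar>f x\<bar>) = sq_int m f" by (simp add: sq_int_def)
  have le: "sq_int m ((B ^^ n) f) <= sq_int m ((B ^^ n) (%x. \<bar>f x\<bar>))"
  proof (rule sq_int_mono[OF Bn_closed[OF af] L2D(1)[OF Bn_closed[OF f]]])
   fix x show "\<bar>(B ^^ n) f x\<bar> <= \<bar>(B ^^ n) (%x. \<bar>f x\<bar>) x\<bar>"
    using Bn_abs[OF f, of n x] by linarith
  qed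
  show "sq_int m ((B ^^ n) f) <= (C + 1) * sq_int m f"
  proof (cases "sq_int m f = 0")
   case True
   \<comment> \<open>With no norm to divide by, scaling works in the other direction: every multiple
     of a null function lies in the unit ball, so arbitrarily large multiples of its image obey the
     same bound \<open>C\<close>.\<close>
   then have "sq_int m (%x. c * \<bar>f x\<bar>) <= 1" for c using aeq by (simp only: sq_int_cmult mult_zero_right zero_le_one)
   then have "sq_int m ((B ^^ n) (%x. \<bar>c\<bar> * \<bar>f x\<bar>)) <= C" for c
    by (intro C L2_cmult af) auto
   moreover have "(B ^^ n) (%x. c * \<bar>f x\<bar>) = (%x. c * (B ^^ n) (%x. \<bar>f x\<bar>) x)" for c
    using Bn_linear[OF af af, of n c 0] by simp
   ultimately have "sq_int m (%x. \<bar>c\<bar> * (B ^^ n) (%x. \<bar>f x\<bar>) x) <= C" for c by simp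
   then have *: "c^2 * sq_int m ((B ^^ n) (%x. \<bar>f x\<bar>)) <= C" for c
    by (simp only: sq_int_cmult power2_abs)
   have "sq_int m ((B ^^ n) (%x. \<bar>f x\<bar>)) = 0"
   proof (rule ccontr)
    assume "\<not> ?thesis"
    then have p: "0 < sq_int m ((B ^^ n) (%x. \<bar>f x\<bar>))" by (simp add: order_less_le)
    define S where "S = sq_int m ((B ^^ n) (%x. \<bar>f x\<bar>))"
    have "(sqrt ((C + 1) / S))^2 * S <= C" unfolding S_def by (rule *)
    then show False using p C0 unfolding S_def[symmetric] by simp
   qed
   then show ?thesis using le True by simp
  next
   case False
   define S where "S = sq_int m f"
   have S: "S > 0" using False unfolding S_def by (simp add: order_less_le)
   define c where "c = 1 / sqrt S"
   have c2: "c^2 = 1 / S" using S by (simp add: c_def power_divide)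
   have "sq_int m ((B ^^ n) (%x. c * \<bar>f x\<bar>)) <= C"
   proof (rule C)
    show "sq_int m (%x. c * \<bar>f x\<bar>) <= 1"
     unfolding sq_int_cmult aeq c2 using S by (simp add: S_def)
    show "0 <= c * \<bar>f x\<bar>" for x using S by (simp add: c_def)
   qed (rule L2_cmult[OF af])
   moreover have "(B ^^ n) (%x. c * \<bar>f x\<bar>) = (%x. c * (B ^^ n) (%x. \<bar>f x\<bar>) x)"
    using Bn_linear[OF af af, of n c 0] by simp
   ultimately have "sq_int m ((B ^^ n) (%x. \<bar>f x\<bar>)) / S <= C"
    by (simp add: sq_int_cmult c2)
   then have "sq_int m ((B ^^ n) (%x. \<bar>f x\<bar>)) <= C * S" using S by (simp add: field_simps)
   then show ?thesis using le S unfolding S_def by (simp add: algebra_simps)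
  qed
 qed
qed

text \<open>
 The weighted \<open>L\<^sup>1\<close> norm is nonincreasing along the orbit, so it is the same for a limit point and
 its image; a strictly positive operator preserves it only for functions of constant sign.
\<close>

lemma limit_point_zero:
 assumes f: "f \<in> L2 m" "(LINT x|m. phi x * f x) = 0"
  and w: "w \<in> L2 m" and r: "strict_mono r"
  and lim: "(%k. sq_int m (%x. (B ^^ (r k)) f x - w x)) \<longlonglongrightarrow> 0"
 shows "AE x in m. w x = 0"
proof -
 define N where "N h = (LINT x|m. phi x * \<bar>h x\<bar>)" for h
 have iN: "integrable m (%x. phi x * \<bar>h x\<bar>)" if "h \<in> L2 m" for h
  by (rule L2_mult[OF weight(1) L2_abs[OF that]])
 have NB: "N (B h) <= N h" if h: "h \<in> L2 m" for h
 proof -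
  have "N (B h) <= (LINT x|m. phi x * B (%x. \<bar>h x\<bar>) x)"
   unfolding N_def
   by (intro integral_mono iN B_closed L2_mult weight(1) L2_abs h mult_left_mono B_abs)
     (simp add: weight(2) less_imp_le)
  also have "... = N h" unfolding N_def by (rule weight_invariant[OF L2_abs[OF h]])
  finally show ?thesis .
 qed
 define a where "a n = N ((B ^^ n) f)" for n
 have "decseq a"
  unfolding a_def by (rule decseq_SucI) (auto intro: NB Bn_closed f)
 moreover have "\<forall>n. 0 <= a n"
  unfolding a_def N_def by (intro allI integral_nonneg_AE) (auto simp: weight(2) less_imp_le)
 ultimately obtain L where L: "a \<longlonglongrightarrow> L"
  using decseq_convergent[of a 0] by blast
 have "(%k. a (r k)) \<longlonglongrightarrow> N w"
  unfolding a_def N_def by (rule integral_mult_tendsto(2)[OF weight(1) Bn_closed[OF f(1)] w lim])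
 then have Lw: "N w = L"
  using LIMSEQ_subseq_LIMSEQ[OF L r] unfolding o_def by (rule LIMSEQ_unique)
 have lim2: "(%k. sq_int m (%x. (B ^^ (Suc (r k))) f x - B w x)) \<longlonglongrightarrow> 0"
 proof (rule tendsto_sandwich[OF _ _ tendsto_const])
  show "(%k. c0 * sq_int m (%x. (B ^^ (r k)) f x - w x)) \<longlonglongrightarrow> 0"
   using tendsto_mult[OF tendsto_const lim, of c0] by simp
  have "sq_int m (%x. (B ^^ (Suc (r k))) f x - B w x) <= c0 * sq_int m (%x. (B ^^ (r k)) f x - w x)" for k
   using B_bound[OF L2_diff[OF Bn_closed[OF f(1)] w], of "r k"] B_diff[OF Bn_closed[OF f(1)] w, of "r k"]
   by simp
  then show "\<forall>\<^sub>F k in sequentially. sq_int m (%x. (B ^^ (Suc (r k))) f x - B w x) <= c0 * sq_int m (%x. (B ^^ (r k)) f x - w x)"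
   by simp
 qed auto
 have "(%k. a (Suc (r k))) \<longlonglongrightarrow> N (B w)"
  unfolding a_def N_def by (rule integral_mult_tendsto(2)[OF weight(1) Bn_closed[OF f(1)] B_closed[OF w] lim2])
 moreover have "(%k. a (Suc (r k))) \<longlonglongrightarrow> L"
  using LIMSEQ_subseq_LIMSEQ[OF LIMSEQ_Suc[OF L] r] by (simp add: o_def)
 ultimately have LBw: "N (B w) = L" by (rule LIMSEQ_unique)
 have w0: "(LINT x|m. phi x * w x) = 0"
  using integral_mult_tendsto(1)[OF weight(1) Bn_closed[OF f(1)] w lim] Bn_weight[OF f(1)] f(2)
  by (simp add: LIMSEQ_const_iff)
 let ?p = "%x. max 0 (w x)" and ?n = "%x. max 0 (- w x)"
 have p: "?p \<in> L2 m" and n: "?n \<in> L2 m"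
  using w by (auto intro!: L2_bound[OF w] dest: L2D)
 have wpn: "w = (%x. ?p x - ?n x)" "(%x. \<bar>w x\<bar>) = (%x. 1 * ?p x + 1 * ?n x)" by auto
 have Bw: "B w = (%x. B ?p x - B ?n x)" by (subst wpn(1)) (rule B_diff[OF p n])
 have Baw: "B (%x. \<bar>w x\<bar>) = (%x. B ?p x + B ?n x)"
  by (subst wpn(2), subst B_linear[OF p n]) simp
 have one: "(AE x in m. ?p x = 0) \<or> (AE x in m. ?n x = 0)"
 proof (rule ccontr)
  assume "\<not> ?thesis"
  then have pos: "0 < B ?p x" "0 < B ?n x" for x
   using B_pos[OF p] B_pos[OF n] by auto
  let ?D = "%x. phi x * B (%x. \<bar>w x\<bar>) x - phi x * \<bar>B w x\<bar>"
  have i1: "integrable m (%x. phi x * B (%x. \<bar>w x\<bar>) x)"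
   by (intro L2_mult weight(1) B_closed L2_abs w)
  have "(LINT x|m. ?D x) = N w - N (B w)"
   using i1 iN[OF B_closed[OF w]] weight_invariant[OF L2_abs[OF w]] by (simp add: N_def)
  then have "(LINT x|m. ?D x) = 0" using Lw LBw by simp
  moreover have Dpos: "0 < ?D x" for x
   unfolding Bw Baw using pos[of x] weight(2)[of x] by (auto simp: right_diff_distrib[symmetric] abs_if)
  ultimately have "AE x in m. ?D x = 0"
   using integral_nonneg_eq_0_iff_AE[of m ?D] i1 iN[OF B_closed[OF w]] by (auto simp: less_imp_le)
  then have "AE x in m. False"
   by (rule AE_mp) (rule AE_I2, metis Dpos less_irrefl)
  then show False using nontrivial AE_iff_measurable[OF sets.top, of m "%_. False"] by simp
 qed
 \<comment> \<open>On a function of constant sign the weighted norm is, up to sign, the weighted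
   integral, and that is inherited from \<open>f\<close> and equal to zero.\<close>
 have "N w = 0"
  using one
 proof
  assume "AE x in m. ?p x = 0"
  then have "AE x in m. phi x * \<bar>w x\<bar> = - (phi x * w x)" by eventually_elim auto
  then have "N w = (LINT x|m. - (phi x * w x))"
   unfolding N_def using w[THEN L2D(1)] weight(1)[THEN L2D(1)] by (intro integral_cong_AE) auto
  then show ?thesis using w0 by simp
 next
  assume "AE x in m. ?n x = 0"
  then have "AE x in m. phi x * \<bar>w x\<bar> = phi x * w x" by eventually_elim auto
  then have "N w = (LINT x|m. phi x * w x)"
   unfolding N_def using w[THEN L2D(1)] weight(1)[THEN L2D(1)] by (intro integral_cong_AE) auto
  then show ?thesis using w0 by simp
 qed
 then show ?thesis using AE_zero_of_weighted_abs[OF w weight] by (simp add: N_def)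
qed

text \<open>If infinitely many iterates stayed away from zero, compactness of \<open>B\<close> on
  the bounded orbit would yield a limit point of them, which \<open>limit_point_zero\<close> forces
  to vanish.\<close>

lemma Bn_tendsto_zero:
 assumes f: "f \<in> L2 m" "(LINT x|m. phi x * f x) = 0"
 shows "(%n. sq_int m ((B ^^ n) f)) \<longlonglongrightarrow> 0"
proof (rule ccontr)
 assume "\<not> ?thesis"
 then obtain e where e: "e > 0" "!!n0. \<exists>n\<ge>n0. e <= sq_int m ((B ^^ n) f)"
  unfolding LIMSEQ_iff by (auto simp: not_less)
 obtain C where C: "C > 0" "!!n f. f \<in> L2 m ==> sq_int m ((B ^^ n) f) <= C * sq_int m f"
  using Bn_bounded by metis
 \<comment> \<open>The index is shifted by one because compactness is a statement about images under
   \<open>B\<close>.\<close>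
 have inf: "infinite {n. e <= sq_int m ((B ^^ Suc n) f)}"
  unfolding infinite_nat_iff_unbounded_le
 proof
  fix n0
  obtain n where "n \<ge> Suc n0" "e <= sq_int m ((B ^^ n) f)" using e(2) by blast
  then obtain j where "n = Suc j" by (cases n) auto
  then show "\<exists>n\<ge>n0. n \<in> {n. e <= sq_int m ((B ^^ Suc n) f)}"
   using \<open>n \<ge> Suc n0\<close> \<open>e <= _\<close> by (intro exI[of _ j]) auto
 qed
 define s where "s = enumerate {n. e <= sq_int m ((B ^^ Suc n) f)}"
 have s: "strict_mono s" unfolding s_def by (rule strict_mono_enumerate[OF inf])
 have se: "e <= sq_int m ((B ^^ Suc (s k)) f)" for k
  using enumerate_in_set[OF inf, of k] unfolding s_def by simp
 obtain w r where w: "w \<in> L2 m" and r: "strict_mono r"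
  and lim: "(%k. sq_int m (%x. B ((B ^^ s (r k)) f) x - w x)) \<longlonglongrightarrow> 0"
  using B_compact[of "%k. (B ^^ s k) f" "C * sq_int m f"] Bn_closed[OF f(1)] C(2)[OF f(1)] by blast
 have "AE x in m. w x = 0"
 proof (rule limit_point_zero[OF f w])
  show "strict_mono (%k. Suc (s (r k)))"
   using s r by (auto simp: strict_mono_def)
  show "(%k. sq_int m (%x. (B ^^ Suc (s (r k))) f x - w x)) \<longlonglongrightarrow> 0"
   using lim by simp
 qed
 then have "sq_int m w = 0" using sq_int_eq_0_iff[OF w] by simp
 moreover have "e <= 2 * sq_int m (%x. B ((B ^^ s (r k)) f) x - w x) + 2 * sq_int m w" for k
  using sq_int_add_le[OF L2_diff[OF B_closed[OF Bn_closed[OF f(1), of "s (r k)"]] w] w] se[of "r k"]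
  by simp
 ultimately have "e / 2 <= sq_int m (%x. B ((B ^^ s (r k)) f) x - w x)" for k
  by (simp add: mult.commute)
 then have "e / 2 <= 0"
  by (intro LIMSEQ_le_const[OF lim]) auto
 then show False using e(1) by simp
qed

text \<open>Decay of each single orbit becomes uniform: normalised counterexamples
  \<open>f n\<close> for all powers \<open>n\<close> would have, after one application of
  \<open>B\<close>, a convergent subsequence. Its limit \<open>w\<close> has a decaying orbit, and
  the uniform bound on the powers controls the distance to that orbit.\<close>

lemma Bn_contraction:
 "\<exists>n. \<forall>f\<in>L2 m. (LINT x|m. phi x * f x) = 0 \<longrightarrow> sq_int m ((B ^^ n) f) <= sq_int m f / 2"
proof (rule ccontr)
 assume "\<not> ?thesis"
 then have "\<forall>n. \<exists>f\<in>L2 m. (LINT x|m. phi x * f x) = 0 \<and> sq_int m f / 2 < sq_int m ((B ^^ n) f)"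
  by (auto simp: not_le)
 then obtain h where h: "!!n. h n \<in> L2 m" "!!n. (LINT x|m. phi x * h n x) = 0"
  "!!n. sq_int m (h n) / 2 < sq_int m ((B ^^ n) (h n))" by metis
 obtain C where C: "C > 0" "!!n f. f \<in> L2 m ==> sq_int m ((B ^^ n) f) <= C * sq_int m f"
  using Bn_bounded by metis
 have hpos: "0 < sq_int m (h n)" for n
 proof (rule ccontr)
  assume "\<not> ?thesis"
  then have "sq_int m (h n) = 0" using sq_int_nonneg[of m "h n"] by linarith
  then show False using h(3)[of n] C(2)[OF h(1), of n n] by simp
 qed
 define f where "f n = (%x. (1 / sqrt (sq_int m (h n))) * h n x)" for n
 have f: "f n \<in> L2 m" for n unfolding f_def by (rule L2_cmult[OF h(1)])
 have f1: "sq_int m (f n) = 1" for n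
  unfolding f_def sq_int_cmult using hpos[of n] by (simp add: power_divide)
 have f0: "(LINT x|m. phi x * f n x) = 0" for n
 proof -
  have "(LINT x|m. phi x * f n x) = (LINT x|m. (1 / sqrt (sq_int m (h n))) * (phi x * h n x))"
   unfolding f_def by (rule integral_cong) auto
  then show ?thesis using h(2)[of n] by simp
 qed
 have fn: "1 / 2 < sq_int m ((B ^^ n) (f n))" for n
 proof -
  have "(B ^^ n) (f n) = (%x. (1 / sqrt (sq_int m (h n))) * (B ^^ n) (h n) x)"
   unfolding f_def using Bn_linear[OF h(1)[of n] h(1)[of n], of n "1 / sqrt (sq_int m (h n))" 0] by simp
  then have "sq_int m ((B ^^ n) (f n)) = (1 / sqrt (sq_int m (h n)))^2 * sq_int m ((B ^^ n) (h n))"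
   by (simp only: sq_int_cmult)
  also have "... = sq_int m ((B ^^ n) (h n)) / sq_int m (h n)"
   using hpos[of n] by (simp add: power_divide)
  finally show ?thesis using h(3)[of n] hpos[of n] by (simp add: less_divide_eq)
 qed
 obtain w r where w: "w \<in> L2 m" and r: "strict_mono r"
  and lim: "(%k. sq_int m (%x. B (f (r k)) x - w x)) \<longlonglongrightarrow> 0"
  using B_compact[of f 1] f f1 by auto
 have w0: "(LINT x|m. phi x * w x) = 0"
  using integral_mult_tendsto(1)[OF weight(1) B_closed[OF f] w lim] weight_invariant[OF f] f0
  by (simp add: LIMSEQ_const_iff)
 \<comment> \<open>Starting at \<open>Suc k\<close> keeps the index \<open>r (Suc k)\<close>
   positive, so that one application of \<open>B\<close> can be split off.\<close>
 have "(%k. 2 * (C * sq_int m (%x. B (f (r (Suc k))) x - w x)) + 2 * sq_int m ((B ^^ (r (Suc k) - 1)) w)) \<longlonglongrightarrow> 2 * (C * 0) + 2 * 0"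
 proof (intro tendsto_intros)
  show "(%k. sq_int m (%x. B (f (r (Suc k))) x - w x)) \<longlonglongrightarrow> 0"
   using LIMSEQ_Suc[OF lim] by simp
  have "strict_mono (%k. r (Suc k) - 1)"
  proof (rule strict_monoI_Suc)
   fix k have "r (Suc k) < r (Suc (Suc k))" using r by (simp add: strict_mono_def)
   moreover have "0 < r (Suc k)" using strict_mono_imp_increasing[OF r, of "Suc k"] by simp
   ultimately show "r (Suc k) - 1 < r (Suc (Suc k)) - 1" by linarith
  qed
  from LIMSEQ_subseq_LIMSEQ[OF Bn_tendsto_zero[OF w w0] this]
  show "(%k. sq_int m ((B ^^ (r (Suc k) - 1)) w)) \<longlonglongrightarrow> 0" by (simp add: o_def)
 qed
 moreover have "1 / 2 <= 2 * (C * sq_int m (%x. B (f (r (Suc k))) x - w x)) + 2 * sq_int m ((B ^^ (r (Suc k) - 1)) w)" for k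
 proof -
  define n where "n = r (Suc k) - 1"
  have n: "r (Suc k) = Suc n" using strict_mono_imp_increasing[OF r, of "Suc k"] by (simp add: n_def)
  have d: "(%x. B (f (r (Suc k))) x - w x) \<in> L2 m"
   by (rule L2_diff[OF B_closed[OF f] w])
  have "(B ^^ Suc n) (f (Suc n)) = (B ^^ n) (%x. 1 * (B (f (Suc n)) x - w x) + 1 * w x)"
   by (simp add: funpow_swap1)
  also have "... = (%x. 1 * (B ^^ n) (%x. B (f (Suc n)) x - w x) x + 1 * (B ^^ n) w x)"
   using d w n by (intro Bn_linear) auto
  finally have "sq_int m ((B ^^ Suc n) (f (Suc n))) \<le>
    2 * sq_int m ((B ^^ n) (%x. B (f (Suc n)) x - w x)) + 2 * sq_int m ((B ^^ n) w)"
   using sq_int_add_le[OF Bn_closed[OF d, of n] Bn_closed[OF w, of n]] n by simp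
  also have "... <= 2 * (C * sq_int m (%x. B (f (Suc n)) x - w x)) + 2 * sq_int m ((B ^^ n) w)"
   using C(2)[OF d, of n] n by simp
  finally show ?thesis using fn[of "Suc n"] by (simp only: n diff_Suc_1)
 qed
 ultimately have "1 / 2 <= 2 * (C * 0) + 2 * (0::real)"
  by (intro LIMSEQ_le_const) blast+
 then show False by simp
qed

theorem Bn_exponential_decay:
 obtains C \<rho> where "C > 0" "0 < \<rho>" "\<rho> < 1"
  "!!n f. f \<in> L2 m ==> (LINT x|m. phi x * f x) = 0 ==> sq_int m ((B ^^ n) f) <= C * \<rho> ^ n * sq_int m f"
proof -
 obtain N where N: "!!f. f \<in> L2 m ==> (LINT x|m. phi x * f x) = 0 ==> sq_int m ((B ^^ N) f) <= sq_int m f / 2"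
  using Bn_contraction by blast
 obtain C where C: "C > 0" "!!n f. f \<in> L2 m ==> sq_int m ((B ^^ n) f) <= C * sq_int m f"
  using Bn_bounded by metis
 \<comment> \<open>The exponent \<open>N\<close> may be zero, whereas \<open>root M\<close> asks for
   a positive index.\<close>
 define M where "M = Suc N"
 have NM: "sq_int m ((B ^^ (N * k)) f) <= (1/2) ^ k * sq_int m f"
  if f: "f \<in> L2 m" "(LINT x|m. phi x * f x) = 0" for k f
 proof (induction k)
  case (Suc k)
  have "(B ^^ (N * Suc k)) f = (B ^^ N) ((B ^^ (N * k)) f)"
   by (simp add: funpow_add)
  then have "sq_int m ((B ^^ (N * Suc k)) f) <= sq_int m ((B ^^ (N * k)) f) / 2"
   using N[of "(B ^^ (N * k)) f"] Bn_closed[OF f(1)] Bn_weight[OF f(1)] f(2) by simp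
  then show ?case using Suc by simp
 qed simp
 define \<rho> where "\<rho> = root M (1/2)"
 have M0: "M > 0" by (simp add: M_def)
 have \<rho>: "0 < \<rho>" "\<rho> < 1" "\<rho> ^ M = 1/2"
  using M0 by (auto simp: \<rho>_def)
 show ?thesis
 proof (rule that[of "2 * C" \<rho>])
  fix n f assume f: "f \<in> L2 m" "(LINT x|m. phi x * f x) = 0"
  define k where "k = n div M"
  have "N * k <= n" 
   using mult_le_mono1[of N M k] times_div_less_eq_dividend[of M n] unfolding k_def M_def by linarith
  then have "(B ^^ n) f = (B ^^ (n - N * k)) ((B ^^ (N * k)) f)"
   by (metis comp_apply funpow_add le_add_diff_inverse2)
  then have "sq_int m ((B ^^ n) f) <= C * sq_int m ((B ^^ (N * k)) f)"
   using C(2)[OF Bn_closed[OF f(1)]] by simp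
  also have "... <= C * ((1/2) ^ k * sq_int m f)"
   using NM[OF f] C(1) by (intro mult_left_mono) auto
  \<comment> \<open>Rounding \<open>n\<close> up to the next multiple of \<open>M\<close> loses at
    most one block, which costs the factor 2, the inverse of \<open>\<rho> ^ M\<close>.\<close>
  also have "(1/2) ^ k <= 2 * \<rho> ^ n"
  proof -
   have "n <= M * k + M" unfolding k_def using M0
    using M0 mod_less_divisor[of M n] mult_div_mod_eq[of M n] by linarith
   then have "\<rho> ^ (M * k + M) <= \<rho> ^ n"
    using \<rho> by (intro power_decreasing) auto
   then show ?thesis using \<rho>(3) by (simp add: power_add power_mult)
  qed
  then have "C * ((1/2) ^ k * sq_int m f) <= C * (2 * \<rho> ^ n * sq_int m f)"
   using C(1) by (intro mult_left_mono mult_right_mono) auto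
  finally show "sq_int m ((B ^^ n) f) <= 2 * C * \<rho> ^ n * sq_int m f" by simp
 qed (use C \<rho> in auto)
qed

end

text \<open>Time is replaced by the next grid point strictly to its right. This takes countably many
  values, so the composition is measurable, and right continuity recovers \<open>Fn\<close> as the
  mesh tends to zero.\<close>

lemma borel_measurable_right_continuous_joint:
 fixes Fn :: "real => 'a => real"
 assumes m: "!!v. 0 <= v ==> Fn v \<in> borel_measurable N"
  and rc: "!!v y. 0 <= v ==> y \<in> space N ==> ((%w. Fn w y) \<longlongrightarrow> Fn v y) (at_right v)"
 shows "(%z. Fn (max 0 (fst z)) (snd z)) \<in> borel_measurable (borel \<Otimes>\<^sub>M N)"
proof (rule borel_measurable_LIMSEQ_real)
 \<comment> \<open>The added 1 makes the grid point strictly larger than \<open>v\<close>, as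
   convergence within \<open>at_right\<close> demands.\<close>
 define d where "d k v = (real (nat \<lfloor>real (Suc k) * max 0 v\<rfloor>) + 1) / real (Suc k)" for k :: nat and v :: real
 have d: "max 0 v < d k v" "d k v <= max 0 v + 1 / real (Suc k)" for k v
 proof -
  have "real (nat \<lfloor>real (Suc k) * max 0 v\<rfloor>) = of_int \<lfloor>real (Suc k) * max 0 v\<rfloor>"
   by simp
  then have *: "real (Suc k) * max 0 v < real (nat \<lfloor>real (Suc k) * max 0 v\<rfloor>) + 1"
   "real (nat \<lfloor>real (Suc k) * max 0 v\<rfloor>) <= real (Suc k) * max 0 v"
   by linarith+
  show "max 0 v < d k v"
   unfolding d_def using *(1) by (subst pos_less_divide_eq) (simp_all only: mult.commute of_nat_0_less_iff zero_less_Suc)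
  have "d k v <= (real (Suc k) * max 0 v + 1) / real (Suc k)"
   unfolding d_def using *(2) by (intro divide_right_mono) auto
  also have "... = max 0 v + 1 / real (Suc k)"
   by (subst add_divide_distrib) simp
  finally show "d k v <= max 0 v + 1 / real (Suc k)" .
 qed
 show "(%z. Fn (d k (fst z)) (snd z)) \<in> borel_measurable (borel \<Otimes>\<^sub>M N)" for k
 proof -
  have "(%z. (%i z. Fn ((real i + 1) / real (Suc k)) (snd z)) (nat \<lfloor>real (Suc k) * max 0 (fst z)\<rfloor>) z)
    \<in> borel_measurable (borel \<Otimes>\<^sub>M N)"
  proof (rule measurable_compose_countable[where f="%i z. Fn ((real i + 1) / real (Suc k)) (snd z)"
     and g="%z. nat \<lfloor>real (Suc k) * max 0 (fst z)\<rfloor>"])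
   show "(%z. Fn ((real i + 1) / real (Suc k)) (snd z)) \<in> borel_measurable (borel \<Otimes>\<^sub>M N)" for i
    by (rule measurable_compose[OF measurable_snd m]) simp
  qed measurable
  then show ?thesis by (simp add: d_def)
 qed
 show "(%k. Fn (d k (fst z)) (snd z)) \<longlonglongrightarrow> Fn (max 0 (fst z)) (snd z)" if "z \<in> space (borel \<Otimes>\<^sub>M N)" for z
 proof -
  let ?v = "max 0 (fst z)"
  have lim: "(%k. d k (fst z)) \<longlonglongrightarrow> ?v"
  proof (rule tendsto_sandwich[of "%_. ?v" _ _ "%k. ?v + 1 / real (Suc k)"])
   show "(%k. ?v + 1 / real (Suc k)) \<longlonglongrightarrow> ?v"
    using tendsto_add[OF tendsto_const lim_inverse_n'[THEN LIMSEQ_Suc], of ?v] by simp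
  qed (use d in \<open>auto intro!: always_eventually less_imp_le simp del: of_nat_Suc\<close>)
  have "filterlim (%k. d k (fst z)) (at_right ?v) sequentially"
   using lim d(1)[of "fst z"] less_imp_neq[OF d(1)[of "fst z"], symmetric]
   unfolding filterlim_at greaterThan_iff by (intro conjI always_eventually allI)
  moreover have "snd z \<in> space N" using that by (auto simp: space_pair_measure)
  ultimately show ?thesis
   using filterlim_compose[OF rc[of ?v "snd z"]] by auto
 qed
qed

section \<open>The one-point compactification\<close>

abbreviation opc :: "'a::t2_space option topology" where "opc \<equiv> one_point_compactification"

lemma sets_borel_on_opc: "sets (borel_on opc) = sigma_sets UNIV {U. openin opc U}"
 unfolding borel_on_def by (subst sets_measure_of) auto

lemma space_borel_on: "space (borel_on S) = topspace S"
 unfolding borel_on_def by (intro space_measure_of) (auto dest: openin_subset)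

lemma openin_opc_Some: "open U ==> openin opc (Some ` U)"
 by (simp add: openin_one_point_compactification inj_vimage_image_eq)

lemma Some_image_sets:
 fixes B :: "'a::t2_space set"
 assumes "B \<in> sets borel"
 shows "Some ` B \<in> sets (borel_on opc)"
proof -
 have op: "Some ` U \<in> sets (borel_on opc)" if "open U" for U :: "'a set"
  unfolding sets_borel_on_opc by (intro sigma_sets.Basic) (simp add: openin_opc_Some that)
 from assms have "B \<in> sigma_sets UNIV {S. open S}" by (simp add: borel_def)
 then show ?thesis
 proof induction
  case (Compl A)
  have "Some ` (UNIV - A) = Some ` UNIV - Some ` A" by auto
  then show ?case using Compl op[OF open_UNIV] by auto
 next
  case (Union A)
  have "Some ` (\<Union>i. A i) = (\<Union>i. Some ` A i)" by auto
  then show ?case using Union by auto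
 qed (use op in auto)
qed

text \<open>The images under \<open>Some\<close> of open sets already generate: an open set
  containing the cemetery is the complement of the image of a closed set, and that image is a
  difference of two images of open sets.\<close>

lemma measurable_borel_on_opc:
 assumes "!!U. open U ==> f -` (Some ` U) \<inter> space M \<in> sets M"
 shows "f \<in> M \<rightarrow>\<^sub>M borel_on (opc :: 'a::t2_space option topology)"
 unfolding borel_on_def
proof (rule measurable_measure_of)
 fix V :: "'a option set" assume "V \<in> {U. openin opc U}"
 then have V: "open (Some -` V)" "None \<in> V ==> compact (- (Some -` V))"
  by (auto simp: openin_one_point_compactification)
 show "f -` V \<inter> space M \<in> sets M"
 proof (cases "None \<in> V")
  case True
  have "f -` V \<inter> space M = space M - (f -` (Some ` (- (Some -` V))) \<inter> space M)"
  proof -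
   have "v \<in> V \<longleftrightarrow> v \<notin> Some ` (- (Some -` V))" for v using True by (cases v) auto
   then have "f w \<in> V \<longleftrightarrow> f w \<notin> Some ` (- (Some -` V))" for w .
   then show ?thesis by (intro set_eqI) (simp only: Int_iff Diff_iff vimage_eq, blast)
  qed
  moreover have "f -` (Some ` (- (Some -` V))) \<inter> space M =
    (f -` (Some ` UNIV) \<inter> space M) - (f -` (Some ` (Some -` V)) \<inter> space M)"
   by auto
  moreover have "f -` (Some ` UNIV) \<inter> space M \<in> sets M" "f -` (Some ` (Some -` V)) \<inter> space M \<in> sets M"
   using assms[OF open_UNIV] assms[OF V(1)] .
  ultimately show ?thesis by (metis sets.Diff sets.top)
 next
  case False
  then have "V = Some ` (Some -` V)" by (auto simp: image_iff) (metis option.exhaust)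
  then show ?thesis using assms[OF V(1)] by metis
 qed
qed auto

lemma measurable_ext:
 fixes f :: "'a::t2_space => 'b::{zero, topological_space}"
 assumes "f \<in> borel_measurable borel"
 shows "ext f \<in> borel_measurable (borel_on opc)"
proof (rule measurableI)
 fix A :: "'b set" assume A: "A \<in> sets borel"
 have 1: "f -` A \<in> sets borel" using measurable_sets[OF assms A] by simp
 have "ext f -` A \<inter> space (borel_on opc) =
   (if 0 \<in> A then UNIV - Some ` (UNIV - f -` A) else Some ` (f -` A))"
  proof -
   have "v \<in> ext f -` A \<longleftrightarrow> v \<in> (if 0 \<in> A then UNIV - Some ` (UNIV - f -` A) else Some ` (f -` A))" for v
    by (cases v) auto
   then show ?thesis by (auto simp: space_borel_on)
  qed
 moreover have "UNIV - Some ` (UNIV - f -` A) \<in> sets (borel_on opc)"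
  using Some_image_sets[of "UNIV - f -` A"] 1 sets.compl_sets[of _ "borel_on opc"]
  by (metis borel_comp Compl_eq_Diff_UNIV space_borel_on topspace_one_point_compactification)
 ultimately show "ext f -` A \<inter> space (borel_on opc) \<in> sets (borel_on opc)"
  using Some_image_sets[OF 1] by simp
qed auto

text \<open>At the cemetery: if \<open>0\<close> lies in the target set, the complement of the
  preimage is a closed part of \<open>K\<close>, hence compact.\<close>

lemma continuous_map_opc_ext:
 fixes f :: "'a::t2_space => real"
 assumes f: "continuous_on UNIV f" and K: "compact K" "{x. f x \<noteq> 0} \<subseteq> K"
 shows "continuous_map opc euclideanreal (ext f)"
 unfolding continuous_map_def
proof (intro conjI allI impI)
 fix U :: "real set" assume "openin euclideanreal U"
 then have U: "open U" by simp
 have pre: "open (f -` U)" using f U by (simp add: continuous_on_open_vimage)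
 have S: "Some -` {x \<in> topspace opc. ext f x \<in> U} = f -` U" by auto
 show "openin opc {x \<in> topspace opc. ext f x \<in> U}"
  unfolding openin_one_point_compactification S
 proof (intro conjI impI pre)
  assume "None \<in> {x \<in> topspace opc. ext f x \<in> U}"
  then have "- (f -` U) = K \<inter> - (f -` U)" using K(2) by auto
  moreover have "closed (- (f -` U))" using pre by auto
  ultimately show "compact (- (f -` U))" using K(1) compact_Int_closed by metis
 qed
qed auto

lemma compact_support_C0:
 fixes f :: "'a::t2_space => real"
 assumes f: "continuous_on UNIV f" and K: "compact K" "{x. f x \<noteq> 0} \<subseteq> K"
 shows "f \<in> C0"
proof -
 have "limitin euclideanreal (ext f) (ext f None) (atin opc None)"
  using continuous_map_opc_ext[OF assms] unfolding continuous_map_atin by (metis UNIV_I topspace_one_point_compactification)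
 then show ?thesis using f by (simp add: C0_def limitin_canonical_iff)
qed

text \<open>Lipschitz functions increasing in \<open>k\<close> to the indicator of an open set. The
  whole space is treated separately because \<open>infdist\<close> to the empty set is zero by
  convention.\<close>

definition bump :: "nat => 'a::metric_space set => 'a => real" where
 "bump k V x = (if V = UNIV then 1 else min 1 (real k * infdist x (- V)))"

lemma bump_props:
 shows "0 <= bump k V x" "bump k V x <= 1" "continuous_on UNIV (bump k V)" "x \<notin> V ==> bump k V x = 0"
proof -
 show "0 <= bump k V x" "bump k V x <= 1" "x \<notin> V ==> bump k V x = 0"
  by (auto simp: bump_def infdist_nonneg)
 show "continuous_on UNIV (bump k V)"
  by (cases "V = UNIV") (auto simp: bump_def[abs_def] intro!: continuous_intros)
qed

lemma bump_tendsto: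
 assumes "open V" "x \<in> V"
 shows "(%k. bump k V x) \<longlonglongrightarrow> 1"
proof (cases "V = UNIV")
 case False
 then have ne: "- V \<noteq> {}" by auto
 have "infdist x (- V) > 0"
  using assms ne in_closed_iff_infdist_zero[of "- V" x] infdist_nonneg[of x "- V"] by (auto simp: less_le)
 then obtain N :: nat where N: "1 < real N * infdist x (- V)" using reals_Archimedean3 by blast
 have "bump k V x = 1" if "k \<ge> N" for k
 proof -
  have "real N * infdist x (- V) <= real k * infdist x (- V)"
   using that infdist_nonneg by (intro mult_right_mono) auto
  then show ?thesis using N False by (simp add: bump_def)
 qed
 then show ?thesis by (intro tendsto_eventually) (auto simp: eventually_sequentially)
qed (simp add: bump_def)

lemma bump_support: "{x. bump k V x \<noteq> 0} \<subseteq> closure V"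
 using bump_props(4) closure_subset by blast

text \<open>Inside a compact neighbourhood every basic open set has compact closure, so discarding
  the other members of a countable basis leaves a basis.\<close>

lemma relatively_compact_base:
 assumes "locally_compact_space (euclidean :: 'e::{metric_space, second_countable_topology} topology)"
 obtains b :: "nat => 'e::{metric_space, second_countable_topology} set" where "!!i. open (b i)" "!!i. compact (closure (b i))"
  "!!U x. open U ==> x \<in> U ==> \<exists>i. x \<in> b i \<and> b i \<subseteq> U"
proof -
 obtain B :: "'e set set" where B: "countable B" "topological_basis B"
  using ex_countable_basis by blast
 \<comment> \<open>The empty set keeps the family nonempty, so that it is the range of an
   enumeration by \<open>nat\<close>.\<close>
 define B' where "B' = insert {} {V \<in> B. compact (closure V)}"
 have "countable B'" using B(1) by (simp add: B'_def)
 moreover have "B' \<noteq> {}" by (simp add: B'_def)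
 ultimately have r: "range (from_nat_into B') = B'" by (rule range_from_nat_into[rotated])
 have "\<exists>V\<in>B'. x \<in> V \<and> V \<subseteq> U" if U: "open U" "x \<in> U" for U x
 proof -
  obtain W K where W: "open W" "compact K" "x \<in> W" "W \<subseteq> K"
   using assms unfolding locally_compact_space_def by (simp add: compactin_euclidean_iff) metis
  obtain V where V: "V \<in> B" "x \<in> V" "V \<subseteq> U \<inter> W"
   using topological_basisE[OF B(2), of "U \<inter> W" x] U W by (metis Int_iff open_Int)
  have "closure V \<subseteq> K" using V W by (intro closure_minimal) (auto intro: compact_imp_closed)
  then have "compact (closure V)" using W(2) by (metis closed_closure compact_Int_closed inf.absorb_iff2)
  then show ?thesis using V by (auto simp: B'_def)
 qed
 moreover have "open V \<and> compact (closure V)" if "V \<in> B'" for V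
  using that B(2) by (auto simp: B'_def topological_basis_open)
 ultimately show ?thesis
  using that[of "from_nat_into B'"] r by (metis rangeE rangeI)
qed

text \<open>Bumps on growing finite unions of relatively compact basic sets. Being compactly
  supported, they extend continuously by zero to the cemetery, and right continuity of paths in the
  compactification applies to them.\<close>

lemma open_limit_compact_support:
 fixes U :: "'e::{metric_space, second_countable_topology} set"
 assumes "locally_compact_space (euclidean :: 'e topology)" "open U"
 obtains f :: "nat => 'e::{metric_space, second_countable_topology} => real" and K where "!!k. continuous_on UNIV (f k)" "!!k. compact (K k)"
  "!!k. {x. f k x \<noteq> 0} \<subseteq> K k" "!!k x. 0 <= f k x" "!!k x. f k x <= indicator U x"
  "!!x. (%k. f k x) \<longlonglongrightarrow> indicator U x"
proof -
 obtain b :: "nat => 'e set" where b: "!!i. open (b i)" "!!i. compact (closure (b i))"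
  "!!U x. open U ==> x \<in> U ==> \<exists>i. x \<in> b i \<and> b i \<subseteq> U"
  using relatively_compact_base[OF assms(1)] by blast
 define V where "V k = (\<Union>i\<in>{i. i <= k \<and> b i \<subseteq> U}. b i)" for k :: nat
 have Vo: "open (V k)" "V k \<subseteq> U" for k using b(1) by (auto simp: V_def)
 have Vc: "compact (closure (V k))" for k
 proof -
  let ?C = "\<Union>i\<in>{i. i <= k \<and> b i \<subseteq> U}. closure (b i)"
  have C: "compact ?C" using b(2) by (intro compact_UN) auto
  have "closure (V k) \<subseteq> ?C"
   using closure_subset by (intro closure_minimal compact_imp_closed[OF C]) (fastforce simp: V_def)
  then show ?thesis using C by (metis closed_closure compact_Int_closed inf.absorb_iff2)
 qed
 have Vm: "V j \<subseteq> V k" if "j <= k" for j k using that unfolding V_def by (intro UN_mono) auto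
 show ?thesis
 proof (rule that[of "%k. bump k (V k)" "%k. closure (V k)"])
  show "bump k (V k) x <= indicator U x" for k x
   using bump_props(2)[of k "V k" x] bump_props(4)[of x "V k" k] Vo(2)[of k]
   by (cases "x \<in> V k") (auto simp: indicator_def)
  show "(%k. bump k (V k) x) \<longlonglongrightarrow> indicator U x" for x
  proof (cases "x \<in> U")
   case True
   then obtain i where i: "x \<in> b i" "b i \<subseteq> U" using b(3) assms(2) by blast
   then have xV: "x \<in> V k" if "k \<ge> i" for k using that by (auto simp: V_def)
   have le: "bump k (V i) x <= bump k (V k) x" if "k \<ge> i" for k
   proof (cases "V k = UNIV")
    case False
    then have "V i \<noteq> UNIV" using Vm[OF that] by auto
    moreover have "infdist x (- V i) <= infdist x (- V k)"
     using False Vm[OF that] by (intro infdist_mono) auto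
    then have "real k * infdist x (- V i) <= real k * infdist x (- V k)"
     by (intro mult_left_mono) auto
    ultimately show ?thesis using False by (simp add: bump_def)
   qed (auto simp: bump_def)
   have "(%k. bump k (V k) x) \<longlonglongrightarrow> 1"
    by (rule tendsto_sandwich[OF _ _ bump_tendsto[OF Vo(1)[of i] xV[OF order_refl]] tendsto_const])
     (use le bump_props(2) in \<open>blast intro: eventually_sequentiallyI\<close>)+
   then show ?thesis using True by simp
  next
   case False
   then have "bump k (V k) x = 0" for k using Vo(2)[of k] bump_props(4) by blast
   then show ?thesis using False by simp
  qed
 qed (use bump_props(1,3) Vc bump_support in blast)+
qed

text \<open>To lie in the image of an open set means that one of countably many compactly supported
  continuous functions is positive; along the path each of these is real-valued and right
  continuous.\<close>

lemma process_jointly_measurable: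
 fixes Y :: "real => 'a => 'e::{metric_space, second_countable_topology} option"
 assumes lc: "locally_compact_space (euclidean :: 'e topology)"
  and m: "!!t. 0 <= t ==> Y t \<in> M \<rightarrow>\<^sub>M borel_on opc"
  and rc: "!!t w. 0 <= t ==> w \<in> space M ==> limitin opc (%s. Y s w) (Y t w) (at_right t)"
 shows "(%z. Y (max 0 (fst z)) (snd z)) \<in> borel \<Otimes>\<^sub>M M \<rightarrow>\<^sub>M borel_on opc"
proof (rule measurable_borel_on_opc)
 fix U :: "'e set" assume "open U"
 obtain f :: "nat => 'e => real" and K where f: "!!k. continuous_on UNIV (f k)" "!!k. compact (K k)"
  "!!k. {x. f k x \<noteq> 0} \<subseteq> K k" "!!k x. 0 <= f k x" "!!k x. f k x <= indicator U x"
  "!!x. (%k. f k x) \<longlonglongrightarrow> indicator U x"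
  using open_limit_compact_support[OF lc \<open>open U\<close>] by metis
 have [measurable]: "(%z. ext (f k) (Y (max 0 (fst z)) (snd z))) \<in> borel_measurable (borel \<Otimes>\<^sub>M M)" for k
 proof (rule borel_measurable_right_continuous_joint)
  show "(%w. ext (f k) (Y t w)) \<in> borel_measurable M" if "0 <= t" for t
   using f(1) by (intro measurable_compose[OF m[OF that] measurable_ext] borel_measurable_continuous_onI)
  show "((%s. ext (f k) (Y s w)) \<longlongrightarrow> ext (f k) (Y t w)) (at_right t)" if "0 <= t" "w \<in> space M" for t w
   using continuous_map_limit[OF continuous_map_opc_ext[OF f(1-3)] rc[OF that]]
   by (simp add: o_def limitin_canonical_iff)
 qed
 have "z \<in> Some ` U \<longleftrightarrow> (\<exists>k. 0 < ext (f k) z)" for z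
 proof (cases z)
  case (Some x)
  show ?thesis
  proof
   assume "z \<in> Some ` U"
   then have "(%k. f k x) \<longlonglongrightarrow> 1" using f(6)[of x] Some by auto
   then have "\<forall>\<^sub>F k in sequentially. 0 < f k x" by (rule order_tendstoD) simp
   then show "\<exists>k. 0 < ext (f k) z" using Some by (auto dest: eventually_happens)
  next
   assume "\<exists>k. 0 < ext (f k) z"
   then obtain k where "0 < f k x" using Some by auto
   then have "0 < (indicator U x :: real)" using f(5)[of k x] by linarith
   then show "z \<in> Some ` U" using Some by (simp add: indicator_def split: if_splits)
  qed
 qed auto
 then have "(%z. Y (max 0 (fst z)) (snd z)) -` (Some ` U) \<inter> space (borel \<Otimes>\<^sub>M M) =
   {z \<in> space (borel \<Otimes>\<^sub>M M). \<exists>k. 0 < ext (f k) (Y (max 0 (fst z)) (snd z))}"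
  by auto
 also have "... \<in> sets (borel \<Otimes>\<^sub>M M)" by measurable
 finally show "(%z. Y (max 0 (fst z)) (snd z)) -` (Some ` U) \<inter> space (borel \<Otimes>\<^sub>M M) \<in> sets (borel \<Otimes>\<^sub>M M)" .
qed

section \<open>The Markov property\<close>

context hunt_process
begin

lemma space_P: "x \<in> topspace S ==> space (P x) = \<Omega>"
 using sets_eq_imp_space_eq[OF sets_P] space_F by simp

lemma measurable_F_P:
 assumes "x \<in> topspace S" "f \<in> F t \<rightarrow>\<^sub>M N"
 shows "f \<in> P x \<rightarrow>\<^sub>M N"
proof -
 have "sets (F t) \<subseteq> sets (P x)" using sets_F_mono[of t \<top>] sets_P[OF assms(1)] by simp
 then show ?thesis using assms space_P[OF assms(1)] space_F[of t] by (auto simp: measurable_def)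
qed

lemma measurable_F_mono:
 assumes "f \<in> F s \<rightarrow>\<^sub>M N" "s <= t"
 shows "f \<in> F t \<rightarrow>\<^sub>M N"
 using assms sets_F_mono[of s t] space_F by (auto simp: measurable_def)

lemma measurable_X: "x \<in> topspace S ==> 0 <= t ==> X t \<in> P x \<rightarrow>\<^sub>M borel_on S"
 using measurable_F_P adapted by blast

lemma X_in_space: "w \<in> \<Omega> ==> 0 <= t ==> X t w \<in> topspace S"
 using measurable_space[OF adapted, of t w] by (simp add: space_F space_borel_on)

definition transition :: "real => 's => 's measure" where
 "transition t x = distr (P x) (borel_on S) (X t)"

lemma transition_measurable:
 assumes "0 <= t"
 shows "transition t \<in> borel_on S \<rightarrow>\<^sub>M subprob_algebra (borel_on S)"
proof (rule measurable_subprob_algebra)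
 fix x assume "x \<in> space (borel_on S)"
 then have x: "x \<in> topspace S" by (simp add: space_borel_on)
 interpret prob_space "P x" by (rule prob_space_P[OF x])
 show "subprob_space (transition t x)" unfolding transition_def
  by (intro prob_space_imp_subprob_space prob_space_distr measurable_X x assms)
 show "sets (transition t x) = sets (borel_on S)" by (simp add: transition_def)
next
 fix B assume B: "B \<in> sets (borel_on S)"
 have "emeasure (transition t x) B = emeasure (P x) {w \<in> \<Omega>. X t w \<in> B}" if "x \<in> topspace S" for x
  unfolding transition_def using measurable_X[OF that assms] B
  by (subst emeasure_distr) (auto simp: space_P[OF that] intro!: arg_cong[where f="emeasure _"])
 then show "(%x. emeasure (transition t x) B) \<in> borel_measurable (borel_on S)"
  using kernel[OF assms B] by (subst measurable_cong[of "borel_on S"]) (auto simp: space_borel_on)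
qed

lemma nn_integral_transition:
 assumes "x \<in> topspace S" "0 <= t" "h \<in> borel_measurable (borel_on S)"
 shows "(NN (transition t x) h) = (NN (P x) (%w. h (X t w)))"
 unfolding transition_def using assms(3) by (intro nn_integral_distr measurable_X[OF assms(1,2)]) simp

lemma measurable_nn_integral_transition:
 assumes "0 <= t" "h \<in> borel_measurable (borel_on S)"
 shows "(%x. NN (transition t x) h) \<in> borel_measurable (borel_on S)"
 by (rule measurable_compose[OF transition_measurable[OF assms(1)] nn_integral_measurable_subprob_algebra[OF assms(2)]])

text \<open>The strong Markov property at a constant stopping time.\<close>

lemma markov_indicator:
 assumes x: "x \<in> topspace S" and s: "0 <= s" and r: "0 <= r" and A: "A \<in> sets (F (ennreal s))"
  and B: "B \<in> sets (borel_on S)"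
 shows "(NN (P x) (%w. indicator A w * indicator B (X (s + r) w))) =
   (NN (P x) (%w. indicator A w * emeasure (transition r (X s w)) B))"
proof -
 have A\<Omega>: "A \<subseteq> \<Omega>" using sets.sets_into_space[OF A] space_F by simp
 have st: "stopping_time F (%_. ennreal s)" by (rule stopping_time_const)
 have "A \<in> sets (pre_sigma (%_. ennreal s))"
 proof (rule sets_pre_sigmaI[OF st])
  fix t show "{w \<in> A. ennreal s <= t} \<in> sets (F t)"
   using A sets_F_mono[of "ennreal s" t] by (cases "ennreal s <= t") auto
 qed
 from strong_markov[OF st this r x B] s
 have "emeasure (P x) {w \<in> A. X (s + r) w \<in> B} =
  (NN (P x) (%w. emeasure (P (X s w)) {w' \<in> \<Omega>. X r w' \<in> B} * indicator A w))"
  by simp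
 moreover have "{w \<in> A. X (s + r) w \<in> B} = A \<inter> (X (s + r) -` B \<inter> space (P x))"
  using A\<Omega> space_P[OF x] by auto
 moreover have "A \<in> sets (P x)" using A sets_F_mono[of "ennreal s" \<top>] sets_P[OF x] by auto
 moreover have "X (s + r) -` B \<inter> space (P x) \<in> sets (P x)"
  using measurable_sets[OF measurable_X[OF x, of "s + r"] B] s r by simp
 ultimately have "(NN (P x) (%w. indicator (A \<inter> (X (s + r) -` B \<inter> space (P x))) w)) =
  (NN (P x) (%w. emeasure (P (X s w)) {w' \<in> \<Omega>. X r w' \<in> B} * indicator A w))"
  by simp
 moreover have "(NN (P x) (%w. indicator (A \<inter> (X (s + r) -` B \<inter> space (P x))) w)) =
   (NN (P x) (%w. indicator A w * indicator B (X (s + r) w)))"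
  by (intro nn_integral_cong) (auto simp: indicator_def)
 moreover have "(NN (P x) (%w. emeasure (P (X s w)) {w' \<in> \<Omega>. X r w' \<in> B} * indicator A w)) =
   (NN (P x) (%w. indicator A w * emeasure (transition r (X s w)) B))"
 proof (intro nn_integral_cong)
  fix w assume "w \<in> space (P x)"
  then have "X s w \<in> topspace S" using X_in_space s space_P[OF x] by simp
  then have "emeasure (transition r (X s w)) B = emeasure (P (X s w)) {w' \<in> \<Omega>. X r w' \<in> B}"
   unfolding transition_def using measurable_X[OF _ r] B
   by (subst emeasure_distr) (auto simp: space_P intro!: arg_cong[where f="emeasure _"])
  then show "emeasure (P (X s w)) {w' \<in> \<Omega>. X r w' \<in> B} * indicator A w =
    indicator A w * emeasure (transition r (X s w)) B" by (simp add: mult.commute)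
 qed
 ultimately show ?thesis by simp
qed

text \<open>Two monotone class arguments: in \<open>h\<close> with an indicator for the past, then
  in the past functional \<open>g\<close>.\<close>

lemma markov_nn_integral:
 assumes x: "x \<in> topspace S" and s: "0 <= s" and r: "0 <= r"
  and g: "g \<in> borel_measurable (F (ennreal s))" and h: "h \<in> borel_measurable (borel_on S)"
 shows "(NN (P x) (%w. g w * h (X (s + r) w))) =
   (NN (P x) (%w. g w * (NN (transition r (X s w)) h)))"
proof -
 have sr: "0 <= s + r" using s r by simp
 note [measurable] = measurable_X[OF x s] measurable_X[OF x sr]
 have ind: "(NN (P x) (%w. indicator A w * h (X (s + r) w))) =
   (NN (P x) (%w. indicator A w * (NN (transition r (X s w)) h)))"
  if A: "A \<in> sets (F (ennreal s))" for A
  using h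
 proof induction
  case (cong f g)
  have "(NN (transition r (X s w)) f) = (NN (transition r (X s w)) g)" for w
   using cong(3) by (intro nn_integral_cong) (auto simp: transition_def)
  moreover have "(NN (P x) (%w. indicator A w * f (X (s + r) w))) = (NN (P x) (%w. indicator A w * g (X (s + r) w)))"
   using cong(3) X_in_space[OF _ sr] by (intro nn_integral_cong) (auto simp: space_P[OF x] space_borel_on)
  ultimately show ?case using cong(4) by simp
 next
  case (set B)
  have "(NN (transition r y) (indicator B)) = emeasure (transition r y) B" for y
   using set by (intro nn_integral_indicator) (auto simp: transition_def)
  then show ?case using markov_indicator[OF x s r A set] by simp
 next
  case (mult u c)
  have [measurable]: "A \<in> sets (P x)" using A sets_F_mono[of "ennreal s" \<top>] sets_P[OF x] by auto
  note [measurable] = mult.hyps(2) measurable_nn_integral_transition[OF r mult.hyps(2)]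
  have u: "u \<in> borel_measurable (transition r y)" for y using mult.hyps(2) by (simp add: transition_def)
  show ?case
   using mult.IH by (simp add: nn_integral_cmult[OF u] mult.left_commute[of _ c] nn_integral_cmult)
 next
  case (add u v)
  have [measurable]: "A \<in> sets (P x)" using A sets_F_mono[of "ennreal s" \<top>] sets_P[OF x] by auto
  note [measurable] = add.hyps(1) add.hyps(3) measurable_nn_integral_transition[OF r add.hyps(1)] measurable_nn_integral_transition[OF r add.hyps(3)]
  have u: "u \<in> borel_measurable (transition r y)" "v \<in> borel_measurable (transition r y)" for y
   using add by (auto simp: transition_def)
  show ?case
   using add by (simp add: nn_integral_add[OF u(2,1)] distrib_left nn_integral_add)
 next
  case (seq U)
  have [measurable]: "A \<in> sets (P x)" using A sets_F_mono[of "ennreal s" \<top>] sets_P[OF x] by auto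
  note [measurable] = seq.hyps(1) measurable_nn_integral_transition[OF r seq.hyps(1)]
  have U: "U i \<in> borel_measurable (transition r y)" for i y using seq.hyps(1) by (simp add: transition_def)
  have "(NN (P x) (%w. indicator A w * (SUP i. U i) (X (s + r) w))) =
    (NN (P x) (%w. (SUP i. indicator A w * U i (X (s + r) w))))"
   by (simp add: SUP_mult_left_ennreal image_image)
  also have "... = (SUP i. NN (P x) (%w. indicator A w * U i (X (s + r) w)))"
   using seq.hyps(3) by (intro nn_integral_monotone_convergence_SUP) (auto simp: incseq_def le_fun_def intro!: mult_left_mono)
  also have "... = (SUP i. NN (P x) (%w. indicator A w * (NN (transition r (X s w)) (U i))))"
   using seq by simp
  also have "... = (NN (P x) (%w. (SUP i. indicator A w * (NN (transition r (X s w)) (U i)))))"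
   using seq.hyps(3) by (intro nn_integral_monotone_convergence_SUP[symmetric])
    (auto simp: incseq_def le_fun_def intro!: mult_left_mono nn_integral_mono)
  also have "... = (NN (P x) (%w. indicator A w * (NN (transition r (X s w)) (%z. (SUP i. U i) z))))"
   using seq.hyps(3) U by (simp add: SUP_mult_left_ennreal[symmetric] nn_integral_monotone_convergence_SUP image_image)
  finally show ?case .
 qed
 have gP: "g' \<in> borel_measurable (P x)" if "g' \<in> borel_measurable (F (ennreal s))" for g' :: "_ => ennreal"
  using measurable_F_P[OF x that] .
 note [measurable] = h measurable_nn_integral_transition[OF r h]
 show ?thesis using g
 proof induction
  case (cong f g)
  have "(NN (P x) (%w. f w * H w)) = (NN (P x) (%w. g w * H w))" for H
   using cong(3) by (intro nn_integral_cong) (simp add: space_P[OF x] space_F)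
  then show ?case using cong(4) by simp
 next
  case (set A) then show ?case by (rule ind)
 next
  case (mult u c)
  note [measurable] = gP[OF mult.hyps(2)]
  show ?case using mult.IH by (simp add: mult.assoc nn_integral_cmult)
 next
  case (add u v)
  note [measurable] = gP[OF add.hyps(1)] gP[OF add.hyps(3)]
  show ?case using add by (simp add: distrib_right nn_integral_add)
 next
  case (seq U)
  note [measurable] = gP[OF seq.hyps(1)]
  have "(NN (P x) (%w. (SUP i. U i) w * H w)) = (SUP i. NN (P x) (%w. U i w * H w))"
   if [measurable]: "H \<in> borel_measurable (P x)" for H
  proof -
   have "(NN (P x) (%w. (SUP i. U i) w * H w)) = (NN (P x) (%w. (SUP i. U i w * H w)))"
    by (simp add: SUP_mult_right_ennreal image_image)
   also have "... = (SUP i. NN (P x) (%w. U i w * H w))"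
    using seq.hyps(3) by (intro nn_integral_monotone_convergence_SUP) (auto simp: incseq_def le_fun_def intro!: mult_right_mono)
   finally show ?thesis .
  qed
  then show ?case using seq by simp
 qed
qed

end

section \<open>Feynman--Kac\<close>

lemma exp_diff_le:
 fixes a b R :: real
 assumes "\<bar>a\<bar> <= R" "\<bar>b\<bar> <= R"
 shows "\<bar>exp a - exp b\<bar> <= exp R * \<bar>a - b\<bar>"
proof -
 have *: "exp y - exp x <= exp R * (y - x)" if "x <= y" "y <= R" for x y :: real
 proof -
  have "exp y - exp x = exp y * (1 - exp (x - y))" by (simp add: algebra_simps exp_diff)
  also have "... <= exp y * (y - x)"
   using exp_ge_add_one_self[of "x - y"] by (intro mult_left_mono) (linarith, simp)
  also have "... <= exp R * (y - x)" using that by (intro mult_right_mono) auto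
  finally show ?thesis .
 qed
 show ?thesis
 proof (cases "a <= b")
  case True
  then show ?thesis using *[of a b] assms(2) by (simp add: abs_le_iff abs_minus_commute abs_of_nonneg)
 next
  case False
  then show ?thesis using *[of b a] assms(1) by (simp add: abs_le_iff abs_of_nonneg)
 qed
qed

lemma exp_diff_linear_le:
 fixes D R :: real
 assumes "\<bar>D\<bar> <= R"
 shows "\<bar>exp D - 1 - D\<bar> <= exp R * D^2"
proof -
 have 1: "0 <= exp D - 1 - D" using exp_ge_add_one_self[of D] by linarith
 have "(exp D - 1) - D <= D * (exp D - 1)"
 proof -
  have "exp D * (1 - D) <= exp D * exp (- D)"
   using exp_ge_add_one_self[of "- D"] by (intro mult_left_mono) auto
  also have "... = 1" by (simp add: exp_minus)
  finally show ?thesis by (simp add: algebra_simps)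
 qed
 also have "... <= \<bar>D\<bar> * (exp R * \<bar>D\<bar>)"
  using exp_diff_le[of D R 0] assms abs_ge_self[of "D * (exp D - 1)"]
  by (simp add: abs_mult) (smt (verit, best) abs_ge_zero mult_left_mono)
 also have "... = exp R * D^2" by (simp add: power2_eq_square abs_mult_self_eq algebra_simps)
 finally show ?thesis using 1 by simp
qed

text \<open>With \<open>n\<close> equal steps the quadratic increments add up to order
  \<open>1 / n\<close>. This takes the place of differentiation where the integrand is merely
  bounded and measurable.\<close>

lemma zero_increment_const:
 fixes D :: "real => real"
 assumes D: "!!r r'. 0 <= r ==> r <= r' ==> r' <= T ==> \<bar>D r' - D r\<bar> <= C * (r' - r)^2" and T: "0 <= T"
 shows "D T = D 0"
proof -
 have step: "\<bar>D (real k * (T / real n)) - D 0\<bar> <= real k * (C * (T / real n)^2)" if "k <= n" "n > 0" for k n :: nat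
  using that
 proof (induction k)
  case (Suc k)
  let ?h = "T / real n"
  have "real (Suc k) * ?h <= real n * ?h" using Suc T by (intro mult_right_mono) auto
  then have "real (Suc k) * ?h <= T" using Suc by simp
  moreover have "0 <= real k * ?h" using T by simp
  moreover have "real k * ?h <= real (Suc k) * ?h" using T by (intro mult_right_mono) simp_all
  ultimately have "\<bar>D (real (Suc k) * ?h) - D (real k * ?h)\<bar> <= C * (real (Suc k) * ?h - real k * ?h)^2"
   by (intro D) auto
  also have "real (Suc k) * ?h - real k * ?h = ?h"
   by (simp only: of_nat_Suc distrib_right mult_1_left add_diff_cancel_right')
  finally have "\<bar>D (real (Suc k) * ?h) - D 0\<bar> <= C * ?h^2 + real k * (C * ?h^2)"
   using Suc by linarith
  then show ?case by (simp add: algebra_simps)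
 qed simp
 have "\<bar>D T - D 0\<bar> <= C * T^2 * (1 / real (Suc n))" for n
  using step[of "Suc n" "Suc n"] by (simp add: power2_eq_square field_simps del: of_nat_Suc)
 moreover have "(%n. C * T^2 * (1 / real (Suc n))) \<longlonglongrightarrow> C * T^2 * 0"
  using lim_inverse_n'[THEN LIMSEQ_Suc] by (intro tendsto_intros) auto
 ultimately have "\<bar>D T - D 0\<bar> <= C * T^2 * 0"
  by (intro LIMSEQ_le_const) auto
 then show ?thesis by simp
qed

lemma set_integrable_bounded_interval:
 fixes g :: "real => real"
 assumes "g \<in> borel_measurable borel" "!!s. \<bar>g s\<bar> <= K"
 shows "set_integrable lborel {a..b} g"
 unfolding set_integrable_def
proof (rule integrable_bound[of _ "%s. indicator {a..b} s * K"])
 show "integrable lborel (%s. indicator {a..b} s * K)"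
  by (intro integrable_mult_left integrable_real_indicator) (auto simp: emeasure_lborel_Icc_eq)
 show "(%s. indicat_real {a..b} s *\<^sub>R g s) \<in> borel_measurable lborel" using assms(1) by simp
 show "AE s in lborel. norm (indicat_real {a..b} s *\<^sub>R g s) <= norm (indicat_real {a..b} s * K)"
  using assms(2) by (auto simp: indicator_def intro: order_trans[OF _ abs_ge_self])
qed

lemma set_integral_bound_interval:
 fixes g :: "real => real"
 assumes "g \<in> borel_measurable borel" "!!s. a <= s ==> s <= b ==> \<bar>g s\<bar> <= K" "a <= b"
 shows "\<bar>LINT s:{a..b}|lborel. g s\<bar> <= K * (b - a)"
proof -
 have "\<bar>LINT s:{a..b}|lborel. g s\<bar> <= (LINT s|lborel. norm (indicator {a..b} s *\<^sub>R g s))"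
  unfolding set_lebesgue_integral_def
  using integral_norm_bound[of lborel "%s. indicator {a..b} s *\<^sub>R g s"] by simp
 also have "... <= (LINT s|lborel. indicator {a..b} s * K)"
 proof (rule integral_mono')
  have K: "0 <= K" using assms(2)[of a] assms(3) by simp
  show "integrable lborel (%s. indicator {a..b} s * K)"
   by (intro integrable_mult_left integrable_real_indicator) (auto simp: emeasure_lborel_Icc_eq)
  show "0 <= indicator {a..b} s * K" for s using K by simp
  show "norm (indicator {a..b} s *\<^sub>R g s) <= indicator {a..b} s * K" for s
   using assms(2)[of s] by (auto simp: indicator_def)
 qed
 also have "... = K * (b - a)" using assms(3) by simp
 finally show ?thesis .
qed

lemma set_integral_increment:
 fixes g :: "real => real"
 assumes g: "g \<in> borel_measurable borel" "!!s. \<bar>g s\<bar> <= K" and r: "0 <= r" "r <= r'"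
 shows "(LINT s:{0..r'}|lborel. g s) - (LINT s:{0..r}|lborel. g s) = (LINT s:{r..r'}|lborel. g s)"
proof -
 have "{0..r'} = {0..r} \<union> {r<..r'}" using r by auto
 then have "(LINT s:{0..r'}|lborel. g s) = (LINT s:{0..r}|lborel. g s) + (LINT s:{r<..r'}|lborel. g s)"
  using set_integrable_bounded_interval[OF g]
  by (simp only:) (rule set_integral_Un, auto intro: set_integrable_subset[of _ "{r..r'}"])
 also have "(LINT s:{r<..r'}|lborel. g s) = (LINT s:{r..r'}|lborel. g s)"
  unfolding set_lebesgue_integral_def
  by (rule integral_cong_AE) (use AE_lborel_singleton[of r] g(1) in \<open>auto simp: indicator_def elim!: eventually_mono\<close>)
 finally show ?thesis by simp
qed

text \<open>The chain rule for the exponential of a Lipschitz primitive: first-order terms cancel in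
  the defect \<open>D\<close>, so its increments are quadratic and
  \<open>zero_increment_const\<close> applies.\<close>

lemma exp_integral_identity:
 fixes g :: "real => real"
 assumes g[measurable]: "g \<in> borel_measurable borel" and K: "!!s. \<bar>g s\<bar> <= K" and T: "0 <= T"
 defines "G \<equiv> %r. LINT s:{0..r}|lborel. g s"
 assumes G[measurable]: "G \<in> borel_measurable borel"
 shows "exp (G T) - 1 = (LINT s:{0..T}|lborel. exp (G s) * g s)"
proof -
 have K0: "0 <= K" using K[of 0] by simp
 have Ginc: "G r' - G r = (LINT s:{r..r'}|lborel. g s)" if "0 <= r" "r <= r'" for r r'
  unfolding G_def by (rule set_integral_increment[OF g K that])
 have Gb: "\<bar>G r' - G r\<bar> <= K * (r' - r)" if "0 <= r" "r <= r'" for r r'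
  unfolding Ginc[OF that] using K that by (intro set_integral_bound_interval) auto
 have G0: "G 0 = 0"
  using set_integral_bound_interval[of g 0 0 K] K unfolding G_def by simp
 have GT: "\<bar>G r\<bar> <= K * T" if "0 <= r" "r <= T" for r
  using Gb[of 0 r] that G0 K0 mult_left_mono[of r T K] by auto
 define M where "M = exp (K * T)"
 \<comment> \<open>Cutting off the exponent outside \<open>[0, T]\<close> gives an integrand bounded
   on the whole line, which coincides with the original one under the integral.\<close>
 define c where "c s = exp (if 0 <= s \<and> s <= T then G s else 0) * g s" for s
 have c[measurable]: "c \<in> borel_measurable borel" unfolding c_def[abs_def] by measurable
 have M1: "M \<ge> 1" using K0 T by (simp add: M_def)
 have cb: "\<bar>c s\<bar> <= M * K" for s
 proof -
  have "(if 0 <= s \<and> s <= T then G s else 0) <= K * T" using GT[of s] K0 T by auto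
  then show ?thesis unfolding c_def abs_mult M_def using K[of s] by (intro mult_mono) auto
 qed
 define D where "D r = exp (G r) - 1 - (LINT s:{0..r}|lborel. c s)" for r
 note cinc = set_integral_increment[OF c cb]
 have "D T = D 0"
 proof (rule zero_increment_const[OF _ T])
  fix r r' assume r: "0 <= r" "r <= r'" "r' <= T"
  define \<Delta> where "\<Delta> = G r' - G r"
  have \<Delta>: "\<bar>\<Delta>\<bar> <= K * (r' - r)" unfolding \<Delta>_def using Gb r by simp
  have \<Delta>T: "\<bar>\<Delta>\<bar> <= K * T" using \<Delta> r K0 mult_left_mono[of "r' - r" T K] by linarith
  let ?d = "%s. c s - exp (G r) * g s"
  have "D r' - D r = exp (G r) * (exp \<Delta> - 1 - \<Delta>) - (LINT s:{r..r'}|lborel. ?d s)"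
  proof -
   have "(LINT s:{r..r'}|lborel. ?d s) = (LINT s:{r..r'}|lborel. c s) - exp (G r) * \<Delta>"
    using set_integrable_bounded_interval[OF c cb] set_integrable_bounded_interval[OF g K] Ginc[OF r(1,2)]
    by (subst set_integral_diff) (auto simp: \<Delta>_def)
   then show ?thesis unfolding D_def using cinc[OF r(1,2)]
    by (simp add: \<Delta>_def exp_diff right_diff_distrib)
  qed
  moreover have "\<bar>exp (G r) * (exp \<Delta> - 1 - \<Delta>)\<bar> <= M * (M * (K * (r' - r))^2)"
   unfolding abs_mult
  proof (rule mult_mono)
   show "\<bar>exp (G r)\<bar> <= M" using GT[of r] r by (simp add: M_def)
   have "\<bar>exp \<Delta> - 1 - \<Delta>\<bar> <= M * \<Delta>^2" unfolding M_def by (rule exp_diff_linear_le[OF \<Delta>T])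
   also have "... <= M * (K * (r' - r))^2"
    using \<Delta> M1 K0 r by (intro mult_left_mono) (auto simp: abs_le_square_iff[symmetric])
   finally show "\<bar>exp \<Delta> - 1 - \<Delta>\<bar> <= M * (K * (r' - r))^2" .
  qed (use M1 in auto)
  moreover have "\<bar>LINT s:{r..r'}|lborel. ?d s\<bar> <= (M * (K * (r' - r)) * K) * (r' - r)"
  proof (rule set_integral_bound_interval)
   fix s assume s: "r <= s" "s <= r'"
   have "?d s = (exp (G s) - exp (G r)) * g s" using s r by (simp add: c_def left_diff_distrib)
   moreover have "\<bar>exp (G s) - exp (G r)\<bar> <= M * (K * (r' - r))"
   proof -
    have "\<bar>exp (G s) - exp (G r)\<bar> <= M * \<bar>G s - G r\<bar>"
     unfolding M_def using GT s r by (intro exp_diff_le) auto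
    also have "\<bar>G s - G r\<bar> <= K * (r' - r)"
     using Gb[of r s] s r K0 mult_left_mono[of "s - r" "r' - r" K] by linarith
    finally show ?thesis using M1 by (simp add: mult_left_mono)
   qed
   ultimately show "\<bar>?d s\<bar> <= M * (K * (r' - r)) * K"
    using K[of s] M1 K0 r by (simp add: abs_mult) (intro mult_mono, auto)
  qed (use r in auto)
  moreover have "M * (M * (K * (r' - r))^2) + (M * (K * (r' - r)) * K) * (r' - r) = (M * M * K^2 + M * K^2) * (r' - r)^2"
   by (simp add: power2_eq_square algebra_simps)
  ultimately show "\<bar>D r' - D r\<bar> <= (M * M * K^2 + M * K^2) * (r' - r)^2" by linarith
 qed
 moreover have "D 0 = 0"
  unfolding D_def G0 using set_integral_bound_interval[of c 0 0 "M * K"] cb by simp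
 moreover have "(LINT s:{0..T}|lborel. c s) = (LINT s:{0..T}|lborel. exp (G s) * g s)"
  unfolding set_lebesgue_integral_def by (rule integral_cong) (auto simp: c_def indicator_def)
 ultimately show ?thesis by (simp add: D_def)
qed

lemma (in prob_space) fubini_interval:
 fixes g :: "real => 'a => real"
 assumes g[measurable]: "(%z. g (fst z) (snd z)) \<in> borel_measurable (borel \<Otimes>\<^sub>M M)" and K: "!!s w. w \<in> space M ==> \<bar>g s w\<bar> <= K"
 shows "(LINT w|M. (LINT s:{a..b}|lborel. g s w)) = (LINT s:{a..b}|lborel. (LINT w|M. g s w))"
  and "(%w. LINT s:{a..b}|lborel. g s w) \<in> borel_measurable M"
  and "(%s. LINT w|M. g s w) \<in> borel_measurable borel"
proof -
 note times = emeasure_pair_measure_Times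
 interpret pair_sigma_finite lborel M ..
 have K0: "0 <= K" using K[of _ 0] not_empty by fastforce
 have g'[measurable]: "(%(s, w). g s w) \<in> borel_measurable (lborel \<Otimes>\<^sub>M M)"
  using g by (simp add: case_prod_beta)
 have gsw[measurable]: "(%(w, s). g s w) \<in> borel_measurable (M \<Otimes>\<^sub>M lborel)"
  using measurable_pair_swap[OF g'] by (simp add: case_prod_beta)
 show m: "(%w. LINT s:{a..b}|lborel. g s w) \<in> borel_measurable M"
  unfolding set_lebesgue_integral_def by measurable
 show "(%s. LINT w|M. g s w) \<in> borel_measurable borel"
  by measurable
 have "integrable (lborel \<Otimes>\<^sub>M M) (%(s, w). indicator {a..b} s *\<^sub>R g s w)"
 proof (rule integrable_bound)
  show "integrable (lborel \<Otimes>\<^sub>M M) (%z. K * indicator ({a..b} \<times> space M) z)"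
  proof (intro integrable_mult_right integrable_real_indicator)
   show "emeasure (lborel \<Otimes>\<^sub>M M) ({a..b} \<times> space M) < \<infinity>"
    by (subst times) (auto simp: emeasure_space_1 emeasure_lborel_Icc_eq)
  qed measurable
  show "(%(s, w). indicat_real {a..b} s *\<^sub>R g s w) \<in> borel_measurable (lborel \<Otimes>\<^sub>M M)"
   by measurable
  show "AE z in lborel \<Otimes>\<^sub>M M. norm (case z of (s, w) => indicator {a..b} s *\<^sub>R g s w) <= norm (K * indicator ({a..b} \<times> space M) z)"
   using K K0 by (intro AE_I2) (auto simp: space_pair_measure indicator_def)
 qed
 from Fubini_integral[OF this]
 show "(LINT w|M. (LINT s:{a..b}|lborel. g s w)) = (LINT s:{a..b}|lborel. (LINT w|M. g s w))"
  by (simp add: set_lebesgue_integral_def)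
qed

lemma (in prob_space) bounded_integral_le:
 fixes g :: "'a => real"
 assumes "!!w. w \<in> space M ==> \<bar>g w\<bar> <= K" "0 <= K"
 shows "\<bar>(LINT w|M. g w)\<bar> <= K"
proof -
 have "\<bar>(LINT w|M. g w)\<bar> <= (LINT w|M. norm (g w))"
  using integral_norm_bound[of M g] by simp
 also have "... <= (LINT w|M. K)" using assms by (intro integral_mono') auto
 finally show ?thesis by (simp add: prob_space)
qed

text \<open>The substitution \<open>r = s + v\<close>, then exchange of the order over the triangle
  \<open>0 \<le> s \<le> r \<le> t\<close>.\<close>

lemma triangle_fubini:
 fixes G :: "real => real => real"
 assumes G[measurable]: "(%z. G (fst z) (snd z)) \<in> borel_measurable (borel \<Otimes>\<^sub>M borel)" and K: "!!s r. \<bar>G s r\<bar> <= K"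
 shows "(LINT s:{0..t}|lborel. (LINT v:{0..t - s}|lborel. G s (s + v))) = (LINT r:{0..t}|lborel. (LINT s:{0..r}|lborel. G s r))"
proof -
 have K0: "0 <= K" using K[of 0 0] by simp
 have "(LINT v:{0..t - s}|lborel. G s (s + v)) = (LINT r|lborel. indicator {s..t} r * G s r)" for s
  unfolding set_lebesgue_integral_def
  by (subst lborel_integral_real_affine[where c=1 and t=s]) (auto simp: indicator_def intro!: integral_cong)
 then have "(LINT s:{0..t}|lborel. (LINT v:{0..t - s}|lborel. G s (s + v))) =
   (LINT s|lborel. (LINT r|lborel. indicator {0..t} s * indicator {s..t} r * G s r))"
  unfolding set_lebesgue_integral_def by (simp add: mult.assoc)
 also have "... = (LINT r|lborel. (LINT s|lborel. indicator {0..t} s * indicator {s..t} r * G s r))"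
 proof (rule lborel_pair.Fubini_integral[symmetric])
  have G'[measurable]: "(%(s, r). G s r) \<in> borel_measurable (lborel \<Otimes>\<^sub>M lborel)"
   using G by (simp add: case_prod_beta)
  have eq: "indicator {0..t} s * indicator {s..t} r = (indicator {z. 0 <= fst z \<and> fst z <= snd z \<and> snd z <= t} (s, r) :: real)" for s r
   by (auto simp: indicator_def)
  have Tm[measurable]: "{z :: real \<times> real. 0 <= fst z \<and> fst z <= snd z \<and> snd z <= t} \<in> sets (borel \<Otimes>\<^sub>M borel)"
  proof -
   have "{z \<in> space (borel \<Otimes>\<^sub>M borel). 0 <= fst z \<and> fst z <= snd z \<and> snd z <= t} \<in> sets (borel \<Otimes>\<^sub>M (borel :: real measure))"
    by measurable
   then show ?thesis by (simp add: space_pair_measure)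
  qed
  show "integrable (lborel \<Otimes>\<^sub>M lborel) (%(s, r). indicator {0..t} s * indicator {s..t} r * G s r)"
   unfolding eq
  proof (rule integrable_bound)
   show "integrable (lborel \<Otimes>\<^sub>M lborel) (%z. K * indicator ({0..t} \<times> {0..t}) z)"
   proof (intro integrable_mult_right integrable_real_indicator)
    show "emeasure (lborel \<Otimes>\<^sub>M lborel) ({0..t} \<times> {0..t}) < \<infinity>"
     by (subst lborel.emeasure_pair_measure_Times) (auto simp: ennreal_mult_less_top emeasure_lborel_Icc_eq)
   qed measurable
   show "(%(s, r). indicat_real {z. 0 <= fst z \<and> fst z <= snd z \<and> snd z <= t} (s, r) * G s r) \<in> borel_measurable (lborel \<Otimes>\<^sub>M lborel)"
    using Tm G by (simp add: case_prod_beta cong: measurable_cong_sets) 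
   show "AE z in lborel \<Otimes>\<^sub>M lborel. norm (case z of (s, r) => indicat_real {z. 0 <= fst z \<and> fst z <= snd z \<and> snd z <= t} (s, r) * G s r)
     <= norm (K * indicator ({0..t} \<times> {0..t}) z)"
    using K K0 by (intro AE_I2) (auto simp: indicator_def)
  qed
 qed
 also have "... = (LINT r:{0..t}|lborel. (LINT s:{0..r}|lborel. G s r))"
  unfolding set_lebesgue_integral_def integral_scaleR_right[symmetric]
  by (intro integral_cong) (auto simp: indicator_def)
 finally show ?thesis .
qed

section \<open>Joint measurability of the motion and of its transition kernel\<close>

lemma sets_borel_on_opc_generated:
 "sets (borel_on (opc :: 'a::t2_space option topology)) = sigma_sets UNIV {Some ` U | U. open U}"
proof
 let ?N = "sigma UNIV {Some ` U | U :: 'a set. open U}"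
 have N: "sets ?N = sigma_sets UNIV {Some ` U | U. open U}" "space ?N = UNIV" by (auto intro: sets_measure_of)
 have "id \<in> ?N \<rightarrow>\<^sub>M borel_on (opc :: 'a option topology)"
 proof (rule measurable_borel_on_opc)
  show "id -` Some ` U \<inter> space ?N \<in> sets ?N" if "open U" for U :: "'a set"
   unfolding N using that by (auto intro!: sigma_sets.Basic)
 qed
 then show "sets (borel_on (opc :: 'a option topology)) \<subseteq> sigma_sets UNIV {Some ` U | U. open U}"
  using measurable_sets[of id ?N "borel_on (opc :: 'a option topology)"] N by auto
 show "sigma_sets UNIV {Some ` U | U. open U} \<subseteq> sets (borel_on (opc :: 'a option topology))"
 proof -
  have "{Some ` U | U :: 'a set. open U} \<subseteq> sets (borel_on opc)" by (auto intro!: Some_image_sets borel_open)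
  from sets.sigma_sets_subset[OF this] show ?thesis by (simp add: space_borel_on)
 qed
qed

context spatial_motion
begin

lemma prob_Q: "prob_space (Q z)"
 using prob_space_P[of z] by simp

lemma space_Q: "space (Q z) = \<Omega>"
 using space_P[of z] by simp

lemma measurable_F_Q: "f \<in> F t \<rightarrow>\<^sub>M N ==> f \<in> Q z \<rightarrow>\<^sub>M N"
 by (rule measurable_F_P[of z]) simp_all

lemma xi_measurable: "0 <= t ==> \<xi> t \<in> Q z \<rightarrow>\<^sub>M borel_on opc"
 using measurable_X[of z t] by simp

lemma xi_joint: "(%j. \<xi> (max 0 (fst j)) (snd j)) \<in> borel \<Otimes>\<^sub>M Q z \<rightarrow>\<^sub>M borel_on opc"
proof (rule process_jointly_measurable[OF locally_compact_E])
 show "\<xi> t \<in> Q z \<rightarrow>\<^sub>M borel_on opc" if "0 <= t" for t using that by (rule xi_measurable)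
 show "limitin opc (%s. \<xi> s w) (\<xi> t w) (at_right t)" if "0 <= t" "w \<in> space (Q z)" for t w
  using right_continuous that by (simp add: space_Q)
qed

text \<open>Freezing the path at time \<open>t\<close> involves only the past up to
  \<open>t\<close>, so time integrals along the path become measurable with respect to
  \<open>F t\<close>. The Feynman-Kac weight needs this in order to enter the Markov
  property.\<close>

lemma xi_progressive:
 assumes t: "0 <= t"
 shows "(%j. \<xi> (min t (max 0 (fst j))) (snd j)) \<in> borel \<Otimes>\<^sub>M F (ennreal t) \<rightarrow>\<^sub>M borel_on opc"
proof -
 have "(%j. (%s. \<xi> (min t s)) (max 0 (fst j)) (snd j)) \<in> borel \<Otimes>\<^sub>M F (ennreal t) \<rightarrow>\<^sub>M borel_on opc"
 proof (rule process_jointly_measurable[OF locally_compact_E])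
  fix s :: real assume s: "0 <= s"
  show "\<xi> (min t s) \<in> F (ennreal t) \<rightarrow>\<^sub>M borel_on opc"
   using s t by (intro measurable_F_mono[OF adapted]) (auto intro: ennreal_leI)
  fix w assume "w \<in> space (F (ennreal t))"
  then have w: "w \<in> \<Omega>" by (simp add: space_F)
  show "limitin opc (%s. \<xi> (min t s) w) (\<xi> (min t s) w) (at_right s)"
  proof (cases "s < t")
   case True
   have "\<forall>\<^sub>F s' in at_right s. \<xi> s' w = \<xi> (min t s') w"
    using order_tendstoD(2)[OF tendsto_ident_at True] by eventually_elim simp
   then show ?thesis
    using limitin_transform_eventually[OF _ right_continuous[OF w s]] True by (simp add: min_def)
  next
   case False
   have "\<forall>\<^sub>F s' in at_right s. \<xi> t w = \<xi> (min t s') w"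
    using eventually_at_right_less[of s] False by (auto elim!: eventually_mono)
   then show ?thesis
    using limitin_transform_eventually[of "%_. \<xi> t w" "%s'. \<xi> (min t s') w" "at_right s" opc "\<xi> t w"] False
    by (simp add: min_def limitin_const)
  qed
 qed
 then show ?thesis by simp
qed

lemma xi_ext_integral_right_continuous:
 fixes f :: "'e => real"
 assumes f: "continuous_on UNIV f" "compact K" "{x. f x \<noteq> 0} \<subseteq> K" "!!x. \<bar>f x\<bar> <= 1" and t: "0 <= t"
 shows "((%s. LINT w|Q z. ext f (\<xi> s w)) \<longlongrightarrow> (LINT w|Q z. ext f (\<xi> t w))) (at_right t)"
 unfolding tendsto_at_iff_sequentially
proof (intro allI impI)
 interpret prob_space "Q z" by (rule prob_Q)
 fix Y :: "nat => real" assume Y: "\<forall>i. Y i \<in> {t<..} - {t}" "Y \<longlonglongrightarrow> t"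
 have m: "(%w. ext f (\<xi> s w)) \<in> borel_measurable (Q z)" if "0 <= s" for s
  using f(1) by (intro measurable_compose[OF xi_measurable[OF that] measurable_ext] borel_measurable_continuous_onI)
 have "(%i. LINT w|Q z. ext f (\<xi> (Y i) w)) \<longlonglongrightarrow> (LINT w|Q z. ext f (\<xi> t w))"
 proof (rule integral_dominated_convergence[where w="%_. 1"])
  show "AE w in Q z. (%i. ext f (\<xi> (Y i) w)) \<longlonglongrightarrow> ext f (\<xi> t w)"
  proof (rule AE_I2)
   fix w assume "w \<in> space (Q z)"
   then have "((%s. ext f (\<xi> s w)) \<longlongrightarrow> ext f (\<xi> t w)) (at_right t)"
    using continuous_map_limit[OF continuous_map_opc_ext[OF f(1-3)] right_continuous[OF _ t]]
    by (simp add: o_def space_Q)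
   then show "(%i. ext f (\<xi> (Y i) w)) \<longlonglongrightarrow> ext f (\<xi> t w)"
    using Y unfolding tendsto_at_iff_sequentially by (auto simp: o_def)
  qed
  show "AE w in Q z. norm (ext f (\<xi> (Y i) w)) <= 1" for i
   using f(4) by (intro AE_I2) (auto split: option.splits)
  show "(%w. ext f (\<xi> (Y i) w)) \<in> borel_measurable (Q z)" for i
   using Y t by (intro m) (auto intro: less_imp_le less_le_trans dest: spec[of _ i])
 qed (use t in \<open>auto intro: m\<close>)
 then show "((%s. LINT w|Q z. ext f (\<xi> s w)) \<circ> Y) \<longlonglongrightarrow> (LINT w|Q z. ext f (\<xi> t w))"
  by (simp add: o_def)
qed

text \<open>For a continuous compactly supported function the mean is right continuous in time and
  measurable in the starting point. Monotone-type limits give the images of open sets, an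
  intersection-stable generator.\<close>

lemma transition_joint:
 "(%j. transition (max 0 (fst j)) (snd j)) \<in> borel \<Otimes>\<^sub>M borel_on opc \<rightarrow>\<^sub>M subprob_algebra (borel_on opc)"
proof (rule measurable_subprob_algebra_generated[OF sets_borel_on_opc_generated])
 show "Int_stable {Some ` U | U :: 'e set. open U}"
  unfolding Int_stable_def
 proof (intro ballI)
  fix a b :: "'e option set" assume "a \<in> {Some ` U |U. open U}" "b \<in> {Some ` U |U. open U}"
  then obtain U V where "open U" "open V" "a = Some ` U" "b = Some ` V" by auto
  then show "a \<inter> b \<in> {Some ` U |U. open U}"
   by (intro CollectI exI[of _ "U \<inter> V"]) (auto simp: image_Int)
 qed
 have pr: "prob_space (transition (max 0 v) z)" for v z
  unfolding transition_def using prob_space.prob_space_distr[OF prob_Q xi_measurable] by simp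
 show "subprob_space (transition (max 0 (fst j)) (snd j))" for j :: "real \<times> 'e option"
  by (intro prob_space_imp_subprob_space pr)
 show "sets (transition (max 0 (fst j)) (snd j)) = sets (borel_on opc)" for j :: "real \<times> 'e option"
  by (simp add: transition_def)
 have "emeasure (transition (max 0 v) z) UNIV = 1" for v and z :: "'e option"
  using prob_space.emeasure_space_1[OF pr, of v z] by (simp add: transition_def space_borel_on)
 then show "(%j. emeasure (transition (max 0 (fst j)) (snd j)) UNIV) \<in> borel_measurable (borel \<Otimes>\<^sub>M borel_on (opc :: 'e option topology))"
  by simp
 fix A :: "'e option set" assume "A \<in> {Some ` U | U. open U}"
 then obtain U where U: "open U" "A = Some ` U" by auto
 obtain f :: "nat => 'e => real" and K where f: "!!k. continuous_on UNIV (f k)" "!!k. compact (K k)"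
  "!!k. {x. f k x \<noteq> 0} \<subseteq> K k" "!!k x. 0 <= f k x" "!!k x. f k x <= indicator U x"
  "!!x. (%k. f k x) \<longlonglongrightarrow> indicator U x"
  using open_limit_compact_support[OF locally_compact_E U(1)] by metis
 have f1: "\<bar>f k x\<bar> <= 1" for k x
  using f(4)[of k x] f(5)[of k x] by (cases "x \<in> U") simp_all
 have fb: "f k \<in> borel_measurable borel" for k using f(1) by (rule borel_measurable_continuous_onI)
 have [measurable]: "(%j. LINT w|Q (snd j). ext (f k) (\<xi> (max 0 (fst j)) w)) \<in> borel_measurable (borel \<Otimes>\<^sub>M borel_on (opc :: 'e option topology))" for k
 proof (rule borel_measurable_right_continuous_joint[where Fn="%v z. (LINT w|Q z. ext (f k) (\<xi> v w))"])
  fix v :: real assume v: "0 <= v"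
  have "(%z. LINT y|transition v z. ext (f k) y) \<in> borel_measurable (borel_on (opc :: 'e option topology))"
   by (rule measurable_compose[OF transition_measurable[OF v] integral_measurable_subprob_algebra[OF measurable_ext[OF fb]]])
  then show "(%z. LINT w|Q z. ext (f k) (\<xi> v w)) \<in> borel_measurable (borel_on (opc :: 'e option topology))"
   by (simp add: transition_def integral_distr[OF xi_measurable[OF v] measurable_ext[OF fb]])
  show "((%j. LINT w|Q z. ext (f k) (\<xi> j w)) \<longlongrightarrow> (LINT w|Q z. ext (f k) (\<xi> v w))) (at_right v)" for z
   by (rule xi_ext_integral_right_continuous[OF f(1-3) f1 v])
 qed
 have lim: "(%k. LINT w|Q z. ext (f k) (\<xi> (max 0 v) w)) \<longlonglongrightarrow> measure (transition (max 0 v) z) A" for v z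
 proof -
  interpret prob_space "Q z" by (rule prob_Q)
  have v: "0 <= max 0 v" by simp
  have AS: "A \<in> sets (borel_on opc)" unfolding U(2) by (rule Some_image_sets) (use U(1) in simp)
  have m[measurable]: "\<xi> (max 0 v) \<in> Q z \<rightarrow>\<^sub>M borel_on opc" by (rule xi_measurable[OF v])
  have "(%k. LINT w|Q z. ext (f k) (\<xi> (max 0 v) w)) \<longlonglongrightarrow> (LINT w|Q z. indicator A (\<xi> (max 0 v) w))"
  proof (rule integral_dominated_convergence[where w="%_. 1"])
   show "AE w in Q z. (%i. ext (f i) (\<xi> (max 0 v) w)) \<longlonglongrightarrow> indicator A (\<xi> (max 0 v) w)"
   proof (rule AE_I2)
    fix w
    show "(%i. ext (f i) (\<xi> (max 0 v) w)) \<longlonglongrightarrow> indicator A (\<xi> (max 0 v) w)"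
     using f(6)[of "the (\<xi> (max 0 v) w)"] U(2)
     by (cases "\<xi> (max 0 v) w") (auto simp: indicator_def image_iff)
   qed
   show "AE w in Q z. norm (ext (f i) (\<xi> (max 0 v) w)) <= 1" for i
    using f1 by (intro AE_I2) (auto split: option.splits)
  qed (use AS in \<open>auto intro!: measurable_compose[OF m measurable_ext[OF fb]]\<close>)
  also have "(LINT w|Q z. indicat_real A (\<xi> (max 0 v) w)) = (LINT y|transition (max 0 v) z. indicator A y)"
   unfolding transition_def using AS
   by (intro integral_distr[OF m, where f="indicator A :: _ => real", symmetric]) simp
  also have "... = measure (transition (max 0 v) z) A"
   using AS by (simp add: transition_def space_borel_on)
  finally show ?thesis .
 qed
 have "(%j. measure (transition (max 0 (fst j)) (snd j)) A) \<in> borel_measurable (borel \<Otimes>\<^sub>M borel_on (opc :: 'e option topology))"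
  by (rule borel_measurable_LIMSEQ_real[OF lim]) measurable
 moreover have "emeasure (transition (max 0 v) z) A = ennreal (measure (transition (max 0 v) z) A)" for v z
  using prob_space.finite_measure[OF pr] by (simp add: finite_measure.emeasure_eq_measure)
 ultimately show "(%j. emeasure (transition (max 0 (fst j)) (snd j)) A) \<in> borel_measurable (borel \<Otimes>\<^sub>M borel_on (opc :: 'e option topology))"
  by simp
qed auto

text \<open>Adding the bounds \<open>C\<close> and \<open>C'\<close> makes both factors nonnegative;
  subtracting the same identity with the constant \<open>C\<close> as past functional removes the
  extra terms.\<close>

lemma markov_integral:
 fixes Y :: "'w => real" and h :: "'e option => real"
 assumes s: "0 <= s" and r: "0 <= r"
  and Y: "Y \<in> borel_measurable (F (ennreal s))" "!!w. w \<in> \<Omega> ==> \<bar>Y w\<bar> <= C"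
  and h: "h \<in> borel_measurable (borel_on opc)" "!!y. \<bar>h y\<bar> <= C'"
 shows "(LINT w|Q z. Y w * h (\<xi> (s + r) w)) = (LINT w|Q z. Y w * (LINT y|transition r (\<xi> s w). h y))"
proof -
 interpret prob_space "Q z" by (rule prob_Q)
 have sr: "0 <= s + r" using s r by simp
 note [measurable] = xi_measurable[OF s] xi_measurable[OF sr]
 have pr: "prob_space (transition r z)" for z
  unfolding transition_def using prob_space.prob_space_distr[OF prob_Q xi_measurable[OF r]] .
 have C0: "0 <= C" using Y(2) not_empty unfolding space_Q by force
 have C0': "0 <= C'" using h(2)[of None] by simp
 have Th: "(%z. LINT y|transition r z. h' y) \<in> borel_measurable (borel_on opc)"
  if "h' \<in> borel_measurable (borel_on opc)" for h' :: "'e option => real"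
  by (rule measurable_compose[OF transition_measurable[OF r] integral_measurable_subprob_algebra[OF that]])
 have nonneg: "(LINT w|Q z. Y' w * h' (\<xi> (s + r) w)) = (LINT w|Q z. Y' w * (LINT y|transition r (\<xi> s w). h' y))"
  if Y'[measurable]: "Y' \<in> borel_measurable (F (ennreal s))" and Y'b: "!!w. w \<in> \<Omega> ==> 0 <= Y' w"
   and h'[measurable]: "h' \<in> borel_measurable (borel_on opc)" and h'b: "!!y. 0 <= h' y" "!!y. h' y <= 2 * C'"
  for Y' and h' :: "'e option => real"
 proof -
  note [measurable] = measurable_F_Q[OF Y', of z]
  have hi: "integrable (transition r z) h'" for z
  proof -
   interpret T: prob_space "transition r z" by (rule pr)
   show ?thesis
    by (rule T.integrable_const_bound[where B="2 * C'"]) (use h'b h' in \<open>auto simp: transition_def\<close>)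
  qed
  have h0: "0 <= (LINT y|transition r z. h' y)" for z using h'b by (intro integral_nonneg_AE) auto
  have "(LINT w|Q z. Y' w * h' (\<xi> (s + r) w)) = enn2real (NN (Q z) (%w. ennreal (Y' w) * ennreal (h' (\<xi> (s + r) w))))"
   using Y'b h'b by (subst integral_eq_nn_integral)
    (auto simp: space_Q ennreal_mult'' intro!: arg_cong[where f=enn2real] nn_integral_cong)
  also have "(NN (Q z) (%w. ennreal (Y' w) * ennreal (h' (\<xi> (s + r) w)))) =
    (NN (Q z) (%w. ennreal (Y' w) * (NN (transition r (\<xi> s w)) (%y. ennreal (h' y)))))"
   by (rule markov_nn_integral) (use s r in auto)
  also have "... = (NN (Q z) (%w. ennreal (Y' w) * ennreal (LINT y|transition r (\<xi> s w). h' y)))"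
   using h'b by (subst nn_integral_eq_integral[OF hi]) auto
  also have "enn2real ... = (LINT w|Q z. Y' w * (LINT y|transition r (\<xi> s w). h' y))"
   using Y'b h0 Th[OF h'] by (subst integral_eq_nn_integral)
    (auto simp: space_Q ennreal_mult'' intro!: arg_cong[where f=enn2real] nn_integral_cong)
  finally show ?thesis .
 qed
 note [measurable] = Y(1) h(1) measurable_F_Q[OF Y(1), of z] Th[OF h(1)]
 have Tc: "(LINT y|transition r z. h y + C') = (LINT y|transition r z. h y) + C'" for z
 proof -
  interpret T: prob_space "transition r z" by (rule pr)
  have "integrable (transition r z) h"
   by (rule T.integrable_const_bound[where B=C']) (use h in \<open>auto simp: transition_def\<close>)
  then show ?thesis by (simp add: T.prob_space)
 qed
 have Tb: "\<bar>(LINT y|transition r z. h y)\<bar> <= C'" for z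
  using h(2) C0' by (intro prob_space.bounded_integral_le[OF pr]) auto
 have int: "integrable (Q z) g" if "g \<in> borel_measurable (Q z)" "!!w. w \<in> \<Omega> ==> \<bar>g w\<bar> <= B" for g :: "'w => real" and B
  by (rule integrable_const_bound[where B=B]) (use that in \<open>auto simp: space_Q\<close>)
 have i: "integrable (Q z) (%w. Y w * h (\<xi> (s + r) w))" "integrable (Q z) (%w. h (\<xi> (s + r) w))" "integrable (Q z) Y"
  "integrable (Q z) (%w. Y w * (LINT y|transition r (\<xi> s w). h y))" "integrable (Q z) (%w. LINT y|transition r (\<xi> s w). h y)"
 proof -
  show "integrable (Q z) Y" using Y by (intro int[of _ C]) simp_all
  show "integrable (Q z) (%w. h (\<xi> (s + r) w))" by (rule int[of _ C']) (use h in simp_all)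
  show "integrable (Q z) (%w. LINT y|transition r (\<xi> s w). h y)" by (rule int[of _ C']) (use Tb in simp_all)
  show "integrable (Q z) (%w. Y w * h (\<xi> (s + r) w))"
   by (rule int[of _ "C * C'"]) (use Y(2) h(2) C0 in \<open>auto simp: abs_mult intro!: mult_mono\<close>)
  show "integrable (Q z) (%w. Y w * (LINT y|transition r (\<xi> s w). h y))"
   by (rule int[of _ "C * C'"]) (use Y(2) Tb C0 in \<open>auto simp: abs_mult intro!: mult_mono\<close>)
 qed
 have 1: "(LINT w|Q z. (Y w + C) * (h (\<xi> (s + r) w) + C')) = (LINT w|Q z. (Y w + C) * ((LINT y|transition r (\<xi> s w). h y) + C'))"
  unfolding Tc[symmetric]
 proof (rule nonneg)
  show "0 <= Y w + C" if "w \<in> \<Omega>" for w using Y(2)[OF that] by linarith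
  show "0 <= h y + C'" "h y + C' <= 2 * C'" for y using h(2)[of y] by linarith+
 qed measurable
 have 2: "(LINT w|Q z. C * (h (\<xi> (s + r) w) + C')) = (LINT w|Q z. C * ((LINT y|transition r (\<xi> s w). h y) + C'))"
  unfolding Tc[symmetric]
 proof (rule nonneg)
  show "0 <= h y + C'" "h y + C' <= 2 * C'" for y using h(2)[of y] by linarith+
 qed (use C0 in auto)
 have "(LINT w|Q z. Y w * h (\<xi> (s + r) w)) + C * (LINT w|Q z. h (\<xi> (s + r) w)) =
   (LINT w|Q z. Y w * (LINT y|transition r (\<xi> s w). h y)) + C * (LINT w|Q z. (LINT y|transition r (\<xi> s w). h y))"
  using 1 i by (simp add: algebra_simps prob_space)
 moreover have "C * (LINT w|Q z. h (\<xi> (s + r) w)) = C * (LINT w|Q z. (LINT y|transition r (\<xi> s w). h y))"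
  using 2 i by (auto simp: algebra_simps prob_space)
 ultimately show ?thesis by linarith
qed

end

lemma borel_measurable_ext_pair:
 fixes H :: "'e::t2_space => 'b => real"
 assumes "(%z. H (fst z) (snd z)) \<in> borel_measurable (borel \<Otimes>\<^sub>M N)"
 shows "(%z. ext (%y. H y (snd z)) (fst z)) \<in> borel_measurable (borel_on opc \<Otimes>\<^sub>M N)"
proof -
 \<comment> \<open>A left inverse of \<open>Some\<close>; its arbitrary value at the cemetery is
   masked below by an indicator.\<close>
 define th :: "'e option => 'e" where "th = case_option undefined id"
 have th[measurable]: "th \<in> borel_on opc \<rightarrow>\<^sub>M borel"
 proof (rule measurableI)
  fix A :: "'e set" assume A: "A \<in> sets borel"
  have "th -` A \<inter> space (borel_on opc) = (if undefined \<in> A then UNIV - Some ` (- A) else Some ` A)"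
  proof -
   have "v \<in> th -` A \<longleftrightarrow> v \<in> (if undefined \<in> A then UNIV - Some ` (- A) else Some ` A)" for v
    by (cases v) (auto simp: th_def)
   then show ?thesis by (auto simp: space_borel_on)
  qed
  moreover have "UNIV - Some ` (- A) \<in> sets (borel_on opc)"
   using Some_image_sets[of "- A"] A sets.compl_sets[of "Some ` (- A)" "borel_on opc"] by (simp add: space_borel_on)
  ultimately show "th -` A \<inter> space (borel_on opc) \<in> sets (borel_on opc)"
   using Some_image_sets[OF A] by simp
 qed simp
 have [measurable]: "Some ` UNIV \<in> sets (borel_on (opc :: 'e option topology))"
  by (rule Some_image_sets) simp
 have "(%z. indicator (Some ` UNIV) (fst z) * H (th (fst z)) (snd z)) \<in> borel_measurable (borel_on opc \<Otimes>\<^sub>M N)"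
  using measurable_compose[OF _ assms, of "%z. (th (fst z), snd z)" "borel_on opc \<Otimes>\<^sub>M N"] by simp
 moreover have "indicator (Some ` UNIV) z * H (th z) r = ext (%y. H y r) z" for z r
  by (cases z) (auto simp: th_def indicator_def)
 ultimately show ?thesis by simp
qed

text \<open>Rewrites a signed integral through a nonnegative one, so that measurability in a
  parameter can be read off from that of nonnegative kernel integrals.\<close>

lemma (in prob_space) integral_shift_nonneg:
 fixes f :: "'a => real"
 assumes "f \<in> borel_measurable M" "!!x. x \<in> space M ==> \<bar>f x\<bar> <= C"
 shows "(LINT x|M. f x) = enn2real (NN M (%x. ennreal (f x + C))) - C"
proof -
 have i: "integrable M f" by (rule integrable_const_bound[where B=C]) (use assms in auto)
 have "(LINT x|M. f x + C) = enn2real (NN M (%x. ennreal (f x + C)))"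
 proof (rule integral_eq_nn_integral)
  show "AE x in M. 0 <= f x + C"
  proof (rule AE_I2)
   fix x assume "x \<in> space M" then show "0 <= f x + C" using assms(2)[of x] by linarith
  qed
 qed (use assms in simp)
 moreover have "(LINT x|M. f x + C) = (LINT x|M. f x) + C" using i by (simp add: prob_space)
 ultimately show ?thesis by simp
qed

section \<open>Feynman-Kac weights and variation of constants\<close>

locale feynman_kac = spatial_motion +
 fixes \<alpha> :: "'b => real" and K :: real
 assumes alpha_measurable: "\<alpha> \<in> borel_measurable borel" and alpha_bound: "!!x. \<bar>\<alpha> x\<bar> <= K"
begin

definition weight :: "real => 'a => real" where
 "weight r w = exp (LINT s:{0..r}|lborel. ext \<alpha> (\<xi> s w))"

lemma K_nonneg: "0 <= K"
 using alpha_bound[of undefined] by linarith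

lemma ext_alpha_bound: "\<bar>ext \<alpha> z\<bar> <= K"
 using alpha_bound K_nonneg by (cases z) auto

lemma alpha_path_joint: "(%j. ext \<alpha> (\<xi> (max 0 (fst j)) (snd j))) \<in> borel_measurable (borel \<Otimes>\<^sub>M Q z)"
 by (rule measurable_compose[OF xi_joint measurable_ext[OF alpha_measurable]])

lemma alpha_path: "w \<in> \<Omega> ==> (%s. ext \<alpha> (\<xi> (max 0 s) w)) \<in> borel_measurable borel"
 using measurable_compose[OF _ alpha_path_joint, of "%s. (s, w)" borel None] by (simp add: space_Q)

lemma potential_eq:
 "(LINT s:{0..r}|lborel. ext \<alpha> (\<xi> s w)) = (LINT s:{0..r}|lborel. ext \<alpha> (\<xi> (max 0 s) w))"
 unfolding set_lebesgue_integral_def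
 by (rule integral_cong) (auto simp: indicator_def)

lemma potential_measurable_F:
 assumes "0 <= r"
 shows "(%w. LINT s:{0..r}|lborel. ext \<alpha> (\<xi> s w)) \<in> borel_measurable (F (ennreal r))"
proof -
 have "(%j. ext \<alpha> (\<xi> (min r (max 0 (fst j))) (snd j))) \<in> borel_measurable (borel \<Otimes>\<^sub>M F (ennreal r))"
  by (rule measurable_compose[OF xi_progressive[OF assms] measurable_ext[OF alpha_measurable]])
 then have "(%(s, w). ext \<alpha> (\<xi> (min r (max 0 s)) w)) \<in> borel_measurable (lborel \<Otimes>\<^sub>M F (ennreal r))"
  by (simp add: case_prod_beta)
 from measurable_pair_swap[OF this]
 have [measurable]: "(%(w, s). ext \<alpha> (\<xi> (min r (max 0 s)) w)) \<in> borel_measurable (F (ennreal r) \<Otimes>\<^sub>M lborel)"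
  by (simp add: case_prod_beta)
 have "(%w. LINT s|lborel. indicator {0..r} s *\<^sub>R ext \<alpha> (\<xi> (min r (max 0 s)) w)) \<in> borel_measurable (F (ennreal r))"
  by measurable
 moreover have "(LINT s|lborel. indicator {0..r} s *\<^sub>R ext \<alpha> (\<xi> (min r (max 0 s)) w)) = (LINT s:{0..r}|lborel. ext \<alpha> (\<xi> s w))" for w
  unfolding set_lebesgue_integral_def
  by (rule integral_cong) (auto simp: indicator_def)
 ultimately show ?thesis by (simp only:)
qed

lemma weight_measurable_F: "0 <= r ==> weight r \<in> borel_measurable (F (ennreal r))"
 unfolding weight_def[abs_def] using potential_measurable_F by measurable

lemma weight_measurable: "0 <= r ==> weight r \<in> borel_measurable (Q z)"
 by (rule measurable_F_Q[OF weight_measurable_F])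

lemma potential_increment:
 assumes "w \<in> \<Omega>" "0 <= r" "r <= r'"
 shows "\<bar>(LINT s:{0..r'}|lborel. ext \<alpha> (\<xi> s w)) - (LINT s:{0..r}|lborel. ext \<alpha> (\<xi> s w))\<bar> <= K * (r' - r)"
 unfolding potential_eq set_integral_increment[OF alpha_path[OF assms(1)] ext_alpha_bound assms(2,3)]
 using assms ext_alpha_bound by (intro set_integral_bound_interval alpha_path) auto

lemma potential_zero: "(LINT s:{0..r}|lborel. ext \<alpha> (\<xi> s w)) = 0" if "r <= 0"
proof (cases "r = 0")
 case True
 have "AE s in lborel. indicator {0..r} s *\<^sub>R ext \<alpha> (\<xi> s w) = 0"
  using AE_lborel_singleton[of 0] by eventually_elim (simp add: True indicator_def)
 then show ?thesis unfolding set_lebesgue_integral_def by (rule integral_eq_zero_AE)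
qed (use that in \<open>simp add: set_lebesgue_integral_def\<close>)

lemma weight_bound:
 assumes "w \<in> \<Omega>" "0 <= r"
 shows "exp (- K * r) <= weight r w" "weight r w <= exp (K * r)"
 using potential_increment[OF assms(1) order_refl assms(2)] potential_zero[of 0 w] unfolding weight_def by auto

lemma weight_pos: "0 < weight r w"
 by (simp add: weight_def)

lemma potential_joint:
 "(%j. LINT s:{0..max 0 (fst j)}|lborel. ext \<alpha> (\<xi> s (snd j))) \<in> borel_measurable (borel \<Otimes>\<^sub>M Q z)"
proof (rule borel_measurable_right_continuous_joint)
 show "(%w. LINT s:{0..r}|lborel. ext \<alpha> (\<xi> s w)) \<in> borel_measurable (Q z)" if "0 <= r" for r
  by (rule measurable_F_Q[OF potential_measurable_F[OF that]])
 fix r :: real and w assume r: "0 <= r" and "w \<in> space (Q z)"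
 then have w: "w \<in> \<Omega>" by (simp add: space_Q)
 have "((%r'. (LINT s:{0..r'}|lborel. ext \<alpha> (\<xi> s w)) - (LINT s:{0..r}|lborel. ext \<alpha> (\<xi> s w))) \<longlongrightarrow> 0) (at_right r)"
 proof (rule Lim_null_comparison)
  show "\<forall>\<^sub>F r' in at_right r. norm ((LINT s:{0..r'}|lborel. ext \<alpha> (\<xi> s w)) - (LINT s:{0..r}|lborel. ext \<alpha> (\<xi> s w))) <= K * (r' - r)"
   using eventually_at_right_less[of r] by eventually_elim (use potential_increment[OF w r] in auto)
  have "((%r'. K * (r' - r)) \<longlongrightarrow> K * (r - r)) (at_right r)" by (intro tendsto_intros)
  then show "((%r'. K * (r' - r)) \<longlongrightarrow> 0) (at_right r)" by simp
 qed
 then show "((%r'. LINT s:{0..r'}|lborel. ext \<alpha> (\<xi> s w)) \<longlongrightarrow> (LINT s:{0..r}|lborel. ext \<alpha> (\<xi> s w))) (at_right r)"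
  by (rule LIM_zero_cancel)
qed

lemma weight_joint: "(%j. weight (max 0 (fst j)) (snd j)) \<in> borel_measurable (borel \<Otimes>\<^sub>M Q z)"
 unfolding weight_def using potential_joint by measurable

lemma weight_identity:
 assumes w: "w \<in> \<Omega>" and r: "0 <= r"
 shows "weight r w - 1 = (LINT s:{0..r}|lborel. weight s w * ext \<alpha> (\<xi> s w))"
proof -
 have Gm: "(%r. LINT s:{0..r}|lborel. ext \<alpha> (\<xi> (max 0 s) w)) \<in> borel_measurable borel"
 proof -
  have "(%r. LINT s:{0..max 0 r}|lborel. ext \<alpha> (\<xi> s w)) \<in> borel_measurable borel"
   using measurable_compose[OF _ potential_joint, of "%s. (s, w)" borel None] w by (simp add: space_Q)
  moreover have "(LINT s:{0..max 0 r}|lborel. ext \<alpha> (\<xi> s w)) = (LINT s:{0..r}|lborel. ext \<alpha> (\<xi> (max 0 s) w))" for r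
  proof (cases "0 <= r")
   case False
   then show ?thesis using potential_zero[of "max 0 r" w] by (simp add: set_lebesgue_integral_def)
  qed (simp add: potential_eq)
  ultimately show ?thesis by simp
 qed
 have "weight r w - 1 = (LINT s:{0..r}|lborel. weight s w * ext \<alpha> (\<xi> (max 0 s) w))"
  using exp_integral_identity[OF alpha_path[OF w] ext_alpha_bound r Gm] by (simp add: weight_def potential_eq)
 also have "... = (LINT s:{0..r}|lborel. weight s w * ext \<alpha> (\<xi> s w))"
  unfolding set_lebesgue_integral_def
  by (rule integral_cong) (auto simp: indicator_def)
 finally show ?thesis .
qed

text \<open>
 Variation of constants: expanding \<open>u\<close> inside \<open>E[\<integral> e(s) \<alpha>(\<xi>\<^sub>s) u(\<xi>\<^sub>s, t - s) ds]\<close> by the Markov property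
 and using \<open>e(r) - 1 = \<integral>\<^sub>0\<^sup>r e(s) \<alpha>(\<xi>\<^sub>s) ds\<close>, that quantity cancels from both sides.
\<close>

lemma variation_of_constants:
 fixes u k :: "'b => real => real" and f :: "'b => real"
 assumes t: "0 <= t" and f[measurable]: "f \<in> borel_measurable borel" and fb: "!!y. \<bar>f y\<bar> <= C"
  and u: "(%z. u (fst z) (snd z)) \<in> borel_measurable (borel \<Otimes>\<^sub>M borel)" and ub: "!!y r. \<bar>u y r\<bar> <= C"
  and k: "(%z. k (fst z) (snd z)) \<in> borel_measurable (borel \<Otimes>\<^sub>M borel)" and kb: "!!y r. \<bar>k y r\<bar> <= C"
  and eq: "!!y r. 0 <= r ==> r <= t ==> u y r = (LINT w|Q (Some y). ext f (\<xi> r w)) +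
    (LINT w|Q (Some y). (LINT s:{0..r}|lborel. ext (%y. \<alpha> y * u y (r - s) + k y (r - s)) (\<xi> s w)))"
 shows "u x t = (LINT w|Q (Some x). weight t w * ext f (\<xi> t w)) +
   (LINT r:{0..t}|lborel. (LINT w|Q (Some x). weight r w * ext (%y. k y (t - r)) (\<xi> r w)))"
proof -
 define M where "M = Q (Some x)"
 interpret prob_space M unfolding M_def by (rule prob_Q)
 have sM: "space M = \<Omega>" by (simp add: M_def space_Q)
 have C0: "0 <= C" using fb[of x] by simp
 define H where "H y r = \<alpha> y * u y r + k y r" for y r
 define B where "B = K * C + C"
 have B0: "0 <= B" using K_nonneg C0 by (simp add: B_def)
 have Hb: "\<bar>H y r\<bar> <= B" for y r
 proof -
  have "\<bar>\<alpha> y * u y r\<bar> <= K * C" unfolding abs_mult using alpha_bound ub K_nonneg by (intro mult_mono) auto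
  then show ?thesis unfolding H_def B_def using kb[of y r] by linarith
 qed
 have H: "(%z. H (fst z) (snd z)) \<in> borel_measurable (borel \<Otimes>\<^sub>M borel)"
  unfolding H_def using u k alpha_measurable by measurable
 \<comment> \<open>Clamping makes all integrands jointly measurable and bounded on the whole time
   axis; on \<open>[0, t]\<close>, where they are integrated, it is the identity.\<close>
 define cl where "cl s = min t (max 0 s)" for s :: real
 have cl: "0 <= cl s" "cl s <= t" "max 0 (cl s) = cl s" "0 <= s ==> s <= t ==> cl s = s" for s
  using t by (auto simp: cl_def)
 have [measurable]: "cl \<in> borel_measurable borel" unfolding cl_def[abs_def] by measurable
 have pathm[measurable]: "(%j. \<xi> (cl (fst j)) (snd j)) \<in> borel \<Otimes>\<^sub>M Q z \<rightarrow>\<^sub>M borel_on opc" for z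
  using measurable_compose[OF _ xi_joint, of "%j. (cl (fst j), snd j)" "borel \<Otimes>\<^sub>M Q z" z] by (simp add: cl(3))
 have wm[measurable]: "(%j. weight (cl (fst j)) (snd j)) \<in> borel_measurable (borel \<Otimes>\<^sub>M Q z)" for z
  using measurable_compose[OF _ weight_joint, of "%j. (cl (fst j), snd j)" "borel \<Otimes>\<^sub>M Q z" z] by (simp add: cl(3))
 have pathext: "(%j. ext (%y. h y (r - cl (fst j))) (\<xi> (cl (fst j)) (snd j))) \<in> borel_measurable (borel \<Otimes>\<^sub>M Q z)"
  if h: "(%z. h (fst z) (snd z)) \<in> borel_measurable (borel \<Otimes>\<^sub>M borel)" for h :: "'b => real => real" and z and r :: real
  using measurable_compose[OF _ borel_measurable_ext_pair[OF h], of "%j. (\<xi> (cl (fst j)) (snd j), r - cl (fst j))" "borel \<Otimes>\<^sub>M Q z"]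
  unfolding fst_conv snd_conv by simp
 define wB where "wB = exp (K * t)"
 have wB0: "0 <= wB" "1 <= wB" using K_nonneg t by (auto simp: wB_def)
 have wb: "\<bar>weight (cl s) w\<bar> <= wB" if "w \<in> \<Omega>" for s w
 proof -
  have "weight (cl s) w <= exp (K * cl s)" by (rule weight_bound(2)[OF that cl(1)])
  also have "... <= wB" unfolding wB_def using K_nonneg cl(2)[of s] by (simp add: mult_left_mono)
  finally show ?thesis using weight_pos[of "cl s" w] by simp
 qed
 have extb: "\<bar>ext h z\<bar> <= D" if "!!y. \<bar>h y\<bar> <= D" for h :: "'b => real" and z D
 proof -
  have "0 <= D" using that[of undefined] by linarith
  then show ?thesis using that by (cases z) auto
 qed
 define Y where "Y s w = weight s w * ext \<alpha> (\<xi> s w)" for s w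
 have Yb: "\<bar>Y (cl s) w\<bar> <= wB * K" if "w \<in> \<Omega>" for s w
  unfolding Y_def abs_mult using wb[OF that] ext_alpha_bound wB0 by (intro mult_mono) auto
 have YF: "Y s \<in> borel_measurable (F (ennreal s))" if "0 <= s" for s
  unfolding Y_def[abs_def]
  using weight_measurable_F[OF that] measurable_compose[OF adapted[OF that] measurable_ext[OF alpha_measurable]] by measurable
 have Ym[measurable]: "(%j. Y (cl (fst j)) (snd j)) \<in> borel_measurable (borel \<Otimes>\<^sub>M Q z)" for z
  unfolding Y_def using measurable_compose[OF pathm measurable_ext[OF alpha_measurable]] by measurable
 have bint: "integrable M g" if "g \<in> borel_measurable M" "!!w. w \<in> \<Omega> ==> \<bar>g w\<bar> <= D" for g :: "'a => real" and D
  by (rule integrable_const_bound[where B=D]) (use that in \<open>auto simp: sM\<close>)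
 have xim[measurable]: "\<xi> s \<in> M \<rightarrow>\<^sub>M borel_on opc" if "0 <= s" for s
  unfolding M_def by (rule xi_measurable[OF that])
 have sec: "(%y. h y r) \<in> borel_measurable borel" if "(%z. h (fst z) (snd z)) \<in> borel_measurable (borel \<Otimes>\<^sub>M borel)" for h :: "'b => real => real" and r
  using measurable_compose[OF _ that, of "%y. (y, r)" borel] by simp

 \<comment> \<open>The equation for \<open>u\<close> with remaining time \<open>t - s\<close>, read
   from the position at time \<open>s\<close> and multiplied by the past functional
   \<open>Y s\<close>, turns by the Markov property into an identity along the original
   path.\<close>
 have step: "expectation (%w. Y s w * ext (%y. u y (t - s)) (\<xi> s w)) =
   expectation (%w. Y s w * ext f (\<xi> t w)) +
   (LINT v:{0..t - s}|lborel. expectation (%w. Y s w * ext (%y. H y (t - s - v)) (\<xi> (s + v) w)))"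
  if s: "0 <= s" "s <= t" for s
 proof -
  have ts: "0 <= t - s" "t - s <= t" using s by auto
  have cls: "cl s = s" using cl(4) s by auto
  \<comment> \<open>The mean of the source term a time \<open>v\<close> later, as a function of the
    present position \<open>z\<close>.\<close>
  define \<Phi> where "\<Phi> v z = (LINT y|transition (cl v) z. ext (%y. H y (t - s - cl v)) y)" for v z
  have prT: "prob_space (transition (cl v) z)" for v z
   unfolding transition_def using prob_space.prob_space_distr[OF prob_Q xi_measurable[OF cl(1)]] .
  have \<Phi>m[measurable]: "(%j. \<Phi> (fst j) (snd j)) \<in> borel_measurable (borel \<Otimes>\<^sub>M borel_on opc)"
  proof -
   have tr: "(%j. transition (cl (fst j)) (snd j)) \<in> borel \<Otimes>\<^sub>M borel_on opc \<rightarrow>\<^sub>M subprob_algebra (borel_on opc)"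
    using measurable_compose[OF _ transition_joint, of "%j. (cl (fst j), snd j)" "borel \<Otimes>\<^sub>M borel_on opc"] by (simp add: cl(3))
   have "(%z. ext (%y. H y (t - s - cl (fst (fst z)))) (snd z)) \<in> borel_measurable ((borel \<Otimes>\<^sub>M borel_on (opc :: 'b option topology)) \<Otimes>\<^sub>M borel_on opc)"
    using measurable_compose[OF _ borel_measurable_ext_pair[OF H], of "%z. (snd z, t - s - cl (fst (fst z)))" "(borel \<Otimes>\<^sub>M borel_on (opc :: 'b option topology)) \<Otimes>\<^sub>M borel_on opc"]
    unfolding fst_conv snd_conv by simp
   then have "(%j. integral\<^sup>N (transition (cl (fst j)) (snd j)) (%z. ennreal (ext (%y. H y (t - s - cl (fst j))) z + B))) \<in> borel_measurable (borel \<Otimes>\<^sub>M borel_on opc)"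
    by (intro nn_integral_measurable_subprob_algebra2[OF _ tr]) (simp add: case_prod_beta)
   then have "(%j. enn2real (integral\<^sup>N (transition (cl (fst j)) (snd j)) (%z. ennreal (ext (%y. H y (t - s - cl (fst j))) z + B))) - B) \<in> borel_measurable (borel \<Otimes>\<^sub>M borel_on opc)"
    by simp
   moreover have "\<Phi> v z = enn2real (integral\<^sup>N (transition (cl v) z) (%z. ennreal (ext (%y. H y (t - s - cl v)) z + B))) - B" for v z
    unfolding \<Phi>_def
    by (rule prob_space.integral_shift_nonneg[OF prT])
     (auto simp: transition_def intro!: measurable_ext sec[OF H] extb Hb)
   ultimately show ?thesis by simp
  qed
  have \<Phi>b: "\<bar>\<Phi> v z\<bar> <= B" for v z
   unfolding \<Phi>_def by (rule prob_space.bounded_integral_le[OF prT]) (use extb[OF Hb] B0 in auto)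
  have tT: "0 <= t - s" using s by simp
  have fT: "\<bar>(LINT y|transition (t - s) z. ext f y)\<bar> <= C" for z
   using prob_space.bounded_integral_le[OF prT[of "t - s" z], of "ext f" C] extb[OF fb] C0 cl(4)[of "t - s"] ts by simp
  have pt: "Y s w * ext (%y. u y (t - s)) (\<xi> s w) =
    Y s w * (LINT y|transition (t - s) (\<xi> s w). ext f y) + (LINT v:{0..t - s}|lborel. Y s w * \<Phi> v (\<xi> s w))" for w
  proof (cases "\<xi> s w")
   case None
   then show ?thesis by (simp add: Y_def set_lebesgue_integral_def)
  next
   case (Some y)
   interpret Qy: prob_space "Q (Some y)" by (rule prob_Q)
   have "(LINT w|Q (Some y). (LINT v:{0..t - s}|lborel. ext (%y. H y (t - s - v)) (\<xi> v w))) =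
     (LINT w|Q (Some y). (LINT v:{0..t - s}|lborel. ext (%y. H y (t - s - cl v)) (\<xi> (cl v) w)))"
    unfolding set_lebesgue_integral_def using s
    by (intro integral_cong refl) (auto simp: indicator_def cl(4) cong: option.case_cong)
   also have "... = (LINT v:{0..t - s}|lborel. LINT w|Q (Some y). ext (%y. H y (t - s - cl v)) (\<xi> (cl v) w))"
    by (rule Qy.fubini_interval(1)[OF pathext[OF H] extb[OF Hb]])
   also have "... = (LINT v:{0..t - s}|lborel. \<Phi> v (Some y))"
    unfolding \<Phi>_def transition_def
    by (subst integral_distr[OF xi_measurable[OF cl(1)]]) (auto intro!: measurable_ext sec[OF H])
   finally have "u y (t - s) = (LINT y|transition (t - s) (Some y). ext f y) + (LINT v:{0..t - s}|lborel. \<Phi> v (Some y))"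
    using eq[OF ts, of y] unfolding transition_def H_def
    by (subst integral_distr[OF xi_measurable[OF tT]]) (auto intro!: measurable_ext)
   then show ?thesis using Some
    by (simp add: distrib_left set_lebesgue_integral_def mult.left_commute[of "Y s w"])
  qed
  have YsM[measurable]: "Y s \<in> borel_measurable M" unfolding M_def by (rule measurable_F_Q[OF YF[OF s(1)]])
  have Ysb: "\<bar>Y s w\<bar> <= wB * K" if "w \<in> \<Omega>" for w using Yb[OF that, of s] cls by simp
  have xis[measurable]: "\<xi> s \<in> M \<rightarrow>\<^sub>M borel_on opc" by (rule xim[OF s(1)])
  have fTm[measurable]: "(%z. LINT y|transition (t - s) z. ext f y) \<in> borel_measurable (borel_on opc)"
   by (rule measurable_compose[OF transition_measurable[OF tT] integral_measurable_subprob_algebra[OF measurable_ext[OF f]]])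
  have Y\<Phi>: "(%j. Y s (snd j) * \<Phi> (fst j) (\<xi> s (snd j))) \<in> borel_measurable (borel \<Otimes>\<^sub>M M)"
   using measurable_compose[OF _ \<Phi>m, of "%j. (fst j, \<xi> s (snd j))" "borel \<Otimes>\<^sub>M M"] by simp
  have Y\<Phi>b: "\<bar>Y s w * \<Phi> v (\<xi> s w)\<bar> <= wB * K * B" if "w \<in> space M" for v w
   unfolding abs_mult using Ysb \<Phi>b that wB0 K_nonneg by (intro mult_mono) (auto simp: sM)
  have i1: "integrable M (%w. Y s w * (LINT y|transition (t - s) (\<xi> s w). ext f y))"
  proof (rule bint)
   show "\<bar>Y s w * (LINT y|transition (t - s) (\<xi> s w). ext f y)\<bar> <= (wB * K) * C" if "w \<in> \<Omega>" for w
    unfolding abs_mult using Ysb[OF that] fT wB0 K_nonneg by (intro mult_mono) auto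
  qed measurable
  have i2: "integrable M (%w. LINT v:{0..t - s}|lborel. Y s w * \<Phi> v (\<xi> s w))"
  proof (rule bint)
   show "(%w. LINT v:{0..t - s}|lborel. Y s w * \<Phi> v (\<xi> s w)) \<in> borel_measurable M"
    by (rule fubini_interval(2)[OF Y\<Phi> Y\<Phi>b])
   show "\<bar>LINT v:{0..t - s}|lborel. Y s w * \<Phi> v (\<xi> s w)\<bar> <= wB * K * B * (t - s - 0)" if "w \<in> \<Omega>" for w
   proof (rule set_integral_bound_interval)
    show "(%v. Y s w * \<Phi> v (\<xi> s w)) \<in> borel_measurable borel"
     using measurable_compose[OF _ Y\<Phi>, of "%v. (v, w)" borel] that by (simp add: sM)
   qed (use Y\<Phi>b that s sM in auto)
  qed
  have "expectation (%w. Y s w * ext (%y. u y (t - s)) (\<xi> s w)) =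
    expectation (%w. Y s w * (LINT y|transition (t - s) (\<xi> s w). ext f y)) +
    expectation (%w. LINT v:{0..t - s}|lborel. Y s w * \<Phi> v (\<xi> s w))"
   unfolding pt using i1 i2 by simp
  also have "expectation (%w. Y s w * (LINT y|transition (t - s) (\<xi> s w). ext f y)) = expectation (%w. Y s w * ext f (\<xi> t w))"
   using markov_integral[OF s(1) tT YF[OF s(1)] Ysb measurable_ext[OF f] extb[OF fb], of "Some x"] by (simp add: M_def)
  also have "expectation (%w. LINT v:{0..t - s}|lborel. Y s w * \<Phi> v (\<xi> s w)) =
    (LINT v:{0..t - s}|lborel. expectation (%w. Y s w * \<Phi> v (\<xi> s w)))"
   by (rule fubini_interval(1)[OF Y\<Phi> Y\<Phi>b])
  also have "... = (LINT v:{0..t - s}|lborel. expectation (%w. Y s w * ext (%y. H y (t - s - v)) (\<xi> (s + v) w)))"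
   unfolding set_lebesgue_integral_def
  proof (intro integral_cong refl)
   fix v
   show "indicator {0..t - s} v *\<^sub>R expectation (%w. Y s w * \<Phi> v (\<xi> s w)) =
     indicator {0..t - s} v *\<^sub>R expectation (%w. Y s w * ext (%y. H y (t - s - v)) (\<xi> (s + v) w))"
   proof (cases "v \<in> {0..t - s}")
    case True
    then have v: "0 <= v" "cl v = v" using s cl(4) by auto
    then have Hv: "(%y. H y (t - s - cl v)) = (%y. H y (t - s - v))" by simp
    show ?thesis
     using markov_integral[OF s(1) v(1) YF[OF s(1)] Ysb measurable_ext[OF sec[OF H, of "t - s - v"]] extb[OF Hb], of "Some x"]
     by (simp only: M_def \<Phi>_def Hv v(2))
   qed simp
  qed
  finally show ?thesis .
 qed

 let ?E = "%(h :: 'b => real => real) r w. ext (%y. h y (t - cl r)) (\<xi> (cl r) w)"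
 define GG where "GG s r = expectation (%w. Y (cl s) w * ?E H r w)" for s r
 have prodm: "(%z. Y (cl (fst (fst z))) (snd z) * ext (%y. H y (t - cl (snd (fst z)))) (\<xi> (cl (snd (fst z))) (snd z)))
   \<in> borel_measurable ((borel \<Otimes>\<^sub>M borel) \<Otimes>\<^sub>M M)"
 proof -
  have 1: "(%z. Y (cl (fst (fst z))) (snd z)) \<in> borel_measurable ((borel \<Otimes>\<^sub>M (borel :: real measure)) \<Otimes>\<^sub>M M)"
   using measurable_compose[OF _ Ym[of "Some x"], of "%z. (fst (fst z), snd z)" "(borel \<Otimes>\<^sub>M (borel :: real measure)) \<Otimes>\<^sub>M M"]
   by (simp add: M_def)
  have 2: "(%z. ext (%y. H y (t - cl (snd (fst z)))) (\<xi> (cl (snd (fst z))) (snd z))) \<in> borel_measurable (((borel :: real measure) \<Otimes>\<^sub>M borel) \<Otimes>\<^sub>M M)"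
   using measurable_compose[OF _ pathext[OF H, of t "Some x"], of "%z. (snd (fst z), snd z)" "((borel :: real measure) \<Otimes>\<^sub>M borel) \<Otimes>\<^sub>M M"]
   unfolding fst_conv snd_conv by (simp add: M_def)
  show ?thesis by (rule borel_measurable_times[OF 1 2])
 qed
 have YHb: "\<bar>Y (cl s) w * ?E H r w\<bar> <= wB * K * B" if "w \<in> space M" for s r w
  unfolding abs_mult using Yb extb[OF Hb] that wB0 K_nonneg by (intro mult_mono) (auto simp: sM)
 have GGm: "(%z. GG (fst z) (snd z)) \<in> borel_measurable (borel \<Otimes>\<^sub>M borel)"
  unfolding GG_def using prodm by (intro borel_measurable_lebesgue_integral) (simp add: case_prod_beta)
 have GGb: "\<bar>GG s r\<bar> <= wB * K * B" for s r
  unfolding GG_def using wB0 K_nonneg B0 by (intro bounded_integral_le YHb) auto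
 have wk: "(%j. weight (cl (fst j)) (snd j) * ext (%y. h y (t - cl (fst j))) (\<xi> (cl (fst j)) (snd j))) \<in> borel_measurable (borel \<Otimes>\<^sub>M M)"
  if "(%z. h (fst z) (snd z)) \<in> borel_measurable (borel \<Otimes>\<^sub>M borel)" for h :: "'b => real => real"
  unfolding M_def by (intro borel_measurable_times wm pathext that)
 have wkb: "\<bar>weight (cl s) w * ext (%y. h y (t - cl s)) (\<xi> (cl s) w)\<bar> <= wB * D"
  if "!!y r. \<bar>h y r\<bar> <= D" "w \<in> space M" for h :: "'b => real => real" and D s w
  unfolding abs_mult using wb extb[of "%y. h y (t - cl s)" D] that wB0 by (intro mult_mono) (auto simp: sM)

 \<comment> \<open>The part of \<open>H\<close> that contains \<open>u\<close>; its weighted time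
   integral \<open>I\<close> is the quantity that will cancel.\<close>
 define au where "au y r = \<alpha> y * u y r" for y r
 have aum: "(%z. au (fst z) (snd z)) \<in> borel_measurable (borel \<Otimes>\<^sub>M borel)"
  unfolding au_def using u alpha_measurable by measurable
 have aub: "\<bar>au y r\<bar> <= K * C" for y r
  unfolding au_def abs_mult using alpha_bound ub K_nonneg by (intro mult_mono) auto
 define I where "I = (LINT s:{0..t}|lborel. expectation (%w. weight (cl s) w * ext (%y. au y (t - cl s)) (\<xi> (cl s) w)))"
 have iE: "set_integrable lborel {0..t} (%s. expectation (%w. weight (cl s) w * ext (%y. h y (t - cl s)) (\<xi> (cl s) w)))"
  if "(%z. h (fst z) (snd z)) \<in> borel_measurable (borel \<Otimes>\<^sub>M borel)" "!!y r. \<bar>h y r\<bar> <= D" "0 <= D" for h :: "'b => real => real" and D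
 proof (rule set_integrable_bounded_interval)
  show "(%s. expectation (%w. weight (cl s) w * ext (%y. h y (t - cl s)) (\<xi> (cl s) w))) \<in> borel_measurable borel"
   by (rule fubini_interval(3)[OF wk[OF that(1)] wkb[of h D, OF that(2)]])
  show "\<bar>expectation (%w. weight (cl s) w * ext (%y. h y (t - cl s)) (\<xi> (cl s) w))\<bar> <= wB * D" for s
   using wkb[of h D, OF that(2)] wB0 that(3) by (intro bounded_integral_le) auto
 qed
 have Hpath: "(%j. ext (%y. H y (t - cl (fst j))) (\<xi> (cl (fst j)) (snd j))) \<in> borel_measurable (borel \<Otimes>\<^sub>M M)"
  unfolding M_def by (rule pathext[OF H])

 have "I = (LINT s:{0..t}|lborel. expectation (%w. Y (cl s) w * ext f (\<xi> t w)) + (LINT v:{0..t - s}|lborel. GG s (s + v)))"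
  unfolding I_def set_lebesgue_integral_def[of _ "{0..t}"]
 proof (intro integral_cong refl)
  fix s
  show "indicator {0..t} s *\<^sub>R expectation (%w. weight (cl s) w * ext (%y. au y (t - cl s)) (\<xi> (cl s) w)) =
    indicator {0..t} s *\<^sub>R (expectation (%w. Y (cl s) w * ext f (\<xi> t w)) + (LINT v:{0..t - s}|lborel. GG s (s + v)))"
  proof (cases "s \<in> {0..t}")
   case True
   then have s: "0 <= s" "s <= t" and cls: "cl s = s" using cl(4) by auto
   have "weight s w * ext (%y. au y (t - s)) (\<xi> s w) = Y s w * ext (%y. u y (t - s)) (\<xi> s w)" for w
    unfolding Y_def au_def by (cases "\<xi> s w") auto
   moreover have "(LINT v:{0..t - s}|lborel. GG s (s + v)) =
     (LINT v:{0..t - s}|lborel. expectation (%w. Y s w * ext (%y. H y (t - s - v)) (\<xi> (s + v) w)))"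
    unfolding set_lebesgue_integral_def
   proof (intro integral_cong refl)
    fix v
    show "indicator {0..t - s} v *\<^sub>R GG s (s + v) =
      indicator {0..t - s} v *\<^sub>R expectation (%w. Y s w * ext (%y. H y (t - s - v)) (\<xi> (s + v) w))"
    proof (cases "v \<in> {0..t - s}")
     case True
     then have clv: "cl (s + v) = s + v" using s by (intro cl(4)) auto
     show ?thesis unfolding GG_def cls clv diff_diff_eq ..
    qed simp
   qed
   ultimately show ?thesis using step[OF s] unfolding cls by simp
  qed simp
 qed
 also have "... = (LINT s:{0..t}|lborel. expectation (%w. Y (cl s) w * ext f (\<xi> t w))) + (LINT s:{0..t}|lborel. (LINT v:{0..t - s}|lborel. GG s (s + v)))"
 proof (rule set_integral_add)
  have m: "(%j. Y (cl (fst j)) (snd j) * ext f (\<xi> t (snd j))) \<in> borel_measurable (borel \<Otimes>\<^sub>M M)"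
   using Ym[of "Some x"] measurable_compose[OF xim[OF t] measurable_ext[OF f]] unfolding M_def[symmetric] by measurable
  have b: "\<bar>Y (cl s) w * ext f (\<xi> t w)\<bar> <= wB * K * C" if "w \<in> space M" for s w
   unfolding abs_mult using Yb extb[OF fb] that wB0 K_nonneg by (intro mult_mono) (auto simp: sM)
  show "set_integrable lborel {0..t} (%s. expectation (%w. Y (cl s) w * ext f (\<xi> t w)))"
  proof (rule set_integrable_bounded_interval[OF fubini_interval(3)[OF m b]])
   show "\<bar>expectation (%w. Y (cl s) w * ext f (\<xi> t w))\<bar> <= wB * K * C" for s
    using b wB0 K_nonneg C0 by (intro bounded_integral_le) auto
  qed
  have m2: "(%s. LINT v:{0..t - s}|lborel. GG s (s + v)) \<in> borel_measurable borel"
  proof -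
   have [measurable]: "(%z. GG (fst z) (fst z + snd z)) \<in> borel_measurable (borel \<Otimes>\<^sub>M borel)"
    using measurable_compose[OF _ GGm, of "%z. (fst z, fst z + snd z)" "borel \<Otimes>\<^sub>M borel"] by simp
   have [measurable]: "Measurable.pred (borel \<Otimes>\<^sub>M borel) (%z :: real \<times> real. snd z \<in> {0..t - fst z})"
    unfolding atLeastAtMost_iff by measurable
   have "(%z. indicator {0..t - fst z} (snd z) *\<^sub>R GG (fst z) (fst z + snd z)) \<in> borel_measurable (borel \<Otimes>\<^sub>M lborel)"
    by measurable
   then show ?thesis unfolding set_lebesgue_integral_def
    by (intro lborel.borel_measurable_lebesgue_integral) (simp add: case_prod_beta)
  qed
  have "\<bar>LINT v:{0..t - s}|lborel. GG s (s + v)\<bar> <= wB * K * B * t" if "0 <= s" "s <= t" for s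
  proof -
   have "\<bar>LINT v:{0..t - s}|lborel. GG s (s + v)\<bar> <= wB * K * B * (t - s - 0)"
    using GGb that measurable_compose[OF _ GGm, of "%v. (s, s + v)" borel] by (intro set_integral_bound_interval) auto
   also have "... <= wB * K * B * t" using that wB0 K_nonneg B0 by (intro mult_left_mono) auto
   finally show ?thesis .
  qed
  then have b2: "\<bar>indicator {0..t} s * (LINT v:{0..t - s}|lborel. GG s (s + v))\<bar> <= wB * K * B * t" for s
   using wB0 K_nonneg B0 t by (auto simp: indicator_def)
  have "set_integrable lborel {0..t} (%s. indicator {0..t} s * (LINT v:{0..t - s}|lborel. GG s (s + v)))"
   using m2 b2 by (intro set_integrable_bounded_interval) auto
  then show "set_integrable lborel {0..t} (%s. LINT v:{0..t - s}|lborel. GG s (s + v))"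
   by (simp add: set_integrable_def mult.assoc[symmetric] indicator_inter_arith[symmetric])
 qed
 also have "(LINT s:{0..t}|lborel. expectation (%w. Y (cl s) w * ext f (\<xi> t w))) =
   expectation (%w. LINT s:{0..t}|lborel. Y (cl s) w * ext f (\<xi> t w))"
 proof (rule fubini_interval(1)[symmetric])
  show "(%j. Y (cl (fst j)) (snd j) * ext f (\<xi> t (snd j))) \<in> borel_measurable (borel \<Otimes>\<^sub>M M)"
   using Ym[of "Some x"] measurable_compose[OF xim[OF t] measurable_ext[OF f]] unfolding M_def[symmetric] by measurable
  show "\<bar>Y (cl s) w * ext f (\<xi> t w)\<bar> <= wB * K * C" if "w \<in> space M" for s w
   unfolding abs_mult using Yb extb[OF fb] that wB0 K_nonneg by (intro mult_mono) (auto simp: sM)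
 qed
 also have "... = expectation (%w. weight t w * ext f (\<xi> t w) - ext f (\<xi> t w))"
 proof (intro integral_cong refl)
  fix w assume "w \<in> space M"
  then have "(weight t w - 1) = (LINT s:{0..t}|lborel. Y s w)"
   using weight_identity[OF _ t] by (simp add: sM Y_def)
  also have "... = (LINT s:{0..t}|lborel. Y (cl s) w)"
   unfolding set_lebesgue_integral_def
   by (rule integral_cong) (auto simp: indicator_def cl(4) cong: option.case_cong)
  finally show "(LINT s:{0..t}|lborel. Y (cl s) w * ext f (\<xi> t w)) = weight t w * ext f (\<xi> t w) - ext f (\<xi> t w)"
   by (simp add: algebra_simps)
 qed
 also have "... = expectation (%w. weight t w * ext f (\<xi> t w)) - expectation (%w. ext f (\<xi> t w))"
 proof (rule Bochner_Integration.integral_diff)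
  have fm: "(%w. ext f (\<xi> t w)) \<in> borel_measurable M" by (rule measurable_compose[OF xim[OF t] measurable_ext[OF f]])
  show "integrable M (%w. ext f (\<xi> t w))" by (rule bint[OF fm extb[OF fb]])
  show "integrable M (%w. weight t w * ext f (\<xi> t w))"
  proof (rule bint)
   show "(%w. weight t w * ext f (\<xi> t w)) \<in> borel_measurable M"
    using weight_measurable[OF t, of "Some x"] fm unfolding M_def by measurable
   show "\<bar>weight t w * ext f (\<xi> t w)\<bar> <= wB * C" if "w \<in> \<Omega>" for w
    unfolding abs_mult using wb[OF that, of t] cl(4)[OF t order_refl] extb[OF fb] wB0 by (intro mult_mono) auto
  qed
 qed
 also have "(LINT s:{0..t}|lborel. (LINT v:{0..t - s}|lborel. GG s (s + v))) = (LINT r:{0..t}|lborel. (LINT s:{0..r}|lborel. GG s r))"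
  by (rule triangle_fubini[OF GGm GGb])
 also have "... = (LINT r:{0..t}|lborel. expectation (%w. weight (cl r) w * ?E H r w)
   - expectation (%w. ?E H r w))"
  unfolding set_lebesgue_integral_def[of _ "{0..t}"]
 proof (intro integral_cong refl)
  fix r
  show "indicator {0..t} r *\<^sub>R (LINT s:{0..r}|lborel. GG s r) =
   indicator {0..t} r *\<^sub>R (expectation (%w. weight (cl r) w * ?E H r w)
    - expectation (%w. ?E H r w))"
  proof (cases "r \<in> {0..t}")
   case True
   then have r: "0 <= r" "r <= t" "cl r = r" using cl(4) by auto
   have HM: "(%w. ?E H r w) \<in> borel_measurable M"
    by (rule measurable_compose[OF xim[OF cl(1)] measurable_ext[OF sec[OF H]]])
   have "(LINT s:{0..r}|lborel. GG s r) = expectation (%w. LINT s:{0..r}|lborel. Y (cl s) w * ?E H r w)"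
    unfolding GG_def
   proof (rule fubini_interval(1)[symmetric])
    show "(%j. Y (cl (fst j)) (snd j) * ext (%y. H y (t - cl r)) (\<xi> (cl r) (snd j))) \<in> borel_measurable (borel \<Otimes>\<^sub>M M)"
     using Ym[of "Some x"] HM unfolding M_def[symmetric] by measurable
   qed (rule YHb)
   also have "... = expectation (%w. weight (cl r) w * ?E H r w - ?E H r w)"
   proof (intro integral_cong refl)
    fix w assume "w \<in> space M"
    then have "(weight r w - 1) = (LINT s:{0..r}|lborel. Y s w)"
     using weight_identity[OF _ r(1)] by (simp add: sM Y_def)
    also have "... = (LINT s:{0..r}|lborel. Y (cl s) w)"
     unfolding set_lebesgue_integral_def using r
     by (intro integral_cong refl) (auto simp: indicator_def cl(4) cong: option.case_cong)
    finally show "(LINT s:{0..r}|lborel. Y (cl s) w * ?E H r w) =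
      weight (cl r) w * ?E H r w - ?E H r w"
     using r(3) by (simp add: algebra_simps)
   qed
   also have "... = expectation (%w. weight (cl r) w * ?E H r w)
    - expectation (%w. ?E H r w)"
   proof (rule Bochner_Integration.integral_diff)
    show "integrable M (%w. ?E H r w)" by (rule bint[OF HM extb[OF Hb]])
    show "integrable M (%w. weight (cl r) w * ?E H r w)"
    proof (rule bint)
     show "(%w. weight (cl r) w * ?E H r w) \<in> borel_measurable M"
      using weight_measurable[OF cl(1), of r "Some x"] HM unfolding M_def by measurable
    qed (use wkb[of H B, OF Hb] sM in auto)
   qed
   finally show ?thesis by simp
  qed simp
 qed
 also have "... = (LINT r:{0..t}|lborel. expectation (%w. weight (cl r) w * ?E H r w))
   - (LINT r:{0..t}|lborel. expectation (%w. ?E H r w))"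
 proof (rule set_integral_diff(2)[OF iE[OF H Hb B0]])
  show "set_integrable lborel {0..t} (%r. expectation (%w. ?E H r w))"
  proof (rule set_integrable_bounded_interval[OF fubini_interval(3)[OF Hpath extb[OF Hb]]])
   show "\<bar>expectation (%w. ?E H r w)\<bar> <= B" for r
    using extb[OF Hb] B0 by (intro bounded_integral_le) auto
  qed
 qed
 also have "(LINT r:{0..t}|lborel. expectation (%w. ?E H r w)) =
   u x t - expectation (%w. ext f (\<xi> t w))"
 proof -
  have "(LINT r:{0..t}|lborel. expectation (%w. ?E H r w)) =
    expectation (%w. LINT r:{0..t}|lborel. ?E H r w)"
   by (rule fubini_interval(1)[symmetric, OF Hpath extb[OF Hb]])
  also have "... = expectation (%w. LINT s:{0..t}|lborel. ext (%y. \<alpha> y * u y (t - s) + k y (t - s)) (\<xi> s w))"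
   unfolding set_lebesgue_integral_def H_def
   by (intro integral_cong refl) (auto simp: indicator_def cl(4) cong: option.case_cong)
  finally show ?thesis using eq[OF t order_refl, of x] by (simp add: M_def)
 qed
 also have "(LINT r:{0..t}|lborel. expectation (%w. weight (cl r) w * ?E H r w)) =
   I + (LINT r:{0..t}|lborel. expectation (%w. weight (cl r) w * ?E k r w))"
 proof -
  have "expectation (%w. weight (cl r) w * ?E H r w) =
    expectation (%w. weight (cl r) w * ?E au r w) +
    expectation (%w. weight (cl r) w * ?E k r w)" for r
  proof -
   have "integrable M (%w. weight (cl r) w * ext (%y. h y (t - cl r)) (\<xi> (cl r) w))"
    if "(%z. h (fst z) (snd z)) \<in> borel_measurable (borel \<Otimes>\<^sub>M borel)" "!!y r. \<bar>h y r\<bar> <= D" for h :: "'b => real => real" and D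
   proof (rule bint)
    show "(%w. weight (cl r) w * ext (%y. h y (t - cl r)) (\<xi> (cl r) w)) \<in> borel_measurable M"
     using weight_measurable[OF cl(1), of r "Some x"] measurable_compose[OF xim[OF cl(1)] measurable_ext[OF sec[OF that(1)]]]
     unfolding M_def by measurable
   qed (use wkb[of h D, OF that(2)] sM in auto)
   from this[OF aum aub] this[OF k kb]
   have "expectation (%w. weight (cl r) w * ?E au r w + weight (cl r) w * ?E k r w) =
     expectation (%w. weight (cl r) w * ?E au r w) +
     expectation (%w. weight (cl r) w * ?E k r w)"
    by simp
   moreover have "weight (cl r) w * ?E H r w =
    weight (cl r) w * ?E au r w + weight (cl r) w * ?E k r w" for w
    by (cases "\<xi> (cl r) w") (auto simp: H_def au_def distrib_left)
   ultimately show ?thesis by simp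
  qed
  then show ?thesis unfolding I_def
   using set_integral_add(2)[OF iE[OF aum aub] iE[OF k kb C0]] K_nonneg C0 by simp
 qed
 finally have "u x t = expectation (%w. weight t w * ext f (\<xi> t w)) +
   (LINT r:{0..t}|lborel. expectation (%w. weight (cl r) w * ?E k r w))"
  by linarith
 also have "(LINT r:{0..t}|lborel. expectation (%w. weight (cl r) w * ?E k r w)) =
   (LINT r:{0..t}|lborel. expectation (%w. weight r w * ext (%y. k y (t - r)) (\<xi> r w)))"
  unfolding set_lebesgue_integral_def
  by (intro integral_cong refl) (auto simp: indicator_def cl(4) cong: option.case_cong)
 finally show ?thesis by (simp add: M_def)
qed

end

section \<open>The normalized mean semigroup\<close>

text \<open>There are \<open>t / h\<close> steps of size \<open>o(h)\<close>. This suits semigroups,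
  where the generator gives information only at time zero and the semigroup law transports it to
  every step.\<close>

lemma telescoping_zero:
 fixes \<Phi> :: "real => real"
 assumes t: "0 < t" and \<delta>: "((%h. \<delta> h / h) \<longlongrightarrow> 0) (at_right 0)"
  and step: "!!h j. 0 < h ==> real (Suc j) * h <= t ==> \<bar>\<Phi> (real (Suc j) * h) - \<Phi> (real j * h)\<bar> <= \<delta> h"
 shows "\<Phi> t = \<Phi> 0"
proof -
 have le: "\<bar>\<Phi> t - \<Phi> 0\<bar> <= t * (\<delta> (t / real (Suc n)) / (t / real (Suc n)))" for n
 proof -
  let ?h = "t / real (Suc n)"
  have h: "0 < ?h" using t by simp
  have "\<bar>\<Phi> (real j * ?h) - \<Phi> 0\<bar> <= real j * \<delta> ?h" if "j <= Suc n" for j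
   using that
  proof (induction j)
   case (Suc j)
   have "real (Suc j) * ?h <= real (Suc n) * ?h" using Suc h by (intro mult_right_mono) auto
   then have "real (Suc j) * ?h <= t" by simp
   from step[OF h this] have "\<bar>\<Phi> (real (Suc j) * ?h) - \<Phi> (real j * ?h)\<bar> <= \<delta> ?h" .
   then have "\<bar>\<Phi> (real (Suc j) * ?h) - \<Phi> 0\<bar> <= \<delta> ?h + real j * \<delta> ?h"
    using Suc by linarith
   then show ?case by (simp add: algebra_simps)
  qed simp
  from this[OF order_refl] show ?thesis using t by (simp add: mult.commute del: of_nat_Suc)
 qed
 have "filterlim (%n. t / real (Suc n)) (at_right 0) sequentially"
 proof -
  have "(%n. t * (1 / real (Suc n))) \<longlonglongrightarrow> t * 0"
   using lim_inverse_n'[THEN LIMSEQ_Suc] by (intro tendsto_intros) auto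
  then have "(%n. t / real (Suc n)) \<longlonglongrightarrow> 0" by (simp del: of_nat_Suc)
  moreover have "t / real (Suc n) \<in> {0<..}" "t / real (Suc n) \<noteq> 0" for n using t by auto
  ultimately show ?thesis unfolding filterlim_at by (intro conjI always_eventually allI)
 qed
 from filterlim_compose[OF \<delta> this]
 have "(%n. t * (\<delta> (t / real (Suc n)) / (t / real (Suc n)))) \<longlonglongrightarrow> t * 0"
  by (intro tendsto_intros)
 then have "\<bar>\<Phi> t - \<Phi> 0\<bar> <= t * 0" using le by (intro LIMSEQ_le_const) auto
 then show ?thesis by simp
qed

lemma of_real_l2_iff: "(%x. complex_of_real (f x)) \<in> l2 m \<longleftrightarrow> f \<in> L2 m"
proof -
 have "f \<in> borel_measurable m" if "(%x. complex_of_real (f x)) \<in> borel_measurable m"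
 proof -
  have "(%x. Re (complex_of_real (f x))) \<in> borel_measurable m" using that by measurable
  then show ?thesis by simp
 qed
 moreover have "(%x. complex_of_real (f x)) \<in> borel_measurable m" if "f \<in> borel_measurable m"
  using that by measurable
 ultimately show ?thesis
  unfolding l2_def L2_def mem_Collect_eq norm_of_real power2_abs by blast
qed

lemma l2_norm_of_real: "l2_norm m (%x. complex_of_real (f x)) = sqrt (sq_int m f)"
 by (simp add: l2_norm_def sq_int_def)

text \<open>Pointwise convergence together with convergence of norms implies convergence in norm:
  Fatou is applied to \<open>2 f_k^2 + 2 g^2 - (f_k - g)^2\<close>, which is the square of
  \<open>f_k + g\<close>.\<close>

lemma tendsto_of_sq_norm_tendsto:
 fixes f :: "nat => 'a => real"
 assumes f: "!!k. f k \<in> L2 m" and g: "g \<in> L2 m" and h: "h \<in> L2 m"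
  and pt: "!!y. y \<in> space m ==> (%k. f k y) \<longlonglongrightarrow> g y" and sq: "(%k. sq_int m (f k)) \<longlonglongrightarrow> sq_int m g"
 shows "(%k. LINT y|m. f k y * h y) \<longlonglongrightarrow> (LINT y|m. g y * h y)"
proof -
 let ?F = "%k y. 2 * (f k y)^2 + 2 * (g y)^2 - (f k y - g y)^2"
 have d: "(%y. f k y - g y) \<in> L2 m" for k by (rule L2_diff[OF f g])
 have nn: "0 <= ?F k y" for k y
  using sum_squares_ge_zero[of "f k y + g y" 0] by (simp add: power2_eq_square algebra_simps)
 have iF: "integrable m (?F k)" for k
  by (intro Bochner_Integration.integrable_diff Bochner_Integration.integrable_add integrable_mult_right L2D(2) f g d)
 have IF: "(LINT y|m. ?F k y) = 2 * sq_int m (f k) + 2 * sq_int m g - sq_int m (%y. f k y - g y)" for k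
  using L2D(2)[OF f[of k]] L2D(2)[OF g] L2D(2)[OF d[of k]]
  by (simp add: sq_int_def)
 have "(NN m (%y. liminf (%k. ennreal (?F k y)))) <= liminf (%k. NN m (%y. ennreal (?F k y)))"
  using iF by (intro nn_integral_liminf) auto
 moreover have "liminf (%k. ennreal (?F k y)) = ennreal (4 * (g y)^2)" if "y \<in> space m" for y
 proof -
  have "(%k. ?F k y) \<longlonglongrightarrow> 2 * (g y)^2 + 2 * (g y)^2 - (g y - g y)^2"
   using pt[OF that] by (intro tendsto_intros)
  then have "(%k. ennreal (?F k y)) \<longlonglongrightarrow> ennreal (4 * (g y)^2)" by (intro tendsto_ennrealI) simp
  then show ?thesis by (rule lim_imp_Liminf[rotated]) simp
 qed
 ultimately have "(NN m (%y. ennreal (4 * (g y)^2))) <= liminf (%k. NN m (%y. ennreal (?F k y)))"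
  by (simp cong: nn_integral_cong)
 also have "(NN m (%y. ennreal (4 * (g y)^2))) = ennreal (4 * sq_int m g)"
  using L2D(2)[OF g] by (subst nn_integral_eq_integral) (auto simp: sq_int_def)
 also have "liminf (%k. NN m (%y. ennreal (?F k y))) = liminf (%k. ennreal (2 * sq_int m (f k) + 2 * sq_int m g - sq_int m (%y. f k y - g y)))"
  using iF nn by (subst nn_integral_eq_integral) (simp_all add: IF)
 finally have fat: "ennreal (4 * sq_int m g) <= liminf (%k. ennreal (2 * sq_int m (f k) + 2 * sq_int m g - sq_int m (%y. f k y - g y)))" .
 have lim0: "(%k. sq_int m (%y. f k y - g y)) \<longlonglongrightarrow> 0"
 proof (rule LIMSEQ_I)
  fix e :: real assume e: "0 < e"
  have ev1: "\<forall>\<^sub>F k in sequentially. 2 * sq_int m (f k) < 2 * sq_int m g + e / 2"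
   using order_tendstoD(2)[OF tendsto_mult[OF tendsto_const[of 2] sq], of "2 * sq_int m g + e / 2"] e by simp
  have ev2: "\<forall>\<^sub>F k in sequentially. 4 * sq_int m g - e / 2 < 2 * sq_int m (f k) + 2 * sq_int m g - sq_int m (%y. f k y - g y)"
  proof (cases "4 * sq_int m g - e / 2 < 0")
   case True
   have "0 <= 2 * sq_int m (f k) + 2 * sq_int m g - sq_int m (%y. f k y - g y)" for k
    unfolding IF[symmetric] by (rule integral_nonneg_AE) (use nn in auto)
   then show ?thesis using True by (intro always_eventually allI) (rule less_le_trans)
  next
   case False
   then have "ennreal (4 * sq_int m g - e / 2) < ennreal (4 * sq_int m g)" using e by (intro ennreal_lessI) auto
   then have "ennreal (4 * sq_int m g - e / 2) < liminf (%k. ennreal (2 * sq_int m (f k) + 2 * sq_int m g - sq_int m (%y. f k y - g y)))"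
    using fat by (rule less_le_trans)
   then have "\<forall>\<^sub>F k in sequentially. ennreal (4 * sq_int m g - e / 2) < ennreal (2 * sq_int m (f k) + 2 * sq_int m g - sq_int m (%y. f k y - g y))"
    by (rule less_LiminfD)
   then show ?thesis by eventually_elim (use False in \<open>simp add: ennreal_less_iff\<close>)
  qed
  have "\<forall>\<^sub>F k in sequentially. norm (sq_int m (%y. f k y - g y) - 0) < e"
   using ev1 ev2 by eventually_elim (use sq_int_nonneg in \<open>auto simp: abs_of_nonneg\<close>)
  then show "\<exists>no. \<forall>k\<ge>no. norm (sq_int m (%y. f k y - g y) - 0) < e" by (simp add: eventually_sequentially)
 qed
 show ?thesis
  using integral_mult_tendsto(1)[OF h f g lim0] by (simp add: mult.commute)
qed

section \<open>The rescaled mean semigroup: kernel bounds, continuity, semigroup law\<close>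

locale supercritical_setting =
 feynman_kac \<Omega>' F \<xi> Q m p \<alpha> K + principal_eigenfunctions m \<xi> Q \<alpha> q lam0 phi0 phih0
 for \<Omega>' :: "'w set" and F :: "ennreal => 'w measure"
  and \<xi> :: "real => 'w => 'e::{metric_space, second_countable_topology} option"
  and Q m p \<alpha> K q lam0 phi0 phih0
begin

lemma borel_m: "borel_measurable m = borel_measurable borel"
 using sets_m by (rule measurable_cong_sets) simp

lemma space_m: "space m = UNIV"
 using sets_eq_imp_space_eq[OF sets_m] by simp

sublocale m: sigma_finite_measure m by (rule sigma_finite_m)

lemma null_open: "open U ==> emeasure m U = 0 ==> U = {}"
 using full_support_m unfolding measure_support_def by (metis (mono_tags, lifting) UNIV_I all_not_in_conv less_irrefl mem_Collect_eq)

text \<open>The set where two continuous functions differ is open, and by full support a null open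
  set is empty. This upgrades statements about \<open>L2\<close> classes to statements at every
  point.\<close>

lemma AE_continuous_eq:
 fixes f g :: "'e => real"
 assumes ae: "AE x in m. f x = g x" and f: "continuous_on UNIV f" and g: "continuous_on UNIV g"
 shows "f x = g x"
proof -
 have o: "open {x. f x \<noteq> g x}" by (rule open_Collect_neq[OF f g])
 then have "{x. f x \<noteq> g x} \<in> sets m" using sets_m by (simp add: borel_open)
 then have "emeasure m {x. f x \<noteq> g x} = 0"
  using ae AE_iff_measurable[of "{x. f x \<noteq> g x}" m "%x. f x = g x"] by (simp add: space_m)
 then show ?thesis using null_open[OF o] by auto
qed

lemma AE_continuous_le:
 fixes f g :: "'e => real"
 assumes ae: "AE x in m. f x <= g x" and f: "continuous_on UNIV f" and g: "continuous_on UNIV g"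
 shows "f x <= g x"
proof -
 have "AE x in m. max (f x) (g x) = g x" using ae by eventually_elim simp
 from AE_continuous_eq[OF this continuous_on_max[OF f g] g] have "max (f x) (g x) = g x" .
 then show ?thesis by simp
qed

lemma q_slice_continuous: "0 < t ==> continuous_on UNIV (q t x)" "0 < t ==> continuous_on UNIV (%x. q t x y)"
 using continuous_on_compose2[OF q_continuous continuous_on_Pair[OF continuous_on_const[of UNIV x] continuous_on_id]]
  continuous_on_compose2[OF q_continuous continuous_on_Pair[OF continuous_on_id continuous_on_const[of UNIV y]]] by auto

lemma p_slice_continuous: "0 < t ==> continuous_on UNIV (p t x)" "0 < t ==> continuous_on UNIV (%x. p t x y)"
 using continuous_on_compose2[OF p_continuous continuous_on_Pair[OF continuous_on_const[of UNIV x] continuous_on_id]]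
  continuous_on_compose2[OF p_continuous continuous_on_Pair[OF continuous_on_id continuous_on_const[of UNIV y]]] by auto

lemma qp_measurable:
 assumes "0 < t"
 shows "q t x \<in> borel_measurable m" "p t x \<in> borel_measurable m"
  "(%x. q t x y) \<in> borel_measurable m" "(%x. p t x y) \<in> borel_measurable m"
 unfolding borel_m using q_slice_continuous[OF assms] p_slice_continuous[OF assms]
 by (auto intro: borel_measurable_continuous_onI)

lemma qp_pair_measurable:
 assumes "0 < t"
 shows "(%z. q t (fst z) (snd z)) \<in> borel_measurable (m \<Otimes>\<^sub>M m)"
  "(%z. p t (fst z) (snd z)) \<in> borel_measurable (m \<Otimes>\<^sub>M m)"
proof -
 have e: "borel_measurable (m \<Otimes>\<^sub>M m) = (borel_measurable (borel :: ('e \<times> 'e) measure) :: ('e \<times> 'e => real) set)"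
  unfolding borel_prod[symmetric] by (intro measurable_cong_sets sets_pair_measure_cong sets_m refl)
 show "(%z. q t (fst z) (snd z)) \<in> borel_measurable (m \<Otimes>\<^sub>M m)"
  unfolding e using borel_measurable_continuous_onI[OF q_continuous[OF assms]] unfolding case_prod_beta' .
 show "(%z. p t (fst z) (snd z)) \<in> borel_measurable (m \<Otimes>\<^sub>M m)"
  unfolding e using borel_measurable_continuous_onI[OF p_continuous[OF assms]] unfolding case_prod_beta' .
qed

lemma mean_weight: "mean_op \<xi> Q \<alpha> t f x = (LINT w|Q (Some x). weight t w *\<^sub>R ext f (\<xi> t w))"
 by (simp add: mean_op_def weight_def)

text \<open>The weight lies between \<open>exp (- K * t)\<close> and \<open>exp (K * t)\<close>,
  which compares the two kernels on Borel sets. Continuity of the densities and full support make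
  the comparison pointwise.\<close>

lemma q_p_bounds:
 assumes t: "0 < t"
 shows "exp (- K * t) * p t x y <= q t x y" "q t x y <= exp (K * t) * p t x y"
proof -
 interpret P: prob_space "Q (Some x)" by (rule prob_Q)
 have t0: "0 <= t" using t by simp
 have xi: "\<xi> t \<in> Q (Some x) \<rightarrow>\<^sub>M borel_on opc" by (rule xi_measurable[OF t0])
 have iq: "integrable m (%y. q t x y * indicator A y)" "integrable m (%y. p t x y * indicator A y)"
  and le: "exp (- K * t) * (LINT y|m. p t x y * indicator A y) <= (LINT y|m. q t x y * indicator A y)"
   "(LINT y|m. q t x y * indicator A y) <= exp (K * t) * (LINT y|m. p t x y * indicator A y)"
  if A[measurable]: "A \<in> sets borel" for A
 proof -
  have bd: "bounded (range (indicator A :: 'e => real))"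
   by (rule boundedI[of _ 1]) (auto simp: indicator_def)
  show "integrable m (%y. q t x y * indicator A y)" "integrable m (%y. p t x y * indicator A y)"
   using q_density[OF t _ bd, of x] p_density[OF t _ bd, of x] by auto
  let ?I = "%w. ext (indicat_real A) (\<xi> t w)"
  have Im: "?I \<in> borel_measurable (Q (Some x))" by (rule measurable_compose[OF xi measurable_ext]) simp
  have Ib: "0 <= ?I w" "?I w <= 1" for w by (auto split: option.splits simp: indicator_def)
  have i1: "integrable (Q (Some x)) ?I"
   by (rule P.integrable_const_bound[where B=1]) (use Im Ib in \<open>auto simp: abs_of_nonneg\<close>)
  have i2: "integrable (Q (Some x)) (%w. weight t w * ?I w)"
  proof (rule P.integrable_const_bound[where B="exp (K * t)"])
   show "AE w in Q (Some x). norm (weight t w * ?I w) <= exp (K * t)"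
   proof (rule AE_I2)
    fix w assume "w \<in> space (Q (Some x))"
    then have "weight t w * ?I w <= exp (K * t) * 1"
     using weight_bound[OF _ t0] Ib weight_pos by (intro mult_mono) (auto simp: space_Q less_imp_le)
    then show "norm (weight t w * ?I w) <= exp (K * t)"
     using Ib(1)[of w] weight_pos[of t w] by (simp add: abs_mult)
   qed
  qed (use Im weight_measurable[OF t0] in measurable)
  have "exp (- K * t) * (LINT w|Q (Some x). ?I w) <= (LINT w|Q (Some x). weight t w * ?I w)"
   unfolding integral_mult_right_zero[symmetric]
   using i1 i2 weight_bound[OF _ t0] Ib by (intro integral_mono mult_right_mono) (auto simp: space_Q)
  moreover have "(LINT w|Q (Some x). weight t w * ?I w) <= exp (K * t) * (LINT w|Q (Some x). ?I w)"
   unfolding integral_mult_right_zero[symmetric]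
   using i1 i2 weight_bound[OF _ t0] Ib by (intro integral_mono mult_right_mono) (auto simp: space_Q)
  moreover have "(LINT w|Q (Some x). ?I w) = (LINT y|m. p t x y * indicator A y)"
   using p_density[OF t _ bd, of x] by simp
  moreover have "(LINT w|Q (Some x). weight t w * ?I w) = (LINT y|m. q t x y * indicator A y)"
   using q_density[OF t _ bd, of x] by (simp add: mean_weight)
  ultimately show "exp (- K * t) * (LINT y|m. p t x y * indicator A y) <= (LINT y|m. q t x y * indicator A y)"
   "(LINT y|m. q t x y * indicator A y) <= exp (K * t) * (LINT y|m. p t x y * indicator A y)"
   by simp_all
 qed
 have key: "f y <= g y" if f: "continuous_on UNIV f" and g: "continuous_on UNIV g"
  and i: "!!A. A \<in> sets borel ==> integrable m (%y. f y * indicator A y)" "!!A. A \<in> sets borel ==> integrable m (%y. g y * indicator A y)"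
  and l: "!!A. A \<in> sets borel ==> (LINT y|m. f y * indicator A y) <= (LINT y|m. g y * indicator A y)" for f g :: "'e => real" and y
 proof (rule AE_continuous_le[OF _ f g])
  let ?A = "{y. g y < f y}"
  have "open ?A" by (rule open_Collect_less[OF g f])
  then have A: "?A \<in> sets borel" by (rule borel_open)
  let ?d = "%y. f y * indicator ?A y - g y * indicator ?A y"
  have id: "integrable m ?d" by (intro Bochner_Integration.integrable_diff i A)
  have nn: "0 <= ?d y" for y by (auto simp: indicator_def)
  have "(LINT y|m. ?d y) = (LINT y|m. f y * indicator ?A y) - (LINT y|m. g y * indicator ?A y)"
   by (intro Bochner_Integration.integral_diff i A)
  then have "(LINT y|m. ?d y) <= 0" using l[OF A] by simp
  moreover have "0 <= (LINT y|m. ?d y)" using nn by (intro integral_nonneg_AE) auto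
  ultimately have "(LINT y|m. ?d y) = 0" by simp
  then have "AE y in m. ?d y = 0"
   using integral_nonneg_eq_0_iff_AE[OF id] nn by simp
  then show "AE y in m. f y <= g y" by eventually_elim (auto simp: indicator_def split: if_splits)
 qed
 show "exp (- K * t) * p t x y <= q t x y"
 proof (rule key[of "%y. exp (- K * t) * p t x y" "q t x"])
  show "integrable m (%y. exp (- K * t) * p t x y * indicator A y)" if "A \<in> sets borel" for A
   using iq(2)[OF that] by (simp add: mult.assoc)
  show "(LINT y|m. exp (- K * t) * p t x y * indicator A y) <= (LINT y|m. q t x y * indicator A y)" if "A \<in> sets borel" for A
   using le(1)[OF that] by (simp add: mult.assoc)
 qed (auto intro!: continuous_intros p_slice_continuous q_slice_continuous t iq)
 show "q t x y <= exp (K * t) * p t x y"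
 proof (rule key[of "q t x" "%y. exp (K * t) * p t x y"])
  show "integrable m (%y. exp (K * t) * p t x y * indicator A y)" if "A \<in> sets borel" for A
   using iq(2)[OF that] by (simp add: mult.assoc)
  show "(LINT y|m. q t x y * indicator A y) <= (LINT y|m. exp (K * t) * p t x y * indicator A y)" if "A \<in> sets borel" for A
   using le(2)[OF that] by (simp add: mult.assoc)
 qed (auto intro!: continuous_intros p_slice_continuous q_slice_continuous t iq)
qed

lemma q_pos: "0 < t ==> 0 < q t x y"
 using q_p_bounds(1)[of t x y] p_pos[of t x y] by (smt (verit) exp_gt_zero mult_pos_pos)

lemma p_L2: "0 < t ==> p t x \<in> L2 m" "0 < t ==> (%x. p t x y) \<in> L2 m"
 using qp_measurable sq_mass_finite dual_sq_mass_finite by (auto simp: L2_def)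

lemma q_L2: "0 < t ==> q t x \<in> L2 m" "0 < t ==> (%x. q t x y) \<in> L2 m"
proof -
 assume t: "0 < t"
 have b: "\<bar>q t x y\<bar> <= \<bar>exp (K * t) * p t x y\<bar>" for x y
  using q_p_bounds[OF t, of x y] q_pos[OF t, of x y] by linarith
 show "q t x \<in> L2 m" "(%x. q t x y) \<in> L2 m"
  using L2_bound[OF L2_cmult[OF p_L2(1)[OF t, of x], of "exp (K * t)"] qp_measurable(1)[OF t] b]
   L2_bound[OF L2_cmult[OF p_L2(2)[OF t, of y], of "exp (K * t)"] qp_measurable(3)[OF t] b] .
qed

lemma p_mass: "0 < t ==> integrable m (p t x)" "0 < t ==> (LINT y|m. p t x y) <= 1"
proof -
 assume t: "0 < t"
 interpret P: prob_space "Q (Some x)" by (rule prob_Q)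
 have *: "integrable m (%y. p t x y * 1)" "(LINT w|Q (Some x). ext (%_. 1) (\<xi> t w)) = (LINT y|m. p t x y * 1)"
  using p_density[OF t, of "%_. 1" x] by auto
 show "integrable m (p t x)" using *(1) by simp
 have "\<bar>(LINT w|Q (Some x). ext (%_. 1 :: real) (\<xi> t w))\<bar> <= 1"
  by (rule P.bounded_integral_le) (auto split: option.splits)
 then show "(LINT y|m. p t x y) <= 1" using *(2) by simp
qed

text \<open>Time zero is set by hand because the density exists only for positive times.\<close>

definition U :: "real => ('e => real) => 'e => real" where
 "U t f x = (if t = 0 then f x else exp (- lam0 * t) * (LINT y|m. q t x y * f y))"

lemma U_zero [simp]: "U 0 f = f"
 by (simp add: U_def fun_eq_iff)

lemma qf_integrable: "0 < t ==> f \<in> L2 m ==> integrable m (%y. q t x y * f y)"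
 by (intro L2_mult q_L2)

lemma U_continuous:
 assumes t: "0 < t" and f: "f \<in> L2 m"
 shows "continuous_on UNIV (U t f)"
proof -
 have "continuous_on UNIV (%x. LINT y|m. q t x y * f y)"
  unfolding continuous_on_eq_continuous_at[OF open_UNIV] isCont_def
 proof
  fix x0
  have *: "(%k. LINT y|m. q t (X k) y * f y) \<longlonglongrightarrow> (LINT y|m. q t x0 y * f y)" if X: "X \<longlonglongrightarrow> x0" for X
  proof -
   \<comment> \<open>Pratt's lemma: \<open>q f\<close> is dominated by \<open>p |f|\<close>, whose integrals converge because the \<open>L\<^sup>2\<close> norms of \<open>p(t, X\<^sub>k, \<cdot>)\<close> do.\<close>
   have sqp: "(%k. sq_int m (p t (X k))) \<longlonglongrightarrow> sq_int m (p t x0)"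
    using continuous_on_tendsto_compose[OF sq_mass_continuous[OF t] X] by (simp add: sq_mass_def sq_int_def)
   have ptp: "(%k. p t (X k) y) \<longlonglongrightarrow> p t x0 y" for y
    using continuous_on_tendsto_compose[OF p_slice_continuous(2)[OF t] X] by simp
   have ptq: "(%k. q t (X k) y) \<longlonglongrightarrow> q t x0 y" for y
    using continuous_on_tendsto_compose[OF q_slice_continuous(2)[OF t] X] by simp
   have af: "(%y. \<bar>f y\<bar>) \<in> L2 m" by (rule L2_abs[OF f])
   have lp: "(%k. LINT y|m. p t (X k) y * h y) \<longlonglongrightarrow> (LINT y|m. p t x0 y * h y)" if "h \<in> L2 m" for h
    by (rule tendsto_of_sq_norm_tendsto[OF p_L2(1)[OF t] p_L2(1)[OF t] that ptp sqp])
   have ip: "integrable m (%y. p t z y * \<bar>f y\<bar>)" for z by (intro L2_mult p_L2 t af)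
   let ?D = "%z y. exp (K * t) * (p t z y * \<bar>f y\<bar>)"
   have fatou: "(NN m (%y. ennreal (?D x0 y + s * (q t x0 y * f y)))) <= liminf (%k. NN m (%y. ennreal (?D (X k) y + s * (q t (X k) y * f y))))" for s :: real
   proof -
    have "(NN m (%y. ennreal (?D x0 y + s * (q t x0 y * f y)))) = (NN m (%y. liminf (%k. ennreal (?D (X k) y + s * (q t (X k) y * f y)))))"
     by (intro nn_integral_cong lim_imp_Liminf[symmetric] tendsto_ennrealI tendsto_intros ptp ptq) simp
    also have "... <= liminf (%k. NN m (%y. ennreal (?D (X k) y + s * (q t (X k) y * f y))))"
     using ip qf_integrable[OF t f] by (intro nn_integral_liminf) auto
    finally show ?thesis .
   qed
   have nn: "0 <= ?D z y + s * (q t z y * f y)" if "\<bar>s\<bar> = 1" for s z y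
   proof -
    have "\<bar>s * (q t z y * f y)\<bar> = q t z y * \<bar>f y\<bar>" using that q_pos[OF t, of z y] by (simp add: abs_mult)
    also have "... <= (exp (K * t) * p t z y) * \<bar>f y\<bar>" by (intro mult_right_mono q_p_bounds t) auto
    finally show ?thesis by (simp add: mult.assoc abs_le_iff)
   qed
   define J where "J z = (LINT y|m. q t z y * f y)" for z
   define D where "D z = exp (K * t) * (LINT y|m. p t z y * \<bar>f y\<bar>)" for z
   have I: "(NN m (%y. ennreal (?D z y + s * (q t z y * f y)))) = ennreal (D z + s * J z)" "0 <= D z + s * J z" if "\<bar>s\<bar> = 1" for s z
   proof -
    have e: "(LINT y|m. ?D z y + s * (q t z y * f y)) = D z + s * J z"
     unfolding D_def J_def using ip qf_integrable[OF t f] by simp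
    show "0 <= D z + s * J z" unfolding e[symmetric] using nn[OF that] by (intro integral_nonneg_AE) auto
    show "(NN m (%y. ennreal (?D z y + s * (q t z y * f y)))) = ennreal (D z + s * J z)"
     unfolding e[symmetric] using ip qf_integrable[OF t f] nn[OF that] by (intro nn_integral_eq_integral) auto
   qed
   have Dl: "(%k. D (X k)) \<longlonglongrightarrow> D x0" unfolding D_def by (intro tendsto_intros lp af)
   \<comment> \<open>Lower semicontinuity of \<open>D + s * J\<close> together with convergence of
     \<open>D\<close>; the signs \<open>s = 1\<close> and \<open>s = - 1\<close> bound
     \<open>J\<close> from both sides.\<close>
   have ev: "\<forall>\<^sub>F k in sequentially. s * J x0 - e < s * J (X k)" if s: "\<bar>s\<bar> = 1" and e: "0 < e" for s e :: real
   proof -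
    have "\<forall>\<^sub>F k in sequentially. D x0 + s * J x0 - e / 2 < D (X k) + s * J (X k)"
    proof (cases "D x0 + s * J x0 - e / 2 < 0")
     case True
     then show ?thesis using I(2)[OF s] by (intro always_eventually allI) (rule less_le_trans)
    next
     case False
     then have "ennreal (D x0 + s * J x0 - e / 2) < ennreal (D x0 + s * J x0)" using e by (intro ennreal_lessI) auto
     also have "... <= liminf (%k. ennreal (D (X k) + s * J (X k)))" using fatou[of s] unfolding I(1)[OF s] .
     finally have "\<forall>\<^sub>F k in sequentially. ennreal (D x0 + s * J x0 - e / 2) < ennreal (D (X k) + s * J (X k))"
      by (rule less_LiminfD)
     then show ?thesis by eventually_elim (use False in \<open>simp add: ennreal_less_iff\<close>)
    qed
    moreover have "\<forall>\<^sub>F k in sequentially. D (X k) < D x0 + e / 2"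
     using order_tendstoD(2)[OF Dl, of "D x0 + e / 2"] e by simp
    ultimately show ?thesis by eventually_elim linarith
   qed
   have "(%k. J (X k)) \<longlonglongrightarrow> J x0"
   proof (rule order_tendstoI)
    fix a assume "a < J x0" then show "\<forall>\<^sub>F k in sequentially. a < J (X k)"
     using ev[of 1 "J x0 - a"] by (auto elim!: eventually_mono)
   next
    fix a assume "J x0 < a" then show "\<forall>\<^sub>F k in sequentially. J (X k) < a"
     using ev[of "-1" "a - J x0"] by (auto elim!: eventually_mono)
   qed
   then show ?thesis by (simp add: J_def)
  qed
  show "((%x. LINT y|m. q t x y * f y) \<longlongrightarrow> (LINT y|m. q t x0 y * f y)) (at x0)"
   unfolding tendsto_at_iff_sequentially using * by (auto simp: o_def)
 qed
 then show ?thesis using t by (auto simp: U_def[abs_def] intro!: continuous_intros)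
qed

text \<open>Cauchy-Schwarz against the kernel. The majorant \<open>sq_mass\<close> is continuous,
  hence integrable for compactly supported initial laws, and its square integrability at one time is
  condition (c).\<close>

lemma U_pointwise_bound:
 assumes t: "0 < t" and f: "f \<in> L2 m"
 shows "(U t f x)^2 <= exp (2 * (K - lam0) * t) * sq_mass m p t x * sq_int m f"
proof -
 have "(LINT y|m. q t x y * f y)^2 <= sq_int m (q t x) * sq_int m f"
  by (intro cauchy_schwarz_integral q_L2 f t)
 also have "sq_int m (q t x) <= sq_int m (%y. exp (K * t) * p t x y)"
 proof (rule sq_int_mono)
  show "\<bar>q t x y\<bar> <= \<bar>exp (K * t) * p t x y\<bar>" for y
   using q_p_bounds[OF t, of x y] q_pos[OF t, of x y] by linarith
 qed (auto intro!: L2_cmult p_L2 qp_measurable t)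
 also have "... = exp (2 * K * t) * sq_mass m p t x"
  by (simp add: sq_int_cmult sq_mass_def sq_int_def power2_eq_square exp_add[symmetric])
 finally have "(LINT y|m. q t x y * f y)^2 <= exp (2 * K * t) * sq_mass m p t x * sq_int m f"
  by (simp add: mult_right_mono)
 then have "(exp (- lam0 * t))^2 * (LINT y|m. q t x y * f y)^2 <= (exp (- lam0 * t))^2 * (exp (2 * K * t) * sq_mass m p t x * sq_int m f)"
  by (intro mult_left_mono) auto
 also have "... = ((exp (- lam0 * t))^2 * exp (2 * K * t)) * sq_mass m p t x * sq_int m f" by simp
 also have "(exp (- lam0 * t))^2 * exp (2 * K * t) = exp (2 * (K - lam0) * t)"
  by (simp add: power2_eq_square exp_add[symmetric] algebra_simps)
 finally show ?thesis using t by (simp add: U_def power_mult_distrib)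
qed

text \<open>Schur's test: the rows of \<open>p\<close> have mass at most one because it is a
  transition density, the columns by condition (a), and the weight costs
  \<open>exp (K * t)\<close>.\<close>

lemma U_sq:
 assumes t: "0 <= t" and f: "f \<in> L2 m"
 shows "U t f \<in> L2 m" "sq_int m (U t f) <= exp (2 * (K - lam0) * t) * sq_int m f"
proof -
 have "U t f \<in> L2 m \<and> sq_int m (U t f) <= exp (2 * (K - lam0) * t) * sq_int m f"
 proof (cases "t = 0")
  case False
  then have t: "0 < t" using t by simp
  have f2: "integrable m (%y. (f y)^2)" using L2D(2)[OF f] .
  have fm[measurable]: "f \<in> borel_measurable m" using L2D(1)[OF f] .
  note [measurable] = qp_pair_measurable[OF t] qp_measurable[OF t]
  have mU[measurable]: "U t f \<in> borel_measurable m"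
   unfolding borel_m by (rule borel_measurable_continuous_onI[OF U_continuous[OF t f]])
  have c0: "(exp (- lam0 * t))^2 * exp (K * t) * exp (K * t) = exp (2 * (K - lam0) * t)"
   by (simp add: power2_eq_square exp_add[symmetric] algebra_simps)
  have pt: "ennreal ((U t f x)^2) <= ennreal (exp (2 * (K - lam0) * t)) * (NN m (%y. ennreal (p t x y) * ennreal ((f y)^2)))" for x
  proof (cases "integrable m (%y. p t x y * (f y)^2)")
   case True
   have p0: "0 <= p t x y" for y using p_pos[OF t] less_imp_le by blast
   have s1: "(%y. sqrt (p t x y)) \<in> L2 m" using p_mass[OF t, of x] p0 by (auto simp: L2_def)
   have s2: "(%y. sqrt (p t x y) * \<bar>f y\<bar>) \<in> L2 m"
    using True p0 by (auto simp: L2_def power_mult_distrib)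
   have "\<bar>(LINT y|m. q t x y * f y)\<bar> <= (LINT y|m. norm (q t x y * f y))"
    using integral_norm_bound[of m "%y. q t x y * f y"] by simp
   also have "... <= (LINT y|m. exp (K * t) * (p t x y * \<bar>f y\<bar>))"
   proof (rule integral_mono)
    show "integrable m (%y. norm (q t x y * f y))" using qf_integrable[OF t f] by simp
    show "integrable m (%y. exp (K * t) * (p t x y * \<bar>f y\<bar>))"
     by (intro integrable_mult_right L2_mult p_L2 t L2_abs f)
    show "norm (q t x y * f y) <= exp (K * t) * (p t x y * \<bar>f y\<bar>)" for y
     using q_p_bounds(2)[OF t, of x y] q_pos[OF t, of x y] by (simp add: abs_mult mult_right_mono mult.assoc[symmetric])
   qed
   finally have a: "\<bar>(LINT y|m. q t x y * f y)\<bar> <= exp (K * t) * (LINT y|m. p t x y * \<bar>f y\<bar>)" by simp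
   have "(LINT y|m. p t x y * \<bar>f y\<bar>) = (LINT y|m. sqrt (p t x y) * (sqrt (p t x y) * \<bar>f y\<bar>))"
    using p0 by (simp add: mult.assoc[symmetric])
   then have "(LINT y|m. p t x y * \<bar>f y\<bar>)^2 <= (LINT y|m. p t x y) * (LINT y|m. p t x y * (f y)^2)"
    using cauchy_schwarz_integral[OF s1 s2] p0 by (simp add: sq_int_def power_mult_distrib)
   also have "... <= 1 * (LINT y|m. p t x y * (f y)^2)"
    using p0 p_mass[OF t, of x] by (intro mult_right_mono integral_nonneg_AE) auto
   finally have b: "(LINT y|m. p t x y * \<bar>f y\<bar>)^2 <= (LINT y|m. p t x y * (f y)^2)" by simp
   have "(LINT y|m. q t x y * f y)^2 <= (exp (K * t) * (LINT y|m. p t x y * \<bar>f y\<bar>))^2"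
    using a abs_le_square_iff[of "(LINT y|m. q t x y * f y)" "exp (K * t) * (LINT y|m. p t x y * \<bar>f y\<bar>)"] by linarith
   also have "... <= (exp (K * t))^2 * (LINT y|m. p t x y * (f y)^2)"
    using b by (simp add: power_mult_distrib)
   finally have "(U t f x)^2 <= (exp (- lam0 * t))^2 * ((exp (K * t))^2 * (LINT y|m. p t x y * (f y)^2))"
    using t by (simp add: U_def power_mult_distrib mult_left_mono)
   also have "... = exp (2 * (K - lam0) * t) * (LINT y|m. p t x y * (f y)^2)"
    unfolding c0[symmetric] by (simp add: power2_eq_square)
   finally have "ennreal ((U t f x)^2) <= ennreal (exp (2 * (K - lam0) * t) * (LINT y|m. p t x y * (f y)^2))"
    by (rule ennreal_leI)
   also have "... = ennreal (exp (2 * (K - lam0) * t)) * (NN m (%y. ennreal (p t x y * (f y)^2)))"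
    using True p0 by (subst nn_integral_eq_integral) (auto simp: ennreal_mult')
   finally show ?thesis using p0 by (simp add: ennreal_mult')
  next
   \<comment> \<open>Otherwise the right-hand side is infinite.\<close>
   case False
   then have "(NN m (%y. ennreal (p t x y * (f y)^2))) = \<top>"
    using p_pos[OF t] by (subst (asm) integrable_iff_bounded) (auto simp: less_imp_le abs_mult less_top[symmetric])
   then show ?thesis using p_pos[OF t, of x] by (simp add: ennreal_mult' less_imp_le ennreal_mult_top)
  qed
  have "(NN m (%x. ennreal ((U t f x)^2))) <= (NN m (%x. ennreal (exp (2 * (K - lam0) * t)) * (NN m (%y. ennreal (p t x y) * ennreal ((f y)^2)))))"
   by (intro nn_integral_mono pt)
  also have "... = ennreal (exp (2 * (K - lam0) * t)) * (NN m (%x. (NN m (%y. ennreal (p t x y) * ennreal ((f y)^2)))))"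
   by (rule nn_integral_cmult) measurable
  also have "(NN m (%x. (NN m (%y. ennreal (p t x y) * ennreal ((f y)^2))))) = (NN m (%y. (NN m (%x. ennreal (p t x y) * ennreal ((f y)^2)))))"
  proof -
   interpret pair_sigma_finite m m ..
   show ?thesis by (rule Fubini'[symmetric]) measurable
  qed
  also have "... = (NN m (%y. (NN m (%x. ennreal (p t x y))) * ennreal ((f y)^2)))"
   by (intro nn_integral_cong nn_integral_multc) measurable
  also have "... <= (NN m (%y. 1 * ennreal ((f y)^2)))"
   by (intro nn_integral_mono mult_right_mono dual_mass_le_1 t) simp
  also have "... = ennreal (sq_int m f)" using f2 by (simp add: nn_integral_eq_integral sq_int_def)
  finally have fin: "(NN m (%x. ennreal ((U t f x)^2))) <= ennreal (exp (2 * (K - lam0) * t) * sq_int m f)"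
   by (simp add: mult_left_mono ennreal_mult')
  then have "integrable m (%x. (U t f x)^2)"
   by (intro integrableI_bounded) (auto intro: le_less_trans)
  moreover have "sq_int m (U t f) <= exp (2 * (K - lam0) * t) * sq_int m f"
   using fin \<open>integrable m (%x. (U t f x)^2)\<close>
   by (subst (asm) nn_integral_eq_integral) (auto simp: sq_int_def)
  ultimately show ?thesis using mU by (simp add: L2_def)
 qed (use f in simp)
 then show "U t f \<in> L2 m" "sq_int m (U t f) <= exp (2 * (K - lam0) * t) * sq_int m f" by auto
qed

text \<open>The mean semigroup without rescaling, acting on functions with values in
  \<open>[0, \<infinity>]\<close>. In this form semigroup law and moment formulas hold for every
  Borel function.\<close>

definition kern :: "real => ('e => ennreal) => 'e => ennreal" where
 "kern t f x = (if t = 0 then f x else NN m (%y. ennreal (q t x y) * f y))"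

lemma kern_zero [simp]: "kern 0 f = f"
 by (simp add: kern_def fun_eq_iff)

lemma kern_measurable:
 assumes t: "0 <= t" and f: "f \<in> borel_measurable borel"
 shows "kern t f \<in> borel_measurable borel"
proof (cases "t = 0")
 case False
 then have t: "0 < t" using t by simp
 note [measurable] = qp_pair_measurable(1)[OF t]
 have [measurable]: "f \<in> borel_measurable m" using f by (simp only: borel_m)
 have "(%x. NN m (%y. ennreal (q t x y) * f y)) \<in> borel_measurable m" by measurable
 then have "(%x. NN m (%y. ennreal (q t x y) * f y)) \<in> borel_measurable borel" by (simp only: borel_m)
 then show ?thesis using t by (simp add: kern_def[abs_def])
qed (use f in simp)

lemma weight_zero: "weight 0 w = 1"
 unfolding weight_def using potential_zero[of 0 w] by simp

text \<open>Monotone class, starting from the density hypothesis on indicators. At time zero it is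
  the normality of the process that identifies the starting point.\<close>

lemma nn_integral_weight:
 assumes t: "0 <= t" and f: "f \<in> borel_measurable borel"
 shows "(NN (Q (Some x)) (%w. ennreal (weight t w) * ext f (\<xi> t w))) = kern t f x"
proof (cases "t = 0")
 case True
 interpret P: prob_space "Q (Some x)" by (rule prob_Q)
 have "AE w in Q (Some x). \<xi> 0 w = Some x" using normal[of "Some x"] by simp
 then have "AE w in Q (Some x). ennreal (weight t w) * ext f (\<xi> t w) = f x"
  by eventually_elim (simp add: True weight_zero)
 then have "(NN (Q (Some x)) (%w. ennreal (weight t w) * ext f (\<xi> t w))) = (NN (Q (Some x)) (%w. f x))"
  by (rule nn_integral_cong_AE)
 then show ?thesis using True by (simp add: P.emeasure_space_1)
next
 case False
 then have tp: "0 < t" using t by simp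
 have xi: "\<xi> t \<in> Q (Some x) \<rightarrow>\<^sub>M borel_on opc" by (rule xi_measurable[OF t])
 have wm[measurable]: "weight t \<in> borel_measurable (Q (Some x))" by (rule weight_measurable[OF t])
 have em: "(%w. ext g (\<xi> t w)) \<in> borel_measurable (Q (Some x))" if "g \<in> borel_measurable borel" for g :: "'e => ennreal"
  by (rule measurable_compose[OF xi measurable_ext[OF that]])
 have qm[measurable]: "q t x \<in> borel_measurable m" by (rule qp_measurable[OF tp])
 have bm: "g \<in> borel_measurable m" if "g \<in> borel_measurable borel" for g :: "'e => ennreal"
  using that by (simp only: borel_m)
 have "(NN (Q (Some x)) (%w. ennreal (weight t w) * ext f (\<xi> t w))) = (NN m (%y. ennreal (q t x y) * f y))"
  using f
 proof induction
  case (cong f g)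
  then have fg: "f = g" by auto
  show ?case unfolding fg by (rule cong)
 next
  case (set A)
  interpret P: prob_space "Q (Some x)" by (rule prob_Q)
  have bd: "bounded (range (indicator A :: 'e => real))"
   by (rule boundedI[of _ 1]) (auto simp: indicator_def)
  have qd: "integrable m (%y. q t x y * indicator A y)" "(LINT w|Q (Some x). weight t w * ext (indicator A) (\<xi> t w)) = (LINT y|m. q t x y * indicator A y)"
   using q_density[OF tp _ bd, of x] set by (auto simp: mean_weight)
  have Im: "(%w. ext (indicat_real A) (\<xi> t w)) \<in> borel_measurable (Q (Some x))"
   by (rule measurable_compose[OF xi measurable_ext]) (use set in simp)
  have Ib: "0 <= ext (indicat_real A) z" "ext (indicat_real A) z <= 1" for z by (auto split: option.splits simp: indicator_def)
  have i2: "integrable (Q (Some x)) (%w. weight t w * ext (indicat_real A) (\<xi> t w))"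
  proof (rule P.integrable_const_bound[where B="exp (K * t)"])
   show "AE w in Q (Some x). norm (weight t w * ext (indicat_real A) (\<xi> t w)) <= exp (K * t)"
   proof (rule AE_I2)
    fix w assume "w \<in> space (Q (Some x))"
    then have "weight t w * ext (indicat_real A) (\<xi> t w) <= exp (K * t) * 1"
     using weight_bound[OF _ t] Ib weight_pos by (intro mult_mono) (auto simp: space_Q less_imp_le)
    then show "norm (weight t w * ext (indicat_real A) (\<xi> t w)) <= exp (K * t)"
     using Ib(1)[of "\<xi> t w"] weight_pos[of t w] by (simp add: abs_mult)
   qed
  qed (use Im in measurable)
  have "(NN (Q (Some x)) (%w. ennreal (weight t w) * ext (indicator A) (\<xi> t w))) =
    (NN (Q (Some x)) (%w. ennreal (weight t w * ext (indicator A) (\<xi> t w))))"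
   by (intro nn_integral_cong) (auto split: option.splits simp: indicator_def)
  also have "... = ennreal (LINT w|Q (Some x). weight t w * ext (indicator A) (\<xi> t w))"
   using Ib weight_pos by (intro nn_integral_eq_integral i2) (auto simp: less_imp_le)
  also have "... = ennreal (LINT y|m. q t x y * indicator A y)" by (simp only: qd(2))
  also have "... = (NN m (%y. ennreal (q t x y * indicator A y)))"
   using q_pos[OF tp] by (intro nn_integral_eq_integral[symmetric] qd(1)) (auto simp: less_imp_le)
  also have "... = (NN m (%y. ennreal (q t x y) * indicator A y))"
   by (intro nn_integral_cong) (auto simp: indicator_def)
  finally show ?case .
 next
  case (mult u c)
  note [measurable] = em[OF mult.hyps(2)] bm[OF mult.hyps(2)]
  have "ext (%x. c * u x) z = c * ext u z" for z by (cases z) auto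
  then show ?case using mult.IH by (simp add: mult.left_commute[of _ c] nn_integral_cmult)
 next
  case (add u v)
  note [measurable] = em[OF add.hyps(1)] bm[OF add.hyps(1)] em[OF add.hyps(3)] bm[OF add.hyps(3)]
  have "ext (%x. v x + u x) z = ext v z + ext u z" for z by (cases z) auto
  then show ?case using add.IH by (simp add: distrib_left nn_integral_add)
 next
  case (seq V)
  note [measurable] = em[OF seq.hyps(1)] bm[OF seq.hyps(1)]
  have inc: "V i y <= V j y" if "i <= j" for i j y using seq.hyps(3) that by (auto simp: incseq_def le_fun_def)
  have "ext (SUP i. V i) z = (SUP i. ext (V i) z)" for z by (cases z) (auto simp: image_image)
  then have "(NN (Q (Some x)) (%w. ennreal (weight t w) * ext (SUP i. V i) (\<xi> t w))) =
    (NN (Q (Some x)) (%w. (SUP i. ennreal (weight t w) * ext (V i) (\<xi> t w))))"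
   by (simp add: SUP_mult_left_ennreal)
  also have "... = (SUP i. NN (Q (Some x)) (%w. ennreal (weight t w) * ext (V i) (\<xi> t w)))"
   using inc by (intro nn_integral_monotone_convergence_SUP)
    (auto simp: incseq_def le_fun_def intro!: mult_left_mono split: option.splits)
  also have "... = (SUP i. NN m (%y. ennreal (q t x y) * V i y))" using seq.IH by simp
  also have "... = (NN m (%y. (SUP i. ennreal (q t x y) * V i y)))"
   using inc by (intro nn_integral_monotone_convergence_SUP[symmetric])
    (auto simp: incseq_def le_fun_def intro!: mult_left_mono)
  also have "... = (NN m (%y. ennreal (q t x y) * (SUP i. V i) y))"
   by (simp add: SUP_mult_left_ennreal image_image)
  finally show ?case .
 qed
 then show ?thesis using tp by (simp add: kern_def)
qed

lemma kern_mono: "(!!y. f y <= g y) ==> kern t f x <= kern t g x"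
 by (auto simp: kern_def intro!: nn_integral_mono mult_left_mono)

lemma kern_cmult:
 assumes "f \<in> borel_measurable borel" "0 <= t"
 shows "kern t (%y. c * f y) x = c * kern t f x"
proof (cases "t = 0")
 case False
 then have t: "0 < t" using assms by simp
 note [measurable] = qp_measurable(1)[OF t]
 have [measurable]: "f \<in> borel_measurable m" using assms by (simp only: borel_m)
 show ?thesis using t by (simp add: kern_def mult.left_commute[of _ c] nn_integral_cmult)
qed simp

lemma kern_SUP:
 assumes f: "!!i. f i \<in> borel_measurable borel" and inc: "incseq f" and t: "0 <= t"
 shows "kern t (%y. SUP i::nat. f i y) x = (SUP i. kern t (f i) x)"
proof (cases "t = 0")
 case False
 then have tp: "0 < t" using t by simp
 note [measurable] = qp_measurable(1)[OF tp]
 have [measurable]: "f i \<in> borel_measurable m" for i using f by (simp only: borel_m)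
 have "(NN m (%y. ennreal (q t x y) * (SUP i. f i y))) = (NN m (%y. (SUP i. ennreal (q t x y) * f i y)))"
  by (simp add: SUP_mult_left_ennreal)
 also have "... = (SUP i. NN m (%y. ennreal (q t x y) * f i y))"
  using inc by (intro nn_integral_monotone_convergence_SUP) (auto simp: incseq_def le_fun_def intro!: mult_left_mono)
 finally show ?thesis using tp by (simp add: kern_def)
qed simp

lemma kern_U:
 assumes t: "0 <= t" and f: "f \<in> L2 m" "!!y. 0 <= f y"
 shows "kern t (%y. ennreal (f y)) x = ennreal (exp (lam0 * t) * U t f x)" "0 <= U t f x"
proof -
 have "kern t (%y. ennreal (f y)) x = ennreal (exp (lam0 * t) * U t f x) \<and> 0 <= U t f x"
 proof (cases "t = 0")
  case False
  then have tp: "0 < t" using t by simp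
  have q0: "0 <= q t x y" for y using q_pos[OF tp] less_imp_le by blast
  have "(NN m (%y. ennreal (q t x y) * ennreal (f y))) = ennreal (LINT y|m. q t x y * f y)"
   using q0 f(2) qf_integrable[OF tp f(1), of x]
   by (subst nn_integral_eq_integral[symmetric]) (auto simp: ennreal_mult')
  moreover have "0 <= (LINT y|m. q t x y * f y)" using q0 f(2) by (intro integral_nonneg_AE) auto
  ultimately show ?thesis using tp by (simp add: kern_def U_def mult.assoc[symmetric] exp_add[symmetric])
 qed (use f in simp)
 then show "kern t (%y. ennreal (f y)) x = ennreal (exp (lam0 * t) * U t f x)" "0 <= U t f x" by auto
qed

lemma U_lincomb:
 assumes "0 <= t" "f \<in> L2 m" "g \<in> L2 m"
 shows "U t (%y. c * f y + d * g y) x = c * U t f x + d * U t g x"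
proof (cases "t = 0")
 case False
 then have t: "0 < t" using assms by simp
 have "(LINT y|m. q t x y * (c * f y + d * g y)) = (LINT y|m. c * (q t x y * f y) + d * (q t x y * g y))"
  by (simp add: algebra_simps)
 also have "... = c * (LINT y|m. q t x y * f y) + d * (LINT y|m. q t x y * g y)"
  using qf_integrable[OF t assms(2), of x] qf_integrable[OF t assms(3), of x] by simp
 finally show ?thesis using t by (simp add: U_def algebra_simps)
qed simp

text \<open>The hypotheses on semigroup, compactness and generator speak about complex functions;
  this identity transfers them to the real operator \<open>U\<close>. Parts are integrated
  separately since \<open>f\<close> may be unbounded.\<close>

lemma mean_op_complex:
 assumes t: "0 < t" and f: "f \<in> L2 m"
 shows "mean_op \<xi> Q \<alpha> t (%x. complex_of_real (f x)) x = complex_of_real (exp (lam0 * t) * U t f x)"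
proof -
 interpret P: prob_space "Q (Some x)" by (rule prob_Q)
 have t0: "0 <= t" using t by simp
 have xi: "\<xi> t \<in> Q (Some x) \<rightarrow>\<^sub>M borel_on opc" by (rule xi_measurable[OF t0])
 have wm[measurable]: "weight t \<in> borel_measurable (Q (Some x))" by (rule weight_measurable[OF t0])
 have nonneg: "integrable (Q (Some x)) (%w. weight t w * ext g (\<xi> t w)) \<and>
   (LINT w|Q (Some x). weight t w * ext g (\<xi> t w)) = exp (lam0 * t) * U t g x"
  if g: "g \<in> L2 m" "!!y. 0 <= g y" for g
 proof -
  have gb: "g \<in> borel_measurable borel" using L2D(1)[OF g(1)] by (simp only: borel_m)
  have gm: "(%w. ext g (\<xi> t w)) \<in> borel_measurable (Q (Some x))"
   by (rule measurable_compose[OF xi measurable_ext[OF gb]])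
  have e0: "0 <= ext g z" for z using g(2) by (cases z) auto
  have "(NN (Q (Some x)) (%w. ennreal (weight t w * ext g (\<xi> t w)))) =
    (NN (Q (Some x)) (%w. ennreal (weight t w) * ext (%y. ennreal (g y)) (\<xi> t w)))"
   using weight_pos[of t] e0 by (intro nn_integral_cong) (auto simp: ennreal_mult' less_imp_le split: option.splits)
  also have "... = ennreal (exp (lam0 * t) * U t g x)"
   using nn_integral_weight[OF t0, of "%y. ennreal (g y)" x] kern_U(1)[OF t0 g, of x] gb by simp
  finally have *: "(NN (Q (Some x)) (%w. ennreal (weight t w * ext g (\<xi> t w)))) = ennreal (exp (lam0 * t) * U t g x)" .
  have w0: "0 <= weight t w * ext g (\<xi> t w)" for w using weight_pos[of t w] e0 by (simp add: less_imp_le)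
  have i: "integrable (Q (Some x)) (%w. weight t w * ext g (\<xi> t w))"
   by (rule integrableI_nonneg) (use gm w0 * in auto)
  show ?thesis
   using * w0 kern_U(2)[OF t0 g, of x] by (intro conjI i) (subst integral_eq_nn_integral, use gm in auto)
 qed
 have fpn: "(%y. max 0 (f y)) \<in> L2 m" "(%y. max 0 (- f y)) \<in> L2 m"
  using L2D(1)[OF f] by (auto intro!: L2_bound[OF f])
 have e: "ext f z = ext (%y. max 0 (f y)) z - ext (%y. max 0 (- f y)) z" for z by (cases z) auto
 have "(LINT w|Q (Some x). weight t w * ext f (\<xi> t w)) =
   exp (lam0 * t) * (1 * U t (%y. max 0 (f y)) x + (-1) * U t (%y. max 0 (- f y)) x)"
  unfolding e right_diff_distrib
  using nonneg[OF fpn(1)] nonneg[OF fpn(2)] by (subst Bochner_Integration.integral_diff) (auto simp: algebra_simps)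
 also have "... = exp (lam0 * t) * U t f x"
 proof -
  have "(%y. 1 * max 0 (f y) + (-1) * max 0 (- f y)) = f" by auto
  then show ?thesis using U_lincomb[OF t0 fpn, of 1 "-1" x] by simp
 qed
 finally have "(LINT w|Q (Some x). weight t w * ext f (\<xi> t w)) = exp (lam0 * t) * U t f x" .
 moreover have "weight t w *\<^sub>R ext (%x. complex_of_real (f x)) (\<xi> t w) = complex_of_real (weight t w * ext f (\<xi> t w))" for w
  by (cases "\<xi> t w") (auto simp: scaleR_conv_of_real)
 ultimately show ?thesis by (simp add: mean_weight del: of_real_mult)
qed

text \<open>The hypothesis gives the law almost everywhere, and both sides are continuous.\<close>

lemma U_semigroup:
 assumes s: "0 <= s" and t: "0 <= t" and f: "f \<in> L2 m"
 shows "U (s + t) f = U s (U t f)"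
proof (cases "s = 0 \<or> t = 0")
 case False
 then have s: "0 < s" and t: "0 < t" using s t by auto
 have fl: "(%x. complex_of_real (f x)) \<in> l2 m" using f by (simp add: of_real_l2_iff)
 have Ut: "U t f \<in> L2 m" using U_sq(1)[OF _ f, of t] t by simp
 have "AE x in m. mean_op \<xi> Q \<alpha> (s + t) (%x. complex_of_real (f x)) x = mean_op \<xi> Q \<alpha> s (mean_op \<xi> Q \<alpha> t (%x. complex_of_real (f x))) x"
  using C0_semigroup fl s t unfolding l2_C0_semigroup_def by (simp add: less_imp_le)
 moreover have "mean_op \<xi> Q \<alpha> t (%x. complex_of_real (f x)) = (%x. complex_of_real (exp (lam0 * t) * U t f x))"
  by (rule ext) (rule mean_op_complex[OF t f])
 ultimately have "AE x in m. complex_of_real (exp (lam0 * (s + t)) * U (s + t) f x) =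
   complex_of_real (exp (lam0 * s) * U s (%x. exp (lam0 * t) * U t f x) x)"
  using mean_op_complex[OF s L2_cmult[OF Ut], of "exp (lam0 * t)"] mean_op_complex[of "s + t" f] s t f by simp
 moreover have "U s (%x. exp (lam0 * t) * U t f x) x = exp (lam0 * t) * U s (U t f) x" for x
  using U_lincomb[OF _ Ut Ut, of s "exp (lam0 * t)" 0 x] s by simp
 ultimately have "AE x in m. complex_of_real (exp (lam0 * (s + t)) * U (s + t) f x) =
   complex_of_real (exp (lam0 * s) * (exp (lam0 * t) * U s (U t f) x))" by (simp only:)
 then have ae: "AE x in m. U (s + t) f x = U s (U t f) x"
 proof (rule AE_mp, intro AE_I2 impI)
  fix x
  assume "complex_of_real (exp (lam0 * (s + t)) * U (s + t) f x) =
   complex_of_real (exp (lam0 * s) * (exp (lam0 * t) * U s (U t f) x))"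
  then have "exp (lam0 * (s + t)) * U (s + t) f x = exp (lam0 * (s + t)) * U s (U t f) x"
   unfolding of_real_eq_iff by (simp add: distrib_left exp_add)
  then show "U (s + t) f x = U s (U t f) x" by simp
 qed
 have st: "0 < s + t" using s t by simp
 show ?thesis
  by (rule ext) (rule AE_continuous_eq[OF ae U_continuous[OF st f] U_continuous[OF s Ut]])
qed (use assms in auto)

text \<open>Truncation of the values at \<open>i\<close> and of the space to sets of finite measure
  increasing to everything. Monotone limits along such sequences carry \<open>L2\<close> statements
  to arbitrary nonnegative Borel functions.\<close>

lemma L2_approx:
 fixes f :: "'e => ennreal"
 assumes f: "f \<in> borel_measurable borel"
 obtains g :: "nat => 'e => real" where "!!i. g i \<in> L2 m" "!!i. bounded (range (g i))" "!!i y. 0 <= g i y"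
  "incseq (%i y. ennreal (g i y))" "!!y. f y = (SUP i. ennreal (g i y))"
proof -
 obtain A :: "nat => 'e set" where A: "range A \<subseteq> sets m" "(\<Union>i. A i) = space m" "!!i. emeasure m (A i) \<noteq> \<infinity>" "incseq A"
  by (rule m.sigma_finite_incseq) blast
 define g where "g i y = enn2real (min (of_nat i) (f y)) * indicator (A i) y" for i y
 have fin: "min (of_nat i) (f y) < \<top>" for i y by (simp add: min_less_iff_disj of_nat_less_top)
 have eg: "ennreal (g i y) = min (of_nat i) (f y) * indicator (A i) y" for i y
  using fin[of i y] by (cases "y \<in> A i") (auto simp: g_def ennreal_enn2real)
 have gb: "0 <= g i y" "g i y <= real i * indicator (A i) y" for i y
 proof -
  show "0 <= g i y" by (simp add: g_def)
  have "enn2real (min (of_nat i) (f y)) <= enn2real (of_nat i)" by (intro enn2real_mono) (auto simp: of_nat_less_top)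
  then show "g i y <= real i * indicator (A i) y" unfolding g_def by (intro mult_right_mono) auto
 qed
 have [measurable]: "f \<in> borel_measurable m" using f by (simp only: borel_m)
 have [measurable]: "A i \<in> sets m" for i using A(1) by auto
 have gm: "g i \<in> borel_measurable m" for i unfolding g_def[abs_def] by measurable
 show ?thesis
 proof (rule that[of g])
  show "g i \<in> L2 m" for i
  proof (rule L2_bound[OF _ gm])
   have "emeasure m (A i) < \<infinity>" using A(3)[of i] by (simp add: less_top)
   then show "(%y. real i * indicator (A i) y) \<in> L2 m"
    by (intro L2_cmult) (auto simp: L2_def power2_eq_square indicator_inter_arith[symmetric])
   show "\<bar>g i y\<bar> <= \<bar>real i * indicator (A i) y\<bar>" for y using gb[of i y] by simp
  qed
  show "bounded (range (g i))" for i
  proof (rule boundedI[of _ "real i"])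
   fix z assume "z \<in> range (g i)"
   then obtain y where "z = g i y" by auto
   then show "norm z <= real i" using gb[of i y] by (cases "y \<in> A i") auto
  qed
  show "0 <= g i y" for i y by (rule gb)
  show "incseq (%i y. ennreal (g i y))"
   unfolding eg incseq_def le_fun_def using A(4)
   by (auto simp: indicator_def incseq_def intro: min.coboundedI1)
  show "f y = (SUP i. ennreal (g i y))" for y
  proof (rule LIMSEQ_unique)
   show "(%i. ennreal (g i y)) \<longlonglongrightarrow> (SUP i. ennreal (g i y))"
    using \<open>incseq (%i y. ennreal (g i y))\<close> by (intro LIMSEQ_SUP) (auto simp: incseq_def le_fun_def)
   obtain i0 where i0: "y \<in> A i0" using A(2) space_m by auto
   have "\<forall>\<^sub>F i in sequentially. min (of_nat i) (f y) = ennreal (g i y)"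
    using eventually_ge_at_top[of i0]
   proof eventually_elim
    fix i assume "i0 <= i"
    then have "y \<in> A i" using A(4) i0 by (auto simp: incseq_def)
    then show "min (of_nat i) (f y) = ennreal (g i y)" by (simp add: eg)
   qed
   moreover have "(%i. min (of_nat i) (f y)) \<longlonglongrightarrow> min \<top> (f y)"
    by (intro tendsto_min tendsto_const of_nat_tendsto_top_ennreal)
   ultimately show "(%i. ennreal (g i y)) \<longlonglongrightarrow> f y"
    by (auto dest: Lim_transform_eventually)
  qed
 qed
qed

lemma kern_semigroup:
 assumes s: "0 <= s" and t: "0 <= t" and f: "f \<in> borel_measurable borel"
 shows "kern (s + t) f x = kern s (kern t f) x"
proof -
 obtain g :: "nat => 'e => real" where g: "!!i. g i \<in> L2 m" "!!i. bounded (range (g i))" "!!i y. 0 <= g i y"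
  "incseq (%i y. ennreal (g i y))" "!!y. f y = (SUP i. ennreal (g i y))"
  using L2_approx[OF f] by metis
 have gm: "(%y. ennreal (g i y)) \<in> borel_measurable borel" for i
  using L2D(1)[OF g(1)[of i]] unfolding borel_m by measurable
 have fS: "f = (%y. SUP i. ennreal (g i y))" using g(5) by auto
 have one: "kern (s + t) (%y. ennreal (g i y)) x = kern s (kern t (%y. ennreal (g i y))) x" for i
 proof -
  have Ug: "U t (g i) \<in> L2 m" by (rule U_sq(1)[OF t g(1)])
  have "kern s (kern t (%y. ennreal (g i y))) x = kern s (%y. ennreal (exp (lam0 * t) * U t (g i) y)) x"
  proof -
   have "kern t (%y. ennreal (g i y)) = (%y. ennreal (exp (lam0 * t) * U t (g i) y))"
    by (rule ext) (rule kern_U(1)[OF t g(1,3)])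
   then show ?thesis by (simp only:)
  qed
  also have "... = ennreal (exp (lam0 * s) * U s (%y. exp (lam0 * t) * U t (g i) y) x)"
   using kern_U(2)[OF t g(1,3)] by (intro kern_U(1) s L2_cmult Ug) auto
  also have "U s (%y. exp (lam0 * t) * U t (g i) y) x = exp (lam0 * t) * U (s + t) (g i) x"
   using U_lincomb[OF s Ug Ug, of "exp (lam0 * t)" 0 x] U_semigroup[OF s t g(1)] by simp
  also have "exp (lam0 * s) * (exp (lam0 * t) * U (s + t) (g i) x) = exp (lam0 * (s + t)) * U (s + t) (g i) x"
   by (simp add: distrib_left exp_add)
  also have "ennreal ... = kern (s + t) (%y. ennreal (g i y)) x"
   using s t by (intro kern_U(1)[symmetric] g) auto
  finally show ?thesis by simp
 qed
 have inc: "incseq (%i. kern t (%y. ennreal (g i y)))"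
  using g(4) by (auto simp: incseq_def le_fun_def intro!: kern_mono)
 have "kern t f = (%z. SUP i. kern t (%y. ennreal (g i y)) z)"
  unfolding fS using kern_SUP[OF gm g(4) t] by auto
 then have "kern s (kern t f) x = (SUP i. kern s (kern t (%y. ennreal (g i y))) x)"
  using kern_SUP[OF kern_measurable[OF t gm] inc s] by simp
 also have "... = (SUP i. kern (s + t) (%y. ennreal (g i y)) x)" by (simp add: one)
 also have "... = kern (s + t) f x"
  unfolding fS using s t by (intro kern_SUP[OF gm g(4), symmetric]) simp
 finally show ?thesis by simp
qed

end

section \<open>Eigenfunctions, compactness and geometric decay\<close>

context supercritical_setting
begin

lemma eigenfunctions_L2: "phi0 \<in> L2 m" "phih0 \<in> L2 m"
 using eigenfunction dual_eigenfunction by (auto simp: l2_generator_def of_real_l2_iff)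

text \<open>The eigenvalue equation is a derivative at zero of the unscaled semigroup. Multiplying
  by \<open>exp (- lam0 * h)\<close> removes the linear term, so that the rescaled orbit moves by
  \<open>o(h)\<close>; this is the input for \<open>telescoping_zero\<close>.\<close>

lemma small_o_of_generator:
 fixes g :: "'e => real" and V :: "real => 'e => real"
 assumes g: "g \<in> L2 m" and V: "!!h. 0 < h ==> V h \<in> L2 m"
  and lim: "((%h. l2_norm m (%x. complex_of_real ((exp (lam0 * h) * V h x - g x) / h - lam0 * g x))) \<longlongrightarrow> 0) (at_right 0)"
 shows "((%h. C * sqrt (sq_int m (%x. V h x - g x)) / h) \<longlongrightarrow> 0) (at_right 0)"
proof -
 define R where "R h x = (exp (lam0 * h) * V h x - g x) / h - lam0 * g x" for h x
 \<comment> \<open>What the rescaling leaves of the first-order expansion; the numerator is of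
   second order in \<open>h\<close>.\<close>
 define a where "a h = (exp (- lam0 * h) * (1 + lam0 * h) - 1) / h" for h :: real
 have a: "(a \<longlongrightarrow> 0) (at_right 0)" unfolding a_def by real_asymp
 have e: "((%h :: real. exp (- lam0 * h)) \<longlongrightarrow> 1) (at_right 0)" by real_asymp
 have R: "R h \<in> L2 m" if "0 < h" for h
 proof -
  have "R h = (%x. (exp (lam0 * h) / h) * V h x + (- 1 / h - lam0) * g x)"
   by (auto simp: R_def fun_eq_iff diff_divide_distrib algebra_simps)
  then show ?thesis using L2_lincomb[OF V[OF that] g, of "exp (lam0 * h) / h" "- 1 / h - lam0"] by simp
 qed
 have nR: "((%h. sq_int m (R h)) \<longlongrightarrow> 0) (at_right 0)"
 proof -
  have "((%h. (sqrt (sq_int m (R h)))^2) \<longlongrightarrow> 0^2) (at_right 0)"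
   using lim unfolding l2_norm_of_real R_def by (intro tendsto_intros)
  then show ?thesis by simp
 qed
 have bound: "sq_int m (%x. V h x - g x) / h^2 <= 2 * (exp (- lam0 * h))^2 * sq_int m (R h) + 2 * (a h)^2 * sq_int m g" if h: "0 < h" for h
 proof -
  have "V h x - g x = (exp (- lam0 * h) * h) * R h x + (a h * h) * g x" for x
  proof -
   have "(exp (- lam0 * h) * h) * R h x = exp (- lam0 * h) * (exp (lam0 * h) * V h x - g x) - exp (- lam0 * h) * h * lam0 * g x"
    using h by (simp add: R_def field_simps)
   also have "exp (- lam0 * h) * (exp (lam0 * h) * V h x - g x) = V h x - exp (- lam0 * h) * g x"
    by (simp add: right_diff_distrib mult.assoc[symmetric] exp_add[symmetric])
   finally have 1: "(exp (- lam0 * h) * h) * R h x = V h x - exp (- lam0 * h) * g x - exp (- lam0 * h) * h * lam0 * g x" .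
   have 2: "a h * h = exp (- lam0 * h) * (1 + lam0 * h) - 1" using h by (simp add: a_def)
   show ?thesis unfolding 1 2 by (simp add: algebra_simps)
  qed
  then have "sq_int m (%x. V h x - g x) <= 2 * sq_int m (%x. (exp (- lam0 * h) * h) * R h x) + 2 * sq_int m (%x. (a h * h) * g x)"
   using sq_int_add_le[OF L2_cmult[OF R[OF h]] L2_cmult[OF g]] by simp
  also have "... = (2 * (exp (- lam0 * h))^2 * sq_int m (R h) + 2 * (a h)^2 * sq_int m g) * h^2"
   by (simp only: sq_int_cmult power_mult_distrib) (simp add: algebra_simps)
  finally show ?thesis using h by (simp add: divide_le_eq)
 qed
 have "((%h. sq_int m (%x. V h x - g x) / h^2) \<longlongrightarrow> 0) (at_right 0)"
 proof (rule tendsto_sandwich[OF _ _ tendsto_const])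
  have "((%h. 2 * (exp (- lam0 * h))^2 * sq_int m (R h) + 2 * (a h)^2 * sq_int m g) \<longlongrightarrow> 2 * 1^2 * 0 + 2 * 0^2 * sq_int m g) (at_right 0)"
   by (intro tendsto_intros a e nR)
  then show "((%h. 2 * (exp (- lam0 * h))^2 * sq_int m (R h) + 2 * (a h)^2 * sq_int m g) \<longlongrightarrow> 0) (at_right 0)" by simp
  show "\<forall>\<^sub>F h in at_right 0. sq_int m (%x. V h x - g x) / h^2 <= 2 * (exp (- lam0 * h))^2 * sq_int m (R h) + 2 * (a h)^2 * sq_int m g"
   using eventually_at_right_less[of 0] by eventually_elim (rule bound)
 qed (auto intro!: always_eventually)
 then have "((%h. C * sqrt (sq_int m (%x. V h x - g x) / h^2)) \<longlongrightarrow> C * sqrt 0) (at_right 0)"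
  by (intro tendsto_intros)
 then have "((%h. C * sqrt (sq_int m (%x. V h x - g x) / h^2)) \<longlongrightarrow> 0) (at_right 0)" by simp
 moreover have "\<forall>\<^sub>F h in at_right 0. C * sqrt (sq_int m (%x. V h x - g x) / h^2) = C * sqrt (sq_int m (%x. V h x - g x)) / h"
  using eventually_at_right_less[of 0] by eventually_elim (simp add: real_sqrt_divide)
 ultimately show ?thesis by (rule Lim_transform_eventually)
qed

lemma U_uniform_bound:
 assumes "0 <= s" "s <= t" "f \<in> L2 m"
 shows "sq_int m (U s f) <= exp (2 * (K + \<bar>lam0\<bar>) * t) * sq_int m f"
proof -
 have "sq_int m (U s f) <= exp (2 * (K - lam0) * s) * sq_int m f" by (rule U_sq(2)[OF assms(1,3)])
 also have "2 * (K - lam0) * s <= 2 * (K + \<bar>lam0\<bar>) * t" using assms(1,2) K_nonneg by (intro mult_mono[of "2 * (K - lam0)"]) auto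
 then have "exp (2 * (K - lam0) * s) * sq_int m f <= exp (2 * (K + \<bar>lam0\<bar>) * t) * sq_int m f"
  by (intro mult_right_mono) auto
 finally show ?thesis .
qed

text \<open>The orbit of \<open>phi0\<close> is paired with the fixed function \<psi>, the very
  displacement \<open>U t phi0 - phi0\<close>. The pairing changes by \<open>o(h)\<close> per step,
  hence not at all, while its total change is the squared norm of \<psi>. Continuity then gives
  equality everywhere.\<close>

lemma U_phi0:
 assumes t: "0 <= t"
 shows "U t phi0 = phi0"
proof (cases "t = 0")
 case False
 then have t: "0 < t" using t by simp
 note phi = eigenfunctions_L2(1)
 define \<psi> where "\<psi> x = U t phi0 x - phi0 x" for x
 have Uphi: "U s phi0 \<in> L2 m" if "0 <= s" for s using U_sq(1)[OF that phi] .
 have \<psi>: "\<psi> \<in> L2 m" unfolding \<psi>_def[abs_def] using t by (intro L2_diff Uphi phi) simp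
 define C where "C = sqrt (sq_int m \<psi> * exp (2 * (K + \<bar>lam0\<bar>) * t))"
 define \<Phi> where "\<Phi> s = (LINT x|m. \<psi> x * U s phi0 x)" for s
 have "\<Phi> t = \<Phi> 0"
 proof (rule telescoping_zero[OF t])
  have "((%h. l2_norm m (%x. complex_of_real ((exp (lam0 * h) * U h phi0 x - phi0 x) / h - lam0 * phi0 x))) \<longlongrightarrow> 0) (at_right 0)"
  proof (rule Lim_transform_eventually)
   show "((%h. l2_norm m (%x. (mean_op \<xi> Q \<alpha> h (%x. complex_of_real (phi0 x)) x - complex_of_real (phi0 x)) / complex_of_real h - complex_of_real (lam0 * phi0 x))) \<longlongrightarrow> 0) (at_right 0)"
    using eigenfunction unfolding l2_generator_def by blast
   show "\<forall>\<^sub>F h in at_right 0. l2_norm m (%x. (mean_op \<xi> Q \<alpha> h (%x. complex_of_real (phi0 x)) x - complex_of_real (phi0 x)) / complex_of_real h - complex_of_real (lam0 * phi0 x)) =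
     l2_norm m (%x. complex_of_real ((exp (lam0 * h) * U h phi0 x - phi0 x) / h - lam0 * phi0 x))"
    using eventually_at_right_less[of 0] by eventually_elim (simp add: mean_op_complex[OF _ phi])
  qed
  from small_o_of_generator[OF phi _ this, of C] Uphi
  show "((%h. C * sqrt (sq_int m (%x. U h phi0 x - phi0 x)) / h) \<longlongrightarrow> 0) (at_right 0)" by simp
 next
  fix h :: real and j assume h: "0 < h" and j: "real (Suc j) * h <= t"
  have jh: "0 <= real j * h" "real j * h <= t" using h j by (auto simp: algebra_simps)
  have d: "(%x. U h phi0 x - phi0 x) \<in> L2 m" using h by (intro L2_diff Uphi phi) simp
  have "real (Suc j) * h = real j * h + h" by (simp add: algebra_simps)
  then have "U (real (Suc j) * h) phi0 = U (real j * h) (U h phi0)" using U_semigroup[OF jh(1) _ phi, of h] h by simp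
  then have "U (real (Suc j) * h) phi0 x - U (real j * h) phi0 x = U (real j * h) (%x. U h phi0 x - phi0 x) x" for x
   using U_lincomb[OF jh(1) Uphi phi, of h 1 "-1" x] h by simp
  then have "\<Phi> (real (Suc j) * h) - \<Phi> (real j * h) = (LINT x|m. \<psi> x * U (real j * h) (%x. U h phi0 x - phi0 x) x)"
   unfolding \<Phi>_def using L2_mult[OF \<psi> Uphi] jh h
   by (subst Bochner_Integration.integral_diff[symmetric]) (auto simp: right_diff_distrib[symmetric])
  then have "\<bar>\<Phi> (real (Suc j) * h) - \<Phi> (real j * h)\<bar>^2 <= sq_int m \<psi> * sq_int m (U (real j * h) (%x. U h phi0 x - phi0 x))"
   using cauchy_schwarz_integral[OF \<psi> U_sq(1)[OF jh(1) d]] by simp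
  also have "... <= sq_int m \<psi> * (exp (2 * (K + \<bar>lam0\<bar>) * t) * sq_int m (%x. U h phi0 x - phi0 x))"
   by (intro mult_left_mono U_uniform_bound jh d) simp
  also have "... = (C * sqrt (sq_int m (%x. U h phi0 x - phi0 x)))^2"
   by (simp add: C_def power_mult_distrib)
  finally show "\<bar>\<Phi> (real (Suc j) * h) - \<Phi> (real j * h)\<bar> <= C * sqrt (sq_int m (%x. U h phi0 x - phi0 x))"
   by (rule power2_le_imp_le) (simp add: C_def)
 qed
 moreover have "\<Phi> t - \<Phi> 0 = sq_int m \<psi>"
 proof -
  have "\<Phi> t - \<Phi> 0 = (LINT x|m. \<psi> x * U t phi0 x - \<psi> x * phi0 x)"
   unfolding \<Phi>_def using L2_mult[OF \<psi> Uphi[of t]] L2_mult[OF \<psi> phi] t by simp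
  then show ?thesis by (simp add: \<psi>_def sq_int_def power2_eq_square right_diff_distrib)
 qed
 ultimately have "AE x in m. \<psi> x = 0" using sq_int_eq_0_iff[OF \<psi>] by simp
 then have "AE x in m. U t phi0 x = phi0 x" by eventually_elim (simp add: \<psi>_def)
 then show ?thesis
  using AE_continuous_eq[OF _ U_continuous[OF t phi] eigenfunctions_continuous(1)] by (intro ext)
qed simp

definition U_dual :: "real => ('e => real) => 'e => real" where
 "U_dual t g x = exp (- lam0 * t) * (LINT y|m. q t y x * g y)"

lemma U_dual_pairing:
 assumes t: "0 < t" and f: "f \<in> L2 m" and g: "g \<in> L2 m" "!!x. 0 <= g x"
  and Ud: "U_dual t g \<in> L2 m"
 shows "(LINT x|m. U_dual t g x * f x) = (LINT x|m. g x * U t f x)"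
proof -
 interpret pair_sigma_finite m m ..
 have t0: "0 <= t" using t by simp
 note [measurable] = qp_pair_measurable(1)[OF t] L2D(1)[OF f] L2D(1)[OF g(1)]
 have q0: "0 <= q t x y" for x y using q_pos[OF t] less_imp_le by blast
 have gq: "integrable m (%y. q t y x * g y)" for x
  by (intro L2_mult q_L2 t g)
 have nonneg: "(LINT x|m. U_dual t g x * f x) = (LINT x|m. g x * U t f x)"
  if f: "f \<in> L2 m" "!!x. 0 <= f x" for f
 proof -
  note [measurable] = L2D(1)[OF f(1)]
  have Ud0: "0 <= U_dual t g x" for x
   unfolding U_dual_def using q0 g(2) by (intro mult_nonneg_nonneg integral_nonneg_AE) auto
  have U0: "0 <= U t f x" for x by (rule kern_U(2)[OF t0 f])
  have "ennreal (LINT x|m. U_dual t g x * f x) = (NN m (%x. ennreal (U_dual t g x * f x)))"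
   using Ud0 f(2) by (intro nn_integral_eq_integral[symmetric] L2_mult Ud f(1)) auto
  also have "... = (NN m (%x. (NN m (%y. ennreal (exp (- lam0 * t)) * ennreal (q t y x * g y * f x)))))"
  proof (intro nn_integral_cong)
   fix x
   have "(NN m (%y. ennreal (exp (- lam0 * t)) * ennreal (q t y x * g y * f x))) = (NN m (%y. ennreal (exp (- lam0 * t) * f x * (q t y x * g y))))"
    using q0 g(2) f(2) by (intro nn_integral_cong) (auto simp: ennreal_mult'[symmetric] algebra_simps)
   also have "... = ennreal (LINT y|m. exp (- lam0 * t) * f x * (q t y x * g y))"
    using q0 g(2) f(2) gq[of x] by (intro nn_integral_eq_integral) auto
   also have "... = ennreal (exp (- lam0 * t) * f x * (LINT y|m. q t y x * g y))" by (simp only: integral_mult_right_zero)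
   also have "... = ennreal (U_dual t g x * f x)" by (simp add: U_dual_def mult_ac)
   finally show "ennreal (U_dual t g x * f x) = (NN m (%y. ennreal (exp (- lam0 * t)) * ennreal (q t y x * g y * f x)))" by simp
  qed
  also have "... = (NN m (%y. (NN m (%x. ennreal (exp (- lam0 * t)) * ennreal (q t y x * g y * f x)))))"
   by (rule Fubini') measurable
  also have "... = (NN m (%y. ennreal (g y * U t f y)))"
  proof (intro nn_integral_cong)
   fix y
   have "(NN m (%x. ennreal (exp (- lam0 * t)) * ennreal (q t y x * g y * f x))) = (NN m (%x. ennreal (exp (- lam0 * t) * g y * (q t y x * f x))))"
    using q0 g(2) f(2) by (intro nn_integral_cong) (auto simp: ennreal_mult'[symmetric] algebra_simps)
   also have "... = ennreal (LINT x|m. exp (- lam0 * t) * g y * (q t y x * f x))"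
    using q0 g(2) f(2) qf_integrable[OF t f(1)] by (intro nn_integral_eq_integral) auto
   also have "... = ennreal (exp (- lam0 * t) * g y * (LINT x|m. q t y x * f x))" by (simp only: integral_mult_right_zero)
   also have "... = ennreal (g y * U t f y)" using t by (simp add: U_def mult_ac)
   finally show "(NN m (%x. ennreal (exp (- lam0 * t)) * ennreal (q t y x * g y * f x))) = ennreal (g y * U t f y)" .
  qed
  also have "... = ennreal (LINT x|m. g x * U t f x)"
   using g(2) U0 by (intro nn_integral_eq_integral L2_mult U_sq(1)[OF t0] f g(1)) auto
  finally show ?thesis
   using Ud0 U0 f(2) g(2) by (subst (asm) ennreal_inj) (auto intro!: integral_nonneg_AE)
 qed
 have fpn: "(%y. max 0 (f y)) \<in> L2 m" "(%y. max 0 (- f y)) \<in> L2 m"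
  using L2D(1)[OF f] by (auto intro!: L2_bound[OF f])
 have fe: "f = (%y. 1 * max 0 (f y) + (-1) * max 0 (- f y))" by auto
 have Uf: "U t f x = U t (%y. max 0 (f y)) x - U t (%y. max 0 (- f y)) x" for x
  using U_lincomb[OF t0 fpn, of 1 "-1" x] fe by simp
 have "(LINT x|m. U_dual t g x * f x) = (LINT x|m. U_dual t g x * max 0 (f x) - U_dual t g x * max 0 (- f x))"
  by (intro integral_cong refl) (auto simp: max_def)
 also have "... = (LINT x|m. U_dual t g x * max 0 (f x)) - (LINT x|m. U_dual t g x * max 0 (- f x))"
  by (intro Bochner_Integration.integral_diff L2_mult Ud fpn)
 also have "... = (LINT x|m. g x * U t (%y. max 0 (f y)) x) - (LINT x|m. g x * U t (%y. max 0 (- f y)) x)"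
  using nonneg[OF fpn(1)] nonneg[OF fpn(2)] by simp
 also have "... = (LINT x|m. g x * U t (%y. max 0 (f y)) x - g x * U t (%y. max 0 (- f y)) x)"
  by (intro Bochner_Integration.integral_diff[symmetric] L2_mult g U_sq(1)[OF t0] fpn)
 also have "... = (LINT x|m. g x * U t f x)" by (simp add: Uf right_diff_distrib)
 finally show ?thesis .
qed

lemma weight_phih0_invariant:
 assumes t: "0 <= t" and f: "f \<in> L2 m"
 shows "(LINT x|m. phih0 x * U t f x) = (LINT x|m. phih0 x * f x)"
proof (cases "t = 0")
 case False
 then have t: "0 < t" using t by simp
 note phi = eigenfunctions_L2(2)
 define C where "C = sqrt (exp (2 * (K + \<bar>lam0\<bar>) * t) * sq_int m f)"
 define \<Phi> where "\<Phi> s = (LINT x|m. phih0 x * U s f x)" for s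
 have lim: "((%h. l2_norm m (%x. complex_of_real ((exp (lam0 * h) * U_dual h phih0 x - phih0 x) / h - lam0 * phih0 x))) \<longlongrightarrow> 0) (at_right 0)"
 proof -
  have "dual_op m q h (%x. complex_of_real (phih0 x)) x = complex_of_real (exp (lam0 * h) * U_dual h phih0 x)" for h x
   by (simp add: dual_op_def U_dual_def scaleR_conv_of_real mult.assoc[symmetric] exp_add[symmetric] flip: of_real_mult)
  then show ?thesis
   using dual_eigenfunction unfolding l2_generator_def by (simp del: of_real_mult)
 qed
 have Ud: "U_dual h phih0 \<in> L2 m" if h: "0 < h" for h
 proof -
  have q2: "(%y. q h y x) \<in> L2 m" for x using q_L2(2)[OF h] .
  have [measurable]: "U_dual h phih0 \<in> borel_measurable m"
  proof -
   have [measurable]: "(%z. q h (snd z) (fst z)) \<in> borel_measurable (m \<Otimes>\<^sub>M m)"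
    using measurable_compose[OF _ qp_pair_measurable(1)[OF h], of "%z. (snd z, fst z)" "m \<Otimes>\<^sub>M m"] by simp
   have [measurable]: "phih0 \<in> borel_measurable m" by (rule L2D(1)[OF phi])
   show ?thesis unfolding U_dual_def[abs_def] by measurable
  qed
  \<comment> \<open>\<open>|U_dual h phih0|^2\<close> is dominated pointwise by a multiple of the integrable function \<open>dual_sq_mass\<close>.\<close>
  have pt: "(U_dual h phih0 x)^2 <= ((exp (- lam0 * h))^2 * (exp (K * h))^2 * sq_int m phih0) * dual_sq_mass m p h x" for x
  proof -
   have "(LINT y|m. q h y x * phih0 y)^2 <= sq_int m (%y. q h y x) * sq_int m phih0"
    by (rule cauchy_schwarz_integral[OF q2 phi])
   also have "sq_int m (%y. q h y x) <= sq_int m (%y. exp (K * h) * p h y x)"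
   proof (rule sq_int_mono)
    show "\<bar>q h y x\<bar> <= \<bar>exp (K * h) * p h y x\<bar>" for y
     using q_p_bounds(2)[OF h, of y x] q_pos[OF h, of y x] by linarith
   qed (auto intro!: L2_cmult p_L2 qp_measurable h)
   also have "... = (exp (K * h))^2 * dual_sq_mass m p h x"
    by (simp add: sq_int_cmult dual_sq_mass_def sq_int_def)
   finally have "(LINT y|m. q h y x * phih0 y)^2 <= (exp (K * h))^2 * dual_sq_mass m p h x * sq_int m phih0"
    by (simp add: mult_right_mono)
   then have "(exp (- lam0 * h))^2 * (LINT y|m. q h y x * phih0 y)^2 <= (exp (- lam0 * h))^2 * ((exp (K * h))^2 * dual_sq_mass m p h x * sq_int m phih0)"
    by (intro mult_left_mono) auto
   then show ?thesis by (simp add: U_dual_def power_mult_distrib algebra_simps)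
  qed
  have "integrable m (%x. (U_dual h phih0 x)^2)"
  proof (rule integrable_bound)
   show "integrable m (%x. ((exp (- lam0 * h))^2 * (exp (K * h))^2 * sq_int m phih0) * dual_sq_mass m p h x)"
    using dual_sq_mass_L1[OF h] by simp
   show "AE x in m. norm ((U_dual h phih0 x)^2) <= norm (((exp (- lam0 * h))^2 * (exp (K * h))^2 * sq_int m phih0) * dual_sq_mass m p h x)"
    using pt by (intro AE_I2) (auto intro: order_trans[OF _ abs_ge_self])
  qed measurable
  then show ?thesis by (simp add: L2_def)
 qed
 \<comment> \<open>By duality the step of length \<open>h\<close> is moved onto
   \<open>phih0\<close>, where the generator of the dual semigroup shows that it is
   \<open>o(h)\<close>.\<close>
 have "\<Phi> t = \<Phi> 0"
 proof (rule telescoping_zero[OF t small_o_of_generator[OF phi Ud lim, of C]])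
  fix h :: real and j assume h: "0 < h" and j: "real (Suc j) * h <= t"
  have jh: "0 <= real j * h" "real j * h <= t" using h j by (auto simp: algebra_simps)
  have g: "U (real j * h) f \<in> L2 m" by (rule U_sq(1)[OF jh(1) f])
  have d: "(%x. U_dual h phih0 x - phih0 x) \<in> L2 m" by (intro L2_diff Ud h phi)
  have "real (Suc j) * h = h + real j * h" by (simp add: algebra_simps)
  then have "\<Phi> (real (Suc j) * h) = (LINT x|m. phih0 x * U h (U (real j * h) f) x)"
   unfolding \<Phi>_def using U_semigroup[OF _ jh(1) f, of h] h by simp
  also have "... = (LINT x|m. U_dual h phih0 x * U (real j * h) f x)"
   using U_dual_pairing[OF h g phi _ Ud[OF h]] eigenfunctions_pos(2) by (simp add: less_imp_le)
  finally have "\<Phi> (real (Suc j) * h) - \<Phi> (real j * h) = (LINT x|m. (U_dual h phih0 x - phih0 x) * U (real j * h) f x)"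
   unfolding \<Phi>_def using L2_mult[OF Ud[OF h] g] L2_mult[OF phi g]
   by (simp add: left_diff_distrib)
  then have "\<bar>\<Phi> (real (Suc j) * h) - \<Phi> (real j * h)\<bar>^2 <= sq_int m (%x. U_dual h phih0 x - phih0 x) * sq_int m (U (real j * h) f)"
   using cauchy_schwarz_integral[OF d g] by simp
  also have "... <= sq_int m (%x. U_dual h phih0 x - phih0 x) * (exp (2 * (K + \<bar>lam0\<bar>) * t) * sq_int m f)"
   by (intro mult_left_mono U_uniform_bound jh f) simp
  also have "... = (C * sqrt (sq_int m (%x. U_dual h phih0 x - phih0 x)))^2"
   by (simp add: C_def power_mult_distrib)
  finally show "\<bar>\<Phi> (real (Suc j) * h) - \<Phi> (real j * h)\<bar> <= C * sqrt (sq_int m (%x. U_dual h phih0 x - phih0 x))"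
   by (rule power2_le_imp_le) (simp add: C_def)
 qed
 then show ?thesis by (simp add: \<Phi>_def)
qed simp

text \<open>The subsequence converges in complex \<open>L2\<close>; taking real parts does not
  increase the norm, and rescaling only multiplies it by a constant.\<close>

lemma compact_U:
 assumes t: "0 < t" and f: "!!k::nat. f k \<in> L2 m" and b: "!!k. sq_int m (f k) <= c"
 shows "\<exists>g\<in>L2 m. \<exists>r. strict_mono r \<and> (%k. sq_int m (%x. U t (f (r k)) x - g x)) \<longlonglongrightarrow> 0"
proof -
 have "bounded (range (%k. l2_norm m (%x. complex_of_real (f k x))))"
  using b by (intro boundedI[of _ "sqrt c"]) (auto simp: l2_norm_of_real)
 moreover have "\<forall>k. (%x. complex_of_real (f k x)) \<in> l2 m" using f by (simp add: of_real_l2_iff)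
 ultimately obtain G r where G: "G \<in> l2 m" and r: "strict_mono r"
  and lim: "(%k. l2_norm m (%x. mean_op \<xi> Q \<alpha> t (%x. complex_of_real (f (r k) x)) x - G x)) \<longlonglongrightarrow> 0"
  using compact_T[OF t, unfolded l2_compact_operator_def, THEN conjunct2, THEN spec[of _ "%k x. complex_of_real (f k x)"]]
  by blast
 define c' where "c' = exp (- lam0 * t)"
 define g where "g x = c' * Re (G x)" for x
 have Gm: "G \<in> borel_measurable m" and Gi: "integrable m (%x. (cmod (G x))^2)" using G by (auto simp: l2_def)
 have ReG: "(%x. Re (G x)) \<in> L2 m"
 proof -
  have [measurable]: "(%x. Re (G x)) \<in> borel_measurable m" using Gm by measurable
  have "integrable m (%x. (Re (G x))^2)"
   by (rule integrable_bound[OF Gi]) (auto intro!: AE_I2 simp: abs_le_square_iff[symmetric] abs_Re_le_cmod)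
  then show ?thesis by (simp add: L2_def)
 qed
 have g: "g \<in> L2 m" unfolding g_def[abs_def] by (rule L2_cmult[OF ReG])
 have le: "sq_int m (%x. U t (f (r k)) x - g x) <= c'^2 * (l2_norm m (%x. mean_op \<xi> Q \<alpha> t (%x. complex_of_real (f (r k) x)) x - G x))^2" for k
 proof -
  have Uf: "U t (f (r k)) \<in> L2 m" using U_sq(1)[OF _ f] t by simp
  let ?D = "%x. complex_of_real (exp (lam0 * t) * U t (f (r k)) x) - G x"
  have D: "mean_op \<xi> Q \<alpha> t (%x. complex_of_real (f (r k) x)) x - G x = ?D x" for x
   by (simp add: mean_op_complex[OF t f])
  have [measurable]: "U t (f (r k)) \<in> borel_measurable m" "G \<in> borel_measurable m" using L2D(1)[OF Uf] Gm .
  have iD: "integrable m (%x. (cmod (?D x))^2)"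
  proof (rule integrable_bound)
   show "integrable m (%x. 2 * (exp (lam0 * t) * U t (f (r k)) x)^2 + 2 * (cmod (G x))^2)"
    using L2D(2)[OF L2_cmult[OF Uf]] Gi by simp
   show "AE x in m. norm ((cmod (?D x))^2) <= norm (2 * (exp (lam0 * t) * U t (f (r k)) x)^2 + 2 * (cmod (G x))^2)"
   proof (rule AE_I2)
    fix x
    have "cmod (?D x) <= \<bar>exp (lam0 * t) * U t (f (r k)) x\<bar> + cmod (G x)"
     using norm_triangle_ineq4[of "complex_of_real (exp (lam0 * t) * U t (f (r k)) x)" "G x"] by (simp del: of_real_mult)
    then have "(cmod (?D x))^2 <= (\<bar>exp (lam0 * t) * U t (f (r k)) x\<bar> + cmod (G x))^2"
     by (intro power_mono) auto
    also have "... <= 2 * (exp (lam0 * t) * U t (f (r k)) x)^2 + 2 * (cmod (G x))^2"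
     using sum_squares_bound[of "\<bar>exp (lam0 * t) * U t (f (r k)) x\<bar>" "cmod (G x)"]
     by (simp add: power2_sum)
    finally show "norm ((cmod (?D x))^2) <= norm (2 * (exp (lam0 * t) * U t (f (r k)) x)^2 + 2 * (cmod (G x))^2)" by simp
   qed
  qed measurable
  have "sq_int m (%x. U t (f (r k)) x - g x) <= (LINT x|m. c'^2 * (cmod (?D x))^2)"
   unfolding sq_int_def
  proof (rule integral_mono)
   show "integrable m (%x. (U t (f (r k)) x - g x)^2)" by (rule L2D(2)[OF L2_diff[OF Uf g]])
   show "integrable m (%x. c'^2 * (cmod (?D x))^2)" using iD by simp
   fix x
   have "U t (f (r k)) x - g x = c' * Re (?D x)"
    by (simp add: g_def c'_def right_diff_distrib mult.assoc[symmetric] exp_add[symmetric])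
   then have "(U t (f (r k)) x - g x)^2 = c'^2 * (Re (?D x))^2" by (simp only: power_mult_distrib)
   also have "... <= c'^2 * (cmod (?D x))^2"
    using abs_Re_le_cmod[of "?D x"] by (intro mult_left_mono) (simp_all add: abs_le_square_iff[symmetric])
   finally show "(U t (f (r k)) x - g x)^2 <= c'^2 * (cmod (?D x))^2" .
  qed
  also have "... = c'^2 * (l2_norm m ?D)^2" by (simp add: l2_norm_def integral_nonneg_AE)
  finally show ?thesis by (simp only: D)
 qed
 have "(%k. sq_int m (%x. U t (f (r k)) x - g x)) \<longlonglongrightarrow> 0"
 proof (rule tendsto_sandwich[OF _ _ tendsto_const])
  show "(%k. c'^2 * (l2_norm m (%x. mean_op \<xi> Q \<alpha> t (%x. complex_of_real (f (r k) x)) x - G x))^2) \<longlonglongrightarrow> 0"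
   using tendsto_mult[OF tendsto_const tendsto_power[OF lim, of 2], of "c'^2"] by simp
 qed (use le in auto)
 then show ?thesis using g r by blast
qed

lemma U_cong_zero:
 assumes "0 < t" "f \<in> L2 m" "AE x in m. f x = 0"
 shows "U t f x = 0"
proof -
 have "AE y in m. q t x y * f y = 0" using assms(3) by eventually_elim simp
 then have "(LINT y|m. q t x y * f y) = 0" by (rule integral_eq_zero_AE)
 then show ?thesis using assms(1) by (simp add: U_def)
qed

lemma U_strictly_positive:
 assumes t: "0 < t" and f: "f \<in> L2 m" "!!x. 0 <= f x" "\<not> (AE x in m. f x = 0)"
 shows "0 < U t f x"
proof -
 have nn: "0 <= q t x y * f y" for y using q_pos[OF t, of x y] f(2)[of y] by simp
 have "(LINT y|m. q t x y * f y) \<noteq> 0"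
 proof
  assume "(LINT y|m. q t x y * f y) = 0"
  then have "AE y in m. q t x y * f y = 0"
   using integral_nonneg_eq_0_iff_AE[OF qf_integrable[OF t f(1)]] nn by simp
  then have "AE y in m. f y = 0" by eventually_elim (use q_pos[OF t] in \<open>auto simp: less_le\<close>)
  then show False using f(3) by simp
 qed
 moreover have "0 <= (LINT y|m. q t x y * f y)" using nn by (intro integral_nonneg_AE) auto
 ultimately show ?thesis using t by (simp add: U_def)
qed

lemma positive_compact_U:
 assumes t: "0 < t"
 shows "positive_compact_operator m (U t) phih0 (exp (2 * (K - lam0) * t))"
proof
 show "U t f \<in> L2 m" if "f \<in> L2 m" for f using U_sq(1)[OF _ that] t by simp
 show "U t (%x. c * f x + d * g x) = (%x. c * U t f x + d * U t g x)"
  if "f \<in> L2 m" "g \<in> L2 m" for f g c d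
  using U_lincomb[OF _ that, of t c d] t by auto
 show "U t f x = 0" if "f \<in> L2 m" "AE x in m. f x = 0" for f x using U_cong_zero[OF t that] .
 show "0 < U t f x" if "f \<in> L2 m" "!!x. 0 <= f x" "\<not> (AE x in m. f x = 0)" for f x
  using U_strictly_positive[OF t that] .
 show "sq_int m (U t f) <= exp (2 * (K - lam0) * t) * sq_int m f" if "f \<in> L2 m" for f
  using U_sq(2)[OF _ that] t by simp
 show "\<exists>g\<in>L2 m. \<exists>r. strict_mono r \<and> (%k. sq_int m (%x. U t (F (r k)) x - g x)) \<longlonglongrightarrow> 0"
  if "!!k::nat. F k \<in> L2 m" "!!k. sq_int m (F k) <= c" for F c
  using compact_U[OF t that] .
 show "phih0 \<in> L2 m" by (rule eigenfunctions_L2(2))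
 show "0 < phih0 x" for x by (rule eigenfunctions_pos(2))
 show "(LINT x|m. phih0 x * U t f x) = (LINT x|m. phih0 x * f x)" if "f \<in> L2 m" for f
  using weight_phih0_invariant[OF _ that] t by simp
 show "emeasure m (space m) \<noteq> 0" using null_open[OF open_UNIV] by (auto simp: space_m)
qed

lemma U_iterate: "0 <= t ==> f \<in> L2 m ==> U (real n * t) f = (U t ^^ n) f"
proof (induction n)
 case (Suc n)
 have "real (Suc n) * t = t + real n * t" by (simp add: algebra_simps)
 then show ?case using Suc U_semigroup[of t "real n * t" f] by simp
qed simp

lemma U_iterates_bounded:
 assumes "0 < t"
 obtains C where "C > 0" "!!n f. f \<in> L2 m ==> sq_int m (U (real n * t) f) <= C * sq_int m f"
proof -
 interpret positive_compact_operator m "U t" phih0 "exp (2 * (K - lam0) * t)" by (rule positive_compact_U[OF assms])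
 show ?thesis using Bn_bounded that assms by (auto simp: U_iterate)
qed

lemma U_iterates_decay:
 assumes "0 < t"
 obtains C \<rho> where "C > 0" "0 < \<rho>" "\<rho> < 1" "!!n f. f \<in> L2 m ==> (LINT x|m. phih0 x * f x) = 0 ==>
   sq_int m (U (real n * t) f) <= C * \<rho> ^ n * sq_int m f"
proof -
 interpret positive_compact_operator m "U t" phih0 "exp (2 * (K - lam0) * t)" by (rule positive_compact_U[OF assms])
 show ?thesis using Bn_exponential_decay that assms by (auto simp: U_iterate)
qed

text \<open>Since \<open>phi0 = U t phi0\<close>, its square is at most a constant times
  \<open>sq_mass\<close>, which is square integrable at the time given by condition (c). Second
  moments of \<open>phi0\<close> under the superprocess involve the mean semigroup applied to this
  square.\<close>

lemma phi0_square_L2: "(%x. (phi0 x)^2) \<in> L2 m"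
proof -
 obtain t where t: "0 < t" and i: "integrable m (%x. (sq_mass m p t x)^2)" using sq_mass_L2 by blast
 note phi = eigenfunctions_L2(1)
 have [measurable]: "sq_mass m p t \<in> borel_measurable m" unfolding borel_m
  by (rule borel_measurable_continuous_onI[OF sq_mass_continuous[OF t]])
 have s: "sq_mass m p t \<in> L2 m" using i by (simp add: L2_def)
 have [measurable]: "phi0 \<in> borel_measurable m" by (rule L2D(1)[OF phi])
 show ?thesis
 proof (rule L2_bound[OF L2_cmult[OF s]])
  show "\<bar>(phi0 x)^2\<bar> <= \<bar>(exp (2 * (K - lam0) * t) * sq_int m phi0) * sq_mass m p t x\<bar>" for x
   using U_pointwise_bound[OF t phi, of x] U_phi0[of t] t abs_ge_self[of "(exp (2 * (K - lam0) * t) * sq_int m phi0) * sq_mass m p t x"]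
   by (simp add: algebra_simps)
 qed measurable
qed

end

section \<open>Measurable functionals on the space of finite measures\<close>

lemma sets_borel_on: "sets (borel_on S) = sigma_sets (topspace S) {U. openin S U}"
 unfolding borel_on_def by (rule sets_measure_of) (use openin_subset in blast)

lemma measurable_of_sets_borel: "sets \<nu> = sets borel ==> g \<in> borel_measurable borel ==> g \<in> borel_measurable \<nu>"
 using measurable_cong_sets by blast

lemma bump_abs: "\<bar>bump k V x\<bar> <= 1"
 using bump_props(1,2)[of k V x] by simp

lemma measurable_integral_weak:
 fixes f :: "'e::topological_space => real"
 assumes "continuous_on UNIV f" "bounded (range f)"
 shows "(%\<nu>. LINT x|\<nu>. f x) \<in> borel_measurable (borel_on weak_topology)"
proof (rule borel_measurableI)
 fix S :: "real set" assume S: "open S"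
 have "{\<nu> \<in> finite_borel_measures. (LINT x|\<nu>. f x) \<in> S} \<in> {{mu \<in> finite_borel_measures. (LINT x|mu. g x) \<in> U} | g U.
    continuous_on UNIV (g :: 'e => real) \<and> bounded (range g) \<and> open U}"
  using assms S by blast
 then have "openin weak_topology {\<nu> \<in> finite_borel_measures. (LINT x|\<nu>. f x) \<in> S}"
  unfolding weak_topology_def by (rule topology_generated_by_Basis)
 then have "{\<nu> \<in> finite_borel_measures. (LINT x|\<nu>. f x) \<in> S} \<in> sets (borel_on weak_topology)"
  unfolding sets_borel_on by (intro sigma_sets.Basic) simp
 moreover have "(%\<nu>. LINT x|\<nu>. f x) -` S \<inter> space (borel_on weak_topology) = {\<nu> \<in> finite_borel_measures. (LINT x|\<nu>. f x) \<in> S}"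
  by (auto simp: space_borel_on)
 ultimately show "(%\<nu>. LINT x|\<nu>. f x) -` S \<inter> space (borel_on weak_topology) \<in> sets (borel_on weak_topology)" by simp
qed

text \<open>For open sets the mass is a limit of integrals of bumps, which are weakly continuous; a
  Dynkin argument does the rest.\<close>

lemma measurable_emeasure_weak:
 fixes A :: "'e::metric_space set"
 assumes "A \<in> sets borel"
 shows "(%\<nu>. emeasure \<nu> A) \<in> borel_measurable (borel_on weak_topology)"
proof -
 let ?W = "borel_on weak_topology :: 'e measure measure"
 have fin: "finite_measure \<nu>" "sets \<nu> = sets borel" "space \<nu> = UNIV" if "\<nu> \<in> space ?W" for \<nu>
  using that sets_eq_imp_space_eq[of \<nu> borel] by (auto simp: space_borel_on finite_borel_measures_def)
 have op: "(%\<nu>. emeasure \<nu> U) \<in> borel_measurable ?W" if U: "open U" for U :: "'e set"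
 proof -
  have m: "(%\<nu>. LINT x|\<nu>. bump k U x) \<in> borel_measurable ?W" for k
   by (intro measurable_integral_weak bump_props boundedI[of _ 1]) (use bump_abs in auto)
  have "(%k. LINT x|\<nu>. bump k U x) \<longlonglongrightarrow> measure \<nu> U" if \<nu>: "\<nu> \<in> space ?W" for \<nu>
  proof -
   interpret finite_measure \<nu> by (rule fin(1)[OF \<nu>])
   have "(%k. LINT x|\<nu>. bump k U x) \<longlonglongrightarrow> (LINT x|\<nu>. indicat_real U x)"
   proof (rule integral_dominated_convergence[where w="%_. 1"])
    show "AE x in \<nu>. (%k. bump k U x) \<longlonglongrightarrow> indicator U x"
    proof (rule AE_I2)
     fix x show "(%k. bump k U x) \<longlonglongrightarrow> indicator U x"
      using bump_tendsto[OF U, of x] bump_props(4)[of x U] by (cases "x \<in> U") auto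
    qed
    show "AE x in \<nu>. norm (bump k U x) <= 1" for k using bump_abs by (auto intro!: AE_I2)
    show "bump k U \<in> borel_measurable \<nu>" for k
     by (rule measurable_of_sets_borel[OF fin(2)[OF \<nu>] borel_measurable_continuous_onI[OF bump_props(3)]])
    show "indicat_real U \<in> borel_measurable \<nu>"
     by (rule measurable_of_sets_borel[OF fin(2)[OF \<nu>]]) (use U in simp)
   qed simp
   then show ?thesis using fin[OF \<nu>] by simp
  qed
  from borel_measurable_LIMSEQ_real[OF this m]
  have "(%\<nu>. ennreal (measure \<nu> U)) \<in> borel_measurable ?W" by simp
  then show ?thesis
   by (rule measurable_cong[THEN iffD1, rotated]) (use fin in \<open>auto simp: finite_measure.emeasure_eq_measure\<close>)
 qed
 have gen: "sets (borel :: 'e measure) = sigma_sets UNIV {S. open S}" by (simp add: borel_def)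
 have "Int_stable {S :: 'e set. open S}" "{S :: 'e set. open S} \<subseteq> Pow UNIV" by (auto simp: Int_stable_def)
 from this assms[unfolded gen] show ?thesis
 proof (induction rule: sigma_sets_induct_disjoint)
  case (basic A) then show ?case using op by simp
 next
  case (compl A)
  then have "A \<in> sets borel" by (simp add: gen)
  then have *: "emeasure \<nu> (UNIV - A) = emeasure \<nu> UNIV - emeasure \<nu> A" if "\<nu> \<in> space ?W" for \<nu>
   using fin[OF that] finite_measure.emeasure_finite[OF fin(1)[OF that]]
   by (intro emeasure_Diff) auto
  have "(%\<nu>. emeasure \<nu> UNIV - emeasure \<nu> A) \<in> borel_measurable ?W" using compl op[OF open_UNIV] by simp
  then show ?case by (rule measurable_cong[THEN iffD1, rotated]) (simp add: *)
 next
  case (union A)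
  then have A: "range A \<subseteq> sets borel" by (auto simp: gen)
  have *: "emeasure \<nu> (\<Union>i. A i) = (\<Sum>i. emeasure \<nu> (A i))" if "\<nu> \<in> space ?W" for \<nu>
   using A union(1) fin(2)[OF that] by (intro suminf_emeasure[symmetric]) auto
  have "(%\<nu>. \<Sum>i. emeasure \<nu> (A i)) \<in> borel_measurable ?W" using union by simp
  then show ?case by (rule measurable_cong[THEN iffD1, rotated]) (simp add: *)
 qed auto
qed

lemma measurable_nn_integral_weak:
 fixes f :: "'e::metric_space => ennreal"
 assumes "f \<in> borel_measurable borel"
 shows "(%\<nu>. NN \<nu> f) \<in> borel_measurable (borel_on weak_topology)"
proof -
 let ?W = "borel_on weak_topology :: 'e measure measure"
 have s: "sets \<nu> = sets borel" if "\<nu> \<in> space ?W" for \<nu>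
  using that by (auto simp: space_borel_on finite_borel_measures_def)
 have m: "g \<in> borel_measurable \<nu>" if "\<nu> \<in> space ?W" "g \<in> borel_measurable borel" for \<nu> and g :: "'e => ennreal"
  by (rule measurable_of_sets_borel[OF s[OF that(1)] that(2)])
 show ?thesis
  using assms
 proof induction
  case (cong f g)
  then have fg: "f = g" by auto
  show ?case unfolding fg by (rule cong)
 next
  case (set A)
  then show ?case using measurable_emeasure_weak[OF set] s by (simp cong: measurable_cong)
 next
  case (mult u c)
  have "(%\<nu>. c * (NN \<nu> u)) \<in> borel_measurable ?W" using mult.IH by simp
  then show ?case by (rule measurable_cong[THEN iffD1, rotated]) (simp add: nn_integral_cmult m[OF _ mult.hyps(2)])
 next
  case (add u v)
  have "(%\<nu>. (NN \<nu> v) + (NN \<nu> u)) \<in> borel_measurable ?W" using add.IH by simp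
  then show ?case
   by (rule measurable_cong[THEN iffD1, rotated]) (simp add: nn_integral_add m[OF _ add.hyps(1)] m[OF _ add.hyps(3)])
 next
  case (seq U)
  have e: "(SUP i. NN \<nu> (U i)) = (NN \<nu> (%x. (SUP i. U i) x))" if "\<nu> \<in> space ?W" for \<nu>
   using m[OF that seq.hyps(1)] seq.hyps(3) by (simp add: nn_integral_monotone_convergence_SUP image_image)
  have "(%\<nu>. SUP i. NN \<nu> (U i)) \<in> borel_measurable ?W" using seq.IH by simp
  then show ?case by (rule measurable_cong[THEN iffD1, rotated]) (rule e)
 qed
qed

section \<open>Moments of the superprocess\<close>

text \<open>The upper bound rests on \<open>exp z \<ge> 1 + z + z^2 / 2\<close> and
  \<open>(1 - z + z^2 / 2) * (1 + z + z^2 / 2) = 1 + z^4 / 4\<close>.\<close>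

lemma exp_minus_quadratic_bounds:
 fixes z :: real
 assumes "0 <= z"
 shows "0 <= exp (- z) - 1 + z" "exp (- z) - 1 + z <= z^2" "exp (- z) - 1 + z <= z^2 / 2"
proof -
 show "0 <= exp (- z) - 1 + z" using exp_ge_add_one_self[of "- z"] by simp
 have "exp (- z) * exp z <= (1 - z + z^2 / 2) * exp z"
 proof -
  have "1 <= 1 + (z^2)^2 / 4" by simp
  also have "... = (1 - z + z^2 / 2) * (1 + z + z^2 / 2)" by (simp add: power2_eq_square algebra_simps)
  also have "... <= (1 - z + z^2 / 2) * exp z"
  proof (rule mult_left_mono[OF exp_lower_Taylor_quadratic[OF assms]])
   have "1 - z + z^2 / 2 = (1 - z)^2 / 2 + 1 / 2" by (simp add: power2_eq_square field_simps)
   then show "0 <= 1 - z + z^2 / 2" by simp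
  qed
  finally show ?thesis by (simp add: exp_minus)
 qed
 then have "exp (- z) <= 1 - z + z^2 / 2" by simp
 then show "exp (- z) - 1 + z <= z^2 / 2" by simp
 then show "exp (- z) - 1 + z <= z^2" by (simp add: field_simps) (smt (verit) zero_le_power2)
qed

section \<open>The nonlinear part of the branching mechanism\<close>

context branching_data
begin

text \<open>The mechanism without its linear term: that term goes into the Feynman-Kac weight
  through \<alpha>, and what remains is nonnegative and of second order at zero.\<close>

definition psi0 :: "'e => real => real" where
 "psi0 x l = b x * l^2 + (LINT y|n x. (exp (- l * y) - 1 + l * y))"

lemma space_n: "space (n x) = {0<..}"
 using sets_eq_imp_space_eq[OF sets_n] by (simp add: space_restrict_space)

lemma n_measurable: "g \<in> borel_measurable borel ==> g \<in> borel_measurable (n x)"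
 using measurable_restrict_space1[of g borel borel "{0<..}"] measurable_cong_sets[OF sets_n refl] by blast

lemma n_second_moment:
 obtains s where "0 <= s" "!!x. integrable (n x) (%y. y^2)" "!!x. (LINT y|n x. y^2) <= s"
proof
 define s where "s = enn2real (SUP x. NN (n x) (%y. ennreal (y^2)))"
 have le: "(NN (n x) (%y. ennreal (y^2))) <= ennreal s" for x
  unfolding s_def using second_moment_n by (subst ennreal_enn2real) (auto intro: SUP_upper)
 show "0 <= s" by (simp add: s_def)
 show i: "integrable (n x) (%y. y^2)" for x
 proof (rule integrableI_nonneg)
  show "(%y. y^2) \<in> borel_measurable (n x)" by (rule n_measurable) simp
  show "(NN (n x) (%y. ennreal (y^2))) < \<infinity>" using le_less_trans[OF le[of x] ennreal_less_top] by simp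
 qed simp
 show "(LINT y|n x. y^2) <= s" for x
  using le[of x] \<open>0 <= s\<close> by (subst (asm) nn_integral_eq_integral[OF i]) (auto simp: ennreal_le_iff)
qed

lemma n_integrable:
 assumes "0 <= l"
 shows "integrable (n x) (%y. exp (- l * y) - 1 + l * y)"
proof -
 obtain s where s: "0 <= s" "!!x. integrable (n x) (%y. y^2)" "!!x. (LINT y|n x. y^2) <= s"
  using n_second_moment by blast
 show ?thesis
 proof (rule integrable_bound)
  show "integrable (n x) (%y. l^2 * y^2)" using s(2) by simp
  show "(%y. exp (- l * y) - 1 + l * y) \<in> borel_measurable (n x)" by (rule n_measurable) simp
  show "AE y in n x. norm (exp (- l * y) - 1 + l * y) <= norm (l^2 * y^2)"
  proof (rule AE_I2)
   fix y assume "y \<in> space (n x)"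
   then have "0 <= l * y" using assms by (simp add: space_n)
   from exp_minus_quadratic_bounds[OF this]
   show "norm (exp (- l * y) - 1 + l * y) <= norm (l^2 * y^2)" by (simp add: power_mult_distrib)
  qed
 qed
qed

lemma psi0_bounds:
 obtains C where "0 <= C" "!!x l. 0 <= l ==> 0 <= psi0 x l" "!!x l. 0 <= l ==> psi0 x l <= C * l^2"
proof -
 obtain s where s: "0 <= s" "!!x. integrable (n x) (%y. y^2)" "!!x. (LINT y|n x. y^2) <= s" using n_second_moment by blast
 obtain B where B: "!!x. \<bar>b x\<bar> <= B" using b(2) by (auto simp: bounded_iff)
 have B0: "0 <= B" using B[of undefined] by linarith
 have bd: "0 <= (LINT y|n x. (exp (- l * y) - 1 + l * y))" "(LINT y|n x. (exp (- l * y) - 1 + l * y)) <= s * l^2" if l: "0 <= l" for x l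
 proof -
  have q: "0 <= exp (- l * y) - 1 + l * y" "exp (- l * y) - 1 + l * y <= l^2 * y^2" if "y \<in> space (n x)" for y
   using exp_minus_quadratic_bounds[of "l * y"] that l by (auto simp: space_n power_mult_distrib)
  show "0 <= (LINT y|n x. (exp (- l * y) - 1 + l * y))" using q by (intro integral_nonneg_AE AE_I2) auto
  have "(LINT y|n x. (exp (- l * y) - 1 + l * y)) <= (LINT y|n x. l^2 * y^2)"
   using q s(2) n_integrable[OF l] by (intro integral_mono) auto
  also have "... = l^2 * (LINT y|n x. y^2)" by simp
  also have "... <= l^2 * s" by (intro mult_left_mono s) simp
  also have "... = s * l^2" by (rule mult.commute)
  finally show "(LINT y|n x. (exp (- l * y) - 1 + l * y)) <= s * l^2" .
 qed
 show ?thesis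
 proof (rule that[of "B + s"])
  show "0 <= B + s" using B0 s by simp
  show "0 <= psi0 x l" if "0 <= l" for x l using bd(1)[OF that] b(3)[of x] by (simp add: psi0_def)
  show "psi0 x l <= (B + s) * l^2" if "0 <= l" for x l
  proof -
   have "b x * l^2 <= B * l^2" using B[of x] by (intro mult_right_mono) auto
   then show ?thesis unfolding psi0_def distrib_right using bd(2)[OF that, of x] by linarith
  qed
 qed
qed

lemma measurable_nn_integral_n:
 assumes "g \<in> borel_measurable (restrict_space borel {0<..})"
 shows "(%x. NN (n x) g) \<in> borel_measurable borel"
proof -
 have m: "g \<in> borel_measurable (n x)" if "g \<in> borel_measurable (restrict_space borel {0<..})" for x and g :: "real => ennreal"
  using that measurable_cong_sets[OF sets_n refl] by blast
 show ?thesis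
  using assms
 proof induction
  case (cong f g)
  have "(NN (n x) f) = (NN (n x) g)" for x
   using cong(3) by (intro nn_integral_cong) (simp add: space_n space_restrict_space)
  then show ?case using cong by simp
 next
  case (set A)
  then show ?case using kernel_n[OF set] by (simp add: sets_n)
 next
  case (mult u c)
  then show ?case using m[OF mult.hyps(2)] by (simp add: nn_integral_cmult)
 next
  case (add u v)
  then show ?case using m[OF add.hyps(1)] m[OF add.hyps(3)] by (simp add: nn_integral_add)
 next
  case (seq U)
  then show ?case using m[OF seq.hyps(1)] seq.hyps(3) by (simp add: nn_integral_monotone_convergence_SUP image_image)
 qed
qed

text \<open>Measurable in the point for each \<open>l\<close>, and continuous in \<open>l\<close>:
  the integrand grows by at most \<open>(l' - l) * l' * y^2\<close> between \<open>l\<close> and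
  \<open>l'\<close>, which the second moments of \<open>n\<close> control uniformly.\<close>

lemma psi0_joint: "(%z. psi0 (snd z) (max 0 (fst z))) \<in> borel_measurable (borel \<Otimes>\<^sub>M borel)"
proof -
 obtain s where s: "0 <= s" "!!x. integrable (n x) (%y. y^2)" "!!x. (LINT y|n x. y^2) <= s" using n_second_moment by blast
 define J where "J l x = (LINT y|n x. (exp (- l * y) - 1 + l * y))" for l x
 have "(%z. J (max 0 (fst z)) (snd z)) \<in> borel_measurable (borel \<Otimes>\<^sub>M borel)"
 proof (rule borel_measurable_right_continuous_joint)
  fix l :: real assume l: "0 <= l"
  have "J l x = enn2real (NN (n x) (%y. ennreal (exp (- l * y) - 1 + l * y)))" for x
   unfolding J_def
  proof (rule integral_eq_nn_integral)
   show "AE y in n x. 0 <= exp (- l * y) - 1 + l * y"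
    using exp_minus_quadratic_bounds(1) l by (intro AE_I2) (auto simp: space_n)
  qed (rule n_measurable, simp)
  moreover have "(%x. NN (n x) (%y. ennreal (exp (- l * y) - 1 + l * y))) \<in> borel_measurable borel"
   by (rule measurable_nn_integral_n) (rule measurable_restrict_space1, simp)
  ultimately show "J l \<in> borel_measurable borel" by (simp add: fun_eq_iff[THEN iffD2, THEN sym] cong: measurable_cong)
 next
  fix l :: real and x assume l: "0 <= l"
  have "((%l'. J l' x - J l x) \<longlongrightarrow> 0) (at_right l)"
  proof (rule Lim_null_comparison)
   have "((%l'. (l' - l) * l' * s) \<longlongrightarrow> (l - l) * l * s) (at_right l)" by (intro tendsto_intros)
   then show "((%l'. (l' - l) * l' * s) \<longlongrightarrow> 0) (at_right l)" by simp
   show "\<forall>\<^sub>F l' in at_right l. norm (J l' x - J l x) <= (l' - l) * l' * s"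
    using eventually_at_right_less[of l]
   proof eventually_elim
    fix l' assume l': "l < l'"
    let ?g = "%l y :: real. exp (- l * y) - 1 + l * y"
    have b: "0 <= ?g l' y - ?g l y" "?g l' y - ?g l y <= (l' - l) * l' * y^2" if "y \<in> space (n x)" for y
    proof -
     have y: "0 < y" using that by (simp add: space_n)
     define d where "d = (l' - l) * y"
     have d: "0 <= d" using l' y by (simp add: d_def)
     have ly: "0 <= l * y" using l y by simp
     have "exp (- l' * y) = exp (- l * y) * exp (- d)" unfolding d_def exp_add[symmetric] by (simp add: algebra_simps)
     then have e: "?g l' y - ?g l y = exp (- (l * y)) * (exp (- d) - 1) + d" by (simp add: d_def algebra_simps)
     have e1: "exp (- (l * y)) <= 1" using ly by simp
     have "exp (- (l * y)) * (- d) <= exp (- (l * y)) * (exp (- d) - 1)"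
      using exp_minus_quadratic_bounds(1)[OF d] by (intro mult_left_mono) auto
     moreover have "exp (- (l * y)) * d <= d" using e1 d by (simp add: mult_left_le_one_le)
     ultimately show "0 <= ?g l' y - ?g l y" unfolding e by (simp add: algebra_simps)
     have "exp (- (l * y)) * (exp (- d) - 1) <= exp (- (l * y)) * (d^2 - d)"
      using exp_minus_quadratic_bounds(2)[OF d] by (intro mult_left_mono) auto
     also have "... = exp (- (l * y)) * d^2 - exp (- (l * y)) * d" by (simp add: algebra_simps)
     also have "... <= d^2 - (1 - l * y) * d"
     proof -
      have "exp (- (l * y)) * d^2 <= d^2" using e1 by (simp add: mult_left_le_one_le)
      moreover have "(1 - l * y) * d <= exp (- (l * y)) * d"
       using exp_ge_add_one_self[of "- (l * y)"] d by (intro mult_right_mono) auto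
      ultimately show ?thesis by linarith
     qed
     finally have "?g l' y - ?g l y <= d^2 - (1 - l * y) * d + d" unfolding e by simp
     also have "... = (l' - l) * l' * y^2" by (simp add: d_def power2_eq_square algebra_simps)
     finally show "?g l' y - ?g l y <= (l' - l) * l' * y^2" .
    qed
    have i: "integrable (n x) (?g l')" "integrable (n x) (?g l)" using n_integrable l l' by auto
    have J: "J l' x - J l x = (LINT y|n x. ?g l' y - ?g l y)" unfolding J_def by (rule Bochner_Integration.integral_diff[OF i, symmetric])
    have "0 <= (LINT y|n x. ?g l' y - ?g l y)" using b(1) by (intro integral_nonneg_AE AE_I2) auto
    moreover have "(LINT y|n x. ?g l' y - ?g l y) <= (LINT y|n x. (l' - l) * l' * y^2)"
     using s(2) b(2) by (intro integral_mono Bochner_Integration.integrable_diff i) auto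
    moreover have "(LINT y|n x. (l' - l) * l' * y^2) <= (l' - l) * l' * s"
     using s(3)[of x] l l' by (simp add: mult_left_mono)
    ultimately show "norm (J l' x - J l x) <= (l' - l) * l' * s" unfolding J by simp
   qed
  qed
  then show "((%l'. J l' x) \<longlongrightarrow> J l x) (at_right l)" by (rule LIM_zero_cancel)
 qed
 then show ?thesis unfolding psi0_def J_def[symmetric] using b(1) by measurable
qed

lemma branching_mechanism_Some: "branching_mechanism a b n (Some x) l = - a x * l + psi0 x l"
 by (simp add: branching_mechanism_def psi0_def)

end

text \<open>A first-order expansion of the cumulant with quadratic error replaces differentiation at
  zero. Fatou along \<open>1 / (k + 1)\<close> bounds both moments from above;
  \<open>u - u^2 / 2 \<le> 1 - exp (- u)\<close> bounds the mean from below, which is why the mean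
  is exact and the second moment an inequality.\<close>

lemma (in prob_space) laplace_moments:
 fixes Z :: "'a => real"
 assumes Z[measurable]: "Z \<in> borel_measurable M" and Z0: "!!w. w \<in> space M ==> 0 <= Z w"
  and A: "0 <= A" and D: "0 <= D"
  and L: "!!th. 0 < th ==> \<exists>u. expectation (%w. exp (- th * Z w)) = exp (- u) \<and> 0 <= u \<and> th * A - th^2 * D <= u \<and> u <= th * A"
 shows "integrable M Z" "expectation Z = A" "(NN M (%w. ennreal ((Z w)^2))) <= ennreal (A^2 + 2 * D)"
proof -
 define th where "th k = 1 / real (Suc k)" for k
 have th: "0 < th k" for k by (simp add: th_def)
 have th0: "th \<longlonglongrightarrow> 0" unfolding th_def[abs_def] by real_asymp
 obtain u where u: "!!k. expectation (%w. exp (- th k * Z w)) = exp (- u k)" "!!k. 0 <= u k"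
  "!!k. th k * A - (th k)^2 * D <= u k" "!!k. u k <= th k * A"
  using choice[of "%k u. expectation (%w. exp (- th k * Z w)) = exp (- u) \<and> 0 <= u \<and> th k * A - (th k)^2 * D <= u \<and> u <= th k * A"] L[OF th]
  by blast
 have iexp: "integrable M (%w. exp (- th k * Z w))" for k
 proof (rule integrable_const_bound[where B=1])
  show "AE w in M. norm (exp (- th k * Z w)) <= 1"
   using Z0 th[of k] by (intro AE_I2) (auto simp: less_imp_le)
 qed simp
 have u2: "(u k)^2 <= (th k)^2 * A^2" for k
  using power_mono[OF u(4)[of k] u(2)[of k], of 2] by (simp add: power_mult_distrib)
 have Zfat: "(NN M (%w. ennreal (Z w))) <= ennreal A"
 proof -
  have lim: "(%k. (1 - exp (- th k * z)) / th k) \<longlonglongrightarrow> z" for z :: real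
   unfolding th_def by real_asymp
  have "(NN M (%w. ennreal (Z w))) = (NN M (%w. liminf (%k. ennreal ((1 - exp (- th k * Z w)) / th k))))"
   by (intro nn_integral_cong lim_imp_Liminf[symmetric] tendsto_ennrealI lim) simp
  also have "... <= liminf (%k. NN M (%w. ennreal ((1 - exp (- th k * Z w)) / th k)))"
   by (rule nn_integral_liminf) measurable
  also have "... <= liminf (%k. ennreal A)"
  proof (intro Liminf_mono always_eventually allI)
   fix k
   have "(NN M (%w. ennreal ((1 - exp (- th k * Z w)) / th k))) = ennreal (expectation (%w. (1 - exp (- th k * Z w)) / th k))"
   proof (rule nn_integral_eq_integral)
    show "integrable M (%w. (1 - exp (- th k * Z w)) / th k)" using iexp[of k] by simp
    show "AE w in M. 0 <= (1 - exp (- th k * Z w)) / th k"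
     using Z0 th[of k] by (intro AE_I2) (auto simp: less_imp_le)
   qed
   also have "expectation (%w. (1 - exp (- th k * Z w)) / th k) = (1 - exp (- u k)) / th k"
    using iexp[of k] by (simp add: prob_space u(1)[symmetric])
   also have "... <= A"
    using exp_ge_add_one_self[of "- u k"] u(4)[of k] th[of k] by (simp add: divide_le_eq mult.commute)
   finally show "(NN M (%w. ennreal ((1 - exp (- th k * Z w)) / th k))) <= ennreal A"
    by (simp add: ennreal_leI)
  qed
  finally show ?thesis by (simp add: Liminf_const)
 qed
 show iZ: "integrable M Z"
  by (rule integrableI_nonneg) (use Z0 le_less_trans[OF Zfat ennreal_less_top] in auto)
 have ZA: "expectation Z <= A"
  using Zfat Z0 A by (subst (asm) nn_integral_eq_integral[OF iZ]) auto
 have "A - th k * (D + A^2 / 2) <= expectation Z" for k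
 proof -
  have "1 - exp (- u k) <= th k * expectation Z"
  proof -
   have "expectation (%w. 1 - exp (- th k * Z w)) <= expectation (%w. th k * Z w)"
   proof (rule integral_mono)
    show "1 - exp (- th k * Z w) <= th k * Z w" for w
     using exp_ge_add_one_self[of "- th k * Z w"] by simp
   qed (use iexp[of k] iZ in auto)
   then show ?thesis using iexp[of k] by (simp add: prob_space u(1)[symmetric])
  qed
  moreover have "u k - (u k)^2 / 2 <= 1 - exp (- u k)"
   using exp_minus_quadratic_bounds(3)[OF u(2)[of k]] by simp
  ultimately have "th k * A - (th k)^2 * D - (th k)^2 * A^2 / 2 <= th k * expectation Z"
   using u(3)[of k] u2[of k] by linarith
  then have "th k * (A - th k * (D + A^2 / 2)) <= th k * expectation Z"
   by (simp add: power2_eq_square algebra_simps)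
  then show ?thesis using th[of k] by simp
 qed
 moreover have "(%k. A - th k * (D + A^2 / 2)) \<longlonglongrightarrow> A - 0 * (D + A^2 / 2)"
  by (intro tendsto_intros th0)
 ultimately have "A - 0 * (D + A^2 / 2) <= expectation Z"
  by (intro LIMSEQ_le_const2) auto
 then show EZ: "expectation Z = A" using ZA by simp
 \<comment> \<open>The second-order difference quotient of the Laplace transform; its limit is half
   of the square, whence the factor 2 at the end.\<close>
 define h where "h k z = (exp (- (th k * z)) - 1 + th k * z) / (th k)^2" for k z
 have hl: "(%k. h k z) \<longlonglongrightarrow> z^2 / 2" if "0 <= z" for z
 proof (cases "z = 0")
  case False
  then have "0 < z" using that by simp
  then have "(%k. h k z) \<longlonglongrightarrow> z * z / 2" unfolding h_def th_def by real_asymp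
  then show ?thesis by (simp only: power2_eq_square)
 qed (simp add: h_def)
 have h0: "0 <= h k z" if "0 <= z" for k z
  unfolding h_def using exp_minus_quadratic_bounds(1)[of "th k * z"] that th[of k] by simp
 have "(NN M (%w. ennreal ((Z w)^2 / 2))) = (NN M (%w. liminf (%k. ennreal (h k (Z w)))))"
  using Z0 by (intro nn_integral_cong lim_imp_Liminf[symmetric] tendsto_ennrealI hl) auto
 also have "... <= liminf (%k. NN M (%w. ennreal (h k (Z w))))"
  unfolding h_def by (rule nn_integral_liminf) measurable
 also have "... <= liminf (%k. ennreal (D + A^2 / 2))"
 proof (intro Liminf_mono always_eventually allI)
  fix k
  have i: "integrable M (%w. h k (Z w))" unfolding h_def using iexp[of k] iZ by simp
  have "(NN M (%w. ennreal (h k (Z w)))) = ennreal (expectation (%w. h k (Z w)))"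
   using h0 Z0 by (intro nn_integral_eq_integral i AE_I2) auto
  also have "expectation (%w. h k (Z w)) = (exp (- u k) - 1 + th k * A) / (th k)^2"
   unfolding h_def using iexp[of k] iZ by (simp add: prob_space u(1)[symmetric] EZ)
  also have "... <= D + A^2 / 2"
  proof -
   have "exp (- u k) - 1 + th k * A <= (th k)^2 * (D + A^2 / 2)"
    using exp_minus_quadratic_bounds(3)[OF u(2)[of k]] u(3)[of k] u2[of k] by (simp add: algebra_simps)
   then show ?thesis using th[of k] by (simp add: divide_le_eq mult.commute)
  qed
  finally show "(NN M (%w. ennreal (h k (Z w)))) <= ennreal (D + A^2 / 2)" by (simp add: ennreal_leI)
 qed
 finally have "(NN M (%w. ennreal ((Z w)^2 / 2))) <= ennreal (D + A^2 / 2)" by (simp add: Liminf_const)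
 then have "ennreal 2 * (NN M (%w. ennreal ((Z w)^2 / 2))) <= ennreal 2 * ennreal (D + A^2 / 2)"
  by (rule mult_left_mono) simp
 also have "ennreal 2 * (NN M (%w. ennreal ((Z w)^2 / 2))) = (NN M (%w. ennreal 2 * ennreal ((Z w)^2 / 2)))"
  by (rule nn_integral_cmult[symmetric]) measurable
 also have "... = (NN M (%w. ennreal ((Z w)^2)))"
  by (intro nn_integral_cong) (simp add: ennreal_mult'[symmetric] del: ennreal_numeral)
 also have "ennreal 2 * ennreal (D + A^2 / 2) = ennreal (A^2 + 2 * D)"
  using A D by (simp add: ennreal_mult'[symmetric] distrib_left add.commute del: ennreal_numeral)
 finally show "(NN M (%w. ennreal ((Z w)^2))) <= ennreal (A^2 + 2 * D)" .
qed

context supercritical_setting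
begin

lemma weight_integral:
 assumes t: "0 <= t" and g: "g \<in> L2 m" "!!y. 0 <= g y"
 shows "integrable (Q (Some x)) (%w. weight t w * ext g (\<xi> t w))"
  "(LINT w|Q (Some x). weight t w * ext g (\<xi> t w)) = exp (lam0 * t) * U t g x"
proof -
 have xi: "\<xi> t \<in> Q (Some x) \<rightarrow>\<^sub>M borel_on opc" by (rule xi_measurable[OF t])
 have wm[measurable]: "weight t \<in> borel_measurable (Q (Some x))" by (rule weight_measurable[OF t])
 have gb: "g \<in> borel_measurable borel" using L2D(1)[OF g(1)] by (simp only: borel_m)
 have gm[measurable]: "(%w. ext g (\<xi> t w)) \<in> borel_measurable (Q (Some x))"
  by (rule measurable_compose[OF xi measurable_ext[OF gb]])
 have e0: "0 <= ext g z" for z using g(2) by (cases z) auto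
 have "(NN (Q (Some x)) (%w. ennreal (weight t w * ext g (\<xi> t w)))) =
   (NN (Q (Some x)) (%w. ennreal (weight t w) * ext (%y. ennreal (g y)) (\<xi> t w)))"
  using weight_pos[of t] e0 by (intro nn_integral_cong) (auto simp: ennreal_mult' less_imp_le split: option.splits)
 also have "... = ennreal (exp (lam0 * t) * U t g x)"
  using nn_integral_weight[OF t, of "%y. ennreal (g y)" x] kern_U(1)[OF t g, of x] gb by simp
 finally have *: "(NN (Q (Some x)) (%w. ennreal (weight t w * ext g (\<xi> t w)))) = ennreal (exp (lam0 * t) * U t g x)" .
 have w0: "0 <= weight t w * ext g (\<xi> t w)" for w using weight_pos[of t w] e0 by (simp add: less_imp_le)
 show "integrable (Q (Some x)) (%w. weight t w * ext g (\<xi> t w))"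
  by (rule integrableI_nonneg) (use w0 * in auto)
 show "(LINT w|Q (Some x). weight t w * ext g (\<xi> t w)) = exp (lam0 * t) * U t g x"
  using * w0 kern_U(2)[OF t g, of x] by (subst integral_eq_nn_integral) auto
qed

lemma L2_square:
 assumes "f \<in> L2 m" "!!y. \<bar>f y\<bar> <= C"
 shows "(%y. (f y)^2) \<in> L2 m"
proof (rule L2_bound[OF L2_cmult[OF assms(1)]])
 show "(%y. (f y)^2) \<in> borel_measurable m" using L2D(1)[OF assms(1)] by measurable
 have "0 <= C" using assms(2)[of undefined] by linarith
 then show "\<bar>(f y)^2\<bar> <= \<bar>C * f y\<bar>" for y
  using mult_right_mono[OF assms(2)[of y] abs_ge_zero[of "f y"]] by (simp add: power2_eq_square abs_mult)
qed

text \<open>Jensen's inequality for the measure with density \<open>q t x\<close>, whose mass is at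
  most \<open>exp (K * t)\<close>.\<close>

lemma mean_square_le:
 assumes t: "0 <= t" and f: "f \<in> L2 m" "!!y. \<bar>f y\<bar> <= C"
 shows "(exp (lam0 * t) * U t f x)^2 <= exp (K * t) * (exp (lam0 * t) * U t (%y. (f y)^2) x)"
proof (cases "t = 0")
 case False
 then have t: "0 < t" using t by simp
 have f2: "(%y. (f y)^2) \<in> L2 m" by (rule L2_square[OF f])
 have q0: "0 <= q t x y" for y using q_pos[OF t] less_imp_le by blast
 have qi: "integrable m (q t x)"
  using q_density[OF t, of "%_. 1" x] by simp
 have s1: "(%y. sqrt (q t x y)) \<in> L2 m"
  using qi q0 by (auto simp: L2_def)
 have s2: "(%y. sqrt (q t x y) * f y) \<in> L2 m"
  using qf_integrable[OF t f2, of x] q0 qp_measurable(1)[OF t, of x] L2D(1)[OF f(1)]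
  by (auto simp: L2_def power_mult_distrib)
 have "(LINT y|m. q t x y * f y) = (LINT y|m. sqrt (q t x y) * (sqrt (q t x y) * f y))"
  using q0 by (simp add: mult.assoc[symmetric])
 then have "(LINT y|m. q t x y * f y)^2 <= (LINT y|m. q t x y) * (LINT y|m. q t x y * (f y)^2)"
  using cauchy_schwarz_integral[OF s1 s2] q0 by (simp add: sq_int_def power_mult_distrib)
 also have "... <= exp (K * t) * (LINT y|m. q t x y * (f y)^2)"
 proof (rule mult_right_mono)
  have "(LINT y|m. q t x y) <= (LINT y|m. exp (K * t) * p t x y)"
   using qi p_mass(1)[OF t, of x] q_p_bounds(2)[OF t] by (intro integral_mono) auto
  also have "... <= exp (K * t) * 1"
   using p_mass(2)[OF t, of x] by (simp add: mult_left_mono)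
  finally show "(LINT y|m. q t x y) <= exp (K * t)" by simp
  show "0 <= (LINT y|m. q t x y * (f y)^2)" using q0 by (intro integral_nonneg_AE) auto
 qed
 finally show ?thesis using t by (simp add: U_def mult.assoc[symmetric] exp_add[symmetric])
qed simp

lemma mean_bounded:
 assumes t: "0 <= t" and f: "f \<in> L2 m" "!!y. 0 <= f y" "!!y. f y <= C"
 shows "exp (lam0 * t) * U t f x <= exp (K * t) * C"
proof -
 interpret prob_space "Q (Some x)" by (rule prob_Q)
 have C0: "0 <= C" using f(2,3)[of undefined] by linarith
 have e: "ext f z <= C" for z using f(3) C0 by (cases z) auto
 have e0: "0 <= ext f z" for z using f(2) by (cases z) auto
 have "\<bar>(LINT w|Q (Some x). weight t w * ext f (\<xi> t w))\<bar> <= exp (K * t) * C"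
 proof (rule bounded_integral_le)
  fix w assume "w \<in> space (Q (Some x))"
  then have "weight t w * ext f (\<xi> t w) <= exp (K * t) * C"
   using weight_bound[OF _ t] weight_pos e e0 by (intro mult_mono) (auto simp: space_Q less_imp_le)
  then show "\<bar>weight t w * ext f (\<xi> t w)\<bar> <= exp (K * t) * C"
   using e0[of "\<xi> t w"] weight_pos[of t w] by (simp add: abs_mult)
 qed (use C0 in simp)
 then show ?thesis using weight_integral(2)[OF t f(1,2), of x] by linarith
qed

end

section \<open>Cumulants and the first two moments\<close>

locale superprocess_setting =
 supercritical_setting \<Omega>' F \<xi> Q m p \<alpha> K q lam0 phi0 phih0 +
 BR: branching_data \<beta> a b n +
 SP: superprocess \<Omega> G X P \<xi> Q \<beta> "branching_mechanism a b n"
 for \<Omega>' :: "'w set" and F :: "ennreal => 'w measure"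
  and \<xi> :: "real => 'w => 'e::{metric_space, second_countable_topology} option"
  and Q m p \<alpha> K q lam0 phi0 phih0 and \<beta> a b :: "'e => real" and n :: "'e => real measure"
  and \<Omega> :: "'v set" and G :: "ennreal => 'v measure"
  and X :: "real => 'v => 'e measure" and P :: "'e measure => 'v measure" +
 assumes alpha_eq: "\<alpha> = (%x. \<beta> x * a x)"
begin

text \<open>Once the linear term is in the weight, the cumulant is the linear mean minus the
  integrated mean of a nonnegative quadratic term, which gives the upper bound. Inserting that upper
  bound into the quadratic term and applying \<open>mean_square_le\<close>, the semigroup law merges
  the two time pieces into time \<open>t\<close>; the integral over time leaves the factor
  \<open>t\<close>.\<close>

lemma cumulant_bounds:
 obtains c where "0 <= c"
  "!!f t x u. f \<in> L2 m ==> bounded (range f) ==> (!!y. 0 <= f y) ==> 0 <= t ==>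
   cumulant_solution \<xi> Q \<beta> (branching_mechanism a b n) f u ==>
   u x t <= exp (lam0 * t) * U t f x \<and>
   exp (lam0 * t) * U t f x - c * t * exp (K * t) * (exp (lam0 * t) * U t (%y. (f y)^2) x) <= u x t"
proof -
 obtain C\<psi> where \<psi>: "0 <= C\<psi>" "!!x l. 0 <= l ==> 0 <= BR.psi0 x l" "!!x l. 0 <= l ==> BR.psi0 x l <= C\<psi> * l^2"
  using BR.psi0_bounds by blast
 obtain B\<beta> where B\<beta>: "!!x. \<bar>\<beta> x\<bar> <= B\<beta>" using BR.beta(2) by (auto simp: bounded_iff)
 have B\<beta>0: "0 <= B\<beta>" using B\<beta>[of undefined] by linarith
 show ?thesis
 proof (rule that[of "B\<beta> * C\<psi>"])
  show "0 <= B\<beta> * C\<psi>" using B\<beta>0 \<psi>(1) by simp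
  fix f and t :: real and x u
  assume f: "f \<in> L2 m" "bounded (range f)" "!!y. 0 <= f y" and t: "0 <= t"
   and cs: "cumulant_solution \<xi> Q \<beta> (branching_mechanism a b n) f u"
  have fb: "f \<in> borel_measurable borel" using L2D(1)[OF f(1)] by (simp only: borel_m)
  obtain C2 where C2: "!!y. \<bar>f y\<bar> <= C2" using f(2) by (auto simp: bounded_iff)
  from cs have um: "(%(x, t). u x t) \<in> borel_measurable (borel \<Otimes>\<^sub>M restrict_space borel {0..})"
   and u0: "!!y (r :: real). 0 <= r ==> 0 <= u y r"
   and ueq: "!!y (r :: real). 0 <= r ==> u y r + (LINT w|Q (Some y). (LINT s:{0..r}|lborel. branching_mechanism a b n (\<xi> s w) (ext (%y. u y (r - s)) (\<xi> s w)) * ext \<beta> (\<xi> s w))) = (LINT w|Q (Some y). ext f (\<xi> r w))"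
   unfolding cumulant_solution_def by blast+
  have "\<exists>C. \<forall>y. \<forall>r\<in>{0..t}. u y r <= C" using cs unfolding cumulant_solution_def by blast
  then obtain C1 where C1': "\<forall>y. \<forall>r\<in>{0..t}. u y r <= C1" by blast
  then have C1: "u y r <= C1" if "r \<in> {0..t}" for y r using that by blast
  have C10: "0 <= C1" using C1[of 0 undefined] u0[of 0 undefined] t by simp
  define k where "k y r = - \<beta> y * BR.psi0 y (u y r)" for y r
  have upper_lower: "u y r <= exp (lam0 * r) * U r f y \<and>
    (u y r = exp (lam0 * r) * U r f y - (LINT s:{0..r}|lborel. (LINT w|Q (Some y). weight s w * ext (%y. - k y (r - s)) (\<xi> s w))))"
   if r: "0 <= r" "r <= t" for y r
  proof -
   \<comment> \<open>Outside \<open>[0, r]\<close> the solution carries no bound, so it is cut off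
     there to meet the global bounds of \<open>variation_of_constants\<close>.\<close>
   define u' where "u' y s = (if 0 <= s \<and> s <= r then u y s else 0)" for y s
   define k' where "k' y s = - \<beta> y * BR.psi0 y (max 0 (u' y s))" for y s
   have u'0: "0 <= u' y s" for y s using u0 by (simp add: u'_def)
   have u'C: "u' y s <= C1" for y s using C1 C10 r by (auto simp: u'_def)
   define C where "C = C1 + C2 + B\<beta> * (C\<psi> * C1^2)"
   have C20: "0 <= C2" using C2[of undefined] by linarith
   have um': "(%z. u' (fst z) (snd z)) \<in> borel_measurable (borel \<Otimes>\<^sub>M borel)"
   proof -
    have mx: "(%z. (fst z, max 0 (snd z))) \<in> borel \<Otimes>\<^sub>M borel \<rightarrow>\<^sub>M (borel :: 'e measure) \<Otimes>\<^sub>M restrict_space (borel :: real measure) {0..}"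
     by (intro measurable_Pair measurable_fst measurable_restrict_space2) auto
    have [measurable]: "(%z. u (fst z) (max 0 (snd z))) \<in> borel_measurable ((borel :: 'e measure) \<Otimes>\<^sub>M (borel :: real measure))"
     using measurable_compose[OF mx um] by simp
    have "(%z. if 0 <= snd z \<and> snd z <= r then u (fst z) (max 0 (snd z)) else 0) \<in> borel_measurable ((borel :: 'e measure) \<Otimes>\<^sub>M (borel :: real measure))"
     by measurable
    moreover have "(%z. if 0 <= snd z \<and> snd z <= r then u (fst z) (max 0 (snd z)) else 0) = (%z. u' (fst z) (snd z))"
     by (auto simp: u'_def fun_eq_iff)
    ultimately show ?thesis by simp
   qed
   have km': "(%z. k' (fst z) (snd z)) \<in> borel_measurable (borel \<Otimes>\<^sub>M borel)"
   proof -
    have [measurable]: "(%z. BR.psi0 (fst z) (max 0 (u' (fst z) (snd z)))) \<in> borel_measurable ((borel :: 'e measure) \<Otimes>\<^sub>M (borel :: real measure))"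
     using measurable_compose[OF _ BR.psi0_joint, of "%z. (u' (fst z) (snd z), fst z)" "borel \<Otimes>\<^sub>M borel"] um' by simp
    show ?thesis unfolding k'_def using BR.beta(1) by measurable
   qed
   have kb': "\<bar>k' y s\<bar> <= B\<beta> * (C\<psi> * C1^2)" for y s
   proof -
    have "BR.psi0 y (u' y s) <= C\<psi> * C1^2"
     using \<psi>(3)[OF u'0, of y y s] mult_left_mono[OF power_mono[OF u'C[of y s] u'0, of 2] \<psi>(1)] by linarith
    then show ?thesis unfolding k'_def abs_mult abs_minus_cancel using B\<beta> \<psi>(2)[OF u'0, of y y s] u'0[of y s] B\<beta>0
     by (intro mult_mono) (auto simp: max_def)
   qed
   have "u' y r = (LINT w|Q (Some y). weight r w * ext f (\<xi> r w)) +
     (LINT s:{0..r}|lborel. (LINT w|Q (Some y). weight s w * ext (%y. k' y (r - s)) (\<xi> s w)))"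
   proof (rule variation_of_constants[where C=C, OF r(1) fb _ um' _ km'])
    have nn: "0 <= B\<beta> * (C\<psi> * C1^2)" using B\<beta>0 \<psi>(1) by simp
    show "\<bar>f y\<bar> <= C" for y using C2[of y] C10 nn by (simp add: C_def)
    show "\<bar>u' y s\<bar> <= C" for y s using u'0[of y s] u'C[of y s] C20 nn by (simp add: C_def)
    show "\<bar>k' y s\<bar> <= C" for y s using kb'[of y s] C20 C10 by (simp add: C_def)
    fix y s assume s: "0 <= s" "s <= r"
    have "(LINT w|Q (Some y). (LINT v:{0..s}|lborel. branching_mechanism a b n (\<xi> v w) (ext (%y. u y (s - v)) (\<xi> v w)) * ext \<beta> (\<xi> v w))) =
     (LINT w|Q (Some y). - (LINT v:{0..s}|lborel. ext (%y. \<alpha> y * u' y (s - v) + k' y (s - v)) (\<xi> v w)))"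
    proof (intro integral_cong refl)
     fix w
     have "(LINT v:{0..s}|lborel. branching_mechanism a b n (\<xi> v w) (ext (%y. u y (s - v)) (\<xi> v w)) * ext \<beta> (\<xi> v w)) =
       (LINT v|lborel. - (indicator {0..s} v *\<^sub>R ext (%y. \<alpha> y * u' y (s - v) + k' y (s - v)) (\<xi> v w)))"
      unfolding set_lebesgue_integral_def
     proof (intro integral_cong refl)
      fix v
      show "indicator {0..s} v *\<^sub>R (branching_mechanism a b n (\<xi> v w) (ext (%y. u y (s - v)) (\<xi> v w)) * ext \<beta> (\<xi> v w)) =
        - (indicator {0..s} v *\<^sub>R ext (%y. \<alpha> y * u' y (s - v) + k' y (s - v)) (\<xi> v w))"
      proof (cases "v \<in> {0..s}")
       case True
       then have sv: "0 <= s - v" "s - v <= r" using s by auto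
       show ?thesis
       proof (cases "\<xi> v w")
        case (Some y)
        have "u' y (s - v) = u y (s - v)" "max 0 (u y (s - v)) = u y (s - v)" using sv u0 by (auto simp: u'_def)
        then show ?thesis using True Some
         by (simp add: BR.branching_mechanism_Some k'_def alpha_eq algebra_simps)
       qed simp
      qed simp
     qed
     then show "(LINT v:{0..s}|lborel. branching_mechanism a b n (\<xi> v w) (ext (%y. u y (s - v)) (\<xi> v w)) * ext \<beta> (\<xi> v w)) =
       - (LINT v:{0..s}|lborel. ext (%y. \<alpha> y * u' y (s - v) + k' y (s - v)) (\<xi> v w))"
      by (simp add: set_lebesgue_integral_def)
    qed
    then show "u' y s = (LINT w|Q (Some y). ext f (\<xi> s w)) +
      (LINT w|Q (Some y). (LINT v:{0..s}|lborel. ext (%y. \<alpha> y * u' y (s - v) + k' y (s - v)) (\<xi> v w)))"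
     using ueq[OF s(1), of y] s by (simp add: u'_def)
   qed
   also have "(LINT w|Q (Some y). weight r w * ext f (\<xi> r w)) = exp (lam0 * r) * U r f y"
    by (rule weight_integral(2)[OF r(1) f(1,3)])
   also have "(LINT s:{0..r}|lborel. (LINT w|Q (Some y). weight s w * ext (%y. k' y (r - s)) (\<xi> s w))) =
     (LINT s|lborel. - (indicator {0..r} s *\<^sub>R (LINT w|Q (Some y). weight s w * ext (%y. - k y (r - s)) (\<xi> s w))))"
    unfolding set_lebesgue_integral_def
   proof (intro integral_cong refl)
    fix s
    show "indicator {0..r} s *\<^sub>R (LINT w|Q (Some y). weight s w * ext (%y. k' y (r - s)) (\<xi> s w)) =
      - (indicator {0..r} s *\<^sub>R (LINT w|Q (Some y). weight s w * ext (%y. - k y (r - s)) (\<xi> s w)))"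
    proof (cases "s \<in> {0..r}")
     case True
     then have "k' y (r - s) = k y (r - s)" for y using u0 by (simp add: k'_def k_def u'_def max_def)
     then have "weight s w * ext (%y. k' y (r - s)) (\<xi> s w) = - (weight s w * ext (%y. - k y (r - s)) (\<xi> s w))" for w
      by (cases "\<xi> s w") auto
     then show ?thesis by simp
    qed simp
   qed
   also have "... = - (LINT s:{0..r}|lborel. (LINT w|Q (Some y). weight s w * ext (%y. - k y (r - s)) (\<xi> s w)))"
    by (simp add: set_lebesgue_integral_def)
   finally have e: "u' y r = exp (lam0 * r) * U r f y - (LINT s:{0..r}|lborel. (LINT w|Q (Some y). weight s w * ext (%y. - k y (r - s)) (\<xi> s w)))"
    by simp
   have "0 <= (LINT s:{0..r}|lborel. (LINT w|Q (Some y). weight s w * ext (%y. - k y (r - s)) (\<xi> s w)))"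
    unfolding set_lebesgue_integral_def
   proof (rule integral_nonneg_AE, rule AE_I2)
    fix s
    have "0 <= ext (%y. - k y (r - s)) z" if "s \<in> {0..r}" for z
     using that BR.beta(3) \<psi>(2) u0 by (cases z) (auto simp: k_def)
    then show "0 <= indicator {0..r} s *\<^sub>R (LINT w|Q (Some y). weight s w * ext (%y. - k y (r - s)) (\<xi> s w))"
     using weight_pos[of s] by (cases "s \<in> {0..r}") (auto intro!: integral_nonneg_AE simp: less_imp_le)
   qed
   then show ?thesis using e r by (simp add: u'_def)
  qed
  define f2 where "f2 y = (f y)^2" for y
  have f2: "f2 \<in> L2 m" "!!y. 0 <= f2 y"
   unfolding f2_def[abs_def] using L2_square[OF f(1) C2] by auto
  define R where "R = B\<beta> * C\<psi> * exp (K * t) * (exp (lam0 * t) * U t f2 x)"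
  have R0: "0 <= R" unfolding R_def using B\<beta>0 \<psi>(1) kern_U(2)[OF t f2, of x] by simp
  have "(LINT s:{0..t}|lborel. (LINT w|Q (Some x). weight s w * ext (%y. - k y (t - s)) (\<xi> s w))) <= (LINT s|lborel. indicator {0..t} s * R)"
   unfolding set_lebesgue_integral_def
  proof (rule integral_mono')
   show "integrable lborel (%s. indicator {0..t} s * R)"
    by (intro integrable_mult_left integrable_real_indicator) (auto simp: emeasure_lborel_Icc_eq)
   show "0 <= indicator {0..t} s * R" for s using R0 by simp
   fix s :: real
   show "indicator {0..t} s *\<^sub>R (LINT w|Q (Some x). weight s w * ext (%y. - k y (t - s)) (\<xi> s w)) <= indicator {0..t} s * R"
   proof (cases "s \<in> {0..t}")
    case True
    then have s: "0 <= s" "0 <= t - s" "t - s <= t" "s + (t - s) = t" by auto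
    \<comment> \<open>Collects all constants that do not depend on the point, so that
      \<open>g\<close> is a multiple of \<open>U (t - s) f2\<close> and the semigroup law
      applies.\<close>
    define cc where "cc = B\<beta> * C\<psi> * exp (K * t) * exp (lam0 * (t - s))"
    have cc0: "0 <= cc" unfolding cc_def using B\<beta>0 \<psi>(1) by simp
    define g where "g y = cc * U (t - s) f2 y" for y
    have Uf2: "U (t - s) f2 \<in> L2 m" by (rule U_sq(1)[OF s(2) f2(1)])
    have g: "g \<in> L2 m" "!!y. 0 <= g y"
     unfolding g_def[abs_def] using L2_cmult[OF Uf2] kern_U(2)[OF s(2) f2] cc0 by auto
    have kg: "- k y (t - s) <= g y" for y
    proof -
     let ?S = "exp (lam0 * (t - s)) * U (t - s) f y"
     have us: "0 <= u y (t - s)" "u y (t - s) <= ?S" using u0[OF s(2)] conjunct1[OF upper_lower[OF s(2,3), of y]] by auto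
     have "- k y (t - s) <= B\<beta> * (C\<psi> * (u y (t - s))^2)"
      unfolding k_def using B\<beta>[of y] BR.beta(3)[of y] \<psi>(2,3)[OF us(1), of y] B\<beta>0
      by (auto intro!: mult_mono)
     also have "... <= B\<beta> * (C\<psi> * ?S^2)"
      using us B\<beta>0 \<psi>(1) by (intro mult_left_mono power_mono) auto
     also have "... <= B\<beta> * (C\<psi> * (exp (K * (t - s)) * (exp (lam0 * (t - s)) * U (t - s) f2 y)))"
      unfolding f2_def[abs_def] using B\<beta>0 \<psi>(1) by (intro mult_left_mono mean_square_le[OF s(2) f(1) C2]) auto
     also have "... <= B\<beta> * (C\<psi> * (exp (K * t) * (exp (lam0 * (t - s)) * U (t - s) f2 y)))"
      using B\<beta>0 \<psi>(1) K_nonneg s kern_U(2)[OF s(2) f2, of y]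
      by (intro mult_left_mono mult_right_mono) (auto intro!: mult_left_mono)
     also have "... = g y" by (simp add: g_def cc_def)
     finally show ?thesis .
    qed
    have "(LINT w|Q (Some x). weight s w * ext (%y. - k y (t - s)) (\<xi> s w)) <= (LINT w|Q (Some x). weight s w * ext g (\<xi> s w))"
    proof (rule integral_mono'[OF weight_integral(1)[OF s(1) g]])
     fix w
     show "weight s w * ext (%y. - k y (t - s)) (\<xi> s w) <= weight s w * ext g (\<xi> s w)"
      by (rule mult_left_mono) (use kg weight_pos[of s w] in \<open>auto split: option.splits simp: less_imp_le\<close>)
     show "0 <= weight s w * ext g (\<xi> s w)"
      using g(2) weight_pos[of s w] by (cases "\<xi> s w") (auto simp: less_imp_le)
    qed
    also have "... = exp (lam0 * s) * U s g x" by (rule weight_integral(2)[OF s(1) g])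
    also have "U s g x = cc * U t f2 x"
     using U_lincomb[OF s(1) Uf2 Uf2, of cc 0 x] U_semigroup[OF s(1,2) f2(1)] s(4) by (simp add: g_def[abs_def])
    also have "exp (lam0 * s) * (cc * U t f2 x) = R"
    proof -
     have "exp (lam0 * s) * exp (lam0 * (t - s)) = exp (lam0 * t)" by (simp add: exp_add[symmetric] algebra_simps)
     then show ?thesis unfolding cc_def R_def by (metis mult.assoc mult.left_commute)
    qed
    finally show ?thesis using True by simp
   qed simp
  qed
  also have "... = R * t" using t by simp
  finally have "(LINT s:{0..t}|lborel. (LINT w|Q (Some x). weight s w * ext (%y. - k y (t - s)) (\<xi> s w))) <= R * t" .
  then show "u x t <= exp (lam0 * t) * U t f x \<and>
   exp (lam0 * t) * U t f x - B\<beta> * C\<psi> * t * exp (K * t) * (exp (lam0 * t) * U t (%y. (f y)^2) x) <= u x t"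
   using upper_lower[OF t order_refl, of x] unfolding R_def f2_def[abs_def] by (auto simp: algebra_simps)
 qed
qed

lemma X_finite_borel:
 assumes "w \<in> \<Omega>" "0 <= t"
 shows "finite_measure (X t w)" "sets (X t w) = sets borel" "space (X t w) = UNIV"
 using SP.X_in_space[OF assms] sets_eq_imp_space_eq[of "X t w" borel] by (auto simp: finite_borel_measures_def)

lemma mass_measurable_G:
 assumes "f \<in> borel_measurable borel" "0 <= t"
 shows "(%w. NN (X t w) f) \<in> borel_measurable (G (ennreal t))"
 by (rule measurable_compose[OF SP.adapted[OF assms(2)] measurable_nn_integral_weak[OF assms(1)]])

lemma mass_measurable:
 assumes "mu \<in> finite_borel_measures" "f \<in> borel_measurable borel" "0 <= t"
 shows "(%w. NN (X t w) f) \<in> borel_measurable (P mu)"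
 using SP.measurable_F_P[of mu, OF _ mass_measurable_G[OF assms(2,3)]] assms(1) by simp

text \<open>Stated in \<open>[0, \<infinity>]\<close> so as to survive monotone limits. The square
  is a separate argument because it is taken among the reals for bounded functions and in
  \<open>ennreal\<close> for general ones.\<close>

definition moment_bound :: "real => ('e => ennreal) => ('e => ennreal) => real => 'e measure => bool" where
 "moment_bound c f f2 t mu \<longleftrightarrow> (NN (P mu) (%w. (NN (X t w) f))) = (NN mu (kern t f)) \<and>
   (NN (P mu) (%w. (NN (X t w) f)^2)) <= (NN mu (kern t f))^2 +
    ennreal (c * t * exp (K * t)) * (NN mu (kern t f2))"

lemma moments_bounded:
 obtains c where "0 <= c"
  "!!f t mu. f \<in> L2 m ==> bounded (range f) ==> (!!y. 0 <= f y) ==> 0 <= t ==> mu \<in> finite_borel_measures ==>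
   moment_bound c (%y. ennreal (f y)) (%y. ennreal ((f y)^2)) t mu"
proof -
 obtain c where c: "0 <= c" and cb: "!!f t x u. f \<in> L2 m ==> bounded (range f) ==> (!!y. 0 <= f y) ==> 0 <= t ==>
   cumulant_solution \<xi> Q \<beta> (branching_mechanism a b n) f u ==>
   u x t <= exp (lam0 * t) * U t f x \<and>
   exp (lam0 * t) * U t f x - c * t * exp (K * t) * (exp (lam0 * t) * U t (%y. (f y)^2) x) <= u x t"
  using cumulant_bounds by blast
 show ?thesis
 \<comment> \<open>The factor 2 is that of \<open>2 * D\<close> in
   \<open>laplace_moments\<close>.\<close>
 proof (rule that[of "2 * c"])
  show "0 <= 2 * c" using c by simp
  fix f and t :: real and mu :: "'e measure"
  assume f: "f \<in> L2 m" "bounded (range f)" "!!y. 0 <= f y" and t: "0 <= t" and mu: "mu \<in> finite_borel_measures"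
  interpret Pm: prob_space "P mu" using SP.prob_space_P[of mu] mu by simp
  have spP: "space (P mu) = \<Omega>" using SP.space_P[of mu] mu by simp
  interpret mu: finite_measure mu using mu by (simp add: finite_borel_measures_def)
  have smu: "sets mu = sets borel" using mu by (simp add: finite_borel_measures_def)
  have fb: "f \<in> borel_measurable borel" using L2D(1)[OF f(1)] by (simp only: borel_m)
  obtain C where C: "!!y. \<bar>f y\<bar> <= C" using f(2) by (auto simp: bounded_iff)
  have C': "f y <= C" for y using C[of y] by simp
  have C0: "0 <= C" using C[of undefined] by linarith
  define f2 where "f2 y = (f y)^2" for y
  have f2: "f2 \<in> L2 m" "!!y. 0 <= f2 y" "!!y. f2 y <= C^2"
   unfolding f2_def[abs_def] using L2_square[OF f(1) C] C abs_le_square_iff[of _ C] C0 by auto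
  define S where "S g x = exp (lam0 * t) * U t g x" for g x
  have S0: "0 <= S f x" "0 <= S f2 x" for x
   unfolding S_def using kern_U(2)[OF t f(1,3)] kern_U(2)[OF t f2(1,2)] by auto
  have Sb: "S f x <= exp (K * t) * C" "S f2 x <= exp (K * t) * C^2" for x
   unfolding S_def using mean_bounded[OF t f(1,3) C'] mean_bounded[OF t f2] by auto
  have Sm: "S g \<in> borel_measurable mu" if "g \<in> L2 m" for g
  proof -
   have "U t g \<in> borel_measurable borel" using L2D(1)[OF U_sq(1)[OF t that]] by (simp only: borel_m)
   then have "S g \<in> borel_measurable borel" unfolding S_def[abs_def] by measurable
   then show ?thesis by (rule measurable_of_sets_borel[OF smu])
  qed
  have Si: "integrable mu (S f)" "integrable mu (S f2)"
   using mu.integrable_const_bound[of "S f" "exp (K * t) * C"] mu.integrable_const_bound[of "S f2" "exp (K * t) * C^2"]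
    Sm[OF f(1)] Sm[OF f2(1)] S0 Sb by auto
  define A where "A = (LINT x|mu. S f x)"
  define V where "V = (LINT x|mu. S f2 x)"
  define D where "D = c * t * exp (K * t) * V"
  have A0: "0 <= A" unfolding A_def using S0 by (intro integral_nonneg_AE) auto
  have V0: "0 <= V" unfolding V_def using S0 by (intro integral_nonneg_AE) auto
  have D0: "0 <= D" unfolding D_def using c t V0 by simp
  define Z where "Z w = (LINT x|X t w. f x)" for w
  have Zn: "(NN (X t w) (%x. ennreal (f x))) = ennreal (Z w)" if "w \<in> \<Omega>" for w
  proof -
   interpret finite_measure "X t w" by (rule X_finite_borel(1)[OF that t])
   have "integrable (X t w) f"
    by (rule integrable_const_bound[where B=C]) (use C measurable_of_sets_borel[OF X_finite_borel(2)[OF that t] fb] in auto)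
   then show ?thesis unfolding Z_def using f(3) by (intro nn_integral_eq_integral) auto
  qed
  have Z0: "0 <= Z w" for w unfolding Z_def using f(3) by (intro integral_nonneg_AE) auto
  have Zm: "Z \<in> borel_measurable (P mu)"
  proof -
   have "(%w. enn2real (NN (X t w) (%x. ennreal (f x)))) \<in> borel_measurable (P mu)"
    using mass_measurable[OF mu _ t, of "%x. ennreal (f x)"] fb by measurable
   then show ?thesis
    by (rule measurable_cong[THEN iffD1, rotated]) (use Zn Z0 in \<open>simp add: spP\<close>)
  qed
  have mk: "(NN mu (%x. kern t (%y. ennreal (f y)) x)) = ennreal A" "(NN mu (%x. kern t (%y. ennreal ((f y)^2)) x)) = ennreal V"
   using kern_U(1)[OF t f(1,3)] kern_U(1)[OF t f2(1,2)] S0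
    nn_integral_eq_integral[OF Si(1)] nn_integral_eq_integral[OF Si(2)]
   unfolding A_def V_def f2_def[symmetric] S_def by simp_all
  have L: "\<exists>u. Pm.expectation (%w. exp (- th * Z w)) = exp (- u) \<and> 0 <= u \<and> th * A - th^2 * D <= u \<and> u <= th * A" if th: "0 < th" for th
  proof -
   let ?g = "%y. th * f y"
   have g: "?g \<in> L2 m" "!!y. 0 <= ?g y" "?g \<in> borel_measurable borel"
    using L2_cmult[OF f(1)] f(3) th fb by auto
   have gb: "bounded (range ?g)"
   proof (rule boundedI[of _ "th * C"])
    fix z assume "z \<in> range ?g"
    then obtain y where "z = th * f y" by auto
    then show "norm z <= th * C" using C[of y] th by (simp add: abs_mult)
   qed
   obtain u where cs: "cumulant_solution \<xi> Q \<beta> (branching_mechanism a b n) ?g u"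
    and lap: "\<forall>mu\<in>finite_borel_measures. \<forall>t\<ge>0. - ln (LINT w|P mu. exp (- (LINT x|X t w. ?g x))) = (LINT x|mu. u x t)"
    using SP.log_laplace[OF g(3) gb g(2)] by blast
   have Ug: "U t ?g x = th * U t f x" "U t (%y. (?g y)^2) x = th^2 * U t f2 x" for x
    using U_lincomb[OF t f(1) f(1), of th 0 x] U_lincomb[OF t f2(1) f2(1), of "th^2" 0 x]
    by (simp_all add: power_mult_distrib f2_def)
   have ub: "u x t <= th * S f x" "th * S f x - th^2 * (c * t * exp (K * t)) * S f2 x <= u x t" for x
    using cb[OF g(1) gb g(2) t cs, of x] unfolding Ug S_def by (auto simp: algebra_simps)
   have u0: "0 <= u x t" for x using cs t unfolding cumulant_solution_def by blast
   have um: "(%x. u x t) \<in> borel_measurable mu"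
   proof (rule measurable_of_sets_borel[OF smu])
    have 1: "(%(x, t). u x t) \<in> borel_measurable (borel \<Otimes>\<^sub>M restrict_space borel {0..})"
     using cs unfolding cumulant_solution_def by blast
    have 2: "(%x. (x, t)) \<in> borel \<rightarrow>\<^sub>M (borel :: 'e measure) \<Otimes>\<^sub>M restrict_space (borel :: real measure) {0..}"
     using t by (intro measurable_Pair) (auto simp: space_restrict_space)
    show "(%x. u x t) \<in> borel_measurable borel" using measurable_compose[OF 2 1] by simp
   qed
   have ui: "integrable mu (%x. u x t)"
    by (rule integrable_bound[OF integrable_mult_right[OF Si(1), of th] um])
     (use ub(1) u0 S0 th in \<open>auto intro!: AE_I2\<close>)
   define v where "v = (LINT x|mu. u x t)"
   have "v <= (LINT x|mu. th * S f x)" unfolding v_def using ui Si ub by (intro integral_mono) auto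
   then have w1: "v <= th * A" by (simp add: A_def)
   have "(LINT x|mu. th * S f x - th^2 * (c * t * exp (K * t)) * S f2 x) <= v" unfolding v_def using ui Si ub by (intro integral_mono) auto
   then have w2: "th * A - th^2 * D <= v" using Si by (simp add: A_def V_def D_def mult.assoc)
   have w0: "0 <= v" unfolding v_def using u0 by (intro integral_nonneg_AE) auto
   define I where "I = Pm.expectation (%w. exp (- th * Z w))"
   have iI: "integrable (P mu) (%w. exp (- th * Z w))"
    using Z0 th Zm by (intro Pm.integrable_const_bound[where B=1]) auto
   \<comment> \<open>The log-Laplace identity determines \<open>I\<close> only once the argument of
     the logarithm is known to be positive.\<close>
   have "I \<noteq> 0"
   proof
    assume "I = 0"
    then have "AE w in P mu. exp (- th * Z w) = 0"
     unfolding I_def by (subst (asm) integral_nonneg_eq_0_iff_AE[OF iI]) auto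
    then show False by simp
   qed
   moreover have "0 <= I" unfolding I_def by (intro integral_nonneg_AE) auto
   ultimately have I0: "0 < I" by simp
   have "- ln I = v" using lap mu t unfolding I_def v_def Z_def by (simp add: mult.commute)
   then have "I = exp (- v)" using I0 by (metis exp_ln minus_minus)
   then show ?thesis using w0 w1 w2 unfolding I_def by blast
  qed
  note mom = Pm.laplace_moments[OF Zm Z0 A0 D0 L]
  have "(NN (P mu) (%w. (NN (X t w) (%x. ennreal (f x))))) = (NN (P mu) (%w. ennreal (Z w)))"
   by (intro nn_integral_cong) (simp add: Zn spP)
  also have "... = ennreal A" using mom(1,2) Z0 by (subst nn_integral_eq_integral) auto
  finally have 1: "(NN (P mu) (%w. (NN (X t w) (%x. ennreal (f x))))) = ennreal A" .
  have "(NN (P mu) (%w. (NN (X t w) (%x. ennreal (f x)))^2)) = (NN (P mu) (%w. ennreal ((Z w)^2)))"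
   by (intro nn_integral_cong) (simp add: Zn spP Z0 ennreal_power)
  also have "... <= ennreal (A^2 + 2 * D)" by (rule mom(3))
  also have "... = (ennreal A)^2 + ennreal (2 * c * t * exp (K * t)) * ennreal V"
   using A0 V0 D0 c t by (simp add: ennreal_power D_def ennreal_mult'[symmetric] mult.assoc)
  finally show "moment_bound (2 * c) (%y. ennreal (f y)) (%y. ennreal ((f y)^2)) t mu"
   unfolding moment_bound_def mk using 1 by blast
 qed
qed

text \<open>Monotone convergence passes the mean to the limit as an equality; for the second moment
  Fatou gives the inequality, which is the direction required for variance bounds.\<close>

lemma moments:
 obtains c where "0 <= c"
  "!!f t mu. f \<in> borel_measurable borel ==> 0 <= t ==> mu \<in> finite_borel_measures ==>
   moment_bound c f (%y. (f y)^2) t mu"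
proof -
 obtain c where c: "0 <= c" and mb: "!!f t mu. f \<in> L2 m ==> bounded (range f) ==> (!!y. 0 <= f y) ==> 0 <= t ==> mu \<in> finite_borel_measures ==>
   moment_bound c (%y. ennreal (f y)) (%y. ennreal ((f y)^2)) t mu"
  using moments_bounded by blast
 show ?thesis
 proof (rule that[OF c])
  fix f :: "'e => ennreal" and t :: real and mu :: "'e measure"
  assume f: "f \<in> borel_measurable borel" and t: "0 <= t" and mu: "mu \<in> finite_borel_measures"
  have spP: "space (P mu) = \<Omega>" using SP.space_P[of mu] mu by simp
  have smu: "sets mu = sets borel" using mu by (simp add: finite_borel_measures_def)
  obtain g :: "nat => 'e => real" where g: "!!i. g i \<in> L2 m" "!!i. bounded (range (g i))" "!!i y. 0 <= g i y"
   "incseq (%i y. ennreal (g i y))" "!!y. f y = (SUP i. ennreal (g i y))"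
   using L2_approx[OF f] by metis
  have gm: "(%y. ennreal (g i y)) \<in> borel_measurable borel" for i
   using L2D(1)[OF g(1)[of i]] unfolding borel_m by measurable
  have fS: "f = (%y. SUP i. ennreal (g i y))" using g(5) by auto
  have inc: "ennreal (g i y) <= ennreal (g j y)" if "i <= j" for i j y
   using g(4) that by (auto simp: incseq_def le_fun_def)
  have Xf: "(NN (X t w) f) = (SUP i. NN (X t w) (%x. ennreal (g i x)))" if "w \<in> \<Omega>" for w
   unfolding fS using g(4) measurable_of_sets_borel[OF X_finite_borel(2)[OF that t] gm]
   by (rule nn_integral_monotone_convergence_SUP)
  have Xinc: "incseq (%i. NN (X t w) (%x. ennreal (g i x)))" for w
   using inc by (auto simp: incseq_def intro!: nn_integral_mono)
  have mkf: "(NN mu (kern t f)) = (SUP i. NN mu (%x. kern t (%y. ennreal (g i y)) x))"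
  proof -
   have "(NN mu (kern t f)) = (NN mu (%x. (SUP i. kern t (%y. ennreal (g i y)) x)))"
    unfolding fS by (intro nn_integral_cong kern_SUP gm g(4) t)
   also have "... = (SUP i. NN mu (%x. kern t (%y. ennreal (g i y)) x))"
    using inc measurable_of_sets_borel[OF smu kern_measurable[OF t gm]]
    by (intro nn_integral_monotone_convergence_SUP) (auto simp: incseq_def le_fun_def intro!: kern_mono)
   finally show ?thesis .
  qed
  have mkle: "kern t (%y. ennreal (g i y)) x <= kern t f x" for i x
   unfolding fS by (intro kern_mono SUP_upper) simp
  have mk2le: "kern t (%y. ennreal ((g i y)^2)) x <= kern t (%y. (f y)^2) x" for i x
  proof (rule kern_mono)
   fix y
   have "ennreal (g i y) <= f y" unfolding fS by (intro SUP_upper) simp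
   then show "ennreal ((g i y)^2) <= (f y)^2"
    using g(3)[of i y] by (simp add: ennreal_power[symmetric] power_mono)
  qed
  have Xm: "(%w. NN (X t w) (%x. ennreal (g i x))) \<in> borel_measurable (P mu)" for i
   by (rule mass_measurable[OF mu gm t])
  have "(NN (P mu) (%w. (NN (X t w) f))) = (NN (P mu) (%w. (SUP i. NN (X t w) (%x. ennreal (g i x)))))"
   by (intro nn_integral_cong) (simp add: Xf spP)
  also have "... = (SUP i. NN (P mu) (%w. (NN (X t w) (%x. ennreal (g i x)))))"
   using Xinc by (intro nn_integral_monotone_convergence_SUP Xm) (auto simp: incseq_def le_fun_def)
  also have "... = (SUP i. NN mu (%x. kern t (%y. ennreal (g i y)) x))"
   using mb[OF g(1-3) t mu] by (simp add: moment_bound_def)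
  finally have 1: "(NN (P mu) (%w. (NN (X t w) f))) = (NN mu (kern t f))" using mkf by simp
  have "(NN (P mu) (%w. (NN (X t w) f)^2)) <= (NN (P mu) (%w. liminf (%i. (NN (X t w) (%x. ennreal (g i x)))^2)))"
  proof (intro nn_integral_mono)
   fix w assume "w \<in> space (P mu)"
   then have "(%i. NN (X t w) (%x. ennreal (g i x))) \<longlonglongrightarrow> (NN (X t w) f)"
    using LIMSEQ_SUP[OF Xinc] Xf by (simp add: spP)
   then have "(%i. (NN (X t w) (%x. ennreal (g i x)))^2) \<longlonglongrightarrow> (NN (X t w) f)^2"
    unfolding power2_eq_square by (intro tendsto_mult_ennreal) (auto simp: zero_less_iff_neq_zero)
   then show "(NN (X t w) f)^2 <= liminf (%i. (NN (X t w) (%x. ennreal (g i x)))^2)"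
    by (simp add: lim_imp_Liminf)
  qed
  also have "... <= liminf (%i. NN (P mu) (%w. (NN (X t w) (%x. ennreal (g i x)))^2))"
   unfolding power2_eq_square by (intro nn_integral_liminf borel_measurable_times_ennreal Xm)
  also have "... <= liminf (%i :: nat. (NN mu (kern t f))^2 +
    ennreal (c * t * exp (K * t)) * (NN mu (%x. kern t (%y. (f y)^2) x)))"
  proof (intro Liminf_mono always_eventually allI)
   fix i
   have "(NN (P mu) (%w. (NN (X t w) (%x. ennreal (g i x)))^2)) <= (NN mu (%x. kern t (%y. ennreal (g i y)) x))^2 +
    ennreal (c * t * exp (K * t)) * (NN mu (%x. kern t (%y. ennreal ((g i y)^2)) x))"
    using mb[OF g(1-3) t mu] unfolding moment_bound_def by blast
   also have "... <= (NN mu (kern t f))^2 +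
    ennreal (c * t * exp (K * t)) * (NN mu (%x. kern t (%y. (f y)^2) x))"
    by (intro add_mono power_mono mult_left_mono nn_integral_mono mkle mk2le) auto
   finally show "(NN (P mu) (%w. (NN (X t w) (%x. ennreal (g i x)))^2)) <= (NN mu (kern t f))^2 +
    ennreal (c * t * exp (K * t)) * (NN mu (%x. kern t (%y. (f y)^2) x))" .
  qed
  finally have 2: "(NN (P mu) (%w. (NN (X t w) f)^2)) <= (NN mu (kern t f))^2 +
    ennreal (c * t * exp (K * t)) * (NN mu (%x. kern t (%y. (f y)^2) x))"
   by (simp add: Liminf_const)
  show "moment_bound c f (%y. (f y)^2) t mu"
   unfolding moment_bound_def using 1 2 by blast
 qed
qed

end

section \<open>Convergence along dyadic times\<close>

text \<open>Doob's inequality by decomposition at the first exceedance. The martingale property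
  enters in weak form, as equality of the pairings with square integrable functions of the past, so
  no conditional expectations appear.\<close>

lemma (in prob_space) maximal_inequality:
 fixes D :: "nat => 'a => real"
 assumes D: "!!i. i <= N ==> D i \<in> L2 M"
  and D_F: "!!i j. j <= i ==> i <= N ==> D j \<in> borel_measurable (F i)"
  and orth: "!!i H. i <= N ==> H \<in> L2 M ==> H \<in> borel_measurable (F i) ==>
   (LINT w|M. H w * D i w) = (LINT w|M. H w * D N w)"
  and eps: "0 < eps"
 shows "prob {w \<in> space M. \<exists>i\<le>N. eps < \<bar>D i w\<bar>} <= sq_int M (D N) / eps^2"
proof -
 define c where "c i w = (indicator {..eps} \<bar>D i w\<bar> :: real)" for i w
 \<comment> \<open>The indicator that the level is exceeded first at index \<open>i\<close>, written
   as a product so that the sums telescope.\<close>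
 define a where "a i w = (1 - c i w) * (\<Prod>j<i. c j w)" for i w
 have c01: "c i w = 0 \<or> c i w = 1" for i w by (auto simp: c_def indicator_def)
 have prod01: "(\<Prod>j\<in>J. c j w) = 0 \<or> (\<Prod>j\<in>J. c j w) = 1" for J w
 proof (induction J rule: infinite_finite_induct)
  case (insert x J)
  have "(\<Prod>j\<in>insert x J. c j w) = c x w * (\<Prod>j\<in>J. c j w)" using insert(1,2) by simp
  then show ?case using insert(3) c01[of x w] by auto
 qed auto
 have a01: "a i w = 0 \<or> a i w = 1" for i w
  using c01[of i w] prod01[of w "{..<i}"] by (auto simp: a_def)
 have tele: "(\<Sum>i<n. a i w) = 1 - (\<Prod>j<n. c j w)" for n w
  by (induction n) (auto simp: a_def algebra_simps)
 have cF: "c j \<in> borel_measurable (F i)" if "j <= i" "i <= N" for i j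
  unfolding c_def[abs_def] using D_F[OF that] by measurable
 have aF: "a i \<in> borel_measurable (F i)" if "i <= N" for i
  unfolding a_def[abs_def] using that
  by (intro borel_measurable_times borel_measurable_diff borel_measurable_const borel_measurable_prod cF) auto
 have cM: "c j \<in> borel_measurable M" if "j <= N" for j
  unfolding c_def[abs_def] using L2D(1)[OF D[OF that]] by measurable
 have aM: "a i \<in> borel_measurable M" if "i <= N" for i
  unfolding a_def[abs_def] using that
  by (intro borel_measurable_times borel_measurable_diff borel_measurable_const borel_measurable_prod cM) auto
 have aint: "integrable M (a i)" if "i <= N" for i
  using a01 by (intro integrable_const_bound[where B=1] aM that AE_I2) (metis abs_0 abs_1 order_refl real_norm_def zero_le_one)
 have asq: "(%w. a i w * g w) \<in> L2 M" if "i <= N" "g \<in> L2 M" for i g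
 proof (rule L2_bound[OF that(2)])
  show "(%w. a i w * g w) \<in> borel_measurable M" using aM[OF that(1)] L2D(1)[OF that(2)] by measurable
  show "\<bar>a i w * g w\<bar> <= \<bar>g w\<bar>" for w using a01[of i w] by auto
 qed
 have ai: "integrable M (%w. a i w * (D N w)^2)" if "i <= N" for i
  using L2_mult[OF asq[OF that D[OF order_refl]] D[OF order_refl]] by (simp add: power2_eq_square mult.assoc)
 have key: "eps^2 * (LINT w|M. a i w) <= (LINT w|M. a i w * (D N w)^2)" if i: "i <= N" for i
 proof -
  note Di = D[OF i] and DN = D[OF order_refl]
  let ?H = "%w. a i w * D i w"
  have H: "?H \<in> L2 M" by (rule asq[OF i Di])
  have "?H \<in> borel_measurable (F i)" using aF[OF i] D_F[OF order_refl i] by measurable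
  then have o: "(LINT w|M. ?H w * D i w) = (LINT w|M. ?H w * D N w)" by (rule orth[OF i H])
  have 0: "0 <= (LINT w|M. a i w * (D N w - D i w)^2)"
   by (intro integral_nonneg_AE AE_I2) (metis a01 mult_nonneg_nonneg order_refl zero_le_one zero_le_power2)
  have "(LINT w|M. a i w * (D N w - D i w)^2) =
    (LINT w|M. a i w * (D N w)^2 - 2 * (?H w * D N w) + ?H w * D i w)"
   by (intro integral_cong refl) (simp add: power2_eq_square algebra_simps)
  also have "... = (LINT w|M. a i w * (D N w)^2) - 2 * (LINT w|M. ?H w * D N w) + (LINT w|M. ?H w * D i w)"
   using ai[OF i] L2_mult[OF H DN] L2_mult[OF H Di] by simp
  finally have 1: "(LINT w|M. ?H w * D i w) <= (LINT w|M. a i w * (D N w)^2)" using 0 o by linarith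
  have "(LINT w|M. eps^2 * a i w) <= (LINT w|M. ?H w * D i w)"
  proof (intro integral_mono integrable_mult_right aint i L2_mult[OF H Di])
   fix w
   show "eps^2 * a i w <= ?H w * D i w"
   proof (cases "a i w = 0")
    case False
    then have "c i w = 0" using c01[of i w] by (auto simp: a_def)
    then have "eps < \<bar>D i w\<bar>" by (auto simp: c_def indicator_def split: if_splits)
    then have "eps^2 <= (D i w)^2" using eps by (metis abs_le_square_iff abs_of_pos less_imp_le)
    then show ?thesis using False a01[of i w] by (auto simp: power2_eq_square)
   qed simp
  qed
  then show ?thesis using 1 by simp
 qed
 have "prob {w \<in> space M. \<exists>i\<le>N. eps < \<bar>D i w\<bar>} = (LINT w|M. indicator {w \<in> space M. \<exists>i\<le>N. eps < \<bar>D i w\<bar>} w)"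
  by (simp add: Int_absorb2 subset_eq)
 also have "... = (LINT w|M. (\<Sum>i<Suc N. a i w))"
 proof (intro integral_cong refl)
  fix w assume w: "w \<in> space M"
  show "indicat_real {w \<in> space M. \<exists>i\<le>N. eps < \<bar>D i w\<bar>} w = (\<Sum>i<Suc N. a i w)"
  proof (cases "\<exists>i\<le>N. eps < \<bar>D i w\<bar>")
   case True
   then obtain i where "i <= N" "eps < \<bar>D i w\<bar>" by blast
   then have "(\<Prod>j<Suc N. c j w) = 0" by (intro prod_zero) (auto simp: c_def intro!: bexI[of _ i])
   then show ?thesis unfolding tele using True w by simp
  next
   case False
   then have "c j w = 1" if "j < Suc N" for j using that by (auto simp: c_def not_less)
   then have "(\<Prod>j<Suc N. c j w) = 1" by (intro prod.neutral) auto
   then show ?thesis unfolding tele using False by (auto simp: indicator_def)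
  qed
 qed
 also have "... = (\<Sum>i<Suc N. LINT w|M. a i w)" using aint by (intro Bochner_Integration.integral_sum) auto
 finally have "eps^2 * prob {w \<in> space M. \<exists>i\<le>N. eps < \<bar>D i w\<bar>} = (\<Sum>i<Suc N. eps^2 * (LINT w|M. a i w))"
  by (simp only: sum_distrib_left)
 also have "... <= (\<Sum>i<Suc N. LINT w|M. a i w * (D N w)^2)" using key by (intro sum_mono) auto
 also have "... = (LINT w|M. (\<Sum>i<Suc N. a i w * (D N w)^2))" using ai by (intro Bochner_Integration.integral_sum[symmetric]) auto
 also have "... <= sq_int M (D N)"
  unfolding sq_int_def sum_distrib_right[symmetric] tele
 proof (rule integral_mono')
  show "integrable M (%w. (D N w)^2)" using L2D(2)[OF D[OF order_refl]] .
  show "(1 - (\<Prod>j<Suc N. c j w)) * (D N w)^2 <= (D N w)^2" for w using prod01[of w "{..<Suc N}"] by (elim disjE) (simp_all only:, simp_all)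
 qed simp
 finally show ?thesis using eps by (simp add: field_simps)
qed

lemma AE_measure_support:
 fixes mu :: "'e::second_countable_topology measure"
 assumes "sets mu = sets borel"
 shows "AE x in mu. x \<in> measure_support mu"
proof -
 obtain \<B> :: "'e set set" where \<B>: "countable \<B>" "topological_basis \<B>" using ex_countable_basis by blast
 have "(\<Union>B\<in>{B \<in> \<B>. emeasure mu B = 0}. B) \<in> null_sets mu"
  using \<B>(1) topological_basis_open[OF \<B>(2)] assms by (intro null_sets_UN' null_setsI) auto
 then show ?thesis
 proof (rule AE_I')
  show "{x \<in> space mu. x \<notin> measure_support mu} \<subseteq> (\<Union>B\<in>{B \<in> \<B>. emeasure mu B = 0}. B)"
  proof
   fix x assume "x \<in> {x \<in> space mu. x \<notin> measure_support mu}"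
   then obtain U where U: "open U" "x \<in> U" "emeasure mu U = 0" by (auto simp: measure_support_def)
   then obtain B where B: "B \<in> \<B>" "x \<in> B" "B \<subseteq> U" using topological_basisE[OF \<B>(2)] by metis
   then have "emeasure mu B = 0" using emeasure_mono[of B U mu] U assms by simp
   then show "x \<in> (\<Union>B\<in>{B \<in> \<B>. emeasure mu B = 0}. B)" using B by auto
  qed
 qed
qed

text \<open>This is how compactness of the support of the initial law enters: continuous functions
  such as \<open>phi0\<close>, which may be unbounded, become integrable.\<close>

lemma integrable_compact_support:
 fixes mu :: "'e::second_countable_topology measure" and h :: "'e => real"
 assumes mu: "mu \<in> finite_borel_measures" "compact (measure_support mu)" and h: "continuous_on UNIV h"
 shows "integrable mu h"
proof -
 have s: "sets mu = sets borel" using mu by (simp add: finite_borel_measures_def)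
 interpret finite_measure mu using mu by (simp add: finite_borel_measures_def)
 have "bounded (h ` measure_support mu)"
  by (rule compact_imp_bounded[OF compact_continuous_image[OF continuous_on_subset[OF h] mu(2)]]) simp
 then obtain C where C: "!!x. x \<in> measure_support mu ==> norm (h x) <= C" by (auto simp: bounded_iff)
 show ?thesis
 proof (rule integrable_const_bound)
  show "AE x in mu. norm (h x) <= C" using AE_measure_support[OF s] by eventually_elim (rule C)
  show "h \<in> borel_measurable mu" by (rule measurable_of_sets_borel[OF s borel_measurable_continuous_onI[OF h]])
 qed
qed

section \<open>Functions dominated by a multiple of the eigenfunction\<close>

context supercritical_setting
begin

definition dominated :: "real => ('e => real) => bool" where
 "dominated c f \<longleftrightarrow> f \<in> borel_measurable borel \<and> (\<forall>x. \<bar>f x\<bar> <= c * phi0 x)"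

lemma phi0_borel: "phi0 \<in> borel_measurable borel"
 by (rule borel_measurable_continuous_onI[OF eigenfunctions_continuous(1)])

lemma dominatedD:
 assumes "dominated c f"
 shows "f \<in> borel_measurable borel" "\<bar>f x\<bar> <= c * phi0 x" "0 <= c" "f \<in> L2 m"
proof -
 show f: "f \<in> borel_measurable borel" and fc: "\<bar>f x\<bar> <= c * phi0 x" for x using assms by (auto simp: dominated_def)
 have "0 <= c * phi0 undefined" using fc[of undefined] by linarith
 then show c: "0 <= c" using eigenfunctions_pos(1)[of undefined] by (simp add: zero_le_mult_iff)
 show "f \<in> L2 m"
  by (rule L2_bound[OF L2_cmult[OF eigenfunctions_L2(1), of c]])
   (use f fc in \<open>auto simp: borel_m intro: order_trans[OF _ abs_ge_self]\<close>)
qed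

lemma dominated_phi0: "dominated 1 phi0"
 using phi0_borel eigenfunctions_pos(1) less_imp_le by (auto simp: dominated_def)

lemma dominated_parts:
 assumes "dominated c f"
 shows "dominated c (%x. max (f x) 0)" "dominated c (%x. max (- f x) 0)" "dominated c (%x. \<bar>f x\<bar>)"
proof -
 note [measurable] = dominatedD(1)[OF assms]
 have "max (f x) 0 <= c * phi0 x" "max (- f x) 0 <= c * phi0 x" for x using dominatedD(2)[OF assms, of x] by auto
 then show "dominated c (%x. max (f x) 0)" "dominated c (%x. max (- f x) 0)" "dominated c (%x. \<bar>f x\<bar>)"
  using dominatedD(2)[OF assms] by (auto simp: dominated_def)
qed

lemma dominated_lincomb:
 assumes "dominated c f" "dominated d g"
 shows "dominated (\<bar>u\<bar> * c + \<bar>v\<bar> * d) (%x. u * f x + v * g x)"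
 unfolding dominated_def
proof (intro conjI allI)
 show "(%x. u * f x + v * g x) \<in> borel_measurable borel" using dominatedD(1)[OF assms(1)] dominatedD(1)[OF assms(2)] by measurable
 fix x
 have "\<bar>u * f x + v * g x\<bar> <= \<bar>u\<bar> * \<bar>f x\<bar> + \<bar>v\<bar> * \<bar>g x\<bar>" by (simp add: abs_mult[symmetric])
 also have "... <= \<bar>u\<bar> * (c * phi0 x) + \<bar>v\<bar> * (d * phi0 x)"
  by (intro add_mono mult_left_mono dominatedD(2)[OF assms(1)] dominatedD(2)[OF assms(2)]) auto
 finally show "\<bar>u * f x + v * g x\<bar> <= (\<bar>u\<bar> * c + \<bar>v\<bar> * d) * phi0 x" by (simp add: algebra_simps)
qed

lemma U_mono:
 assumes t: "0 <= t" and f: "f \<in> L2 m" "g \<in> L2 m" "!!x. f x <= g x"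
 shows "U t f x <= U t g x"
proof -
 have "0 <= U t (%x. 1 * g x + (- 1) * f x) x"
  using kern_U(2)[OF t L2_lincomb[OF f(2,1)], of 1 "- 1" x] f(3) by simp
 then show ?thesis unfolding U_lincomb[OF t f(2,1)] by simp
qed

text \<open>\<open>U t\<close> is monotone and fixes \<open>phi0\<close>, so the constant
  \<open>c\<close> is preserved; bounds that depend on \<open>f\<close> only through
  \<open>c\<close> therefore stay uniform along the orbit.\<close>

lemma U_dominated:
 assumes t: "0 <= t" and f: "dominated c f"
 shows "dominated c (U t f)"
 unfolding dominated_def
proof (intro conjI allI)
 note fs = dominatedD(4)[OF f] and phi = eigenfunctions_L2(1)
 show "U t f \<in> borel_measurable borel" using L2D(1)[OF U_sq(1)[OF t fs]] by (simp only: borel_m)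
 fix x
 have e: "U t (%x. a * phi0 x) x = a * phi0 x" for a using U_lincomb[OF t phi phi, of a 0 x] U_phi0[OF t] by simp
 have b: "f y <= c * phi0 y" "(- c) * phi0 y <= f y" for y using dominatedD(2)[OF f, of y] by auto
 have "U t f x <= c * phi0 x" using U_mono[OF t fs L2_cmult[OF phi] b(1), of x] unfolding e .
 moreover have "(- c) * phi0 x <= U t f x" using U_mono[OF t L2_cmult[OF phi] fs b(2), of x] unfolding e .
 ultimately show "\<bar>U t f x\<bar> <= c * phi0 x" by auto
qed

lemma kern_phi0: "0 <= t ==> kern t (%y. ennreal (phi0 y)) x = ennreal (exp (lam0 * t) * phi0 x)"
 using kern_U(1)[OF _ eigenfunctions_L2(1) less_imp_le[OF eigenfunctions_pos(1)]] by (simp add: U_phi0)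

end

section \<open>Rescaled integrals and their variance\<close>

context superprocess_setting
begin

text \<open>
 The positive and negative parts are integrated separately so that \<open>R t f\<close> is measurable everywhere,
 not only where \<open>f\<close> is integrable; it is junk where a part is infinite.
\<close>

definition R :: "real => ('e => real) => 'v => real" where
 "R t f w = exp (- lam0 * t) * (enn2real (NN (X t w) (%x. ennreal (f x))) - enn2real (NN (X t w) (%x. ennreal (- f x))))"

text \<open>Where it holds, \<open>R\<close> of a dominated function is a genuine integral. It is
  obtained almost surely at each fixed time, hence simultaneously at all dyadic ones.\<close>

definition fin :: "real => 'v => bool" where
 "fin t w \<longleftrightarrow> (NN (X t w) (%x. ennreal (phi0 x))) < \<top>"

lemma R_measurable_G: "0 <= t ==> f \<in> borel_measurable borel ==> R t f \<in> borel_measurable (G (ennreal t))"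
proof -
 assume t: "0 <= t" and [measurable]: "f \<in> borel_measurable borel"
 have "(%w. enn2real (NN (X t w) (%x. ennreal (f x)))) \<in> borel_measurable (G (ennreal t))"
  "(%w. enn2real (NN (X t w) (%x. ennreal (- f x)))) \<in> borel_measurable (G (ennreal t))"
  by (rule measurable_compose[OF mass_measurable_G[OF _ t]]; measurable)+
 then show ?thesis unfolding R_def[abs_def] by (intro borel_measurable_times borel_measurable_const borel_measurable_diff)
qed

lemma R_measurable:
 "mu \<in> finite_borel_measures ==> 0 <= t ==> f \<in> borel_measurable borel ==> R t f \<in> borel_measurable (P mu)"
 using SP.measurable_F_P[of mu, OF _ R_measurable_G] by simp

lemma R_integral:
 assumes w: "w \<in> \<Omega>" "0 <= t" "fin t w" and f: "dominated c f"
 shows "integrable (X t w) f" "R t f w = exp (- lam0 * t) * (LINT x|X t w. f x)"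
proof -
 note s = X_finite_borel(2)[OF w(1,2)]
 have "integrable (X t w) phi0"
  using w(3) abs_of_pos[OF eigenfunctions_pos(1)] measurable_of_sets_borel[OF s phi0_borel]
  by (auto simp: fin_def integrable_iff_bounded)
 then have "integrable (X t w) (%x. c * phi0 x)" by simp
 then show i: "integrable (X t w) f"
  by (rule integrable_bound)
   (use measurable_of_sets_borel[OF s dominatedD(1)[OF f]] dominatedD(2)[OF f] order_trans[OF _ abs_ge_self] in auto)
 show "R t f w = exp (- lam0 * t) * (LINT x|X t w. f x)"
  unfolding R_def real_lebesgue_integral_def[OF i] by simp
qed

lemma R_lincomb:
 assumes "w \<in> \<Omega>" "0 <= t" "fin t w" and f: "dominated c f" "dominated d g"
 shows "R t (%x. u * f x + v * g x) w = u * R t f w + v * R t g w"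
 using R_integral[OF assms(1-3) f(1)] R_integral[OF assms(1-3) f(2)] R_integral(2)[OF assms(1-3) dominated_lincomb[OF f, of u v]]
 by (simp add: algebra_simps)

lemma R_abs_le:
 assumes "w \<in> \<Omega>" "0 <= t" "fin t w" and f: "dominated c f" "dominated d g" "!!x. \<bar>f x\<bar> <= g x"
 shows "\<bar>R t f w\<bar> <= R t g w"
proof -
 note Rf = R_integral[OF assms(1-3) f(1)] and Rg = R_integral[OF assms(1-3) f(2)]
 have "\<bar>(LINT x|X t w. f x)\<bar> <= (LINT x|X t w. \<bar>f x\<bar>)" by (rule integral_abs_bound)
 also have "... <= (LINT x|X t w. g x)" using Rf(1) Rg(1) f(3) by (intro integral_mono) auto
 finally show ?thesis unfolding Rf Rg by (simp add: abs_mult)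
qed

lemma R_abs_le_phi0:
 assumes "w \<in> \<Omega>" "0 <= t" "fin t w" and f: "dominated c f"
 shows "\<bar>R t f w\<bar> <= c * R t phi0 w"
proof -
 have d: "dominated c (%x. c * phi0 x)"
  using dominated_lincomb[OF dominated_phi0 dominated_phi0, of c 0] dominatedD(3)[OF f] by simp
 have "\<bar>R t f w\<bar> <= R t (%x. c * phi0 x) w" by (rule R_abs_le[OF assms(1-3) f d dominatedD(2)[OF f]])
 also have "... = c * R t phi0 w"
  using R_lincomb[OF assms(1-3) dominated_phi0 dominated_phi0, of c 0] by simp
 finally show ?thesis .
qed

lemma R_nn:
 assumes "w \<in> \<Omega>" "0 <= t" "fin t w" and f: "dominated c f" "!!x. 0 <= f x"
 shows "ennreal (R t f w) = ennreal (exp (- lam0 * t)) * (NN (X t w) (%x. ennreal (f x)))"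
 using R_integral[OF assms(1-4)] f(2) nn_integral_eq_integral[of "X t w" f] by (simp add: ennreal_mult')

lemma R_nonneg: "(!!x. 0 <= f x) ==> 0 <= R t f w"
 unfolding R_def by (simp add: ennreal_neg)

text \<open>Both sides consist of the same two nonnegative integrals, so this splitting holds at
  every point of the sample space.\<close>

lemma R_parts: "R t f w = R t (%x. max (f x) 0) w - R t (%x. max (- f x) 0) w"
proof -
 have "ennreal (max z 0) = ennreal z" "ennreal (- max z 0) = 0" for z :: real
  by (auto simp: max_def ennreal_neg)
 then show ?thesis unfolding R_def by (simp only: nn_integral_const mult_zero_left enn2real_0 diff_zero right_diff_distrib)
qed

lemma first_moment:
 assumes "f \<in> borel_measurable borel" "0 <= t" "\<nu> \<in> finite_borel_measures"
 shows "(NN (P \<nu>) (%w. (NN (X t w) f))) = (NN \<nu> (kern t f))"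
proof -
 obtain c where "0 <= c" and mb: "!!f t mu. f \<in> borel_measurable borel ==> 0 <= t ==> mu \<in> finite_borel_measures ==> moment_bound c f (%y. (f y)^2) t mu"
  using moments by blast
 then show ?thesis using mb[OF assms] unfolding moment_bound_def by blast
qed

context
 fixes mu :: "'e measure"
 assumes mu: "mu \<in> finite_borel_measures"
begin

lemma mass_markov:
 assumes t: "0 <= t" "0 <= s" and H: "H \<in> borel_measurable (G (ennreal t))" and f: "f \<in> borel_measurable borel"
 shows "(NN (P mu) (%w. H w * (NN (X (t + s) w) f))) = (NN (P mu) (%w. H w * (NN (X t w) (kern s f))))"
proof -
 have mu': "mu \<in> topspace weak_topology" using mu by simp
 note hm = measurable_nn_integral_weak[OF f]
 have "(NN (P mu) (%w. H w * (NN (X (t + s) w) f))) = (NN (P mu) (%w. H w * (NN (SP.transition s (X t w)) (%\<nu>. (NN \<nu> f)))))"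
  by (rule SP.markov_nn_integral[OF mu' t H hm])
 also have "... = (NN (P mu) (%w. H w * (NN (X t w) (kern s f))))"
 proof (intro nn_integral_cong)
  fix w assume "w \<in> space (P mu)"
  then have "X t w \<in> topspace weak_topology" using SP.X_in_space[OF _ t(1)] SP.space_P[OF mu'] by simp
  then show "H w * (NN (SP.transition s (X t w)) (%\<nu>. (NN \<nu> f))) = H w * (NN (X t w) (kern s f))"
   using SP.nn_integral_transition[OF _ t(2) hm] first_moment[OF f t(2)] by simp
 qed
 finally show ?thesis .
qed

text \<open>The moment bound started afresh from the state at time \<open>t\<close>, then averaged.
  The first moment formula and the semigroup law turn the averaged variance term into one at time
  \<open>t + s\<close>.\<close>

lemma mass_second_moment:
 obtains C where "0 <= C" "!!t s f. 0 <= t ==> 0 <= s ==> f \<in> borel_measurable borel ==>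
  (NN (P mu) (%w. (NN (X (t + s) w) f)^2)) <= (NN (P mu) (%w. (NN (X t w) (kern s f))^2)) +
   ennreal (C * s * exp (K * s)) * (NN mu (%x. kern (t + s) (%y. (f y)^2) x))"
proof -
 obtain C where C: "0 <= C" and mom: "!!f t mu. f \<in> borel_measurable borel ==> 0 <= t ==> mu \<in> finite_borel_measures ==>
   moment_bound C f (%y. (f y)^2) t mu"
  using moments by blast
 show ?thesis
 proof (rule that[OF C])
  fix t s :: real and f :: "'e => ennreal"
  assume t: "0 <= t" "0 <= s" and f: "f \<in> borel_measurable borel"
  have mu': "mu \<in> topspace weak_topology" using mu by simp
  have f2: "(%y. (f y)^2) \<in> borel_measurable borel" using f by measurable
  let ?c = "ennreal (C * s * exp (K * s))"
  have hm: "(%\<nu>. (NN \<nu> f)^2) \<in> borel_measurable (borel_on weak_topology)"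
   using measurable_nn_integral_weak[OF f] by measurable
  have "(NN (P mu) (%w. (NN (X (t + s) w) f)^2)) = (NN (P mu) (%w. (NN (SP.transition s (X t w)) (%\<nu>. (NN \<nu> f)^2))))"
   using SP.markov_nn_integral[OF mu' t borel_measurable_const hm, of 1] by simp
  also have "... <= (NN (P mu) (%w. (NN (X t w) (kern s f))^2 + ?c * (NN (X t w) (%x. kern s (%y. (f y)^2) x))))"
  proof (intro nn_integral_mono)
   fix w assume "w \<in> space (P mu)"
   then have "X t w \<in> topspace weak_topology" using SP.X_in_space[OF _ t(1)] SP.space_P[OF mu'] by simp
   then show "(NN (SP.transition s (X t w)) (%\<nu>. (NN \<nu> f)^2)) \<le>
     (NN (X t w) (kern s f))^2 + ?c * (NN (X t w) (%x. kern s (%y. (f y)^2) x))"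
    using SP.nn_integral_transition[OF _ t(2) hm] mom[OF f t(2)] by (simp add: moment_bound_def)
  qed
  also have "... = (NN (P mu) (%w. (NN (X t w) (kern s f))^2)) + ?c * (NN (P mu) (%w. (NN (X t w) (%x. kern s (%y. (f y)^2) x))))"
  proof -
   note [measurable] = mass_measurable[OF mu kern_measurable[OF t(2) f] t(1)] mass_measurable[OF mu kern_measurable[OF t(2) f2] t(1)]
   show ?thesis by (subst nn_integral_add) (auto simp: nn_integral_cmult)
  qed
  also have "(NN (P mu) (%w. (NN (X t w) (%x. kern s (%y. (f y)^2) x)))) = (NN mu (%x. kern (t + s) (%y. (f y)^2) x))"
   using mom[OF kern_measurable[OF t(2) f2] t(1) mu] kern_semigroup[OF t f2] by (simp add: moment_bound_def)
  finally show "(NN (P mu) (%w. (NN (X (t + s) w) f)^2)) <= (NN (P mu) (%w. (NN (X t w) (kern s f))^2)) +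
   ?c * (NN mu (%x. kern (t + s) (%y. (f y)^2) x))" .
 qed
qed

end

end

lemma sq_int_diff_le:
 assumes "f \<in> L2 m" "g \<in> L2 m"
 shows "sq_int m (%x. f x - g x) <= 2 * sq_int m f + 2 * sq_int m g"
 using sq_int_add_le[OF assms(1) L2_cmult[OF assms(2), of "- 1"]] sq_int_cmult[of m "- 1" g] by simp

lemma (in prob_space) expectation_abs_le_sq:
 assumes f: "f \<in> L2 M"
 shows "integrable M f" "expectation (%w. \<bar>f w\<bar>) <= sqrt (sq_int M f)"
proof -
 have 1: "(%w. 1) \<in> L2 M" by (simp add: L2_def)
 show "integrable M f" using L2_mult[OF f 1] by simp
 have "(LINT w|M. \<bar>f w\<bar> * 1)^2 <= sq_int M (%w. \<bar>f w\<bar>) * sq_int M (%w. 1)"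
  by (rule cauchy_schwarz_integral[OF L2_abs[OF f] 1])
 then have "(expectation (%w. \<bar>f w\<bar>))^2 <= sq_int M f" by (simp add: sq_int_def prob_space)
 then show "expectation (%w. \<bar>f w\<bar>) <= sqrt (sq_int M f)" by (rule real_le_rsqrt)
qed

context superprocess_setting
begin

context
 fixes mu :: "'e measure"
 assumes mu: "mu \<in> finite_borel_measures" and supp: "compact (measure_support mu)"
begin

interpretation Pm: prob_space "P mu" using SP.prob_space_P[of mu] mu by simp

lemma space_Pm: "space (P mu) = \<Omega>"
 using SP.space_P[of mu] mu by simp

lemma sets_mu: "sets mu = sets borel"
 using mu by (simp add: finite_borel_measures_def)

lemma phi0_mass_finite: "(NN mu (%x. ennreal (exp (lam0 * t) * phi0 x))) < \<top>"
proof -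
 have "integrable mu (%x. exp (lam0 * t) * phi0 x)"
  using integrable_compact_support[OF mu supp eigenfunctions_continuous(1)] by simp
 then show ?thesis using less_imp_le[OF eigenfunctions_pos(1)] by (subst nn_integral_eq_integral) auto
qed

lemma mass_square_measurable:
 assumes "f \<in> borel_measurable borel" "0 <= t"
 shows "(%w. (NN (X t w) f)^2) \<in> borel_measurable (P mu)"
 unfolding power2_eq_square by (intro borel_measurable_times_ennreal mass_measurable[OF mu assms])

lemma AE_fin:
 assumes t: "0 <= t"
 shows "AE w in P mu. w \<in> \<Omega> \<and> fin t w"
proof -
 have pm: "(%x. ennreal (phi0 x)) \<in> borel_measurable borel" using phi0_borel by measurable
 have "(NN (P mu) (%w. (NN (X t w) (%x. ennreal (phi0 x))))) \<noteq> \<infinity>"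
  unfolding first_moment[OF pm t mu] kern_phi0[OF t] using phi0_mass_finite[of t] by simp
 then have "AE w in P mu. (NN (X t w) (%x. ennreal (phi0 x))) \<noteq> \<infinity>"
  by (intro nn_integral_PInf_AE mass_measurable[OF mu pm t])
 moreover have "AE w in P mu. w \<in> \<Omega>" using AE_space by (rule AE_mp) (simp add: space_Pm)
 ultimately show ?thesis by eventually_elim (simp add: fin_def less_top)
qed

text \<open>The square of \<open>phi0\<close> is in \<open>L2 m\<close>, so its image under
  \<open>U t\<close> is continuous and can be integrated against an initial law of compact support.
  This keeps all second moments finite.\<close>

lemma U_phi0_square:
 assumes t: "0 <= t"
 shows "integrable mu (U t (%y. (phi0 y)^2))" "0 <= U t (%y. (phi0 y)^2) x"
  "(NN mu (%x. kern t (%y. ennreal ((phi0 y)^2)) x)) = ennreal (exp (lam0 * t) * (LINT x|mu. U t (%y. (phi0 y)^2) x))"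
proof -
 note phi2 = phi0_square_L2
 have "continuous_on UNIV (U t (%y. (phi0 y)^2))"
  using U_continuous[OF _ phi2, of t] t eigenfunctions_continuous(1)
  by (cases "t = 0") (auto intro!: continuous_intros)
 then show i: "integrable mu (U t (%y. (phi0 y)^2))" by (rule integrable_compact_support[OF mu supp])
 show n: "0 <= U t (%y. (phi0 y)^2) x" for x using kern_U(2)[OF t phi2] by simp
 have "(NN mu (%x. kern t (%y. ennreal ((phi0 y)^2)) x)) = (NN mu (%x. ennreal (exp (lam0 * t) * U t (%y. (phi0 y)^2) x)))"
  using kern_U(1)[OF t phi2] by simp
 also have "... = ennreal (LINT x|mu. exp (lam0 * t) * U t (%y. (phi0 y)^2) x)"
  using i n by (intro nn_integral_eq_integral) auto
 finally show "(NN mu (%x. kern t (%y. ennreal ((phi0 y)^2)) x)) = ennreal (exp (lam0 * t) * (LINT x|mu. U t (%y. (phi0 y)^2) x))"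
  by simp
qed

text \<open>Domination by \<open>c * R t phi0\<close> reduces the claim to the second moment of
  \<open>phi0\<close>.\<close>

lemma R_L2:
 assumes t: "0 <= t" and f: "dominated c f"
 shows "R t f \<in> L2 (P mu)"
proof -
 let ?N = "%w. NN (X t w) (%x. ennreal (phi0 x))"
 have pm: "(%x. ennreal (phi0 x)) \<in> borel_measurable borel" using phi0_borel by measurable
 have Rm[measurable]: "R t f \<in> borel_measurable (P mu)" by (rule R_measurable[OF mu t dominatedD(1)[OF f]])
 have "(NN (P mu) (%w. (?N w)^2)) < \<top>"
 proof -
  obtain C where "0 <= C" and mb: "!!f t mu. f \<in> borel_measurable borel ==> 0 <= t ==> mu \<in> finite_borel_measures ==> moment_bound C f (%y. (f y)^2) t mu"
   using moments by blast
  have le: "(NN (P mu) (%w. (?N w)^2)) <= (NN mu (%x. kern t (%x. ennreal (phi0 x)) x))^2 +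
    ennreal (C * t * exp (K * t)) * (NN mu (%x. kern t (%y. (ennreal (phi0 y))^2) x))"
   using mb[OF pm t mu] unfolding moment_bound_def by blast
  have e: "(ennreal (phi0 y))^2 = ennreal ((phi0 y)^2)" for y using eigenfunctions_pos(1)[of y] by (simp add: ennreal_power)
  have "(NN mu (%x. kern t (%x. ennreal (phi0 x)) x)) < \<top>"
   unfolding kern_phi0[OF t] by (rule phi0_mass_finite)
  then show ?thesis using le_less_trans[OF le] unfolding e U_phi0_square(3)[OF t]
   by (simp add: power2_eq_square ennreal_mult_less_top)
 qed
 then have fin2: "ennreal ((c * exp (- lam0 * t))^2) * (NN (P mu) (%w. (?N w)^2)) < \<top>" by (simp add: ennreal_mult_less_top)
 have "(NN (P mu) (%w. ennreal (norm ((R t f w)^2)))) <= (NN (P mu) (%w. ennreal ((c * exp (- lam0 * t))^2) * (?N w)^2))"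
 proof (rule nn_integral_mono_AE)
  show "AE w in P mu. ennreal (norm ((R t f w)^2)) <= ennreal ((c * exp (- lam0 * t))^2) * (?N w)^2"
   using AE_fin[OF t]
  proof eventually_elim
   case (elim w)
   have c: "0 <= c" by (rule dominatedD(3)[OF f])
   have "\<bar>R t f w\<bar> <= c * R t phi0 w" by (rule R_abs_le_phi0[OF _ t _ f]) (use elim in auto)
   then have "\<bar>R t f w\<bar>^2 <= (c * R t phi0 w)^2" by (intro power_mono) auto
   then have "ennreal (norm ((R t f w)^2)) <= ennreal ((c * R t phi0 w)^2)" by (simp add: ennreal_leI)
   also have "... = (ennreal c * ennreal (R t phi0 w))^2"
    using c R_nonneg[of phi0 t w, OF less_imp_le[OF eigenfunctions_pos(1)]] by (simp add: ennreal_power ennreal_mult[symmetric])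
   also have "... = (ennreal c * (ennreal (exp (- lam0 * t)) * ?N w))^2"
    using R_nn[OF _ t _ dominated_phi0 less_imp_le[OF eigenfunctions_pos(1)]] elim by simp
   also have "... = ennreal ((c * exp (- lam0 * t))^2) * (?N w)^2"
    using c by (simp add: power_mult_distrib ennreal_power[symmetric] ennreal_mult mult.assoc)
   finally show ?case .
  qed
 qed
 also have "... = ennreal ((c * exp (- lam0 * t))^2) * (NN (P mu) (%w. (?N w)^2))"
  by (rule nn_integral_cmult[OF mass_square_measurable[OF pm t]])
 finally have "integrable (P mu) (%w. (R t f w)^2)"
  using fin2 by (intro integrableI_bounded) (auto intro: le_less_trans)
 then show ?thesis using Rm by (simp add: L2_def)
qed

lemma R_markov_pos:
 assumes t: "0 <= t" "0 <= s" and f: "dominated c f" "!!x. 0 <= f x"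
  and H: "H \<in> borel_measurable (G (ennreal t))" "!!w. 0 <= H w"
 shows "(LINT w|P mu. H w * R (t + s) f w) = (LINT w|P mu. H w * R t (U s f) w)"
proof -
 have ts: "0 <= t + s" using t by simp
 note fs = dominatedD(4)[OF f(1)] and Ud = U_dominated[OF t(2) f(1)]
 have U0: "0 <= U s f x" for x by (rule kern_U(2)[OF t(2) fs f(2)])
 have fm: "(%x. ennreal (f x)) \<in> borel_measurable borel" "(%x. ennreal (U s f x)) \<in> borel_measurable borel"
  using dominatedD(1)[OF f(1)] dominatedD(1)[OF Ud] by measurable
 have HP[measurable]: "H \<in> borel_measurable (P mu)" using SP.measurable_F_P[of mu, OF _ H(1)] mu by simp
 note [measurable] = R_measurable[OF mu ts dominatedD(1)[OF f(1)]] R_measurable[OF mu t(1) dominatedD(1)[OF Ud]]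
  mass_measurable[OF mu fm(1) ts] mass_measurable[OF mu fm(2) t(1)]
 have "(NN (P mu) (%w. ennreal (H w * R (t + s) f w))) = (NN (P mu) (%w. ennreal (exp (- lam0 * (t + s))) * (ennreal (H w) * (NN (X (t + s) w) (%x. ennreal (f x))))))"
  by (intro nn_integral_cong_AE eventually_mono[OF AE_fin[OF ts]]) (simp add: ennreal_mult' H(2) R_nn[OF _ ts _ f] mult_ac)
 also have "... = ennreal (exp (- lam0 * (t + s))) * (NN (P mu) (%w. ennreal (H w) * (NN (X (t + s) w) (%x. ennreal (f x)))))"
  by (intro nn_integral_cmult) measurable
 also have "(NN (P mu) (%w. ennreal (H w) * (NN (X (t + s) w) (%x. ennreal (f x))))) =
   (NN (P mu) (%w. ennreal (H w) * (NN (X t w) (%x. kern s (%x. ennreal (f x)) x))))"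
  by (rule mass_markov[OF mu t measurable_compose[OF H(1) measurable_ennreal] fm(1)])
 also have "... = (NN (P mu) (%w. ennreal (exp (lam0 * s)) * (ennreal (H w) * (NN (X t w) (%x. ennreal (U s f x))))))"
 proof (intro nn_integral_cong)
  fix w assume "w \<in> space (P mu)"
  then have w: "w \<in> \<Omega>" by (simp add: space_Pm)
  have "(NN (X t w) (%x. kern s (%x. ennreal (f x)) x)) = (NN (X t w) (%x. ennreal (exp (lam0 * s)) * ennreal (U s f x)))"
   using kern_U(1)[OF t(2) fs f(2)] by (simp add: ennreal_mult')
  also have "... = ennreal (exp (lam0 * s)) * (NN (X t w) (%x. ennreal (U s f x)))"
   by (rule nn_integral_cmult[OF measurable_of_sets_borel[OF X_finite_borel(2)[OF w t(1)] fm(2)]])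
  finally show "ennreal (H w) * (NN (X t w) (%x. kern s (%x. ennreal (f x)) x)) =
    ennreal (exp (lam0 * s)) * (ennreal (H w) * (NN (X t w) (%x. ennreal (U s f x))))" by (simp add: mult_ac)
 qed
 also have "... = ennreal (exp (lam0 * s)) * (NN (P mu) (%w. ennreal (H w) * (NN (X t w) (%x. ennreal (U s f x)))))"
  by (intro nn_integral_cmult) measurable
 also have "ennreal (exp (- lam0 * (t + s))) * ... = ennreal (exp (- lam0 * t)) * (NN (P mu) (%w. ennreal (H w) * (NN (X t w) (%x. ennreal (U s f x)))))"
  by (simp add: mult.assoc[symmetric] ennreal_mult[symmetric] exp_add[symmetric] algebra_simps)
 also have "... = (NN (P mu) (%w. ennreal (exp (- lam0 * t)) * (ennreal (H w) * (NN (X t w) (%x. ennreal (U s f x))))))"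
  by (intro nn_integral_cmult[symmetric]) measurable
 also have "... = (NN (P mu) (%w. ennreal (H w * R t (U s f) w)))"
  by (intro nn_integral_cong_AE eventually_mono[OF AE_fin[OF t(1)]]) (simp add: ennreal_mult' H(2) R_nn[OF _ t(1) _ Ud U0] mult_ac)
 finally show ?thesis
  by (subst (1 2) integral_eq_nn_integral) (auto simp: H(2) R_nonneg f(2) U0)
qed

text \<open>Identifies \<open>R t (U s f)\<close> as the conditional expectation of
  \<open>R (t + s) f\<close>, in the weak form that \<open>maximal_inequality\<close>
  consumes.\<close>

lemma R_markov:
 assumes t: "0 <= t" "0 <= s" and f: "dominated c f"
  and H: "H \<in> L2 (P mu)" "H \<in> borel_measurable (G (ennreal t))"
 shows "(LINT w|P mu. H w * R (t + s) f w) = (LINT w|P mu. H w * R t (U s f) w)"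
proof -
 have ts: "0 <= t + s" using t by simp
 let ?f = "%x. max (f x) 0" and ?g = "%x. max (- f x) 0"
 note fp = dominated_parts(1,2)[OF f]
 note Up = fp[THEN U_dominated[OF t(2)]]
 have Us: "U s f = (%x. 1 * U s ?f x + (- 1) * U s ?g x)"
 proof
  fix x
  have "(%x. 1 * ?f x + (- 1) * ?g x) = f" by (auto simp: max_def)
  then show "U s f x = 1 * U s ?f x + (- 1) * U s ?g x"
   using U_lincomb[OF t(2) fp[THEN dominatedD(4)], of 1 "- 1" x] by simp
 qed
 have pos: "(LINT w|P mu. H w * R (t + s) f w) = (LINT w|P mu. H w * R t (U s f) w)"
  if H: "H \<in> L2 (P mu)" "H \<in> borel_measurable (G (ennreal t))" "!!w. 0 <= H w" for H
 proof -
  note i = L2_mult[OF H(1) R_L2]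
  have "(LINT w|P mu. H w * R (t + s) f w) = (LINT w|P mu. H w * R (t + s) ?f w - H w * R (t + s) ?g w)"
   by (subst R_parts) (simp add: algebra_simps)
  also have "... = (LINT w|P mu. H w * R (t + s) ?f w) - (LINT w|P mu. H w * R (t + s) ?g w)"
   by (rule Bochner_Integration.integral_diff[OF i[OF ts fp(1)] i[OF ts fp(2)]])
  also have "... = (LINT w|P mu. H w * R t (U s ?f) w) - (LINT w|P mu. H w * R t (U s ?g) w)"
   using R_markov_pos[OF t fp(1) _ H(2,3)] R_markov_pos[OF t fp(2) _ H(2,3)] by simp
  also have "... = (LINT w|P mu. H w * R t (U s ?f) w - H w * R t (U s ?g) w)"
   by (rule Bochner_Integration.integral_diff[symmetric, OF i[OF t(1) Up(1)] i[OF t(1) Up(2)]])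
  also have "... = (LINT w|P mu. H w * R t (U s f) w)"
  proof (rule integral_cong_AE)
   show "(%w. H w * R t (U s ?f) w - H w * R t (U s ?g) w) \<in> borel_measurable (P mu)"
    using i[OF t(1) Up(1)] i[OF t(1) Up(2)] by auto
   show "(%w. H w * R t (U s f) w) \<in> borel_measurable (P mu)" using i[OF t(1) U_dominated[OF t(2) f]] by auto
   show "AE w in P mu. H w * R t (U s ?f) w - H w * R t (U s ?g) w = H w * R t (U s f) w"
    using AE_fin[OF t(1)]
   proof eventually_elim
    case (elim w)
    then have "R t (U s f) w = R t (U s ?f) w - R t (U s ?g) w"
     using R_lincomb[OF _ t(1) _ Up, of w 1 "- 1"] unfolding Us by simp
    then show ?case by (simp only: right_diff_distrib)
   qed
  qed
  finally show ?thesis .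
 qed
 let ?H = "%w. max (H w) 0" and ?J = "%w. max (- H w) 0"
 have b: "?H \<in> L2 (P mu)" "?J \<in> L2 (P mu)"
  using L2D(1)[OF H(1)] by (auto intro!: L2_bound[OF H(1)])
 have b': "?H \<in> borel_measurable (G (ennreal t))" "?J \<in> borel_measurable (G (ennreal t))"
  using H(2) by measurable
 have split: "(LINT w|P mu. H w * g w) = (LINT w|P mu. ?H w * g w) - (LINT w|P mu. ?J w * g w)" if "g \<in> L2 (P mu)" for g
 proof -
  have "(LINT w|P mu. H w * g w) = (LINT w|P mu. ?H w * g w - ?J w * g w)"
   by (intro integral_cong refl) (auto simp: max_def algebra_simps)
  then show ?thesis using L2_mult[OF b(1) that] L2_mult[OF b(2) that] by simp
 qed
 show ?thesis
  using pos[OF b(1) b'(1)] pos[OF b(2) b'(2)] split[OF R_L2[OF ts f]] split[OF R_L2[OF t(1) U_dominated[OF t(2) f]]]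
  by simp
qed

text \<open>As \<open>Z = R t (U s f)\<close> is the conditional expectation of \<open>Y = R (t + s) f\<close>, \<open>E(Y - Z)\<^sup>2 = E Y\<^sup>2 - E Z\<^sup>2\<close>.\<close>

lemma R_increment:
 obtains C where "0 <= C" "!!t s c f. 0 <= t ==> 0 <= s ==> dominated c f ==>
  sq_int (P mu) (%w. R (t + s) f w - R t (U s f) w) \<le>
   C * s * exp (K * s) * c^2 * exp (- lam0 * (t + s)) * (LINT x|mu. U (t + s) (%y. (phi0 y)^2) x)"
proof -
 obtain C where C: "0 <= C" and sec: "!!t s f. 0 <= t ==> 0 <= s ==> f \<in> borel_measurable borel ==>
  (NN (P mu) (%w. (NN (X (t + s) w) f)^2)) <= (NN (P mu) (%w. (NN (X t w) (kern s f))^2)) +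
   ennreal (C * s * exp (K * s)) * (NN mu (%x. kern (t + s) (%y. (f y)^2) x))"
  using mass_second_moment[OF mu] by blast
 have sqnn: "ennreal (sq_int (P mu) (R t f)) = ennreal ((exp (- lam0 * t))^2) * (NN (P mu) (%w. (NN (X t w) (%x. ennreal (f x)))^2))"
  if t: "0 <= t" and f: "dominated c f" "!!x. 0 <= f x" for t c f
 proof -
  have fm: "(%x. ennreal (f x)) \<in> borel_measurable borel" using dominatedD(1)[OF f(1)] by measurable
  have "ennreal (sq_int (P mu) (R t f)) = (NN (P mu) (%w. ennreal ((R t f w)^2)))"
   unfolding sq_int_def using L2D(2)[OF R_L2[OF t f(1)]] by (intro nn_integral_eq_integral[symmetric]) auto
  also have "... = (NN (P mu) (%w. ennreal ((exp (- lam0 * t))^2) * (NN (X t w) (%x. ennreal (f x)))^2))"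
  proof (rule nn_integral_cong_AE)
   show "AE w in P mu. ennreal ((R t f w)^2) = ennreal ((exp (- lam0 * t))^2) * (NN (X t w) (%x. ennreal (f x)))^2"
    using AE_fin[OF t]
   proof eventually_elim
    case (elim w)
    have "ennreal ((R t f w)^2) = (ennreal (R t f w))^2" using R_nonneg[of f t w] f(2) by (simp add: ennreal_power)
    also have "... = (ennreal (exp (- lam0 * t)) * (NN (X t w) (%x. ennreal (f x))))^2" using R_nn[OF _ t _ f] elim by simp
    finally show ?case by (simp add: power_mult_distrib ennreal_power)
   qed
  qed
  also have "... = ennreal ((exp (- lam0 * t))^2) * (NN (P mu) (%w. (NN (X t w) (%x. ennreal (f x)))^2))"
   by (rule nn_integral_cmult[OF mass_square_measurable[OF fm t]])
  finally show ?thesis .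
 qed
 have pos: "sq_int (P mu) (%w. R (t + s) f w - R t (U s f) w) \<le>
   C * s * exp (K * s) * c^2 * exp (- lam0 * (t + s)) * (LINT x|mu. U (t + s) (%y. (phi0 y)^2) x)"
  if t: "0 <= t" "0 <= s" and f: "dominated c f" "!!x. 0 <= f x" for t s c f
 proof -
  have ts: "0 <= t + s" using t by simp
  note fs = dominatedD(4)[OF f(1)] and Ud = U_dominated[OF t(2) f(1)]
  have U0: "0 <= U s f x" for x by (rule kern_U(2)[OF t(2) fs f(2)])
  have fm: "(%x. ennreal (f x)) \<in> borel_measurable borel" "(%x. ennreal (U s f x)) \<in> borel_measurable borel"
   using dominatedD(1)[OF f(1)] dominatedD(1)[OF Ud] by measurable
  let ?Y = "R (t + s) f" and ?Z = "R t (U s f)"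
  let ?B = "(LINT x|mu. U (t + s) (%y. (phi0 y)^2) x)"
  let ?e = "(exp (- lam0 * (t + s)))^2"
  have B0: "0 <= ?B" using U_phi0_square(2)[OF ts] by (intro integral_nonneg_AE) auto
  note Y = R_L2[OF ts f(1)] and Z = R_L2[OF t(1) Ud]
  have "sq_int (P mu) (%w. ?Y w - ?Z w) = (LINT w|P mu. (?Y w)^2 - 2 * (?Z w * ?Y w) + (?Z w)^2)"
   unfolding sq_int_def by (intro integral_cong refl) (simp add: power2_eq_square algebra_simps)
  also have "... = sq_int (P mu) ?Y - 2 * (LINT w|P mu. ?Z w * ?Y w) + sq_int (P mu) ?Z"
   unfolding sq_int_def using L2D(2)[OF Y] L2D(2)[OF Z] L2_mult[OF Z Y] by simp
  also have "(LINT w|P mu. ?Z w * ?Y w) = sq_int (P mu) ?Z"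
   using R_markov[OF t f(1) Z R_measurable_G[OF t(1) dominatedD(1)[OF Ud]]] by (simp add: sq_int_def power2_eq_square)
  finally have 1: "sq_int (P mu) (%w. ?Y w - ?Z w) = sq_int (P mu) ?Y - sq_int (P mu) ?Z" by simp
  have "(NN (P mu) (%w. (NN (X t w) (%x. kern s (%y. ennreal (f y)) x))^2)) =
    (NN (P mu) (%w. ennreal ((exp (lam0 * s))^2) * (NN (X t w) (%x. ennreal (U s f x)))^2))"
  proof (intro nn_integral_cong)
   fix w assume "w \<in> space (P mu)"
   then have w: "w \<in> \<Omega>" by (simp add: space_Pm)
   have "(NN (X t w) (%x. kern s (%x. ennreal (f x)) x)) = (NN (X t w) (%x. ennreal (exp (lam0 * s)) * ennreal (U s f x)))"
    using kern_U(1)[OF t(2) fs f(2)] by (simp add: ennreal_mult')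
   also have "... = ennreal (exp (lam0 * s)) * (NN (X t w) (%x. ennreal (U s f x)))"
    by (rule nn_integral_cmult[OF measurable_of_sets_borel[OF X_finite_borel(2)[OF w t(1)] fm(2)]])
   finally show "(NN (X t w) (%x. kern s (%y. ennreal (f y)) x))^2 = ennreal ((exp (lam0 * s))^2) * (NN (X t w) (%x. ennreal (U s f x)))^2"
    by (simp add: power_mult_distrib ennreal_power)
  qed
  also have "... = ennreal ((exp (lam0 * s))^2) * (NN (P mu) (%w. (NN (X t w) (%x. ennreal (U s f x)))^2))"
   by (rule nn_integral_cmult[OF mass_square_measurable[OF fm(2) t(1)]])
  finally have mk: "(NN (P mu) (%w. (NN (X t w) (%x. kern s (%y. ennreal (f y)) x))^2)) =
    ennreal ((exp (lam0 * s))^2) * (NN (P mu) (%w. (NN (X t w) (%x. ennreal (U s f x)))^2))" .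
  have "(NN mu (%x. kern (t + s) (%y. (ennreal (f y))^2) x)) <= (NN mu (%x. kern (t + s) (%y. ennreal (c^2) * ennreal ((phi0 y)^2)) x))"
  proof (intro nn_integral_mono kern_mono)
   fix y
   have "(f y)^2 <= (c * phi0 y)^2" using dominatedD(2)[OF f(1), of y] f(2)[of y] by (intro power_mono) auto
   then show "(ennreal (f y))^2 <= ennreal (c^2) * ennreal ((phi0 y)^2)"
    using f(2)[of y] by (simp add: ennreal_power ennreal_mult[symmetric] power_mult_distrib ennreal_leI)
  qed
  also have "... = (NN mu (%x. ennreal (c^2) * kern (t + s) (%y. ennreal ((phi0 y)^2)) x))"
   using phi0_borel by (intro nn_integral_cong kern_cmult[OF _ ts]) measurable
  also have "... = ennreal (c^2) * (NN mu (%x. kern (t + s) (%y. ennreal ((phi0 y)^2)) x))"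
   using phi0_borel by (intro nn_integral_cmult measurable_of_sets_borel[OF sets_mu] kern_measurable[OF ts]) measurable
  also have "... = ennreal (c^2 * (exp (lam0 * (t + s)) * ?B))" unfolding U_phi0_square(3)[OF ts] by (simp add: ennreal_mult')
  finally have k2: "(NN mu (%x. kern (t + s) (%y. (ennreal (f y))^2) x)) <= ennreal (c^2 * (exp (lam0 * (t + s)) * ?B))" .
  have "ennreal (sq_int (P mu) ?Y) = ennreal ?e * (NN (P mu) (%w. (NN (X (t + s) w) (%x. ennreal (f x)))^2))" by (rule sqnn[OF ts f])
  also have "... <= ennreal ?e * (ennreal ((exp (lam0 * s))^2) * (NN (P mu) (%w. (NN (X t w) (%x. ennreal (U s f x)))^2)) +
    ennreal (C * s * exp (K * s)) * ennreal (c^2 * (exp (lam0 * (t + s)) * ?B)))"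
   using order_trans[OF sec[OF t fm(1)] add_left_mono[OF mult_left_mono[OF k2]]] unfolding mk by (intro mult_left_mono) auto
  \<comment> \<open>The squared rescaling \<open>exp (- 2 * lam0 * (t + s))\<close> meets the growth
    \<open>exp (lam0 * (t + s))\<close> of the mean of the square of \<open>phi0\<close>; the
    quotient is the decay of the variance.\<close>
  also have "... = ennreal (sq_int (P mu) ?Z) + ennreal (C * s * exp (K * s) * c^2 * exp (- lam0 * (t + s)) * ?B)"
  proof -
   have "?e * (exp (lam0 * s))^2 = (exp (- lam0 * t))^2" by (simp add: power2_eq_square exp_add[symmetric] algebra_simps)
   moreover have "?e * (C * s * exp (K * s) * (c^2 * (exp (lam0 * (t + s)) * ?B))) = C * s * exp (K * s) * c^2 * exp (- lam0 * (t + s)) * ?B"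
   proof -
    have e2: "?e * exp (lam0 * (t + s)) = exp (- lam0 * (t + s))" by (simp add: power2_eq_square exp_add[symmetric])
    have "?e * (C * s * exp (K * s) * (c^2 * (exp (lam0 * (t + s)) * ?B))) = C * s * exp (K * s) * c^2 * (?e * exp (lam0 * (t + s))) * ?B"
     by (simp only: mult_ac)
    then show ?thesis unfolding e2 .
   qed
   ultimately show ?thesis unfolding sqnn[OF t(1) Ud U0]
    using C t B0 by (simp add: distrib_left mult.assoc[symmetric] ennreal_mult[symmetric])
  qed
  also have "... = ennreal (sq_int (P mu) ?Z + C * s * exp (K * s) * c^2 * exp (- lam0 * (t + s)) * ?B)"
   using C t B0 by (intro ennreal_plus[symmetric]) auto
  finally have "sq_int (P mu) ?Y <= sq_int (P mu) ?Z + C * s * exp (K * s) * c^2 * exp (- lam0 * (t + s)) * ?B"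
   using C t B0 by (subst (asm) ennreal_le_iff) auto
  then show ?thesis using 1 by simp
 qed
 show ?thesis
 \<comment> \<open>For signed \<open>f\<close> the two parts contribute \<open>2 * C\<close> each,
   by \<open>sq_int_diff_le\<close>.\<close>
 proof (rule that[of "4 * C"])
  show "0 <= 4 * C" using C by simp
  fix t s c :: real and f
  assume t: "0 <= t" "0 <= s" and f: "dominated c f"
  have ts: "0 <= t + s" using t by simp
  let ?f = "%x. max (f x) 0" and ?g = "%x. max (- f x) 0"
  note fp = dominated_parts(1,2)[OF f]
  note Up = fp[THEN U_dominated[OF t(2)]]
  have Us: "U s f = (%x. 1 * U s ?f x + (- 1) * U s ?g x)"
  proof
   fix x
   have "(%x. 1 * ?f x + (- 1) * ?g x) = f" by (auto simp: max_def)
   then show "U s f x = 1 * U s ?f x + (- 1) * U s ?g x"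
    using U_lincomb[OF t(2) fp[THEN dominatedD(4)], of 1 "- 1" x] by simp
  qed
  define D where "D h w = R (t + s) h w - R t (U s h) w" for h w
  have Ds: "D h \<in> L2 (P mu)" if "dominated c h" for h
   unfolding D_def[abs_def] by (intro L2_diff R_L2[OF ts that] R_L2[OF t(1) U_dominated[OF t(2) that]])
  have "sq_int (P mu) (D f) = sq_int (P mu) (%w. D ?f w - D ?g w)"
   unfolding sq_int_def
  proof (rule integral_cong_AE)
   show "(%w. (D f w)^2) \<in> borel_measurable (P mu)" "(%w. (D ?f w - D ?g w)^2) \<in> borel_measurable (P mu)"
    using L2D(1)[OF Ds[OF f]] L2D(1)[OF Ds[OF fp(1)]] L2D(1)[OF Ds[OF fp(2)]] by measurable
   show "AE w in P mu. (D f w)^2 = (D ?f w - D ?g w)^2" using AE_fin[OF t(1)]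
   proof eventually_elim
    case (elim w)
    then have "R t (U s f) w = R t (U s ?f) w - R t (U s ?g) w"
     using R_lincomb[OF _ t(1) _ Up, of w 1 "- 1"] unfolding Us by simp
    then have "D f w = D ?f w - D ?g w" unfolding D_def using R_parts[of "t + s" f w] by linarith
    then show ?case by (rule arg_cong)
   qed
  qed
  also have "... <= 2 * sq_int (P mu) (D ?f) + 2 * sq_int (P mu) (D ?g)" by (rule sq_int_diff_le[OF Ds[OF fp(1)] Ds[OF fp(2)]])
  finally show "sq_int (P mu) (%w. R (t + s) f w - R t (U s f) w) \<le>
   4 * C * s * exp (K * s) * c^2 * exp (- lam0 * (t + s)) * (LINT x|mu. U (t + s) (%y. (phi0 y)^2) x)"
   using pos[OF t fp(1)] pos[OF t fp(2)] unfolding D_def[abs_def] by simp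
 qed
qed

end

end

lemma (in prob_space) AE_summable_abs:
 fixes Y :: "nat => 'a => real"
 assumes Y: "!!n. integrable M (Y n)" and a: "!!n. expectation (%w. \<bar>Y n w\<bar>) <= a n" "summable a"
 shows "AE w in M. summable (%n. \<bar>Y n w\<bar>)"
proof -
 have a0: "0 <= a n" for n by (rule order_trans[OF _ a(1)[of n]]) simp
 have "(NN M (%w. (\<Sum>n. ennreal \<bar>Y n w\<bar>))) = (\<Sum>n. NN M (%w. ennreal \<bar>Y n w\<bar>))"
  using Y by (intro nn_integral_suminf) auto
 also have "... <= (\<Sum>n. ennreal (a n))"
  using Y a(1) by (intro suminf_le) (auto simp: nn_integral_eq_integral ennreal_leI)
 also have "... < \<top>" using suminf_ennreal_eq[OF a0 summable_sums[OF a(2)]] by simp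
 finally have "AE w in M. (\<Sum>n. ennreal \<bar>Y n w\<bar>) \<noteq> \<infinity>"
  using Y by (intro nn_integral_PInf_AE) (auto intro!: borel_measurable_suminf_order)
 then show ?thesis
 proof eventually_elim
  case (elim w)
  then show ?case by (intro summable_suminf_not_top) auto
 qed
qed

text \<open>All quantifiers run over natural numbers, including the accuracy
  \<open>1 / real (Suc k)\<close>, so an event defined by such limits is measurable by countable
  operations.\<close>

definition dyadic_limit :: "(real => real) => real => bool" where
 "dyadic_limit h l \<longleftrightarrow> (\<forall>k::nat. \<exists>n::nat. \<forall>i N::nat. real n <= real i / 2 ^ N \<longrightarrow> \<bar>h (real i / 2 ^ N) - l\<bar> <= 1 / real (Suc k))"

lemma dyadic_limitD:
 assumes "dyadic_limit h l" "0 < eps"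
 obtains n :: nat where "!!i N :: nat. real n <= real i / 2 ^ N ==> \<bar>h (real i / 2 ^ N) - l\<bar> <= eps"
proof -
 obtain k :: nat where "1 / real (Suc k) < eps" using nat_approx_posE[OF assms(2)] by metis
 then show ?thesis using assms(1) that unfolding dyadic_limit_def by (meson less_imp_le order_trans)
qed

lemma dyadic_limitI:
 assumes "!!eps. 0 < eps ==> \<exists>n::nat. \<forall>i N::nat. real n <= real i / 2 ^ N \<longrightarrow> \<bar>h (real i / 2 ^ N) - l\<bar> <= eps"
 shows "dyadic_limit h l"
 unfolding dyadic_limit_def using assms by simp

text \<open>Division of \<open>i * 2 ^ k\<close> by \<open>2 ^ N\<close> with remainder: a dyadic
  time is a point of the lattice of mesh \<open>1 / 2 ^ k\<close> plus a dyadic fraction of one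
  mesh.\<close>

lemma dyadic_decomposition:
 fixes i N k n0 :: nat
 assumes "real (Suc n0) <= real i / 2 ^ N"
 obtains n j :: nat where "n0 <= n" "j <= 2 ^ N" "real i / 2 ^ N = real n * (1 / 2 ^ k) + real j * (1 / 2 ^ k) / 2 ^ N"
proof (rule that)
 let ?n = "(i * 2 ^ k) div 2 ^ N" and ?j = "(i * 2 ^ k) mod 2 ^ N"
 have "real (i * 2 ^ k) = real (?n * 2 ^ N + ?j)" by (simp only: div_mult_mod_eq)
 then have "real i * 2 ^ k = real ?n * 2 ^ N + real ?j" by (simp only: of_nat_add of_nat_mult of_nat_power of_nat_numeral)
 then show "real i / 2 ^ N = real ?n * (1 / 2 ^ k) + real ?j * (1 / 2 ^ k) / 2 ^ N" by (simp add: field_simps)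
 show "?j <= 2 ^ N" by (simp add: less_imp_le)
 have "real n0 * 2 ^ N <= real (Suc n0) * 2 ^ N" by (intro mult_right_mono) auto
 also have "... <= real i" using assms by (simp add: field_simps)
 finally have "real (n0 * 2 ^ N) <= real i" by simp
 then have "n0 * 2 ^ N <= i" by (simp only: of_nat_le_iff)
 also have "i <= i * 2 ^ k" by simp
 finally show "n0 <= ?n" by (simp add: less_eq_div_iff_mult_less_eq)
qed

section \<open>Almost sure limits on lattices and at dyadic times\<close>

context superprocess_setting
begin

context
 fixes mu :: "'e measure"
 assumes mu: "mu \<in> finite_borel_measures" and supp: "compact (measure_support mu)" and lam0_pos: "0 < lam0"
begin

interpretation Pm: prob_space "P mu" using SP.prob_space_P[of mu] mu by simp

lemmas fin_AE = AE_fin[OF mu supp]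
 and R_sq = R_L2[OF mu supp]

text \<open>The passage from \<open>L2 m\<close> to the initial law, which may be singular to
  \<open>m\<close>: the kernel turns an \<open>L2\<close> bound into a pointwise bound by a
  continuous function.\<close>

lemma U_mu_bound:
 assumes t: "0 < t"
 obtains D where "0 <= D" "!!h. h \<in> L2 m ==> (LINT x|mu. \<bar>U t h x\<bar>) <= D * sqrt (sq_int m h)"
proof -
 define g where "g x = sqrt (exp (2 * (K - lam0) * t) * sq_mass m p t x)" for x
 have "continuous_on UNIV g"
  unfolding g_def[abs_def] using sq_mass_continuous[OF t] by (intro continuous_intros)
 then have gi: "integrable mu g" by (rule integrable_compact_support[OF mu supp])
 have g0: "0 <= g x" for x
  unfolding g_def sq_mass_def by simp
 show ?thesis
 proof (rule that[of "(LINT x|mu. g x)"])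
  show "0 <= (LINT x|mu. g x)" using g0 by simp
  fix h assume h: "h \<in> L2 m"
  have "(LINT x|mu. \<bar>U t h x\<bar>) <= (LINT x|mu. g x * sqrt (sq_int m h))"
  proof (rule integral_mono')
   show "integrable mu (%x. g x * sqrt (sq_int m h))" using gi by simp
   show "\<bar>U t h x\<bar> <= g x * sqrt (sq_int m h)" for x
    using real_sqrt_le_mono[OF U_pointwise_bound[OF t h, of x]] unfolding g_def by (simp only: real_sqrt_mult real_sqrt_abs)
  qed (use g0 in simp)
  then show "(LINT x|mu. \<bar>U t h x\<bar>) <= (LINT x|mu. g x) * sqrt (sq_int m h)" by simp
 qed
qed

text \<open>The remaining mean of the square of \<open>phi0\<close> is bounded in \<open>n\<close>:
  its iterates under \<open>U\<close> are bounded in \<open>L2 m\<close>, and the last step of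
  length \<open>sig\<close> is reserved for \<open>U_mu_bound\<close>.\<close>

lemma increment_bound:
 assumes sig: "0 < sig"
 obtains A where "0 <= A" "!!n c f. dominated c f ==>
  sq_int (P mu) (%w. R (real (Suc n) * sig) f w - R (real n * sig) (U sig f) w) <= A * c^2 * exp (- lam0 * sig) ^ n"
proof -
 obtain C where C: "0 <= C" and inc: "!!t s c f. 0 <= t ==> 0 <= s ==> dominated c f ==>
  sq_int (P mu) (%w. R (t + s) f w - R t (U s f) w) \<le>
   C * s * exp (K * s) * c^2 * exp (- lam0 * (t + s)) * (LINT x|mu. U (t + s) (%y. (phi0 y)^2) x)"
  using R_increment[OF mu supp] by blast
 obtain D where D: "0 <= D" "!!h. h \<in> L2 m ==> (LINT x|mu. \<bar>U sig h x\<bar>) <= D * sqrt (sq_int m h)"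
  using U_mu_bound[OF sig] by blast
 obtain C1 where C1: "C1 > 0" "!!n f. f \<in> L2 m ==> sq_int m (U (real n * sig) f) <= C1 * sq_int m f"
  using U_iterates_bounded[OF sig] by blast
 let ?phi = "%y. (phi0 y)^2"
 define B where "B = D * sqrt (C1 * sq_int m ?phi)"
 have B0: "0 <= B" unfolding B_def using D(1) C1(1) by simp
 have UB: "(LINT x|mu. U (real (Suc n) * sig) ?phi x) <= B" for n
 proof -
  have nsig: "0 <= real n * sig" using sig by simp
  have e: "U (real (Suc n) * sig) ?phi = U sig (U (real n * sig) ?phi)"
   using U_semigroup[OF less_imp_le[OF sig] nsig phi0_square_L2] by (simp add: algebra_simps)
  have "(LINT x|mu. U (real (Suc n) * sig) ?phi x) <= (LINT x|mu. \<bar>U sig (U (real n * sig) ?phi) x\<bar>)"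
   unfolding e using integral_abs_bound[of mu "U sig (U (real n * sig) ?phi)"] by linarith
  also have "... <= D * sqrt (sq_int m (U (real n * sig) ?phi))" by (rule D(2)[OF U_sq(1)[OF nsig phi0_square_L2]])
  also have "... <= B" unfolding B_def using C1(2)[OF phi0_square_L2] D(1) by (intro mult_left_mono real_sqrt_le_mono) auto
  finally show ?thesis .
 qed
 show ?thesis
 proof (rule that[of "C * sig * exp (K * sig) * B"])
  show "0 <= C * sig * exp (K * sig) * B" using C sig B0 by simp
  fix n c f assume f: "dominated c f"
  have nsig: "0 <= real n * sig" using sig by simp
  have e: "real n * sig + sig = real (Suc n) * sig" by (simp add: algebra_simps)
  have "- lam0 * (real (Suc n) * sig) = real (Suc n) * (- lam0 * sig)" by (simp only: mult_ac)
  then have "exp (- lam0 * (real (Suc n) * sig)) = exp (- lam0 * sig) ^ Suc n" by (simp only: exp_of_nat_mult)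
  also have "... <= exp (- lam0 * sig) ^ n" using lam0_pos sig by (intro power_decreasing) auto
  finally have ex: "exp (- lam0 * (real (Suc n) * sig)) <= exp (- lam0 * sig) ^ n" .
  have "sq_int (P mu) (%w. R (real (Suc n) * sig) f w - R (real n * sig) (U sig f) w) \<le>
   C * sig * exp (K * sig) * c^2 * exp (- lam0 * (real (Suc n) * sig)) * (LINT x|mu. U (real (Suc n) * sig) ?phi x)"
   using inc[OF nsig less_imp_le[OF sig] f] unfolding e .
  also have "... <= C * sig * exp (K * sig) * c^2 * exp (- lam0 * (real (Suc n) * sig)) * B"
   using C sig by (intro mult_left_mono UB) auto
  also have "... <= C * sig * exp (K * sig) * c^2 * exp (- lam0 * sig) ^ n * B"
   using C sig B0 by (intro mult_right_mono mult_left_mono ex) auto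
  also have "... = C * sig * exp (K * sig) * B * c^2 * exp (- lam0 * sig) ^ n" by (simp only: mult_ac)
  finally show "sq_int (P mu) (%w. R (real (Suc n) * sig) f w - R (real n * sig) (U sig f) w) <= ..." .
 qed
qed

lemma increment_abs_bound:
 assumes sig: "0 < sig"
 obtains A r where "0 <= A" "0 < r" "r < 1" "!!n c f. dominated c f ==>
  Pm.expectation (%w. \<bar>R (real (Suc n) * sig) f w - R (real n * sig) (U sig f) w\<bar>) <= A * c * r ^ n"
proof -
 obtain A where A: "0 <= A" "!!n c f. dominated c f ==>
  sq_int (P mu) (%w. R (real (Suc n) * sig) f w - R (real n * sig) (U sig f) w) <= A * c^2 * exp (- lam0 * sig) ^ n"
  using increment_bound[OF sig] by blast
 show ?thesis
 proof (rule that[of "sqrt A" "sqrt (exp (- lam0 * sig))"])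
  show "0 <= sqrt A" "0 < sqrt (exp (- lam0 * sig))" "sqrt (exp (- lam0 * sig)) < 1" using A lam0_pos sig by auto
  fix n c f assume f: "dominated c f"
  have n: "0 <= real n * sig" "0 <= real (Suc n) * sig" using sig by auto
  have "Pm.expectation (%w. \<bar>R (real (Suc n) * sig) f w - R (real n * sig) (U sig f) w\<bar>) <= sqrt (A * c^2 * exp (- lam0 * sig) ^ n)"
   using Pm.expectation_abs_le_sq(2)[OF L2_diff[OF R_sq[OF n(2) f] R_sq[OF n(1) U_dominated[OF less_imp_le[OF sig] f]]]]
    real_sqrt_le_mono[OF A(2)[OF f]] by (rule order_trans)
  also have "... = sqrt A * c * sqrt (exp (- lam0 * sig)) ^ n"
   using dominatedD(3)[OF f] by (simp add: real_sqrt_mult real_sqrt_power)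
  finally show "Pm.expectation (%w. \<bar>R (real (Suc n) * sig) f w - R (real n * sig) (U sig f) w\<bar>) <= ..." .
 qed
qed

lemma R_integrable: "0 <= t ==> dominated c f ==> integrable (P mu) (R t f)"
 by (rule Pm.expectation_abs_le_sq(1)[OF R_sq])

text \<open>Since \<open>U\<close> fixes \<open>phi0\<close>, consecutive values differ by an
  increment whose \<open>L1\<close> norm decays geometrically, so the series of increments converges
  absolutely.\<close>

lemma martingale_converges: "AE w in P mu. convergent (%n. R (real n) phi0 w)"
proof -
 obtain A r where A: "0 <= A" "0 < r" "r < 1" "!!n c f. dominated c f ==>
  Pm.expectation (%w. \<bar>R (real (Suc n) * 1) f w - R (real n * 1) (U 1 f) w\<bar>) <= A * c * r ^ n"
  using increment_abs_bound[of 1] by auto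
 have "AE w in P mu. summable (%n. \<bar>R (real (Suc n)) phi0 w - R (real n) phi0 w\<bar>)"
 proof (rule Pm.AE_summable_abs)
  show "integrable (P mu) (%w. R (real (Suc n)) phi0 w - R (real n) phi0 w)" for n
   using R_integrable[OF _ dominated_phi0] by simp
  show "Pm.expectation (%w. \<bar>R (real (Suc n)) phi0 w - R (real n) phi0 w\<bar>) <= A * r ^ n" for n
   using A(4)[OF dominated_phi0, of n] U_phi0[of 1] by simp
  show "summable (%n. A * r ^ n)" using A by (intro summable_mult summable_geometric) auto
 qed
 then show ?thesis
 proof eventually_elim
  case (elim w)
  have "convergent (%N. \<Sum>n<N. R (real (Suc n)) phi0 w - R (real n) phi0 w)"
   using summable_rabs_cancel[OF elim] by (simp only: summable_iff_convergent)
  then have "convergent (%N. R (real N) phi0 w - R (real 0) phi0 w)"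
   unfolding sum_lessThan_telescope[of "%n. R (real n) phi0 w"] .
  then have "convergent (%N. (R (real N) phi0 w - R (real 0) phi0 w) + R (real 0) phi0 w)" by (intro convergent_add convergent_const)
  then show ?case by simp
 qed
qed

lemma R_expectation_abs_le:
 assumes t: "0 <= t" and f: "dominated c f"
 shows "Pm.expectation (%w. \<bar>R t f w\<bar>) <= (LINT x|mu. U t (%y. \<bar>f y\<bar>) x)"
proof -
 let ?f = "%y. \<bar>f y\<bar>"
 note fa = dominated_parts(3)[OF f]
 have fm: "(%x. ennreal (?f x)) \<in> borel_measurable borel" using dominatedD(1)[OF f] by measurable
 have U0: "0 <= U t ?f x" for x by (rule kern_U(2)[OF t dominatedD(4)[OF fa]]) simp
 note Ud = U_dominated[OF t fa]
 have "integrable mu (%x. c * phi0 x)" using integrable_compact_support[OF mu supp eigenfunctions_continuous(1)] by simp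
 then have Ui: "integrable mu (U t ?f)"
  by (rule integrable_bound)
   (use measurable_of_sets_borel[OF sets_mu[OF mu supp] dominatedD(1)[OF Ud]] order_trans[OF dominatedD(2)[OF Ud] abs_ge_self] in auto)
 have le: "Pm.expectation (%w. \<bar>R t f w\<bar>) <= Pm.expectation (R t ?f)"
 proof (rule integral_mono_AE[OF integrable_abs[OF R_integrable[OF t f]] R_integrable[OF t fa]])
  show "AE w in P mu. \<bar>R t f w\<bar> <= R t ?f w" by (rule eventually_mono[OF fin_AE[OF t]]) (auto intro!: R_abs_le[OF _ t _ f fa])
 qed
 have "ennreal (Pm.expectation (R t ?f)) = (NN (P mu) (%w. ennreal (R t ?f w)))"
  by (rule nn_integral_eq_integral[symmetric, OF R_integrable[OF t fa] AE_I2[OF R_nonneg]]) simp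
 also have "... = (NN (P mu) (%w. ennreal (exp (- lam0 * t)) * (NN (X t w) (%x. ennreal (?f x)))))"
  by (intro nn_integral_cong_AE eventually_mono[OF fin_AE[OF t]]) (simp add: R_nn[OF _ t _ fa])
 also have "... = ennreal (exp (- lam0 * t)) * (NN mu (%x. kern t (%x. ennreal (?f x)) x))"
  using first_moment[OF fm t mu] by (simp add: nn_integral_cmult[OF mass_measurable[OF mu fm t]])
 also have "(NN mu (%x. kern t (%x. ennreal (?f x)) x)) = ennreal (LINT x|mu. exp (lam0 * t) * U t ?f x)"
  using kern_U(1)[OF t dominatedD(4)[OF fa]] U0 Ui by (simp add: nn_integral_eq_integral)
 also have "ennreal (exp (- lam0 * t)) * ... = ennreal (LINT x|mu. U t ?f x)"
  by (simp add: ennreal_mult'[symmetric] mult.assoc[symmetric] mult_exp_exp)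
 finally have "Pm.expectation (R t ?f) = (LINT x|mu. U t ?f x)"
  by (subst (asm) ennreal_inj) (auto intro!: integral_nonneg_AE R_nonneg U0)
 then show ?thesis using le by simp
qed

text \<open>Telescoping through the functions \<open>U (real j * \<tau>) f\<close>. All of them are
  dominated with the same \<open>c\<close>, so one constant serves every summand.\<close>

lemma lattice_increment:
 assumes A: "!!n c f. dominated c f ==>
  Pm.expectation (%w. \<bar>R (real (Suc n) * \<tau>) f w - R (real n * \<tau>) (U \<tau> f) w\<bar>) <= A * c * r ^ n"
  and \<tau>: "0 < \<tau>" and f: "dominated c f"
 shows "Pm.expectation (%w. \<bar>R (real (k + i) * \<tau>) f w - R (real k * \<tau>) (U (real i * \<tau>) f) w\<bar>) <= A * c * (\<Sum>j<i. r ^ (k + j))"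
 using f
proof (induction i arbitrary: f)
 case (Suc i)
 have \<tau>0: "0 <= \<tau>" "0 <= real i * \<tau>" "0 <= real k * \<tau>" "0 <= real (k + i) * \<tau>" "0 <= real (k + Suc i) * \<tau>" using \<tau> by auto
 note Uf = U_dominated[OF \<tau>0(1) Suc.prems]
 have "real (Suc i) * \<tau> = real i * \<tau> + \<tau>" by (simp add: algebra_simps)
 then have e: "U (real (Suc i) * \<tau>) f = U (real i * \<tau>) (U \<tau> f)" using U_semigroup[OF \<tau>0(2,1) dominatedD(4)[OF Suc.prems]] by simp
 let ?a = "%w. R (real (k + Suc i) * \<tau>) f w - R (real (k + i) * \<tau>) (U \<tau> f) w"
 let ?b = "%w. R (real (k + i) * \<tau>) (U \<tau> f) w - R (real k * \<tau>) (U (real i * \<tau>) (U \<tau> f)) w"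
 have i: "integrable (P mu) ?a" "integrable (P mu) ?b"
  by (rule Bochner_Integration.integrable_diff[OF R_integrable[OF \<tau>0(5) Suc.prems] R_integrable[OF \<tau>0(4) Uf]],
   rule Bochner_Integration.integrable_diff[OF R_integrable[OF \<tau>0(4) Uf] R_integrable[OF \<tau>0(3) U_dominated[OF \<tau>0(2) Uf]]])
 have "Pm.expectation (%w. \<bar>R (real (k + Suc i) * \<tau>) f w - R (real k * \<tau>) (U (real (Suc i) * \<tau>) f) w\<bar>) \<le>
   Pm.expectation (%w. \<bar>?a w\<bar> + \<bar>?b w\<bar>)"
  unfolding e using i by (intro integral_mono') auto
 also have "... = Pm.expectation (%w. \<bar>?a w\<bar>) + Pm.expectation (%w. \<bar>?b w\<bar>)" using i by simp
 also have "... <= A * c * r ^ (k + i) + A * c * (\<Sum>j<i. r ^ (k + j))"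
  using A[OF Suc.prems, of "k + i"] Suc.IH[OF Uf] by simp
 finally show ?case by (simp add: algebra_simps)
qed simp

text \<open>
 With \<open>\<tau> = \<sigma> / 2\<close>, time \<open>2 k \<tau>\<close> is compared with time \<open>k \<tau>\<close>: the increments in between sum to a
 geometric tail, and what remains is \<open>R\<close> of the small function \<open>U (k \<tau>) f\<close>.
\<close>

lemma lattice_tendsto_zero:
 assumes sig: "0 < sig" and f: "dominated c f" and f0: "(LINT x|m. phih0 x * f x) = 0"
 shows "AE w in P mu. (%n. R (real n * sig) f w) \<longlonglongrightarrow> 0"
proof -
 define \<tau> where "\<tau> = sig / 2"
 have \<tau>: "0 < \<tau>" using sig by (simp add: \<tau>_def)
 obtain A r where A: "0 <= A" "0 < r" "r < 1" "!!n c f. dominated c f ==>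
  Pm.expectation (%w. \<bar>R (real (Suc n) * \<tau>) f w - R (real n * \<tau>) (U \<tau> f) w\<bar>) <= A * c * r ^ n"
  using increment_abs_bound[OF \<tau>] by blast
 obtain D where D: "0 <= D" "!!h. h \<in> L2 m ==> (LINT x|mu. \<bar>U \<tau> h x\<bar>) <= D * sqrt (sq_int m h)"
  using U_mu_bound[OF \<tau>] by blast
 obtain C1 where C1: "C1 > 0" "!!n f. f \<in> L2 m ==> sq_int m (U (real n * \<tau>) f) <= C1 * sq_int m f"
  using U_iterates_bounded[OF \<tau>] by blast
 obtain C2 \<rho> where C2: "C2 > 0" "0 < \<rho>" "\<rho> < 1" "!!n f. f \<in> L2 m ==> (LINT x|m. phih0 x * f x) = 0 ==>
   sq_int m (U (real n * \<tau>) f) <= C2 * \<rho> ^ n * sq_int m f"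
  using U_iterates_decay[OF \<tau>] by blast
 have c: "0 <= c" by (rule dominatedD(3)[OF f])
 note fs = dominatedD(4)[OF f]
 define a where "a n = A * c / (1 - r) * r ^ n + D * sqrt (C1 * C2 * sq_int m f) * sqrt \<rho> ^ n" for n
 have bound: "Pm.expectation (%w. \<bar>R (real (Suc n) * sig) f w\<bar>) <= a (Suc n)" for n
 proof -
  \<comment> \<open>With \<open>k\<close> positive one step of length \<tau> is left over for the
    smoothing in \<open>U_mu_bound\<close>.\<close>
  define k where "k = Suc n"
  have k0: "0 <= real n * \<tau>" "0 <= real k * \<tau>" "0 <= real (k + k) * \<tau>" using \<tau> by auto
  define g where "g = U (real k * \<tau>) f"
  have g: "dominated c g" unfolding g_def by (rule U_dominated[OF k0(2) f])
  have ga: "dominated c (%y. \<bar>g y\<bar>)" by (rule dominated_parts(3)[OF g])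
  have gs: "(%y. \<bar>g y\<bar>) \<in> L2 m" by (rule dominatedD(4)[OF ga])
  have kk: "real (Suc n) * sig = real (k + k) * \<tau>" by (simp add: k_def \<tau>_def algebra_simps)
  have "real k * \<tau> = \<tau> + real n * \<tau>" by (simp add: k_def algebra_simps)
  then have Uk: "U (real k * \<tau>) (%y. \<bar>g y\<bar>) = U \<tau> (U (real n * \<tau>) (%y. \<bar>g y\<bar>))"
   using U_semigroup[OF less_imp_le[OF \<tau>] k0(1) gs] by simp
  have "Pm.expectation (%w. \<bar>R (real k * \<tau>) g w\<bar>) <= (LINT x|mu. U (real k * \<tau>) (%y. \<bar>g y\<bar>) x)"
   by (rule R_expectation_abs_le[OF k0(2) g])
  also have "... <= (LINT x|mu. \<bar>U \<tau> (U (real n * \<tau>) (%y. \<bar>g y\<bar>)) x\<bar>)"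
   unfolding Uk using integral_abs_bound[of mu "U \<tau> (U (real n * \<tau>) (%y. \<bar>g y\<bar>))"] by linarith
  also have "... <= D * sqrt (sq_int m (U (real n * \<tau>) (%y. \<bar>g y\<bar>)))" by (rule D(2)[OF U_sq(1)[OF k0(1) gs]])
  also have "... <= D * sqrt (C1 * (C2 * \<rho> ^ k * sq_int m f))"
  proof (intro mult_left_mono real_sqrt_le_mono D(1))
   have "sq_int m (U (real n * \<tau>) (%y. \<bar>g y\<bar>)) <= C1 * sq_int m (%y. \<bar>g y\<bar>)" by (rule C1(2)[OF gs])
   also have "sq_int m (%y. \<bar>g y\<bar>) = sq_int m g" by (simp add: sq_int_def)
   also have "C1 * sq_int m g <= C1 * (C2 * \<rho> ^ k * sq_int m f)"
    unfolding g_def using C1(1) by (intro mult_left_mono C2(4)[OF fs f0]) simp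
   finally show "sq_int m (U (real n * \<tau>) (%y. \<bar>g y\<bar>)) <= C1 * (C2 * \<rho> ^ k * sq_int m f)" .
  qed
  also have "... = D * sqrt (C1 * C2 * sq_int m f) * sqrt \<rho> ^ k" by (simp add: real_sqrt_mult real_sqrt_power mult_ac)
  finally have 1: "Pm.expectation (%w. \<bar>R (real k * \<tau>) g w\<bar>) <= D * sqrt (C1 * C2 * sq_int m f) * sqrt \<rho> ^ k" .
  have "(\<Sum>j<k. r ^ (k + j)) = r ^ k * (\<Sum>j<k. r ^ j)" by (simp add: power_add sum_distrib_left)
  also have "... <= r ^ k * (1 / (1 - r))"
   using A by (intro mult_left_mono) (auto simp: sum_gp_strict field_simps)
  finally have "A * c * (\<Sum>j<k. r ^ (k + j)) <= A * c * (r ^ k * (1 / (1 - r)))" using A c by (intro mult_left_mono) auto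
  then have 2: "Pm.expectation (%w. \<bar>R (real (k + k) * \<tau>) f w - R (real k * \<tau>) g w\<bar>) <= A * c / (1 - r) * r ^ k"
   using lattice_increment[OF A(4) \<tau> f, of k k] unfolding g_def by simp
  note i = R_integrable[OF k0(3) f] R_integrable[OF k0(2) g]
  have "Pm.expectation (%w. \<bar>R (real (k + k) * \<tau>) f w\<bar>) \<le>
   Pm.expectation (%w. \<bar>R (real (k + k) * \<tau>) f w - R (real k * \<tau>) g w\<bar> + \<bar>R (real k * \<tau>) g w\<bar>)"
   using i by (intro integral_mono) auto
  also have "... = Pm.expectation (%w. \<bar>R (real (k + k) * \<tau>) f w - R (real k * \<tau>) g w\<bar>) + Pm.expectation (%w. \<bar>R (real k * \<tau>) g w\<bar>)"
   using i by simp
  also have "... <= a k" unfolding a_def using 1 2 by linarith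
  finally show ?thesis unfolding kk by (simp add: k_def)
 qed
 have "AE w in P mu. summable (%n. \<bar>R (real (Suc n) * sig) f w\<bar>)"
 proof (rule Pm.AE_summable_abs[OF _ bound])
  show "integrable (P mu) (R (real (Suc n) * sig) f)" for n using sig by (intro R_integrable[OF _ f]) auto
  have "summable a" unfolding a_def[abs_def] using A C2 by (intro summable_add summable_mult summable_geometric) auto
  then show "summable (%n. a (Suc n))" by (subst summable_Suc_iff)
 qed
 then show ?thesis
 proof eventually_elim
  case (elim w)
  then have "(%n. R (real (Suc n) * sig) f w) \<longlonglongrightarrow> 0" using summable_LIMSEQ_zero tendsto_rabs_zero_iff by blast
  then show ?case by (rule LIMSEQ_imp_Suc)
 qed
qed

text \<open>Within one lattice interval these differences form a martingale started at zero, whose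
  final value is the increment of \<open>increment_bound\<close>. The maximal inequality gives a
  probability bound independent of the grid level \<open>N\<close> and summable in \<open>n\<close>;
  Borel-Cantelli finishes.\<close>

lemma dyadic_closeness:
 assumes sig: "0 < sig" and f: "dominated c f" and eps: "0 < eps"
 shows "AE w in P mu. \<exists>n0. \<forall>n\<ge>n0. \<forall>N. \<forall>i\<le>2 ^ N.
  \<bar>R (real n * sig + real i * sig / 2 ^ N) (U (sig - real i * sig / 2 ^ N) f) w - R (real n * sig) (U sig f) w\<bar> <= eps"
proof -
 obtain A where A: "0 <= A" "!!n c f. dominated c f ==>
  sq_int (P mu) (%w. R (real (Suc n) * sig) f w - R (real n * sig) (U sig f) w) <= A * c^2 * exp (- lam0 * sig) ^ n"
  using increment_bound[OF sig] by blast
 define t where "t n N i = real n * sig + real i * sig / 2 ^ N" for n N i :: nat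
 define Z where "Z n N i = R (t n N i) (U (sig - real i * sig / 2 ^ N) f)" for n N i :: nat
 define D where "D n N i w = Z n N i w - R (real n * sig) (U sig f) w" for n N i :: nat and w
 have n0: "0 <= real n * sig" for n :: nat using sig by simp
 have t0: "0 <= t n N i" for n N i using sig by (simp add: t_def)
 have s0: "0 <= sig - real i * sig / 2 ^ N" if "i <= 2 ^ N" for i N :: nat
 proof -
  have "real i <= 2 ^ N" using that by (metis of_nat_le_iff of_nat_numeral of_nat_power)
  then show ?thesis using sig by (simp add: field_simps)
 qed
 note Us = U_dominated[OF less_imp_le[OF sig] f]
 have Zd: "dominated c (U (sig - real i * sig / 2 ^ N) f)" if "i <= 2 ^ N" for i N :: nat by (rule U_dominated[OF s0[OF that] f])
 have Zs: "Z n N i \<in> L2 (P mu)" if "i <= 2 ^ N" for n N i unfolding Z_def by (rule R_sq[OF t0 Zd[OF that]])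
 have Ds: "D n N i \<in> L2 (P mu)" if "i <= 2 ^ N" for n N i
  unfolding D_def[abs_def] by (rule L2_diff[OF Zs[OF that] R_sq[OF n0 Us]])
 have last: "D n N (2 ^ N) = (%w. R (real (Suc n) * sig) f w - R (real n * sig) (U sig f) w)" for n N
  by (simp add: D_def[abs_def] Z_def t_def algebra_simps)
 define E where "E n N = {w \<in> space (P mu). \<exists>i\<le>2 ^ N. eps < \<bar>D n N i w\<bar>}" for n N
 have EN: "Pm.prob (E n N) <= A * c^2 * exp (- lam0 * sig) ^ n / eps^2" for n N
 proof -
  have "Pm.prob (E n N) <= sq_int (P mu) (D n N (2 ^ N)) / eps^2"
   unfolding E_def
  proof (rule Pm.maximal_inequality[where F="%i. G (ennreal (t n N i))"])
   show "D n N i \<in> L2 (P mu)" if "i <= 2 ^ N" for i by (rule Ds[OF that])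
   show "D n N j \<in> borel_measurable (G (ennreal (t n N i)))" if "j <= i" "i <= 2 ^ N" for i j
   proof -
    have "t n N j <= t n N i" "real n * sig <= t n N i" using that sig by (auto simp: t_def divide_right_mono mult_right_mono)
    then show ?thesis unfolding D_def[abs_def] Z_def
     using that by (intro borel_measurable_diff SP.measurable_F_mono[OF R_measurable_G[OF t0 dominatedD(1)[OF Zd]]]
      SP.measurable_F_mono[OF R_measurable_G[OF n0 dominatedD(1)[OF Us]]] ennreal_leI) auto
   qed
   fix i H assume i: "i <= 2 ^ N" and H: "H \<in> L2 (P mu)" "H \<in> borel_measurable (G (ennreal (t n N i)))"
   note hi = L2_mult[OF H(1)]
   have "t n N i + (sig - real i * sig / 2 ^ N) = t n N (2 ^ N)" by (simp add: t_def)
   then have "(LINT w|P mu. H w * Z n N i w) = (LINT w|P mu. H w * Z n N (2 ^ N) w)"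
    using R_markov[OF mu supp t0 s0[OF i] f H] by (simp add: Z_def)
   then show "(LINT w|P mu. H w * D n N i w) = (LINT w|P mu. H w * D n N (2 ^ N) w)"
    unfolding D_def right_diff_distrib using hi[OF Zs[OF i]] hi[OF Zs[OF order_refl]] hi[OF R_sq[OF n0 Us]] by simp
  qed (rule eps)
  also have "... <= A * c^2 * exp (- lam0 * sig) ^ n / eps^2" unfolding last by (intro divide_right_mono A(2)[OF f]) simp
  finally show ?thesis .
 qed
 have Em: "E n N \<in> sets (P mu)" for n N
 proof -
  have "{w \<in> space (P mu). eps < \<bar>D n N i w\<bar>} \<in> sets (P mu)" if "i <= 2 ^ N" for i
   using L2D(1)[OF Ds[OF that]] by measurable
  then have "(\<Union>i\<in>{..2 ^ N}. {w \<in> space (P mu). eps < \<bar>D n N i w\<bar>}) \<in> sets (P mu)" by (intro sets.finite_UN) auto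
  also have "(\<Union>i\<in>{..2 ^ N}. {w \<in> space (P mu). eps < \<bar>D n N i w\<bar>}) = E n N" by (auto simp: E_def)
  finally show ?thesis .
 qed
 \<comment> \<open>Index \<open>i\<close> at level \<open>N\<close> is index \<open>2 * i\<close> at
   the next level, so the exceedance events increase and their union obeys the same bound.\<close>
 have inc: "incseq (E n)" for n
 proof (rule incseq_SucI)
  fix N
  have "D n (Suc N) (2 * i) = D n N i" for i by (simp add: D_def[abs_def] Z_def t_def)
  then have "\<exists>i\<le>2 ^ Suc N. eps < \<bar>D n (Suc N) i w\<bar>" if "i <= 2 ^ N" "eps < \<bar>D n N i w\<bar>" for i w
   using that by (intro exI[of _ "2 * i"]) simp
  then show "E n N <= E n (Suc N)" unfolding E_def by auto
 qed
 have Eu: "Pm.prob (\<Union>N. E n N) <= A * c^2 * exp (- lam0 * sig) ^ n / eps^2" for n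
  by (rule LIMSEQ_le_const2[OF Pm.finite_Lim_measure_incseq[OF _ inc]]) (use Em EN in auto)
 have "AE w in P mu. eventually (%n. w \<in> space (P mu) - (\<Union>N. E n N)) sequentially"
 proof (rule borel_cantelli_AE1)
  show "(\<Union>N. E n N) \<in> sets (P mu)" for n using Em by auto
  show "emeasure (P mu) (\<Union>N. E n N) < \<infinity>" for n by (simp add: Pm.emeasure_eq_measure)
  have "summable (%n. A * c^2 / eps^2 * exp (- lam0 * sig) ^ n)"
   using lam0_pos sig by (intro summable_mult summable_geometric) auto
  then show "summable (%n. Pm.prob (\<Union>N. E n N))"
   by (rule summable_comparison_test'[where N=0]) (use Eu in auto)
 qed
 then show ?thesis
 proof eventually_elim
  case (elim w)
  then obtain n1 where n1: "!!n. n \<ge> n1 ==> w \<in> space (P mu) - (\<Union>N. E n N)" by (auto simp: eventually_sequentially)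
  have "\<bar>D n N i w\<bar> <= eps" if "n \<ge> n1" "i <= 2 ^ N" for n N i using n1[OF that(1)] that(2) by (force simp: E_def)
  then show ?case unfolding D_def Z_def t_def by blast
 qed
qed

text \<open>For \<open>phi0\<close> the interpolating martingale is the process itself, because
  \<open>U\<close> fixes \<open>phi0\<close>; closeness to the last integer time is then already
  convergence.\<close>

lemma dyadic_limit_phi0: "AE w in P mu. dyadic_limit (%t. R t phi0 w) (lim (%n. R (real n) phi0 w))"
proof -
 have "AE w in P mu. \<forall>k::nat. \<exists>n0. \<forall>n\<ge>n0. \<forall>N. \<forall>i\<le>2 ^ N.
  \<bar>R (real n * 1 + real i * 1 / 2 ^ N) (U (1 - real i * 1 / 2 ^ N) phi0) w - R (real n * 1) (U 1 phi0) w\<bar> <= 1 / real (Suc k)"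
  unfolding AE_all_countable by (intro allI dyadic_closeness[OF _ dominated_phi0]) auto
 with martingale_converges show ?thesis
 proof eventually_elim
  case (elim w)
  let ?L = "lim (%n. R (real n) phi0 w)"
  have L: "(%n. R (real n) phi0 w) \<longlonglongrightarrow> ?L" using elim(1) by (simp add: convergent_LIMSEQ_iff)
  show ?case
  proof (rule dyadic_limitI)
   fix eps :: real assume eps: "0 < eps"
   then obtain k :: nat where k: "1 / real (Suc k) < eps / 2" using nat_approx_posE[of "eps / 2"] by auto
   obtain n0 where n0: "!!n N i. n \<ge> n0 ==> i <= 2 ^ N ==>
    \<bar>R (real n * 1 + real i * 1 / 2 ^ N) (U (1 - real i * 1 / 2 ^ N) phi0) w - R (real n * 1) (U 1 phi0) w\<bar> <= 1 / real (Suc k)"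
    using elim(2) by blast
   obtain n1 where n1: "!!n. n \<ge> n1 ==> \<bar>R (real n) phi0 w - ?L\<bar> < eps / 2"
    using LIMSEQ_D[OF L, of "eps / 2"] eps by auto
   have "\<bar>R (real i / 2 ^ N) phi0 w - ?L\<bar> <= eps" if big: "real (Suc (max n0 n1)) <= real i / 2 ^ N" for i N :: nat
   proof -
    obtain n j where nj: "max n0 n1 <= n" "j <= 2 ^ N" "real i / 2 ^ N = real n * (1 / 2 ^ 0) + real j * (1 / 2 ^ 0) / 2 ^ N"
     using dyadic_decomposition[OF big] by blast
    have "real j <= 2 ^ N" using nj(2) by (metis of_nat_le_iff of_nat_numeral of_nat_power)
    then have "U (1 - real j * 1 / 2 ^ N) phi0 = phi0" by (intro U_phi0) (simp add: field_simps)
    then have "\<bar>R (real i / 2 ^ N) phi0 w - R (real n) phi0 w\<bar> <= 1 / real (Suc k)"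
     using n0[of n j N] nj by (simp add: U_phi0)
    moreover have "\<bar>R (real n) phi0 w - ?L\<bar> < eps / 2" using nj(1) by (intro n1) simp
    ultimately show ?thesis using k by linarith
   qed
   then show "\<exists>n::nat. \<forall>i N::nat. real n <= real i / 2 ^ N \<longrightarrow> \<bar>R (real i / 2 ^ N) phi0 w - ?L\<bar> <= eps" by blast
  qed
 qed
qed

lemma dyadic_limit_R:
 assumes f: "dominated c f" and cont: "!!\<delta>. 0 < \<delta> ==> \<exists>sig>0. \<forall>s x. 0 < s \<and> s <= sig \<longrightarrow> \<bar>U s f x - f x\<bar> <= \<delta> * phi0 x"
 shows "AE w in P mu. dyadic_limit (%t. R t f w) ((LINT x|m. phih0 x * f x) * lim (%n. R (real n) phi0 w))"
proof -
 \<comment> \<open>The coefficient for which \<open>f - \<kappa> phi0\<close> is orthogonal to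
   \<open>phih0\<close>, by the normalisation of the eigenfunctions; on this difference
   \<open>lattice_tendsto_zero\<close> applies.\<close>
 define \<kappa> where "\<kappa> = (LINT x|m. phih0 x * f x)"
 have d0: "dominated (\<bar>1\<bar> * c + \<bar>- \<kappa>\<bar> * 1) (%x. 1 * f x + (- \<kappa>) * phi0 x)" by (rule dominated_lincomb[OF f dominated_phi0])
 have "integrable m (%x. phih0 x * f x)" "integrable m (%x. phih0 x * phi0 x)"
  by (rule L2_mult[OF eigenfunctions_L2(2) dominatedD(4)[OF f]],
   rule L2_mult[OF eigenfunctions_L2(2,1)])
 then have "(LINT x|m. phih0 x * f x - \<kappa> * (phi0 x * phih0 x)) = 0"
  using normalization(2) by (simp add: \<kappa>_def mult.commute)
 then have z: "(LINT x|m. phih0 x * (1 * f x + (- \<kappa>) * phi0 x)) = 0"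
  by (simp add: right_diff_distrib mult_ac)
 have "AE w in P mu. \<forall>k::nat. (%n. R (real n * (1 / 2 ^ k)) (%x. 1 * f x + (- \<kappa>) * phi0 x) w) \<longlonglongrightarrow> 0"
  unfolding AE_all_countable by (intro allI lattice_tendsto_zero[OF _ d0 z]) simp
 moreover have "AE w in P mu. \<forall>k l::nat. \<exists>n0. \<forall>n\<ge>n0. \<forall>N. \<forall>i\<le>2 ^ N.
  \<bar>R (real n * (1 / 2 ^ k) + real i * (1 / 2 ^ k) / 2 ^ N) (U (1 / 2 ^ k - real i * (1 / 2 ^ k) / 2 ^ N) f) w - R (real n * (1 / 2 ^ k)) (U (1 / 2 ^ k) f) w\<bar> <= 1 / real (Suc l)"
  unfolding AE_all_countable by (intro allI dyadic_closeness[OF _ f]) auto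
 moreover have "AE w in P mu. \<forall>i N::nat. w \<in> \<Omega> \<and> fin (real i / 2 ^ N) w"
  unfolding AE_all_countable by (intro allI fin_AE) simp
 ultimately show ?thesis using dyadic_limit_phi0
 proof eventually_elim
  case (elim w)
  define L where "L = lim (%n. R (real n) phi0 w)"
  have w: "w \<in> \<Omega>" using elim(3) by blast
  have L: "dyadic_limit (%t. R t phi0 w) L" using elim(4) by (simp add: L_def)
  have "dyadic_limit (%t. R t f w) (\<kappa> * L)"
  proof (rule dyadic_limitI)
   fix eps :: real assume eps: "0 < eps"
   \<comment> \<open>At late times \<open>R t phi0 w\<close> is at most
     \<open>\<bar>L\<bar> + 1\<close>, so replacing \<open>U s f\<close> by \<open>f\<close> costs
     at most \<open>eps / 10\<close>. Five errors of this size, \<open>c1\<close> to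
     \<open>c5\<close>, are added at the end.\<close>
   define \<delta> where "\<delta> = eps / (10 * (\<bar>L\<bar> + 1))"
   have \<delta>: "0 < \<delta>" unfolding \<delta>_def using eps by (intro divide_pos_pos) auto
   have \<delta>L: "\<delta> * (\<bar>L\<bar> + 1) = eps / 10" unfolding \<delta>_def by (simp add: field_simps)
   obtain sig where sig: "0 < sig" "!!s x. 0 < s ==> s <= sig ==> \<bar>U s f x - f x\<bar> <= \<delta> * phi0 x" using cont[OF \<delta>] by blast
   obtain k :: nat where "(1 / 2) ^ k < sig" using real_arch_pow_inv[OF sig(1), of "1 / 2"] by auto
   then have k: "1 / 2 ^ k <= sig" by (simp add: power_divide)
   have cl: "\<bar>U s f x - f x\<bar> <= \<delta> * phi0 x" if "0 <= s" "s <= 1 / 2 ^ k" for s x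
    using sig(2)[of s x] that k \<delta> eigenfunctions_pos(1)[of x] by (cases "s = 0") auto
   have dd: "dominated \<delta> (%x. 1 * U s f x + (- 1) * f x)" if "0 <= s" "s <= 1 / 2 ^ k" for s
    unfolding dominated_def using dominatedD(1)[OF f] dominatedD(1)[OF U_dominated[OF that(1) f]] cl[OF that] by simp
   have Rcl: "\<bar>R (real i / 2 ^ N) (U s f) w - R (real i / 2 ^ N) f w\<bar> <= \<delta> * R (real i / 2 ^ N) phi0 w"
    if s: "0 <= s" "s <= 1 / 2 ^ k" for s and i N :: nat
   proof -
    have t: "0 <= real i / 2 ^ N" "fin (real i / 2 ^ N) w" using elim(3) by auto
    show ?thesis
     using R_abs_le_phi0[OF w t dd[OF s]] R_lincomb[OF w t U_dominated[OF s(1) f] f, of 1 "- 1"] by simp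
   qed
   define eps' where "eps' = eps / (10 * (\<bar>\<kappa>\<bar> + 1))"
   have eps': "0 < eps'" unfolding eps'_def using eps by (intro divide_pos_pos) auto
   have eps\<kappa>: "(\<bar>\<kappa>\<bar> + 1) * eps' = eps / 10" unfolding eps'_def by (simp add: field_simps)
   obtain na :: nat where na: "!!i N :: nat. real na <= real i / 2 ^ N ==> \<bar>R (real i / 2 ^ N) phi0 w - L\<bar> <= min 1 eps'"
    using dyadic_limitD[OF L, of "min 1 eps'"] eps' by auto
   obtain nb :: nat where nb: "!!n. n \<ge> nb ==> \<bar>R (real n * (1 / 2 ^ k)) (%x. 1 * f x + (- \<kappa>) * phi0 x) w\<bar> < eps / 10"
    using LIMSEQ_D[OF spec[OF elim(1), of k], of "eps / 10"] eps by auto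
   obtain l :: nat where l: "1 / real (Suc l) < eps / 10" using nat_approx_posE[of "eps / 10"] eps by auto
   obtain nc :: nat where nc: "!!n N i. n \<ge> nc ==> i <= 2 ^ N ==>
    \<bar>R (real n * (1 / 2 ^ k) + real i * (1 / 2 ^ k) / 2 ^ N) (U (1 / 2 ^ k - real i * (1 / 2 ^ k) / 2 ^ N) f) w - R (real n * (1 / 2 ^ k)) (U (1 / 2 ^ k) f) w\<bar> <= 1 / real (Suc l)"
    using elim(2) by blast
   \<comment> \<open>The factor \<open>2 ^ k\<close> converts times into numbers of lattice steps,
     so that the lattice point \<open>n / 2 ^ k\<close> lies beyond \<open>na\<close> as
     well.\<close>
   have "\<bar>R (real i / 2 ^ N) f w - \<kappa> * L\<bar> <= eps" if big: "real (Suc (max (na * 2 ^ k) (max nb nc))) <= real i / 2 ^ N" for i N :: nat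
   proof -
    obtain n j where nj: "max (na * 2 ^ k) (max nb nc) <= n" "j <= 2 ^ N" "real i / 2 ^ N = real n * (1 / 2 ^ k) + real j * (1 / 2 ^ k) / 2 ^ N"
     using dyadic_decomposition[OF big] by blast
    define s where "s = 1 / 2 ^ k - real j * (1 / 2 ^ k) / (2 ^ N :: real)"
    have "real j <= 2 ^ N" using nj(2) by (metis of_nat_le_iff of_nat_numeral of_nat_power)
    then have s: "0 <= s" "s <= 1 / 2 ^ k" unfolding s_def by (auto simp: field_simps)
    have tn: "real n * (1 / 2 ^ k) = real n / 2 ^ k" by simp
    have "real (na * 2 ^ k) <= real n" using nj(1) by (subst of_nat_le_iff) simp
    then have n_big: "real na <= real n / 2 ^ k" by (simp add: field_simps)
    have "real na <= real (na * 2 ^ k)" by (subst of_nat_le_iff) simp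
    then have i_big: "real na <= real i / 2 ^ N" using big by (simp only: of_nat_Suc of_nat_max)
    note W1 = na[OF n_big] and W2 = na[OF i_big]
    have b1: "\<delta> * R (real n / 2 ^ k) phi0 w <= eps / 10" "\<delta> * R (real i / 2 ^ N) phi0 w <= eps / 10"
     unfolding \<delta>L[symmetric] using W1 W2 \<delta> by (auto intro!: mult_left_mono)
    have c1: "\<bar>R (real i / 2 ^ N) (U s f) w - R (real i / 2 ^ N) f w\<bar> <= eps / 10" using Rcl[OF s, of i N] b1 by linarith
    have c2: "\<bar>R (real n / 2 ^ k) (U (1 / 2 ^ k) f) w - R (real n / 2 ^ k) f w\<bar> <= eps / 10" using Rcl[of "1 / 2 ^ k" n k] b1 by simp
    have c3: "\<bar>R (real i / 2 ^ N) (U s f) w - R (real n / 2 ^ k) (U (1 / 2 ^ k) f) w\<bar> <= eps / 10"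
     using nc[of n j N] nj l unfolding nj(3)[symmetric] s_def tn by simp
    have fn: "0 <= real n / 2 ^ k" "fin (real n / 2 ^ k) w" using elim(3) by auto
    have c4: "\<bar>R (real n / 2 ^ k) f w - \<kappa> * R (real n / 2 ^ k) phi0 w\<bar> <= eps / 10"
     using nb[of n] nj(1) R_lincomb[OF w fn f dominated_phi0, of 1 "- \<kappa>"] unfolding tn by simp
    have "\<bar>\<kappa>\<bar> * \<bar>R (real n / 2 ^ k) phi0 w - L\<bar> <= (\<bar>\<kappa>\<bar> + 1) * eps'" using W1 eps' by (intro mult_mono) auto
    then have c5: "\<bar>\<kappa> * R (real n / 2 ^ k) phi0 w - \<kappa> * L\<bar> <= eps / 10" unfolding eps\<kappa> by (simp add: right_diff_distrib[symmetric] abs_mult)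
    show ?thesis using c1 c2 c3 c4 c5 eps by linarith
   qed
   then show "\<exists>n::nat. \<forall>i N::nat. real n <= real i / 2 ^ N \<longrightarrow> \<bar>R (real i / 2 ^ N) f w - \<kappa> * L\<bar> <= eps" by blast
  qed
  then show ?case by (simp add: \<kappa>_def L_def)
 qed
qed

end

end

section \<open>Convergence at all times\<close>

lemma layer_count:
 fixes y :: real and N :: nat
 assumes "0 <= y" "y <= real N"
 shows "real (card {i \<in> {1..N}. real i < y}) <= y" "y - 1 <= real (card {i \<in> {1..N}. real i < y})"
proof -
 have fin: "finite {i \<in> {1..N}. real i < y}" by (rule finite_subset[of _ "{1..N}"]) auto
 have "{i \<in> {1..N}. real i < y} \<subseteq> {1..nat \<lfloor>y\<rfloor>}"
 proof
  fix i assume i: "i \<in> {i \<in> {1..N}. real i < y}"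
  then have "real i <= y" by simp
  then have "i <= nat \<lfloor>y\<rfloor>" by (rule le_nat_floor)
  then show "i \<in> {1..nat \<lfloor>y\<rfloor>}" using i by simp
 qed
 then have "card {i \<in> {1..N}. real i < y} <= nat \<lfloor>y\<rfloor>" using card_mono[of "{1..nat \<lfloor>y\<rfloor>}"] by fastforce
 moreover have "real (nat \<lfloor>y\<rfloor>) <= y" using assms(1) by simp
 ultimately show "real (card {i \<in> {1..N}. real i < y}) <= y" by linarith
 have "{1..<nat \<lceil>y\<rceil>} \<subseteq> {i \<in> {1..N}. real i < y}"
 proof
  fix i assume i: "i \<in> {1..<nat \<lceil>y\<rceil>}"
  then have "int i < \<lceil>y\<rceil>" by (simp add: zless_nat_eq_int_zless)
  then have "real i < y" by (simp add: less_ceiling_iff)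
  moreover from this have "real i < real N" using assms(2) by linarith
  ultimately show "i \<in> {i \<in> {1..N}. real i < y}" using i by simp
 qed
 from card_mono[OF fin this] have "nat \<lceil>y\<rceil> - 1 <= card {i \<in> {1..N}. real i < y}" by simp
 moreover have "y <= real (nat \<lceil>y\<rceil>)" by (rule real_nat_ceiling_ge)
 ultimately show "y - 1 <= real (card {i \<in> {1..N}. real i < y})" by linarith
qed

text \<open>
 The average over \<open>i \<le> N\<close> of the indicators of the interiors of \<open>{h > i / N}\<close> is at most \<open>h\<close>, and at
 least \<open>h - 1 / N\<close> at the continuity points of \<open>h\<close>.
\<close>

lemma portmanteau_lower:
 fixes \<nu> :: "'t => 'e::metric_space measure" and h :: "'e => real"
 assumes \<nu>: "\<forall>\<^sub>F t in F. finite_measure (\<nu> t) \<and> sets (\<nu> t) = sets borel"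
  and \<pi>: "finite_measure \<pi>" "sets \<pi> = sets borel"
  and lower: "!!U eps. open U ==> 0 < eps ==> \<forall>\<^sub>F t in F. measure \<pi> U - eps <= measure (\<nu> t) U"
  and h: "h \<in> borel_measurable borel" "!!x. 0 <= h x" "!!x. h x <= 1" "AE x in \<pi>. isCont h x" and eps: "0 < eps"
 shows "\<forall>\<^sub>F t in F. (LINT x|\<pi>. h x) - eps <= (LINT x|\<nu> t. h x)"
proof -
 interpret \<pi>: finite_measure \<pi> by (rule \<pi>(1))
 \<comment> \<open>Enough layers that the loss \<open>1 / real N\<close> per point has
   \<pi>-integral at most \<open>eps / 2\<close>.\<close>
 obtain N :: nat where N: "2 * measure \<pi> UNIV / eps < real N" using reals_Archimedean2 by blast
 have "0 <= 2 * measure \<pi> UNIV / eps" using eps by simp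
 then have N0: "0 < real N" using N by linarith
 then have Neps: "measure \<pi> UNIV / real N <= eps / 2" using N eps by (simp add: field_simps)
 define V where "V i = interior {x. real i < real N * h x}" for i :: nat
 have Vo: "open (V i)" for i by (simp add: V_def)
 define s where "s x = (\<Sum>i=1..N. indicator (V i) x) / real N" for x
 have count: "(\<Sum>i=1..N. indicator (A i) x :: real) = real (card {i \<in> {1..N}. x \<in> A i})" for A :: "nat => 'e set" and x
  by (simp add: indicator_def sum.If_cases Int_def)
 have y: "0 <= real N * h x" "real N * h x <= real N" for x using h(2,3)[of x] N0 by (auto simp: mult_left_le)
 have sh: "s x <= h x" for x
 proof -
  have "{i \<in> {1..N}. x \<in> V i} \<subseteq> {i \<in> {1..N}. real i < real N * h x}"
   unfolding V_def by (auto dest: subsetD[OF interior_subset])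
  then have "card {i \<in> {1..N}. x \<in> V i} <= card {i \<in> {1..N}. real i < real N * h x}" by (intro card_mono) auto
  then have "(\<Sum>i=1..N. indicator (V i) x :: real) <= real N * h x"
   unfolding count using layer_count(1)[OF y, of x] by linarith
  then show ?thesis unfolding s_def using N0 by (simp add: field_simps)
 qed
 have hs: "h x <= s x + 1 / real N" if "isCont h x" for x
 proof -
  have "x \<in> V i" if i: "real i < real N * h x" for i
  proof -
   have "(h \<longlongrightarrow> h x) (nhds x)" using \<open>isCont h x\<close> unfolding isCont_def tendsto_at_iff_tendsto_nhds .
   then have "((%z. real N * h z) \<longlongrightarrow> real N * h x) (nhds x)" by (rule tendsto_mult_left)
   then have "\<forall>\<^sub>F z in nhds x. real i < real N * h z" using i by (rule order_tendstoD(1))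
   then obtain S where "open S" "x \<in> S" "\<forall>z\<in>S. real i < real N * h z" unfolding eventually_nhds by blast
   then show ?thesis unfolding V_def by (auto intro: interiorI)
  qed
  then have "{i \<in> {1..N}. real i < real N * h x} \<subseteq> {i \<in> {1..N}. x \<in> V i}" by auto
  then have "card {i \<in> {1..N}. real i < real N * h x} <= card {i \<in> {1..N}. x \<in> V i}" by (intro card_mono) auto
  then have "real N * h x - 1 <= (\<Sum>i=1..N. indicator (V i) x :: real)"
   unfolding count using layer_count(2)[OF y, of x] by linarith
  then show ?thesis unfolding s_def using N0 by (simp add: field_simps)
 qed
 have int: "(LINT x|M. s x) = (\<Sum>i=1..N. measure M (V i)) / real N" "integrable M s" "integrable M h"
  if M: "finite_measure M" "sets M = sets borel" for M
 proof -
  interpret finite_measure M by (rule M)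
  have V: "V i \<in> sets M" for i using Vo M(2) by simp
  have i: "integrable M (indicat_real (V i))" for i using V by (intro integrable_real_indicator) (auto simp: emeasure_eq_measure)
  then show "integrable M s" unfolding s_def[abs_def] by simp
  have "(LINT x|M. s x) = (\<Sum>i=1..N. (LINT x|M. indicator (V i) x)) / real N" unfolding s_def using i by simp
  then show "(LINT x|M. s x) = (\<Sum>i=1..N. measure M (V i)) / real N" using V by simp
  show "integrable M h" using h measurable_of_sets_borel[OF M(2) h(1)] by (intro integrable_const_bound[where B=1]) auto
 qed
 have "(LINT x|\<pi>. h x) <= (LINT x|\<pi>. s x + 1 / real N)"
  using h(4) hs int(2,3)[OF \<pi>] by (intro integral_mono_AE) (auto elim!: eventually_mono)
 also have "... = (\<Sum>i=1..N. measure \<pi> (V i)) / real N + measure \<pi> UNIV / real N"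
  using int(1,2)[OF \<pi>] sets_eq_imp_space_eq[OF \<pi>(2)] by simp
 finally have hp: "(LINT x|\<pi>. h x) <= (\<Sum>i=1..N. measure \<pi> (V i)) / real N + eps / 2" using Neps by linarith
 have "\<forall>\<^sub>F t in F. \<forall>i\<in>{1..N}. measure \<pi> (V i) - eps / 2 <= measure (\<nu> t) (V i)"
  using lower[OF Vo, of "eps / 2"] eps by (intro eventually_ball_finite) auto
 with \<nu> show ?thesis
 proof eventually_elim
  case (elim t)
  have "(\<Sum>i=1..N. measure \<pi> (V i)) - real N * (eps / 2) = (\<Sum>i=1..N. measure \<pi> (V i) - eps / 2)" by (simp add: sum_subtractf)
  also have "... <= (\<Sum>i=1..N. measure (\<nu> t) (V i))" using elim(2) by (intro sum_mono) auto
  finally have "((\<Sum>i=1..N. measure \<pi> (V i)) - real N * (eps / 2)) / real N <= (\<Sum>i=1..N. measure (\<nu> t) (V i)) / real N"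
   by (rule divide_right_mono) simp
  then have "(\<Sum>i=1..N. measure \<pi> (V i)) / real N - eps / 2 <= (\<Sum>i=1..N. measure (\<nu> t) (V i)) / real N"
   using N0 by (simp add: diff_divide_distrib)
  also have "... = (LINT x|\<nu> t. s x)" using int(1)[of "\<nu> t"] elim(1) by simp
  also have "... <= (LINT x|\<nu> t. h x)" using int(2,3)[of "\<nu> t"] elim(1) sh by (intro integral_mono) auto
  finally show ?case using hp by linarith
 qed
qed

text \<open>The one-sided estimate for functions with values in \<open>[0, 1]\<close> is applied to
  affine images of \<open>h\<close> and of \<open>- h\<close>. Subtracting the constant brings in
  the total mass with a negative sign, and there the upper bound on the mass is used.\<close>

lemma portmanteau:
 fixes \<nu> :: "'t => 'e::metric_space measure" and h :: "'e => real"
 assumes \<nu>: "\<forall>\<^sub>F t in F. sets (\<nu> t) = sets borel"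
  and \<pi>: "finite_measure \<pi>" "sets \<pi> = sets borel"
  and lower: "!!U eps. open U ==> 0 < eps ==> \<forall>\<^sub>F t in F. measure \<pi> U - eps <= measure (\<nu> t) U"
  and upper: "!!eps. 0 < eps ==> \<forall>\<^sub>F t in F. emeasure (\<nu> t) UNIV <= ennreal (measure \<pi> UNIV + eps)"
  and h: "h \<in> borel_measurable borel" "!!x. \<bar>h x\<bar> <= c" "AE x in \<pi>. isCont h x"
 shows "((%t. LINT x|\<nu> t. h x) \<longlongrightarrow> (LINT x|\<pi>. h x)) F"
proof -
 have fin: "\<forall>\<^sub>F t in F. finite_measure (\<nu> t) \<and> sets (\<nu> t) = sets borel"
  using \<nu> upper[OF zero_less_one]
 proof eventually_elim
  case (elim t)
  then have "emeasure (\<nu> t) (space (\<nu> t)) \<noteq> \<infinity>" using sets_eq_imp_space_eq[OF elim(1)] by (auto simp: top_unique)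
  then show ?case using elim(1) by (simp add: finite_measureI)
 qed
 define C where "C = \<bar>c\<bar> + 1"
 have C: "0 < C" "\<bar>h x\<bar> <= C" for x using h(2)[of x] by (auto simp: C_def)
 have low: "\<forall>\<^sub>F t in F. (LINT x|\<pi>. g x) - eps < (LINT x|\<nu> t. g x)"
  if g: "g \<in> borel_measurable borel" "!!x. \<bar>g x\<bar> <= C" "AE x in \<pi>. isCont g x" and eps: "0 < eps" for g :: "'e => real" and eps
 proof -
  define k where "k x = (g x + C) / (2 * C)" for x
  have k: "0 <= k x" "k x <= 1" for x using g(2)[of x] C(1) by (auto simp: k_def field_simps abs_le_iff)
  have km: "k \<in> borel_measurable borel" unfolding k_def[abs_def] using g(1) by measurable
  have kc: "AE x in \<pi>. isCont k x" using g(3) unfolding k_def[abs_def] by (rule eventually_mono) (use C(1) in \<open>auto intro!: continuous_intros\<close>)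
  \<comment> \<open>The layer estimate costs \<open>2 * C * \<eta>\<close> and the total mass
    \<open>C * \<eta>\<close>; the fourth multiple makes the inequality strict.\<close>
  define \<eta> where "\<eta> = eps / (4 * C)"
  have \<eta>: "0 < \<eta>" "4 * C * \<eta> = eps" unfolding \<eta>_def using eps C(1) by auto
  have int: "(LINT x|M. g x) = 2 * C * (LINT x|M. k x) - C * measure M UNIV" if M: "finite_measure M" "sets M = sets borel" for M
  proof -
   interpret finite_measure M by (rule M)
   have ki: "integrable M k" using k measurable_of_sets_borel[OF M(2) km] by (intro integrable_const_bound[where B=1]) auto
   have "(LINT x|M. g x) = (LINT x|M. 2 * C * k x - C)" using C(1) by (simp add: k_def field_simps)
   also have "... = 2 * C * (LINT x|M. k x) - C * measure M UNIV" using ki sets_eq_imp_space_eq[OF M(2)] by simp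
   finally show ?thesis .
  qed
  have "\<forall>\<^sub>F t in F. (LINT x|\<pi>. k x) - \<eta> <= (LINT x|\<nu> t. k x)"
   by (rule portmanteau_lower[OF fin \<pi> _ km k kc \<eta>(1)]) (rule lower)
  with fin upper[OF \<eta>(1)] show ?thesis
  proof eventually_elim
   case (elim t)
   interpret finite_measure "\<nu> t" using elim(1) by simp
   have "measure (\<nu> t) UNIV <= measure \<pi> UNIV + \<eta>"
    using elim(2) \<eta>(1) ennreal_le_iff[of "measure \<pi> UNIV + \<eta>" "measure (\<nu> t) UNIV"] by (simp add: emeasure_eq_measure del: ennreal_plus)
   then have 1: "C * measure (\<nu> t) UNIV <= C * (measure \<pi> UNIV + \<eta>)" using C(1) by (intro mult_left_mono) auto
   have 2: "2 * C * ((LINT x|\<pi>. k x) - \<eta>) <= 2 * C * (LINT x|\<nu> t. k x)" using C(1) elim(3) by (intro mult_left_mono) auto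
   have "0 < C * \<eta>" using C(1) \<eta>(1) by simp
   then show ?case using 1 2 \<eta>(2) int[OF \<pi>] int[of "\<nu> t"] elim(1) by (simp add: algebra_simps)
  qed
 qed
 show ?thesis
 proof (rule tendstoI)
  fix eps :: real assume eps: "0 < eps"
  have "AE x in \<pi>. isCont (%x. - h x) x" using h(3) by (rule eventually_mono) (auto intro!: continuous_intros)
  then have "\<forall>\<^sub>F t in F. (LINT x|\<pi>. - h x) - eps < (LINT x|\<nu> t. - h x)" using h(1) C(2) by (intro low eps) auto
  with low[OF h(1) C(2) h(3) eps] show "\<forall>\<^sub>F t in F. dist (LINT x|\<nu> t. h x) (LINT x|\<pi>. h x) < eps"
   by eventually_elim (auto simp: dist_real_def)
 qed
qed

lemma bump_mono: "V \<subseteq> V' ==> bump k V x <= bump k V' x"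
proof (cases "V' = UNIV")
 case True
 then show ?thesis using bump_props(2)[of k V x] by (simp add: bump_def)
next
 case False
 assume V: "V \<subseteq> V'"
 then have "infdist x (- V) <= infdist x (- V')" using False by (intro infdist_mono) auto
 then have "min 1 (real k * infdist x (- V)) <= min 1 (real k * infdist x (- V'))" by (intro min.mono mult_left_mono) auto
 moreover have "V \<noteq> UNIV" using V False by auto
 ultimately show ?thesis using False by (simp add: bump_def)
qed

text \<open>The finite unions are indexed by lists of naturals, a countable type, so that almost
  sure statements can be quantified over all of them.\<close>

definition base_union :: "(nat => 'e set) => 'e set => nat => nat list" where
 "base_union b U i = filter (%j. b j \<subseteq> U) [0..<Suc i]"

lemma set_base_union: "set (base_union b U i) = {j. j <= i \<and> b j \<subseteq> U}"
 by (auto simp: base_union_def simp del: upt_Suc)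

lemma bump_exhausts:
 fixes U :: "'e::metric_space set" and b :: "nat => 'e set"
 assumes b: "!!i. open (b i)" "!!U x. open U ==> x \<in> U ==> \<exists>i. x \<in> b i \<and> b i \<subseteq> U" and U: "open U"
 shows "bump i (\<Union>(b ` set (base_union b U i))) x <= indicator U x"
  "(%i. bump i (\<Union>(b ` set (base_union b U i))) x) \<longlonglongrightarrow> indicator U x"
proof -
 let ?V = "%i. \<Union>(b ` set (base_union b U i))"
 have sub: "?V i \<subseteq> U" for i by (auto simp: set_base_union)
 show le: "bump i (?V i) x <= indicator U x" for i
 proof (cases "x \<in> U")
  case False
  then have "bump i (?V i) x = 0" using sub[of i] by (intro bump_props(4)) auto
  then show ?thesis by simp
 qed (simp add: bump_props(2))
 show "(%i. bump i (?V i) x) \<longlonglongrightarrow> indicator U x"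
 proof (cases "x \<in> U")
  case True
  then obtain j where j: "x \<in> b j" "b j \<subseteq> U" using b(2)[OF U] by blast
  have "bump i (b j) x <= bump i (?V i) x" if "j <= i" for i
   using j that by (intro bump_mono) (auto simp: set_base_union)
  then have "\<forall>\<^sub>F i in sequentially. bump i (b j) x <= bump i (?V i) x" by (auto simp: eventually_sequentially)
  then show ?thesis
   using True by (auto intro!: tendsto_sandwich[OF _ _ bump_tendsto[OF b(1) j(1)] tendsto_const] always_eventually bump_props(2))
 next
  case False
  then have "bump i (?V i) x = 0" for i using sub[of i] by (intro bump_props(4)) auto
  then show ?thesis using False by simp
 qed
qed

text \<open>One bump below the indicator of \<open>U\<close> already has \<pi>-integral within
  \<open>eps / 2\<close> of the mass of \<open>U\<close>, and for this single bump the integrals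
  converge.\<close>

lemma open_lower_of_bumps:
 fixes \<nu> :: "'t => 'e::metric_space measure" and b :: "nat => 'e set"
 assumes b: "!!i. open (b i)" "!!U x. open U ==> x \<in> U ==> \<exists>i. x \<in> b i \<and> b i \<subseteq> U"
  and \<nu>: "\<forall>\<^sub>F t in F. finite_measure (\<nu> t) \<and> sets (\<nu> t) = sets borel"
  and \<pi>: "finite_measure \<pi>" "sets \<pi> = sets borel"
  and lim: "!!j l. ((%t. LINT x|\<nu> t. bump j (\<Union>(b ` set l)) x) \<longlongrightarrow> (LINT x|\<pi>. bump j (\<Union>(b ` set l)) x)) F"
  and U: "open U" and eps: "0 < eps"
 shows "\<forall>\<^sub>F t in F. measure \<pi> U - eps <= measure (\<nu> t) U"
proof -
 interpret \<pi>: finite_measure \<pi> by (rule \<pi>(1))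
 define g where "g i = bump i (\<Union>(b ` set (base_union b U i)))" for i
 note ex = bump_exhausts[OF b U]
 have gb: "g i \<in> borel_measurable borel" for i unfolding g_def by (rule borel_measurable_continuous_onI[OF bump_props(3)])
 have g01: "\<bar>g i x\<bar> <= 1" "g i x <= indicator U x" for i x unfolding g_def using ex(1) bump_abs by auto
 have "(%i. LINT x|\<pi>. g i x) \<longlonglongrightarrow> (LINT x|\<pi>. indicator U x)"
 proof (rule integral_dominated_convergence[where w="%_. 1"])
  show "AE x in \<pi>. (%i. g i x) \<longlonglongrightarrow> indicator U x" unfolding g_def using ex(2) by simp
  show "indicat_real U \<in> borel_measurable \<pi>" using U \<pi>(2) by (intro borel_measurable_indicator) simp
  show "g i \<in> borel_measurable \<pi>" for i by (rule measurable_of_sets_borel[OF \<pi>(2) gb])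
  show "AE x in \<pi>. norm (g i x) <= 1" for i using g01(1) by simp
 qed simp
 then have "(%i. LINT x|\<pi>. g i x) \<longlonglongrightarrow> measure \<pi> U" using U \<pi>(2) sets_eq_imp_space_eq[OF \<pi>(2)] by simp
 then have "\<forall>\<^sub>F i in sequentially. measure \<pi> U - eps / 2 < (LINT x|\<pi>. g i x)" using eps by (intro order_tendstoD(1)) auto
 then obtain i where i: "measure \<pi> U - eps / 2 < (LINT x|\<pi>. g i x)" by (auto simp: eventually_sequentially)
 have "\<forall>\<^sub>F t in F. (LINT x|\<pi>. g i x) - eps / 2 < (LINT x|\<nu> t. g i x)"
  using lim[of i "base_union b U i"] eps unfolding g_def by (intro order_tendstoD(1)) auto
 with \<nu> show ?thesis
 proof eventually_elim
  case (elim t)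
  interpret finite_measure "\<nu> t" using elim(1) by simp
  have s: "sets (\<nu> t) = sets borel" using elim(1) by simp
  have "(LINT x|\<nu> t. g i x) <= (LINT x|\<nu> t. indicator U x)"
  proof (rule integral_mono)
   show "integrable (\<nu> t) (g i)" using g01(1) measurable_of_sets_borel[OF s gb] by (intro integrable_const_bound[where B=1]) auto
   show "integrable (\<nu> t) (indicat_real U)" using U s by (intro integrable_real_indicator) (auto simp: emeasure_eq_measure)
  qed (rule g01(2))
  then have "(LINT x|\<nu> t. g i x) <= measure (\<nu> t) U" using U s sets_eq_imp_space_eq[OF s] by simp
  then show ?case using i elim(2) by linarith
 qed
qed

lemma dyadic_approximation:
 fixes t :: real
 assumes "0 <= t"
 obtains i :: "nat => nat" where "filterlim (%k. real (i k) / 2 ^ k) (at_right t) sequentially" "!!k. t < real (i k) / 2 ^ k"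
proof -
 \<comment> \<open>The added 1 places the dyadic time strictly to the right of
   \<open>t\<close>.\<close>
 define i where "i k = nat (\<lfloor>t * 2 ^ k\<rfloor> + 1)" for k :: nat
 have r: "real (i k) = of_int \<lfloor>t * 2 ^ k\<rfloor> + 1" for k using assms by (simp add: i_def)
 have gt: "t < real (i k) / 2 ^ k" and le: "real (i k) / 2 ^ k <= t + (1 / 2) ^ k" for k
 proof -
  have "t * 2 ^ k < real (i k)" "real (i k) <= t * 2 ^ k + 1" unfolding r by linarith+
  then show "t < real (i k) / 2 ^ k" "real (i k) / 2 ^ k <= t + (1 / 2) ^ k" by (simp_all add: field_simps power_divide)
 qed
 have 0: "(%k. t + (1 / 2) ^ k) \<longlonglongrightarrow> t"
  using tendsto_add[OF tendsto_const LIMSEQ_power_zero[of "1 / 2 :: real"], of t] by simp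
 have "(%k. real (i k) / 2 ^ k) \<longlonglongrightarrow> t"
  by (rule tendsto_sandwich[OF always_eventually always_eventually tendsto_const 0]) (simp_all only: less_imp_le[OF gt] le simp_thms)
 then have "filterlim (%k. real (i k) / 2 ^ k) (at_right t) sequentially"
  by (rule tendsto_imp_filterlim_at_right) (simp only: gt eventually_True)
 then show ?thesis using gt that by blast
qed

text \<open>Each real time is approached from the right by dyadic times, which are at least as late,
  so the uniform bound at late dyadic times passes to it in the limit.\<close>

lemma dyadic_limit_tendsto:
 assumes h: "dyadic_limit h l" and rc: "!!t. 0 <= t ==> (h \<longlongrightarrow> h t) (at_right t)"
 shows "(h \<longlongrightarrow> l) at_top"
proof (rule tendstoI)
 fix eps :: real assume eps: "0 < eps"
 obtain n :: nat where n: "!!i N :: nat. real n <= real i / 2 ^ N ==> \<bar>h (real i / 2 ^ N) - l\<bar> <= eps / 2"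
  using dyadic_limitD[OF h, of "eps / 2"] eps by auto
 have "dist (h t) l < eps" if t: "real n <= t" for t
 proof -
  have t0: "0 <= t" using t by linarith
  obtain i :: "nat => nat" where i: "filterlim (%k. real (i k) / 2 ^ k) (at_right t) sequentially" "!!k. t < real (i k) / 2 ^ k"
   using dyadic_approximation[OF t0] by blast
  have "(%k. h (real (i k) / 2 ^ k)) \<longlonglongrightarrow> h t" by (rule filterlim_compose[OF rc[OF t0] i(1)])
  then have "(%k. \<bar>h (real (i k) / 2 ^ k) - l\<bar>) \<longlonglongrightarrow> \<bar>h t - l\<bar>" by (intro tendsto_intros)
  moreover have "\<bar>h (real (i k) / 2 ^ k) - l\<bar> <= eps / 2" for k using i(2)[of k] t by (intro n) linarith
  ultimately have "\<bar>h t - l\<bar> <= eps / 2" by (intro LIMSEQ_le_const2) auto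
  then show ?thesis using eps by (simp add: dist_real_def)
 qed
 then show "\<forall>\<^sub>F t in at_top. dist (h t) l < eps" unfolding eventually_at_top_linorder by blast
qed

lemma weak_limit_integral:
 fixes f :: "'e::topological_space => real"
 assumes l: "limitin weak_topology Y \<nu> F" and f: "continuous_on UNIV f" "bounded (range f)"
 shows "((%s. LINT x|Y s. f x) \<longlongrightarrow> (LINT x|\<nu>. f x)) F"
proof (rule topological_tendstoI)
 fix S :: "real set" assume S: "open S" "(LINT x|\<nu>. f x) \<in> S"
 let ?A = "{\<nu> \<in> finite_borel_measures. (LINT x|\<nu>. f x) \<in> S}"
 have "?A \<in> {{\<nu> \<in> finite_borel_measures. (LINT x|\<nu>. g x) \<in> U} | g U.
    continuous_on UNIV (g :: 'e => real) \<and> bounded (range g) \<and> open U}"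
  using S(1) f by blast
 then have "openin weak_topology ?A" unfolding weak_topology_def by (rule topology_generated_by_Basis)
 moreover have "\<nu> \<in> ?A" using l S(2) by (simp add: limitin_def)
 ultimately have "\<forall>\<^sub>F s in F. Y s \<in> ?A" using l unfolding limitin_def by blast
 then show "\<forall>\<^sub>F s in F. (LINT x|Y s. f x) \<in> S" by eventually_elim simp
qed

section \<open>The event of full probability and the limit on it\<close>

context superprocess_setting
begin

text \<open>A limit along integers, measurable as it stands. Its agreement with
  \<open>W_infinity\<close>, a limit over all real times, is known only on the good event and only
  after the main limit has been proved there.\<close>

definition terminal :: "'v => real" where
 "terminal w = lim (%n. R (real n) phi0 w)"

definition test_function :: "(nat => 'e set) => nat => nat list => 'e => real" where
 "test_function bs j l x = bump j (\<Union>(bs ` set l)) x * phi0 x"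

text \<open>Mentions neither an initial law nor the function \<open>f\<close> of the theorem, only
  dyadic times, \<open>phi0\<close> and countably many test functions.\<close>

definition good_event :: "(nat => 'e set) => 'v set" where
 "good_event bs = {w \<in> \<Omega>. (\<forall>i N::nat. fin (real i / 2 ^ N) w) \<and> dyadic_limit (%t. R t phi0 w) (terminal w) \<and>
   (\<forall>j l. dyadic_limit (%t. R t (test_function bs j l) w) ((LINT x|m. phih0 x * test_function bs j l x) * terminal w))}"

context
 fixes bs :: "nat => 'e set"
 assumes b_open: "!!i. open (bs i)" and b_compact: "!!i. compact (closure (bs i))"
  and b_base: "!!U x. open U ==> x \<in> U ==> \<exists>i. x \<in> bs i \<and> bs i \<subseteq> U"
begin

lemma bump_compact_support:
 obtains C where "compact C" "{x. bump j (\<Union>(bs ` set l)) x \<noteq> 0} \<subseteq> C"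
proof (rule that[of "\<Union>i\<in>set l. closure (bs i)"])
 show c: "compact (\<Union>i\<in>set l. closure (bs i))" by (intro compact_UN b_compact) simp
 have "closure (\<Union>(bs ` set l)) \<subseteq> (\<Union>i\<in>set l. closure (bs i))"
  using closure_subset by (intro closure_minimal compact_imp_closed[OF c]) blast
 then  show "{x. bump j (\<Union>(bs ` set l)) x \<noteq> 0} \<subseteq> (\<Union>i\<in>set l. closure (bs i))"
  using bump_support[of j "\<Union>(bs ` set l)"] by simp
qed

lemma test_function_props:
 shows "continuous_on UNIV (test_function bs j l)" "bounded (range (test_function bs j l))" "dominated 1 (test_function bs j l)"
  "0 <= test_function bs j l x" "test_function bs j l x <= phi0 x"
proof -
 show c: "continuous_on UNIV (test_function bs j l)"
  unfolding test_function_def[abs_def] by (intro continuous_on_mult bump_props(3) eigenfunctions_continuous)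
 obtain C where C: "compact C" "{x. bump j (\<Union>(bs ` set l)) x \<noteq> 0} \<subseteq> C" by (rule bump_compact_support)
 have "bounded (test_function bs j l ` C)"
  by (rule compact_imp_bounded[OF compact_continuous_image[OF continuous_on_subset[OF c] C(1)]]) simp
 moreover have "range (test_function bs j l) \<subseteq> insert 0 (test_function bs j l ` C)"
  using C(2) by (force simp: test_function_def)
 ultimately show "bounded (range (test_function bs j l))" by (meson bounded_insert bounded_subset)
 show n: "0 <= test_function bs j l x" "test_function bs j l x <= phi0 x" for x
  using bump_props(1,2)[of j "\<Union>(bs ` set l)" x] eigenfunctions_pos(1)[of x]
  by (auto simp: test_function_def mult_left_le_one_le)
 then show "dominated 1 (test_function bs j l)"
  using borel_measurable_continuous_onI[OF c] by (simp add: dominated_def)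
qed

lemma R_measurable_top: "0 <= t ==> f \<in> borel_measurable borel ==> R t f \<in> borel_measurable (G \<top>)"
 by (rule SP.measurable_F_mono[OF R_measurable_G]) auto

lemma good_event_sets: "good_event bs \<in> sets (G \<top>)"
proof -
 have sp: "space (G \<top>) = \<Omega>" by (rule SP.space_F)
 have d: "0 <= real i / 2 ^ N" for i N :: nat by simp
 have [measurable]: "R (real i / 2 ^ N) phi0 \<in> borel_measurable (G \<top>)" "R (real i) phi0 \<in> borel_measurable (G \<top>)"
  "R (real i / 2 ^ N) (test_function bs j l) \<in> borel_measurable (G \<top>)" for i N j :: nat and l
  by (intro R_measurable_top d phi0_borel borel_measurable_continuous_onI[OF test_function_props(1)]; simp)+
 have [measurable]: "terminal \<in> borel_measurable (G \<top>)" unfolding terminal_def[abs_def] by measurable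
 have "(%x. ennreal (phi0 x)) \<in> borel_measurable borel" using phi0_borel by measurable
 then have N: "(%w. NN (X (real i / 2 ^ N) w) (%x. ennreal (phi0 x))) \<in> borel_measurable (G \<top>)" for i N :: nat
  by (rule SP.measurable_F_mono[OF mass_measurable_G[OF _ d]]) simp
 have [measurable]: "Measurable.pred (G \<top>) (fin (real i / 2 ^ N))" for i N :: nat
  unfolding fin_def[abs_def] pred_def using borel_measurable_less[OF N borel_measurable_const[of "\<top>"]] by simp
 have "good_event bs = {w \<in> space (G \<top>). (\<forall>i N::nat. fin (real i / 2 ^ N) w) \<and> dyadic_limit (%t. R t phi0 w) (terminal w) \<and>
   (\<forall>j l. dyadic_limit (%t. R t (test_function bs j l) w) ((LINT x|m. phih0 x * test_function bs j l x) * terminal w))}"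
  by (simp add: good_event_def sp)
 also have "... \<in> sets (G \<top>)" unfolding dyadic_limit_def by measurable
 finally show ?thesis .
qed

text \<open>Multiplied by \<open>phi0\<close>, the \<open>h\<close>-transformed semigroup on a bump
  is \<open>U\<close> on the test function, so the uniform regularity hypothesis becomes an error
  bound proportional to \<open>phi0\<close>.\<close>

lemma test_function_U_close:
 assumes hC0: "!!f. f \<in> C0 ==>
   ((%t. SUP x. ennreal \<bar>h_transformed_op (mean_op \<xi> Q \<alpha>) lam0 phi0 t f x - f x\<bar>) \<longlongrightarrow> 0) (at_right 0)"
  and \<delta>: "0 < \<delta>"
 shows "\<exists>sig>0. \<forall>s x. 0 < s \<and> s <= sig \<longrightarrow> \<bar>U s (test_function bs j l) x - test_function bs j l x\<bar> <= \<delta> * phi0 x"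
proof -
 let ?g = "bump j (\<Union>(bs ` set l))" and ?f = "test_function bs j l"
 obtain C where C: "compact C" "{x. ?g x \<noteq> 0} \<subseteq> C" by (rule bump_compact_support)
 have "?g \<in> C0" by (rule compact_support_C0[OF bump_props(3) C])
 from hC0[OF this] have "\<forall>\<^sub>F t in at_right 0. (SUP x. ennreal \<bar>h_transformed_op (mean_op \<xi> Q \<alpha>) lam0 phi0 t ?g x - ?g x\<bar>) < ennreal \<delta>"
  by (rule order_tendstoD(2)) (use \<delta> in simp)
 then obtain sig where sig: "0 < sig" "!!t. 0 < t ==> t < sig ==>
   (SUP x. ennreal \<bar>h_transformed_op (mean_op \<xi> Q \<alpha>) lam0 phi0 t ?g x - ?g x\<bar>) < ennreal \<delta>"
  unfolding eventually_at_right_field by auto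
 have "\<bar>U s ?f x - ?f x\<bar> <= \<delta> * phi0 x" if s: "0 < s" "s <= sig / 2" for s x
 proof -
  have "ennreal \<bar>h_transformed_op (mean_op \<xi> Q \<alpha>) lam0 phi0 s ?g x - ?g x\<bar> \<le>
    (SUP x. ennreal \<bar>h_transformed_op (mean_op \<xi> Q \<alpha>) lam0 phi0 s ?g x - ?g x\<bar>)" by (rule SUP_upper) simp
  also have "... < ennreal \<delta>" using sig s by simp
  finally have le: "\<bar>h_transformed_op (mean_op \<xi> Q \<alpha>) lam0 phi0 s ?g x - ?g x\<bar> < \<delta>" by (simp add: ennreal_less_iff)
  have "mean_op \<xi> Q \<alpha> s ?f x = (LINT y|m. q s x y * ?f y)"
   using q_density[OF s(1) borel_measurable_continuous_onI[OF test_function_props(1)] test_function_props(2)] by blast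
  then have "h_transformed_op (mean_op \<xi> Q \<alpha>) lam0 phi0 s ?g x = U s ?f x / phi0 x"
   using s(1) by (simp add: h_transformed_op_def U_def test_function_def[abs_def])
  then have e: "phi0 x * (h_transformed_op (mean_op \<xi> Q \<alpha>) lam0 phi0 s ?g x - ?g x) = U s ?f x - ?f x"
   using eigenfunctions_pos(1)[of x] by (simp add: test_function_def field_simps)
  have "\<bar>U s ?f x - ?f x\<bar> = phi0 x * \<bar>h_transformed_op (mean_op \<xi> Q \<alpha>) lam0 phi0 s ?g x - ?g x\<bar>"
   unfolding e[symmetric] using eigenfunctions_pos(1)[of x] by (simp add: abs_mult)
  also have "... <= phi0 x * \<delta>" using le eigenfunctions_pos(1)[of x] by (intro mult_left_mono) auto
  finally show ?thesis by (simp add: mult.commute)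
 qed
 then show ?thesis using sig(1) by (intro exI[of _ "sig / 2"]) auto
qed

lemma good_event_prob:
 assumes hC0: "!!f. f \<in> C0 ==>
   ((%t. SUP x. ennreal \<bar>h_transformed_op (mean_op \<xi> Q \<alpha>) lam0 phi0 t f x - f x\<bar>) \<longlongrightarrow> 0) (at_right 0)"
  and lam0: "0 < lam0" and mu: "mu \<in> finite_borel_measures" and supp: "compact (measure_support mu)"
 shows "emeasure (P mu) (good_event bs) = 1"
proof -
 interpret Pm: prob_space "P mu" using SP.prob_space_P[of mu] mu by simp
 have s: "good_event bs \<in> sets (P mu)" using good_event_sets SP.sets_P[of mu] mu by simp
 have "AE w in P mu. \<forall>i N::nat. w \<in> \<Omega> \<and> fin (real i / 2 ^ N) w"
  unfolding AE_all_countable by (intro allI AE_fin[OF mu supp]) simp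
 moreover have "AE w in P mu. \<forall>j l. dyadic_limit (%t. R t (test_function bs j l) w) ((LINT x|m. phih0 x * test_function bs j l x) * terminal w)"
  unfolding AE_all_countable terminal_def
  by (intro allI dyadic_limit_R[OF mu supp lam0 test_function_props(3)] test_function_U_close[OF hC0])
 ultimately have "AE w in P mu. w \<in> good_event bs"
  using dyadic_limit_phi0[OF mu supp lam0] by eventually_elim (auto simp: good_event_def terminal_def)
 then show ?thesis by (rule Pm.emeasure_eq_1_AE[OF s])
qed

text \<open>The measures \<nu> have density proportional to \<open>phi0\<close> with respect to
  \<open>X t w\<close>, and \<pi> has density \<open>L * phi0 * phih0\<close>; the claim is
  convergence of the integrals of the bounded function \<open>f / phi0\<close>. Open sets are
  bounded below by test functions, and the total mass is bounded above by a separate argument.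
  Everything takes place on a single path.\<close>

lemma good_event_limit:
 assumes w: "w \<in> good_event bs" and f: "dominated c f" "{x. \<not> isCont f x} \<in> null_sets m"
 shows "((%t. exp (- lam0 * t) * (LINT x|X t w. f x)) \<longlongrightarrow> terminal w * (LINT y|m. phih0 y * f y)) at_top"
proof -
 let ?f = "test_function bs"
 define L where "L = terminal w"
 have wO: "w \<in> \<Omega>" and wf: "!!i N :: nat. fin (real i / 2 ^ N) w"
  and Lphi: "dyadic_limit (%t. R t phi0 w) L"
  and Lf: "!!j l. dyadic_limit (%t. R t (?f j l) w) ((LINT x|m. phih0 x * ?f j l x) * L)"
  using w by (auto simp: good_event_def L_def)
 have phi0: "0 <= phi0 x" "0 <= phih0 x" for x using eigenfunctions_pos[of x] by auto
 have L0: "0 <= L"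
 proof (rule field_le_epsilon)
  fix eps :: real assume "0 < eps"
  then obtain n :: nat where n: "!!i N :: nat. real n <= real i / 2 ^ N ==> \<bar>R (real i / 2 ^ N) phi0 w - L\<bar> <= eps"
   using dyadic_limitD[OF Lphi] by blast
  show "0 <= L + eps" using n[of n 0] R_nonneg[of phi0 "real n / 2 ^ 0" w, OF phi0(1)] by auto
 qed
 have sX: "sets (X t w) = sets borel" and fX: "finite_measure (X t w)" if "0 <= t" for t
  using X_finite_borel[OF wO that] by auto
 define r where "r j l t = exp (- lam0 * t) * (LINT x|X t w. ?f j l x)" for j l t
 have rR: "R t (?f j l) w = r j l t" if "0 <= t" "fin t w" for j l t
  using R_integral(2)[OF wO that test_function_props(3)] by (simp add: r_def)
 have rc: "(r j l \<longlongrightarrow> r j l t) (at_right t)" if "0 <= t" for j l t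
  unfolding r_def using SP.right_continuous[OF wO that] by (intro tendsto_intros weak_limit_integral test_function_props)
 have "dyadic_limit (r j l) ((LINT x|m. phih0 x * ?f j l x) * L)" for j l
  using Lf[of j l] wf rR by (simp add: dyadic_limit_def)
 then have rlim: "(r j l \<longlongrightarrow> (LINT x|m. phih0 x * ?f j l x) * L) at_top" for j l
  by (rule dyadic_limit_tendsto) (rule rc)
 define \<nu> where "\<nu> t = density (X t w) (%x. ennreal (exp (- lam0 * t) * phi0 x))" for t
 define \<pi> where "\<pi> = density m (%x. ennreal (L * (phi0 x * phih0 x)))"
 have mphi: "phi0 \<in> borel_measurable m" "phih0 \<in> borel_measurable m" "integrable m (%x. L * (phi0 x * phih0 x))"
  using eigenfunctions_L2 L2D(1) L2_mult[OF eigenfunctions_L2] by auto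
 have \<pi>e: "emeasure \<pi> UNIV = ennreal L"
 proof -
  have "emeasure \<pi> UNIV = (NN m (%x. ennreal (L * (phi0 x * phih0 x))))"
   unfolding \<pi>_def using mphi sets_m by (subst emeasure_density) auto
  also have "... = ennreal (LINT x|m. L * (phi0 x * phih0 x))" using mphi(3) L0 phi0 by (intro nn_integral_eq_integral) auto
  finally show ?thesis using normalization(2) by simp
 qed
 have \<pi>s: "sets \<pi> = sets borel" by (simp add: \<pi>_def sets_m)
 have \<pi>f: "finite_measure \<pi>" using \<pi>e sets_eq_imp_space_eq[OF \<pi>s] by (intro finite_measureI) simp
 have \<pi>1: "measure \<pi> UNIV = L" using \<pi>e L0 by (simp add: measure_def)
 have \<nu>s: "sets (\<nu> t) = sets borel" if "0 <= t" for t using sX[OF that] by (simp add: \<nu>_def)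
 have \<pi>i: "(LINT x|\<pi>. h x) = L * (LINT y|m. phih0 y * (phi0 y * h y))" if "h \<in> borel_measurable borel" for h :: "'e => real"
 proof -
  have "(LINT x|\<pi>. h x) = (LINT x|m. (L * (phi0 x * phih0 x)) *\<^sub>R h x)"
   unfolding \<pi>_def using mphi L0 phi0 that by (intro integral_density) (auto simp: borel_m)
  also have "... = (LINT x|m. L * (phih0 x * (phi0 x * h x)))" by (intro integral_cong) auto
  finally show ?thesis by simp
 qed
 have \<nu>i: "(LINT x|\<nu> t. h x) = exp (- lam0 * t) * (LINT y|X t w. phi0 y * h y)" if "0 <= t" "h \<in> borel_measurable borel" for h :: "'e => real" and t
 proof -
  note mb = measurable_of_sets_borel[OF sX[OF that(1)]]
  have "(LINT x|\<nu> t. h x) = (LINT x|X t w. (exp (- lam0 * t) * phi0 x) *\<^sub>R h x)"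
   unfolding \<nu>_def using mb[OF that(2)] mb[OF phi0_borel] phi0 by (intro integral_density) auto
  then show ?thesis by (simp add: mult.assoc)
 qed
 have bm: "bump j V \<in> borel_measurable borel" for j and V :: "'e set" by (rule borel_measurable_continuous_onI[OF bump_props(3)])
 have blim: "((%t. LINT x|\<nu> t. bump j (\<Union>(bs ` set l)) x) \<longlongrightarrow> (LINT x|\<pi>. bump j (\<Union>(bs ` set l)) x)) at_top" for j l
 proof (rule Lim_transform_eventually)
  show "(r j l \<longlongrightarrow> (LINT x|\<pi>. bump j (\<Union>(bs ` set l)) x)) at_top"
   using rlim[of j l] unfolding \<pi>i[OF bm] test_function_def by (simp add: mult_ac)
  show "\<forall>\<^sub>F t in at_top. r j l t = (LINT x|\<nu> t. bump j (\<Union>(bs ` set l)) x)"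
   using eventually_ge_at_top[of 0] by eventually_elim (simp add: \<nu>i[OF _ bm] r_def test_function_def mult.commute)
 qed
 \<comment> \<open>Right continuity does not reach the possibly unbounded \<open>phi0\<close>. Each
   test function is right continuous and at dyadic times lies below \<open>phi0\<close>, hence obeys
   the bound \<open>L + eps\<close> at every late time; Fatou along test functions exhausting the
   space passes the bound to the mass of \<nu>. This also shows that \<open>phi0\<close> is
   integrable at late nondyadic times.\<close>
 have upper: "\<forall>\<^sub>F t in at_top. emeasure (\<nu> t) UNIV <= ennreal (measure \<pi> UNIV + eps)" if eps: "0 < eps" for eps
 proof -
  obtain n :: nat where n: "!!i N :: nat. real n <= real i / 2 ^ N ==> \<bar>R (real i / 2 ^ N) phi0 w - L\<bar> <= eps"
   using dyadic_limitD[OF Lphi eps] by blast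
  have "emeasure (\<nu> t) UNIV <= ennreal (L + eps)" if t: "real n <= t" for t
  proof -
   have t0: "0 <= t" using t by linarith
   interpret finite_measure "X t w" by (rule fX[OF t0])
   note mb = measurable_of_sets_borel[OF sX[OF t0]]
   let ?l = "base_union bs UNIV" and ?e = "exp (- lam0 * t)"
   obtain i :: "nat => nat" where i: "filterlim (%k. real (i k) / 2 ^ k) (at_right t) sequentially" "!!k. t < real (i k) / 2 ^ k"
    using dyadic_approximation[OF t0] by blast
   have rle: "r j l t <= L + eps" for j l
   proof (rule LIMSEQ_le_const2[OF filterlim_compose[OF rc[OF t0] i(1)]], intro exI allI impI)
    fix k :: nat
    have "R (real (i k) / 2 ^ k) (?f j l) w <= R (real (i k) / 2 ^ k) phi0 w"
     using R_abs_le[OF wO _ wf test_function_props(3) dominated_phi0, of "i k" k] test_function_props(4,5) by (fastforce simp: abs_le_iff)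
    also have "... <= L + eps" using n[of "i k" k] i(2)[of k] t by linarith
    finally show "r j l (real (i k) / 2 ^ k) <= L + eps" using rR[OF _ wf, of "i k" k] by simp
   qed
   have "emeasure (\<nu> t) UNIV = (NN (X t w) (%x. ennreal (?e * phi0 x)))"
    unfolding \<nu>_def using mb[OF phi0_borel] sX[OF t0] by (subst emeasure_density) auto
   also have "... = (NN (X t w) (%x. liminf (%k. ennreal (?e * ?f k (?l k) x))))"
   proof (intro nn_integral_cong)
    fix x
    have "(%k. ?e * ?f k (?l k) x) \<longlonglongrightarrow> ?e * (indicator UNIV x * phi0 x)"
     unfolding test_function_def by (intro tendsto_mult_left tendsto_mult_right bump_exhausts(2) b_open b_base open_UNIV)
    then have "(%k. ennreal (?e * ?f k (?l k) x)) \<longlonglongrightarrow> ennreal (?e * phi0 x)" by (intro tendsto_ennrealI) simp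
    then show "ennreal (?e * phi0 x) = liminf (%k. ennreal (?e * ?f k (?l k) x))" by (intro lim_imp_Liminf[symmetric]) simp
   qed
   also have "... <= liminf (%k. NN (X t w) (%x. ennreal (?e * ?f k (?l k) x)))"
    using mb[OF borel_measurable_continuous_onI[OF test_function_props(1)]] by (intro nn_integral_liminf) measurable
   also have "... <= liminf (%k::nat. ennreal (L + eps))"
   proof (intro Liminf_mono always_eventually allI)
    fix k
    obtain B where B: "!!x. norm (?f k (?l k) x) <= B" using test_function_props(2)[of k "?l k"] by (auto simp: bounded_iff)
    have "integrable (X t w) (?f k (?l k))"
     using B mb[OF borel_measurable_continuous_onI[OF test_function_props(1)]] by (intro integrable_const_bound[where B=B]) auto
    then have "(NN (X t w) (%x. ennreal (?e * ?f k (?l k) x))) = ennreal (LINT x|X t w. ?e * ?f k (?l k) x)"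
     using test_function_props(4) by (intro nn_integral_eq_integral) auto
    then show "(NN (X t w) (%x. ennreal (?e * ?f k (?l k) x))) <= ennreal (L + eps)"
     using rle[of k "?l k"] by (simp add: r_def ennreal_leI)
   qed
   finally show ?thesis by (simp add: Liminf_const)
  qed
  then show ?thesis unfolding \<pi>1 eventually_at_top_linorder by blast
 qed
 have \<nu>ev: "\<forall>\<^sub>F t in at_top. sets (\<nu> t) = sets borel" using eventually_ge_at_top[of 0] by eventually_elim (rule \<nu>s)
 then have \<nu>fin: "\<forall>\<^sub>F t in at_top. finite_measure (\<nu> t) \<and> sets (\<nu> t) = sets borel"
  using upper[OF zero_less_one]
 proof eventually_elim
  case (elim t)
  then have "emeasure (\<nu> t) (space (\<nu> t)) \<noteq> \<infinity>" using sets_eq_imp_space_eq[OF elim(1)] by (auto simp: top_unique)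
  then show ?case using elim(1) by (simp add: finite_measureI)
 qed
 note lower = open_lower_of_bumps[OF b_open b_base \<nu>fin \<pi>f \<pi>s blim]
 \<comment> \<open>Bounded by \<open>c\<close> and, since \<open>phi0\<close> is continuous and
   positive, continuous wherever \<open>f\<close> is; the null set of discontinuities in the
   hypothesis is therefore also \<pi>-null.\<close>
 define h where "h x = f x / phi0 x" for x
 have hm: "h \<in> borel_measurable borel" unfolding h_def[abs_def] using dominatedD(1)[OF f(1)] phi0_borel by measurable
 have hc: "\<bar>h x\<bar> <= c" for x using dominatedD(2)[OF f(1), of x] eigenfunctions_pos(1)[of x] by (simp add: h_def field_simps)
 have fphi: "phi0 x * h x = f x" for x using eigenfunctions_pos(1)[of x] by (simp add: h_def)
 have "isCont phi0 x" for x using eigenfunctions_continuous(1) by (simp add: continuous_on_eq_continuous_at)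
 then have "isCont h x" if "isCont f x" for x
  unfolding h_def[abs_def] using that eigenfunctions_pos(1)[of x] by (intro continuous_intros) auto
 then have "AE x in m. isCont h x" using AE_not_in[OF f(2)] by (auto elim!: eventually_mono)
 then have hAE: "AE x in \<pi>. isCont h x"
  unfolding \<pi>_def using mphi by (subst AE_density) auto
 have "((%t. LINT x|\<nu> t. h x) \<longlongrightarrow> (LINT x|\<pi>. h x)) at_top"
  by (rule portmanteau[OF \<nu>ev \<pi>f \<pi>s _ _ hm hc hAE]) (rule lower upper; assumption)+
 then have "((%t. LINT x|\<nu> t. h x) \<longlongrightarrow> L * (LINT y|m. phih0 y * f y)) at_top" unfolding \<pi>i[OF hm] fphi .
 then show ?thesis unfolding L_def
 proof (rule Lim_transform_eventually)
  show "\<forall>\<^sub>F t in at_top. (LINT x|\<nu> t. h x) = exp (- lam0 * t) * (LINT x|X t w. f x)"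
   using eventually_ge_at_top[of 0] by eventually_elim (simp add: \<nu>i[OF _ hm] fphi)
 qed
qed

text \<open>The limit theorem applied to \<open>phi0\<close> itself, where the constant is 1 by
  normalisation; only here does the limit over all real times become known to exist.\<close>

lemma good_event_W_infinity:
 assumes "w \<in> good_event bs"
 shows "W_infinity X lam0 phi0 w = terminal w"
proof -
 have "isCont phi0 x" for x using eigenfunctions_continuous(1) by (simp add: continuous_on_eq_continuous_at)
 then have "{x. \<not> isCont phi0 x} \<in> null_sets m" by simp
 from good_event_limit[OF assms dominated_phi0 this]
 have "((%t. W X lam0 phi0 t w) \<longlongrightarrow> terminal w) at_top"
  using normalization(2) by (simp add: W_def mult.commute)
 then show ?thesis unfolding W_infinity_def by (intro tendsto_Lim) auto
qed

end

end

theorem theorem1p4: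
  fixes m :: "'e::{metric_space, second_countable_topology} measure"
    and p q :: "real \<Rightarrow> 'e \<Rightarrow> 'e \<Rightarrow> real"
    and \<Omega>' :: "'w set" and F :: "ennreal \<Rightarrow> 'w measure"
    and \<xi> :: "real \<Rightarrow> 'w \<Rightarrow> 'e option" and Q :: "'e option \<Rightarrow> 'w measure"
    and \<beta> a b :: "'e \<Rightarrow> real" and n :: "'e \<Rightarrow> real measure"
    and \<Omega> :: "'v set" and G :: "ennreal \<Rightarrow> 'v measure"
    and X :: "real \<Rightarrow> 'v \<Rightarrow> 'e measure" and P :: "'e measure \<Rightarrow> 'v measure"
    and \<alpha> :: "'e \<Rightarrow> real" and lam0 :: real and \<phi>0 \<phi>h0 :: "'e \<Rightarrow> real"
  assumes "spatial_motion \<Omega>' F \<xi> Q m p"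
    and "branching_data \<beta> a b n"
    and "superprocess \<Omega> G X P \<xi> Q \<beta> (branching_mechanism a b n)"
    and "\<alpha> = (\<lambda>x. \<beta> x * a x)"
    and "principal_eigenfunctions m \<xi> Q \<alpha> q lam0 \<phi>0 \<phi>h0"
    and "0 < lam0"
    and "\<And>f. f \<in> C0 \<Longrightarrow>
      ((\<lambda>t. SUP x. ennreal \<bar>h_transformed_op (mean_op \<xi> Q \<alpha>) lam0 \<phi>0 t f x - f x\<bar>) \<longlongrightarrow> 0) (at_right 0)"
  shows "\<exists>\<Omega>0\<in>sets (G \<top>).
    (\<forall>\<mu>\<in>finite_borel_measures. compact (measure_support \<mu>) \<longrightarrow> emeasure (P \<mu>) \<Omega>0 = 1) \<and>
    (\<forall>\<omega>\<in>\<Omega>0. \<forall>f. f \<in> borel_measurable borel \<and> bounded (range f) \<and>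
        (\<exists>c>0. \<forall>x. \<bar>f x\<bar> \<le> c * \<phi>0 x) \<and> {x. \<not> isCont f x} \<in> null_sets m \<longrightarrow>
        ((\<lambda>t. exp (- lam0 * t) * (\<integral>x. f x \<partial>X t \<omega>)) \<longlongrightarrow>
           W_infinity X lam0 \<phi>0 \<omega> * (\<integral>y. \<phi>h0 y * f y \<partial>m)) at_top)"
proof -
 interpret BR: branching_data \<beta> a b n by fact
 \<comment> \<open>The product of the two bounds is the constant \<open>K\<close> of the Feynman-Kac
   setting.\<close>
 obtain B1 B2 where B: "!!x. \<bar>\<beta> x\<bar> <= B1" "!!x. \<bar>a x\<bar> <= B2"
  using BR.beta(2) BR.a(2) by (auto simp: bounded_iff)
 have "\<bar>\<alpha> x\<bar> <= B1 * B2" for x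
  unfolding assms(4) abs_mult using B[of x] by (intro mult_mono) (auto intro: order_trans[OF abs_ge_zero])
 moreover have "\<alpha> \<in> borel_measurable borel" unfolding assms(4) using BR.beta(1) BR.a(1) by measurable
 ultimately have fk: "feynman_kac \<Omega>' F \<xi> Q m p \<alpha> (B1 * B2)"
  using assms(1) by (simp add: feynman_kac_def feynman_kac_axioms_def)
 interpret S: superprocess_setting \<Omega>' F \<xi> Q m p \<alpha> "B1 * B2" q lam0 \<phi>0 \<phi>h0 \<beta> a b n \<Omega> G X P
  by (intro superprocess_setting.intro supercritical_setting.intro superprocess_setting_axioms.intro fk assms)
 obtain e :: "nat => 'e set" where e: "!!i. open (e i)" "!!i. compact (closure (e i))"
  "!!U x. open U ==> x \<in> U ==> \<exists>i. x \<in> e i \<and> e i \<subseteq> U"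
  by (rule relatively_compact_base[OF S.locally_compact_E]) blast
 show ?thesis
 proof (intro bexI[of _ "S.good_event e"] conjI ballI allI impI)
  show "S.good_event e \<in> sets (G \<top>)" by (rule S.good_event_sets[OF e])
  show "emeasure (P \<mu>) (S.good_event e) = 1" if "\<mu> \<in> finite_borel_measures" "compact (measure_support \<mu>)" for \<mu>
   by (rule S.good_event_prob[OF e assms(7) assms(6) that])
  fix w f
  assume w: "w \<in> S.good_event e" and f: "f \<in> borel_measurable borel \<and> bounded (range f) \<and>
    (\<exists>c>0. \<forall>x. \<bar>f x\<bar> <= c * \<phi>0 x) \<and> {x. \<not> isCont f x} \<in> null_sets m"
  then obtain c where c: "S.dominated c f" by (auto simp: S.dominated_def)
  have W: "W_infinity X lam0 \<phi>0 w = S.terminal w" by (rule S.good_event_W_infinity[OF e w])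
  show "((%t. exp (- lam0 * t) * (LINT x|X t w. f x)) \<longlongrightarrow> W_infinity X lam0 \<phi>0 w * (LINT y|m. \<phi>h0 y * f y)) at_top"
   unfolding W using f by (blast intro: S.good_event_limit[OF e w c])
 qed
qed

end
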